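(* Let $R$ be a ring, let $M$ be a finitely generated $R$-module, and let $f:M\to F$ be an $R$-linear map from $M$ to a free $R$-module $F$. If the dual map $f^*:F^*\to M^*$ is an epimorphism, then $f$ is versal and $\mathcal{R}(M)=\mathcal{R}(f)$ (that is, the natural surjection $\mathcal{R}(M)\to\mathcal{R}(f)$ is an isomorphism). In particular, formation of the Rees algebra of a finitely generated module over a Noetherian ring commutes with flat base change: if $R$ is Noetherian, $M$ is a finitely generated $R$-module and $S$ is a flat $R$-algebra, then $\mathcal{R}(S\otimes_R M)= S\otimes_R\mathcal{R}(M)$, where $\mathcal{R}(S\otimes_R M)$ is formed over $S$.
   Context: All rings are commutative with identity. For an $R$-module $N$, $N^*=\mathrm{Hom}_R(N,R)$. $\mathrm{Sym}(M)$ is the symmetric algebra of the $R$-module $M$; an $R$-linear map $g:M\to N$ induces a graded $R$-algebra map $\mathrm{Sym}(g):\mathrm{Sym}(M)\to\mathrm{Sym}(N)$. The Rees algebra of the map $g$, denoted $\mathcal{R}(g)$, is the graded $R$-algebra which is the image of $\mathrm{Sym}(g)$. The Rees algebra of the module $M$ is $\mathcal{R}(M)=\mathrm{Sym}(M)/\bigcap_g L_g$, where the intersection is over all $R$-linear maps $g$ from $M$ to free $R$-modules and $L_g=\ker \mathrm{Sym}(g)$. For any $g$ from $M$ to a free module there is a natural surjection $\mathcal{R}(M)\to\mathcal{R}(g)=\mathrm{Sym}(M)/L_g$. A map $f$ from $M$ to a free $R$-module $F$ is called versal if every $R$-linear map from $M$ to a free $R$-module factors through $f$. *)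

theory Defs
  imports "HOL-Algebra.Ring_Divisibility" "HOL-Algebra.QuotRing" "HOL-Algebra.Module"
begin

section \<open>Modules, linear maps, duals, free modules\<close>

text \<open>
  Modules and algebras over a ring \<open>R\<close> are those of HOL-Algebra (locales \<^locale>\<open>module\<close> and
  \<^locale>\<open>algebra\<close>). The record type \<open>('a, 'm) module\<close> extends the type of rings, so it always has
  multiplication fields; for an object that is only a module they carry no information.
\<close>

definition lin_maps ::
  "('a, 'r) ring_scheme \<Rightarrow> ('a, 'm, 'x) module_scheme \<Rightarrow> ('a, 'n, 'y) module_scheme \<Rightarrow> ('m \<Rightarrow> 'n) set"
  where "lin_maps R M N =
    {h \<in> carrier M \<rightarrow> carrier N.
      (\<forall>x\<in>carrier M. \<forall>y\<in>carrier M. h (x \<oplus>\<^bsub>M\<^esub> y) = h x \<oplus>\<^bsub>N\<^esub> h y) \<and>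
      (\<forall>r\<in>carrier R. \<forall>x\<in>carrier M. h (r \<odot>\<^bsub>M\<^esub> x) = r \<odot>\<^bsub>N\<^esub> h x)}"

definition self_module :: "('a, 'r) ring_scheme \<Rightarrow> ('a, 'a) module"
  where "self_module R = ring.extend (ring.truncate R) \<lparr>smult = monoid.mult R\<rparr>"

text \<open>Functionals are made extensional (\<open>undefined\<close> off the carrier) so that equality of elements of
  the dual is equality of functions.\<close>

definition dual :: "('a, 'r) ring_scheme \<Rightarrow> ('a, 'm, 'x) module_scheme \<Rightarrow> ('m \<Rightarrow> 'a) set"
  where "dual R M = lin_maps R M (self_module R) \<inter> extensional (carrier M)"

definition dual_map :: "('a, 'm, 'x) module_scheme \<Rightarrow> ('m \<Rightarrow> 'n) \<Rightarrow> ('n \<Rightarrow> 'a) \<Rightarrow> ('m \<Rightarrow> 'a)"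
  where "dual_map M f \<phi> = compose (carrier M) \<phi> f"

definition submodule_span :: "('a, 'r) ring_scheme \<Rightarrow> ('a, 'm) module \<Rightarrow> 'm set \<Rightarrow> 'm set"
  where "submodule_span R M A = \<Inter>{N. submodule N R M \<and> A \<subseteq> N}"

definition fin_gen_module :: "('a, 'r) ring_scheme \<Rightarrow> ('a, 'm) module \<Rightarrow> bool"
  where "fin_gen_module R M \<longleftrightarrow>
    module R M \<and> (\<exists>A. finite A \<and> A \<subseteq> carrier M \<and> submodule_span R M A = carrier M)"

definition supp :: "('a, 'r) ring_scheme \<Rightarrow> ('k \<Rightarrow> 'a) \<Rightarrow> 'k set"
  where "supp R p = {k. p k \<noteq> \<zero>\<^bsub>R\<^esub>}"

definition fin_funs :: "('a, 'r) ring_scheme \<Rightarrow> 'k set \<Rightarrow> ('k \<Rightarrow> 'a) set"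
  where "fin_funs R K = {p. range p \<subseteq> carrier R \<and> supp R p \<subseteq> K \<and> finite (supp R p)}"

definition is_basis :: "('a, 'r) ring_scheme \<Rightarrow> ('a, 'm) module \<Rightarrow> 'm set \<Rightarrow> bool"
  where "is_basis R F B \<longleftrightarrow> B \<subseteq> carrier F \<and>
    bij_betw (\<lambda>c. \<Oplus>\<^bsub>F\<^esub>b\<in>supp R c. c b \<odot>\<^bsub>F\<^esub> b) (fin_funs R B) (carrier F)"

definition free_module :: "('a, 'r) ring_scheme \<Rightarrow> ('a, 'm) module \<Rightarrow> bool"
  where "free_module R F \<longleftrightarrow> module R F \<and> (\<exists>B. is_basis R F B)"

text \<open>The type argument is the carrier type of the free target modules \<open>G\<close>. A theorem stating
  \<open>versal TYPE('g) R M F f\<close> for a type variable \<open>'g\<close> covers free modules of every type.\<close>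

definition versal ::
  "'g itself \<Rightarrow> ('a, 'r) ring_scheme \<Rightarrow> ('a, 'm) module \<Rightarrow> ('a, 'f) module \<Rightarrow> ('m \<Rightarrow> 'f) \<Rightarrow> bool"
  where "versal _ R M F f \<longleftrightarrow>
    (\<forall>(G :: ('a, 'g) module). \<forall>g. free_module R G \<and> g \<in> lin_maps R M G \<longrightarrow>
      (\<exists>h\<in>lin_maps R F G. \<forall>m\<in>carrier M. g m = h (f m)))"


section \<open>Monoid algebras and quotients\<close>

definition monoid_alg :: "('a, 'r) ring_scheme \<Rightarrow> ('k, 'q) monoid_scheme \<Rightarrow> ('a, 'k \<Rightarrow> 'a) module"
  where "monoid_alg R G =
    \<lparr>carrier = fin_funs R (carrier G),
     monoid.mult = (\<lambda>p q k. \<Oplus>\<^bsub>R\<^esub>i\<in>supp R p. \<Oplus>\<^bsub>R\<^esub>j\<in>supp R q.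
               if i \<otimes>\<^bsub>G\<^esub> j = k then p i \<otimes>\<^bsub>R\<^esub> q j else \<zero>\<^bsub>R\<^esub>),
     one = (\<lambda>k. if k = \<one>\<^bsub>G\<^esub> then \<one>\<^bsub>R\<^esub> else \<zero>\<^bsub>R\<^esub>),
     ring.zero = (\<lambda>k. \<zero>\<^bsub>R\<^esub>),
     add = (\<lambda>p q k. p k \<oplus>\<^bsub>R\<^esub> q k),
     smult = (\<lambda>r p k. r \<otimes>\<^bsub>R\<^esub> p k)\<rparr>"

definition basis_elt :: "('a, 'r) ring_scheme \<Rightarrow> 'k \<Rightarrow> ('k \<Rightarrow> 'a)"
  where "basis_elt R k = (\<lambda>j. if j = k then \<one>\<^bsub>R\<^esub> else \<zero>\<^bsub>R\<^esub>)"

text \<open>The linear map of monoid algebras sending the basis element \<open>k\<close> to the basis element \<open>h k\<close>.\<close>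

definition push :: "('a, 'r) ring_scheme \<Rightarrow> ('k \<Rightarrow> 'l) \<Rightarrow> ('k \<Rightarrow> 'a) \<Rightarrow> ('l \<Rightarrow> 'a)"
  where "push R h p = (\<lambda>l. \<Oplus>\<^bsub>R\<^esub>k\<in>supp R p. if h k = l then p k else \<zero>\<^bsub>R\<^esub>)"

text \<open>Quotient by a submodule \<open>K\<close>, with the ring structure of \<^const>\<open>FactRing\<close>, which is
  meaningful when \<open>A\<close> is an algebra and \<open>K\<close> is an ideal.\<close>

definition quot :: "('a, 'm) module \<Rightarrow> 'm set \<Rightarrow> ('a, 'm set) module"
  where "quot A K = ring.extend (A Quot K)
    \<lparr>smult = (\<lambda>r X. \<Union>x\<in>X. K +>\<^bsub>A\<^esub> (r \<odot>\<^bsub>A\<^esub> x))\<rparr>"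

definition alg_iso ::
  "('a, 'r) ring_scheme \<Rightarrow> ('a, 'm) module \<Rightarrow> ('a, 'n) module \<Rightarrow> ('m \<Rightarrow> 'n) set"
  where "alg_iso R A B = ring_iso A B \<inter> lin_maps R A B"


section \<open>Symmetric algebras\<close>

text \<open>\<open>Sym(M)\<close> is the polynomial ring in variables \<open>X\<^sub>m\<close>, one for each \<open>m \<in> M\<close>, modulo the ideal
  generated by all \<open>X\<^bsub>m+n\<^esub> - X\<^sub>m - X\<^sub>n\<close> and \<open>X\<^bsub>rm\<^esub> - r X\<^sub>m\<close>. Monomials are multisets of elements
  of \<open>M\<close>.\<close>

definition monomials :: "'m set \<Rightarrow> 'm multiset monoid"
  where "monomials V = \<lparr>carrier = {\<mu>. set_mset \<mu> \<subseteq> V}, monoid.mult = (+), one = {#}\<rparr>"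

definition poly_alg :: "('a, 'r) ring_scheme \<Rightarrow> ('a, 'm) module \<Rightarrow> ('a, 'm multiset \<Rightarrow> 'a) module"
  where "poly_alg R M = monoid_alg R (monomials (carrier M))"

definition var :: "('a, 'r) ring_scheme \<Rightarrow> 'm \<Rightarrow> ('m multiset \<Rightarrow> 'a)"
  where "var R m = basis_elt R {#m#}"

definition sym_rels :: "('a, 'r) ring_scheme \<Rightarrow> ('a, 'm) module \<Rightarrow> ('m multiset \<Rightarrow> 'a) set"
  where "sym_rels R M =
    {var R (m \<oplus>\<^bsub>M\<^esub> n) \<ominus>\<^bsub>poly_alg R M\<^esub> (var R m \<oplus>\<^bsub>poly_alg R M\<^esub> var R n) | m n.
        m \<in> carrier M \<and> n \<in> carrier M} \<union>
    {var R (r \<odot>\<^bsub>M\<^esub> m) \<ominus>\<^bsub>poly_alg R M\<^esub> (r \<odot>\<^bsub>poly_alg R M\<^esub> var R m) | r m.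
        r \<in> carrier R \<and> m \<in> carrier M}"

definition sym_ideal :: "('a, 'r) ring_scheme \<Rightarrow> ('a, 'm) module \<Rightarrow> ('m multiset \<Rightarrow> 'a) set"
  where "sym_ideal R M = genideal (poly_alg R M) (sym_rels R M)"

definition sym_alg :: "('a, 'r) ring_scheme \<Rightarrow> ('a, 'm) module \<Rightarrow> ('a, ('m multiset \<Rightarrow> 'a) set) module"
  where "sym_alg R M = quot (poly_alg R M) (sym_ideal R M)"

definition sym_class :: "('a, 'r) ring_scheme \<Rightarrow> ('a, 'm) module \<Rightarrow>
    ('m multiset \<Rightarrow> 'a) \<Rightarrow> ('m multiset \<Rightarrow> 'a) set"
  where "sym_class R M p = sym_ideal R M +>\<^bsub>poly_alg R M\<^esub> p"

text \<open>\<open>Sym(g)\<close> substitutes \<open>X\<^bsub>g m\<^esub>\<close> for \<open>X\<^sub>m\<close>. All representatives of a coset give the same class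
  when \<open>g\<close> is linear, so the union below is that class.\<close>

definition sym_map :: "('a, 'r) ring_scheme \<Rightarrow> ('a, 'n) module \<Rightarrow> ('m \<Rightarrow> 'n) \<Rightarrow>
    ('m multiset \<Rightarrow> 'a) set \<Rightarrow> ('n multiset \<Rightarrow> 'a) set"
  where "sym_map R N g X = (\<Union>p\<in>X. sym_class R N (push R (image_mset g) p))"

definition sym_component ::
  "('a, 'r) ring_scheme \<Rightarrow> ('a, 'm) module \<Rightarrow> nat \<Rightarrow> ('m multiset \<Rightarrow> 'a) set set"
  where "sym_component R M n =
    sym_class R M ` {p \<in> carrier (poly_alg R M). \<forall>\<mu>\<in>supp R p. size \<mu> = n}"


section \<open>Rees algebras\<close>

text \<open>The image of \<open>Sym(g)\<close>, as a subalgebra of \<open>Sym(N)\<close>.\<close>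

definition rees_alg_map :: "('a, 'r) ring_scheme \<Rightarrow> ('a, 'm) module \<Rightarrow> ('a, 'n) module \<Rightarrow>
    ('m \<Rightarrow> 'n) \<Rightarrow> ('a, ('n multiset \<Rightarrow> 'a) set) module"
  where "rees_alg_map R M N g = (sym_alg R N)\<lparr>carrier := sym_map R N g ` carrier (sym_alg R M)\<rparr>"

definition sym_kernel :: "('a, 'r) ring_scheme \<Rightarrow> ('a, 'm) module \<Rightarrow> ('a, 'n) module \<Rightarrow>
    ('m \<Rightarrow> 'n) \<Rightarrow> ('m multiset \<Rightarrow> 'a) set set"
  where "sym_kernel R M N g = a_kernel (sym_alg R M) (sym_alg R N) (sym_map R N g)"

text \<open>The intersection is over all linear maps to free modules. HOL cannot quantify over types inside
  a definition, so the free modules are those with carrier in the type \<open>nat \<Rightarrow> 'a\<close>, which contains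
  a copy of every free module of countable rank. The lemma \<open>rees_ideal_subset_sym_kernel\<close> at the
  end shows that free modules of any other type do not make the intersection smaller.\<close>

definition rees_ideal :: "('a, 'r) ring_scheme \<Rightarrow> ('a, 'm) module \<Rightarrow> ('m multiset \<Rightarrow> 'a) set set"
  where "rees_ideal R M =
    \<Inter>{sym_kernel R M G g | (G :: ('a, nat \<Rightarrow> 'a) module) g.
        free_module R G \<and> g \<in> lin_maps R M G}"

definition rees_alg ::
  "('a, 'r) ring_scheme \<Rightarrow> ('a, 'm) module \<Rightarrow> ('a, ('m multiset \<Rightarrow> 'a) set set) module"
  where "rees_alg R M = quot (sym_alg R M) (rees_ideal R M)"

definition rees_class :: "('a, 'r) ring_scheme \<Rightarrow> ('a, 'm) module \<Rightarrow>
    ('m multiset \<Rightarrow> 'a) set \<Rightarrow> ('m multiset \<Rightarrow> 'a) set set"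
  where "rees_class R M x = rees_ideal R M +>\<^bsub>sym_alg R M\<^esub> x"

definition rees_gen :: "('a, 'r) ring_scheme \<Rightarrow> ('a, 'm) module \<Rightarrow> 'm \<Rightarrow> ('m multiset \<Rightarrow> 'a) set set"
  where "rees_gen R M m = rees_class R M (sym_class R M (var R m))"

definition rees_component ::
  "('a, 'r) ring_scheme \<Rightarrow> ('a, 'm) module \<Rightarrow> nat \<Rightarrow> ('m multiset \<Rightarrow> 'a) set set set"
  where "rees_component R M n = rees_class R M ` sym_component R M n"

text \<open>The natural surjection from \<^const>\<open>rees_alg\<close> to \<^const>\<open>rees_alg_map\<close> for a map \<open>g\<close> into a free
  module: a class is sent to the common value of \<open>Sym(g)\<close> on it.\<close>

definition rees_nat_surj :: "('a, 'r) ring_scheme \<Rightarrow> ('a, 'n) module \<Rightarrow> ('m \<Rightarrow> 'n) \<Rightarrow>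
    ('m multiset \<Rightarrow> 'a) set set \<Rightarrow> ('n multiset \<Rightarrow> 'a) set"
  where "rees_nat_surj R N g X = the_elem (sym_map R N g ` X)"


section \<open>Tensor products, base change, flatness\<close>

text \<open>\<open>A \<otimes>\<^sub>R B\<close> is the free \<open>R\<close>-module on \<open>A \<times> B\<close> modulo the bilinearity relations. It is written
  as a quotient of the monoid algebra of \<open>A \<times> B\<close> so that it carries the usual multiplication
  \<open>(a \<otimes> b)(a' \<otimes> b') = aa' \<otimes> bb'\<close> when \<open>A\<close> and \<open>B\<close> are algebras; for mere modules only the
  module structure is used.\<close>

definition pair_alg ::
  "('a, 'r) ring_scheme \<Rightarrow> ('a, 'm) module \<Rightarrow> ('a, 'n) module \<Rightarrow> ('a, 'm \<times> 'n \<Rightarrow> 'a) module"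
  where "pair_alg R A B = monoid_alg R (A \<times>\<times> B)"

definition tensor_rels ::
  "('a, 'r) ring_scheme \<Rightarrow> ('a, 'm) module \<Rightarrow> ('a, 'n) module \<Rightarrow> ('m \<times> 'n \<Rightarrow> 'a) set"
  where "tensor_rels R A B =
    {basis_elt R (a \<oplus>\<^bsub>A\<^esub> a', b) \<ominus>\<^bsub>pair_alg R A B\<^esub>
        (basis_elt R (a, b) \<oplus>\<^bsub>pair_alg R A B\<^esub> basis_elt R (a', b)) | a a' b.
        a \<in> carrier A \<and> a' \<in> carrier A \<and> b \<in> carrier B} \<union>
    {basis_elt R (a, b \<oplus>\<^bsub>B\<^esub> b') \<ominus>\<^bsub>pair_alg R A B\<^esub>
        (basis_elt R (a, b) \<oplus>\<^bsub>pair_alg R A B\<^esub> basis_elt R (a, b')) | a b b'.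
        a \<in> carrier A \<and> b \<in> carrier B \<and> b' \<in> carrier B} \<union>
    {basis_elt R (r \<odot>\<^bsub>A\<^esub> a, b) \<ominus>\<^bsub>pair_alg R A B\<^esub>
        (r \<odot>\<^bsub>pair_alg R A B\<^esub> basis_elt R (a, b)) | r a b.
        r \<in> carrier R \<and> a \<in> carrier A \<and> b \<in> carrier B} \<union>
    {basis_elt R (a, r \<odot>\<^bsub>B\<^esub> b) \<ominus>\<^bsub>pair_alg R A B\<^esub>
        (r \<odot>\<^bsub>pair_alg R A B\<^esub> basis_elt R (a, b)) | r a b.
        r \<in> carrier R \<and> a \<in> carrier A \<and> b \<in> carrier B}"

definition tensor_kernel ::
  "('a, 'r) ring_scheme \<Rightarrow> ('a, 'm) module \<Rightarrow> ('a, 'n) module \<Rightarrow> ('m \<times> 'n \<Rightarrow> 'a) set"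
  where "tensor_kernel R A B = submodule_span R (pair_alg R A B) (tensor_rels R A B)"

definition tensor ::
  "('a, 'r) ring_scheme \<Rightarrow> ('a, 'm) module \<Rightarrow> ('a, 'n) module \<Rightarrow> ('a, ('m \<times> 'n \<Rightarrow> 'a) set) module"
  where "tensor R A B = quot (pair_alg R A B) (tensor_kernel R A B)"

definition tensor_class :: "('a, 'r) ring_scheme \<Rightarrow> ('a, 'm) module \<Rightarrow> ('a, 'n) module \<Rightarrow>
    ('m \<times> 'n \<Rightarrow> 'a) \<Rightarrow> ('m \<times> 'n \<Rightarrow> 'a) set"
  where "tensor_class R A B p = tensor_kernel R A B +>\<^bsub>pair_alg R A B\<^esub> p"

definition pure_tensor :: "('a, 'r) ring_scheme \<Rightarrow> ('a, 'm) module \<Rightarrow> ('a, 'n) module \<Rightarrow>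
    'm \<Rightarrow> 'n \<Rightarrow> ('m \<times> 'n \<Rightarrow> 'a) set"
  where "pure_tensor R A B a b = tensor_class R A B (basis_elt R (a, b))"

text \<open>For linear maps \<open>f : A \<rightarrow> A'\<close> and \<open>g : B \<rightarrow> B'\<close>, the map \<open>f \<otimes> g\<close>.\<close>

definition tensor_map :: "('a, 'r) ring_scheme \<Rightarrow> ('a, 'm') module \<Rightarrow> ('a, 'n') module \<Rightarrow>
    ('m \<Rightarrow> 'm') \<Rightarrow> ('n \<Rightarrow> 'n') \<Rightarrow> ('m \<times> 'n \<Rightarrow> 'a) set \<Rightarrow> ('m' \<times> 'n' \<Rightarrow> 'a) set"
  where "tensor_map R A' B' f g X = (\<Union>p\<in>X. tensor_class R A' B' (push R (map_prod f g) p))"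

text \<open>\<open>S \<otimes>\<^sub>R M\<close> as a module over \<open>S\<close>, where \<open>s\<close> acts as multiplication by \<open>s\<close> tensored with the
  identity; an \<open>S\<close>-algebra if \<open>M\<close> is an \<open>R\<close>-algebra.\<close>

definition base_change ::
  "('a, 'r) ring_scheme \<Rightarrow> ('a, 's) module \<Rightarrow> ('a, 'm) module \<Rightarrow> ('s, ('s \<times> 'm \<Rightarrow> 'a) set) module"
  where "base_change R S M = ring.extend (ring.truncate (tensor R S M))
    \<lparr>smult = (\<lambda>s. tensor_map R S M (\<lambda>t. s \<otimes>\<^bsub>S\<^esub> t) id)\<rparr>"

text \<open>Injections between modules with carrier in \<open>nat \<Rightarrow> 'a\<close> suffice to test flatness, since they
  include, up to isomorphism, all inclusions of ideals into \<open>R\<close>.\<close>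

definition flat_module :: "('a, 'r) ring_scheme \<Rightarrow> ('a, 's) module \<Rightarrow> bool"
  where "flat_module R S \<longleftrightarrow> module R S \<and>
    (\<forall>(N :: ('a, nat \<Rightarrow> 'a) module) (N' :: ('a, nat \<Rightarrow> 'a) module). \<forall>g\<in>lin_maps R N N'.
      module R N \<and> module R N' \<and> inj_on g (carrier N) \<longrightarrow>
      inj_on (tensor_map R S N' id g) (carrier (tensor R S N)))"


section \<open>Independence of the universe of free modules\<close>

context cring
begin

text \<open>
  The goal is that the ideal \<^const>\<open>rees_ideal\<close>, defined with free modules carried by \<open>nat \<Rightarrow> 'a\<close>,
  lies in the kernel of \<open>Sym(g)\<close> for every linear map \<open>g\<close> to a free module of any type: an element
  of \<open>Sym(M)\<close> involves finitely many elements of \<open>M\<close>, and their images lie in a finitely generated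
  free direct summand.
\<close>

lemma fin_funsD:
  assumes "p \<in> fin_funs R K"
  shows "p k \<in> carrier R" "finite (supp R p)" "supp R p \<subseteq> K"
  using assms by (auto simp: fin_funs_def)

lemma fin_funs_outside: "p \<in> fin_funs R K \<Longrightarrow> k \<notin> K \<Longrightarrow> p k = \<zero>"
  by (auto simp: fin_funs_def supp_def)

lemma fin_funsI:
  assumes "\<And>k. p k \<in> carrier R" "finite A" "A \<subseteq> K" "\<And>k. k \<notin> A \<Longrightarrow> p k = \<zero>"
  shows "p \<in> fin_funs R K"
proof -
  have "supp R p \<subseteq> A" using assms(4) by (auto simp: supp_def)
  then show ?thesis
    using assms finite_subset[of "supp R p" A] by (auto simp: fin_funs_def)
qed

lemma finsum_swap:
  assumes "finite A" "finite B" "\<And>i j. i \<in> A \<Longrightarrow> j \<in> B \<Longrightarrow> u i j \<in> carrier R"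
  shows "(\<Oplus>i\<in>A. \<Oplus>j\<in>B. u i j) = (\<Oplus>j\<in>B. \<Oplus>i\<in>A. u i j)"
  using assms
proof (induction A rule: finite_induct)
  case empty
  then show ?case by (simp add: finsum_zero)
next
  case (insert x A)
  have *: "(\<Oplus>j\<in>B. u x j) \<in> carrier R" "\<And>i. i \<in> A \<Longrightarrow> (\<Oplus>j\<in>B. u i j) \<in> carrier R"
    "\<And>j. j \<in> B \<Longrightarrow> (\<Oplus>i\<in>A. u i j) \<in> carrier R"
    using insert by (auto intro!: finsum_closed)
  have "(\<Oplus>i\<in>insert x A. \<Oplus>j\<in>B. u i j) = (\<Oplus>j\<in>B. u x j) \<oplus> (\<Oplus>j\<in>B. \<Oplus>i\<in>A. u i j)"
    using insert * by (subst finsum_insert) auto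
  also have "\<dots> = (\<Oplus>j\<in>B. u x j \<oplus> (\<Oplus>i\<in>A. u i j))"
    using insert * by (subst finsum_addf) auto
  also have "\<dots> = (\<Oplus>j\<in>B. \<Oplus>i\<in>insert x A. u i j)"
  proof (rule finsum_cong')
    show "(\<lambda>j. \<Oplus>i\<in>insert x A. u i j) \<in> B \<rightarrow> carrier R"
      using insert by (auto intro!: finsum_closed)
    fix j assume "j \<in> B"
    then show "u x j \<oplus> (\<Oplus>i\<in>A. u i j) = (\<Oplus>i\<in>insert x A. u i j)"
      using insert by (subst finsum_insert) auto
  qed simp
  finally show ?case .
qed

text \<open>The pairing \<open>\<Sum>\<^sub>k p(k) v(k)\<close> of a finitely supported function with an arbitrary one;
  products and push-forwards in monoid algebras are expressed through it.\<close>

definition ev :: "('k \<Rightarrow> 'a) \<Rightarrow> ('k \<Rightarrow> 'a) \<Rightarrow> 'a"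
  where "ev p v = (\<Oplus>k\<in>supp R p. p k \<otimes> v k)"

lemma ev_superset:
  assumes "p \<in> fin_funs R K" "finite A" "supp R p \<subseteq> A" "\<And>k. k \<in> A \<Longrightarrow> v k \<in> carrier R"
  shows "ev p v = (\<Oplus>k\<in>A. p k \<otimes> v k)"
  unfolding ev_def
  by (rule add.finprod_mono_neutral_cong_left)
    (use assms in \<open>auto simp: supp_def fin_funsD\<close>)

lemma ev_closed:
  assumes "p \<in> fin_funs R K" "\<And>k. k \<in> supp R p \<Longrightarrow> v k \<in> carrier R"
  shows "ev p v \<in> carrier R"
  unfolding ev_def using assms by (auto intro!: finsum_closed simp: fin_funsD)

lemma ev_cong:
  assumes "p \<in> fin_funs R K" "\<And>k. k \<in> supp R p \<Longrightarrow> v k = w k"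
    "\<And>k. k \<in> supp R p \<Longrightarrow> w k \<in> carrier R"
  shows "ev p v = ev p w"
  unfolding ev_def by (rule finsum_cong') (use assms in \<open>auto simp: fin_funsD\<close>)

lemma ev_add:
  assumes "p \<in> fin_funs R K" "q \<in> fin_funs R K'" "\<And>k. v k \<in> carrier R"
  shows "ev (\<lambda>k. p k \<oplus> q k) v = ev p v \<oplus> ev q v"
proof -
  let ?A = "supp R p \<union> supp R q"
  have pq: "(\<lambda>k. p k \<oplus> q k) \<in> fin_funs R UNIV"
    by (rule fin_funsI[where A = ?A]) (use assms in \<open>auto simp: fin_funsD\<close>, auto simp: supp_def)
  have fA: "finite ?A" using assms by (auto simp: fin_funsD)
  have "ev (\<lambda>k. p k \<oplus> q k) v = (\<Oplus>k\<in>?A. (p k \<oplus> q k) \<otimes> v k)"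
    by (rule ev_superset[OF pq]) (use assms fA in \<open>auto simp: supp_def\<close>)
  also have "\<dots> = (\<Oplus>k\<in>?A. p k \<otimes> v k \<oplus> q k \<otimes> v k)"
    by (rule finsum_cong') (use assms in \<open>auto simp: fin_funsD l_distr\<close>)
  also have "\<dots> = (\<Oplus>k\<in>?A. p k \<otimes> v k) \<oplus> (\<Oplus>k\<in>?A. q k \<otimes> v k)"
    by (rule finsum_addf) (use assms in \<open>auto simp: fin_funsD\<close>)
  also have "(\<Oplus>k\<in>?A. p k \<otimes> v k) = ev p v"
    by (rule ev_superset[symmetric]) (use assms fA in auto)
  also have "(\<Oplus>k\<in>?A. q k \<otimes> v k) = ev q v"
    by (rule ev_superset[symmetric]) (use assms fA in auto)
  finally show ?thesis .
qed

lemma ev_smult: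
  assumes "p \<in> fin_funs R K" "r \<in> carrier R" "\<And>k. v k \<in> carrier R"
  shows "ev (\<lambda>k. r \<otimes> p k) v = r \<otimes> ev p v"
proof -
  have rp: "(\<lambda>k. r \<otimes> p k) \<in> fin_funs R UNIV"
    by (rule fin_funsI[where A = "supp R p"]) (use assms in \<open>auto simp: fin_funsD\<close>, auto simp: supp_def)
  have "ev (\<lambda>k. r \<otimes> p k) v = (\<Oplus>k\<in>supp R p. (r \<otimes> p k) \<otimes> v k)"
    by (rule ev_superset[OF rp]) (use assms in \<open>auto simp: fin_funsD\<close>, auto simp: supp_def)
  also have "\<dots> = (\<Oplus>k\<in>supp R p. r \<otimes> (p k \<otimes> v k))"
    by (rule finsum_cong') (use assms in \<open>auto simp: fin_funsD m_assoc\<close>)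
  also have "\<dots> = r \<otimes> ev p v"
    unfolding ev_def
    by (rule finsum_rdistr[symmetric]) (use assms in \<open>auto simp: fin_funsD\<close>)
  finally show ?thesis .
qed

lemma basis_elt_closed: "k \<in> K \<Longrightarrow> basis_elt R k \<in> fin_funs R K"
  by (rule fin_funsI[where A = "{k}"]) (auto simp: basis_elt_def)

lemma ev_basis_elt:
  assumes "v k \<in> carrier R"
  shows "ev (basis_elt R k) v = v k"
proof -
  have "ev (basis_elt R k) v = (\<Oplus>j\<in>{k}. basis_elt R k j \<otimes> v j)"
    by (rule ev_superset[OF basis_elt_closed[OF UNIV_I]]) (use assms in \<open>auto simp: basis_elt_def supp_def\<close>)
  then show ?thesis using assms by (simp add: basis_elt_def)
qed

lemma ev_swap:
  assumes "p \<in> fin_funs R K" "q \<in> fin_funs R L"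
    "\<And>i j. i \<in> supp R p \<Longrightarrow> j \<in> supp R q \<Longrightarrow> w i j \<in> carrier R"
  shows "ev p (\<lambda>i. ev q (\<lambda>j. w i j)) = ev q (\<lambda>j. ev p (\<lambda>i. w i j))"
proof -
  have "ev p (\<lambda>i. ev q (\<lambda>j. w i j)) = (\<Oplus>i\<in>supp R p. \<Oplus>j\<in>supp R q. p i \<otimes> (q j \<otimes> w i j))"
    unfolding ev_def
  proof (rule finsum_cong')
    fix i assume "i \<in> supp R p"
    then show "p i \<otimes> (\<Oplus>j\<in>supp R q. q j \<otimes> w i j) = (\<Oplus>j\<in>supp R q. p i \<otimes> (q j \<otimes> w i j))"
      by (intro finsum_rdistr) (use assms in \<open>auto simp: fin_funsD\<close>)
  qed (use assms in \<open>auto intro!: finsum_closed simp: fin_funsD\<close>)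
  also have "\<dots> = (\<Oplus>j\<in>supp R q. \<Oplus>i\<in>supp R p. p i \<otimes> (q j \<otimes> w i j))"
    by (rule finsum_swap) (use assms in \<open>auto simp: fin_funsD\<close>)
  also have "\<dots> = ev q (\<lambda>j. ev p (\<lambda>i. w i j))"
    unfolding ev_def
  proof (rule finsum_cong')
    fix j assume j: "j \<in> supp R q"
    have "(\<Oplus>i\<in>supp R p. p i \<otimes> (q j \<otimes> w i j)) = (\<Oplus>i\<in>supp R p. q j \<otimes> (p i \<otimes> w i j))"
      by (rule finsum_cong') (use assms j in \<open>auto simp: fin_funsD m_lcomm\<close>)
    also have "\<dots> = q j \<otimes> (\<Oplus>i\<in>supp R p. p i \<otimes> w i j)"
      by (rule finsum_rdistr[symmetric]) (use assms j in \<open>auto simp: fin_funsD\<close>)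
    finally show "(\<Oplus>i\<in>supp R p. p i \<otimes> (q j \<otimes> w i j)) = q j \<otimes> (\<Oplus>i\<in>supp R p. p i \<otimes> w i j)" .
  qed (use assms in \<open>auto intro!: finsum_closed simp: fin_funsD\<close>)
  finally show ?thesis .
qed

definition delta :: "'k \<Rightarrow> 'k \<Rightarrow> 'a"
  where "delta k l = (if k = l then \<one> else \<zero>)"

lemma delta_closed [simp]: "delta k l \<in> carrier R"
  by (simp add: delta_def)

lemma push_ev:
  assumes "p \<in> fin_funs R K"
  shows "push R h p l = ev p (\<lambda>k. delta (h k) l)"
  unfolding push_def ev_def
  by (rule finsum_cong') (use assms in \<open>auto simp: fin_funsD delta_def\<close>)

lemma mult_ev:
  assumes "p \<in> fin_funs R K" "q \<in> fin_funs R L"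
  shows "(p \<otimes>\<^bsub>monoid_alg R G\<^esub> q) l = ev p (\<lambda>i. ev q (\<lambda>j. delta (i \<otimes>\<^bsub>G\<^esub> j) l))"
proof -
  have "ev p (\<lambda>i. ev q (\<lambda>j. delta (i \<otimes>\<^bsub>G\<^esub> j) l)) =
      (\<Oplus>i\<in>supp R p. \<Oplus>j\<in>supp R q. if i \<otimes>\<^bsub>G\<^esub> j = l then p i \<otimes> q j else \<zero>)"
    unfolding ev_def
  proof (rule finsum_cong')
    fix i assume i: "i \<in> supp R p"
    have "p i \<otimes> (\<Oplus>j\<in>supp R q. q j \<otimes> delta (i \<otimes>\<^bsub>G\<^esub> j) l) =
        (\<Oplus>j\<in>supp R q. p i \<otimes> (q j \<otimes> delta (i \<otimes>\<^bsub>G\<^esub> j) l))"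
      by (rule finsum_rdistr) (use assms in \<open>auto simp: fin_funsD\<close>)
    also have "\<dots> = (\<Oplus>j\<in>supp R q. if i \<otimes>\<^bsub>G\<^esub> j = l then p i \<otimes> q j else \<zero>)"
      by (rule finsum_cong') (use assms in \<open>auto simp: fin_funsD delta_def\<close>)
    finally show "p i \<otimes> (\<Oplus>j\<in>supp R q. q j \<otimes> delta (i \<otimes>\<^bsub>G\<^esub> j) l) =
        (\<Oplus>j\<in>supp R q. if i \<otimes>\<^bsub>G\<^esub> j = l then p i \<otimes> q j else \<zero>)" .
  qed (use assms in \<open>auto intro!: finsum_closed simp: fin_funsD\<close>)
  then show ?thesis by (simp add: monoid_alg_def)
qed

text \<open>Evaluation after regrouping along a map \<open>t\<close>.\<close>

lemma ev_delta:
  assumes "finite L" "t \<in> L" "\<And>l. w l \<in> carrier R"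
  shows "(\<Oplus>l\<in>L. delta t l \<otimes> w l) = w t"
proof -
  have "(\<Oplus>l\<in>L. delta t l \<otimes> w l) = (\<Oplus>l\<in>L. if t = l then w l else \<zero>)"
    by (rule finsum_cong') (use assms in \<open>auto simp: delta_def\<close>)
  also have "\<dots> = w t"
    by (rule finsum_singleton) (use assms in auto)
  finally show ?thesis .
qed

lemma ev_finsum:
  assumes "p \<in> fin_funs R K" "finite L" "\<And>i l. l \<in> L \<Longrightarrow> u i l \<in> carrier R"
    "\<And>l. w l \<in> carrier R"
  shows "(\<Oplus>l\<in>L. ev p (\<lambda>i. u i l) \<otimes> w l) = ev p (\<lambda>i. \<Oplus>l\<in>L. u i l \<otimes> w l)"
proof -
  have "(\<Oplus>l\<in>L. ev p (\<lambda>i. u i l) \<otimes> w l) = (\<Oplus>l\<in>L. \<Oplus>i\<in>supp R p. p i \<otimes> u i l \<otimes> w l)"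
    unfolding ev_def
    by (rule finsum_cong')
      (use assms in \<open>auto intro!: finsum_closed finsum_ldistr simp: fin_funsD\<close>)
  also have "\<dots> = (\<Oplus>i\<in>supp R p. \<Oplus>l\<in>L. p i \<otimes> u i l \<otimes> w l)"
    by (rule finsum_swap) (use assms in \<open>auto simp: fin_funsD\<close>)
  also have "\<dots> = ev p (\<lambda>i. \<Oplus>l\<in>L. u i l \<otimes> w l)"
    unfolding ev_def
  proof (rule finsum_cong')
    fix i assume "i \<in> supp R p"
    have "(\<Oplus>l\<in>L. p i \<otimes> u i l \<otimes> w l) = (\<Oplus>l\<in>L. p i \<otimes> (u i l \<otimes> w l))"
      by (rule finsum_cong') (use assms in \<open>auto simp: fin_funsD m_assoc\<close>)
    also have "\<dots> = p i \<otimes> (\<Oplus>l\<in>L. u i l \<otimes> w l)"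
      by (rule finsum_rdistr[symmetric]) (use assms in \<open>auto simp: fin_funsD\<close>)
    finally show "(\<Oplus>l\<in>L. p i \<otimes> u i l \<otimes> w l) = p i \<otimes> (\<Oplus>l\<in>L. u i l \<otimes> w l)" .
  qed (use assms in \<open>auto intro!: finsum_closed simp: fin_funsD\<close>)
  finally show ?thesis .
qed

lemma ev_zero: "p \<in> fin_funs R K \<Longrightarrow> (\<And>k. k \<in> supp R p \<Longrightarrow> v k = \<zero>) \<Longrightarrow> ev p v = \<zero>"
  unfolding ev_def by (rule add.finprod_one_eqI) (auto simp: fin_funsD)

lemma push_closed:
  assumes "p \<in> fin_funs R K" "h ` K \<subseteq> L"
  shows "push R h p \<in> fin_funs R L"
proof (rule fin_funsI[where A = "h ` supp R p"])
  show "push R h p k \<in> carrier R" for k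
    using assms(1) by (simp add: push_ev[OF assms(1)] ev_closed)
  show "push R h p k = \<zero>" if "k \<notin> h ` supp R p" for k
    unfolding push_ev[OF assms(1)] by (rule ev_zero[OF assms(1)]) (use that in \<open>auto simp: delta_def\<close>)
qed (use assms in \<open>auto simp: fin_funsD dest: fin_funsD(3)\<close>)

lemma ev_push:
  assumes "p \<in> fin_funs R K" "\<And>l. w l \<in> carrier R"
  shows "ev (push R h p) w = ev p (\<lambda>k. w (h k))"
proof -
  let ?L = "h ` supp R p"
  have fL: "finite ?L" using assms by (simp add: fin_funsD)
  have "push R h p l = \<zero>" if "l \<notin> ?L" for l
    unfolding push_ev[OF assms(1)] by (rule ev_zero[OF assms(1)]) (use that in \<open>auto simp: delta_def\<close>)
  then have "supp R (push R h p) \<subseteq> ?L" by (auto simp: supp_def)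
  then have "ev (push R h p) w = (\<Oplus>l\<in>?L. push R h p l \<otimes> w l)"
    by (intro ev_superset[OF push_closed[OF assms(1) subset_UNIV]]) (use assms fL in auto)
  also have "\<dots> = (\<Oplus>l\<in>?L. ev p (\<lambda>k. delta (h k) l) \<otimes> w l)"
    by (simp add: push_ev[OF assms(1)])
  also have "\<dots> = ev p (\<lambda>k. \<Oplus>l\<in>?L. delta (h k) l \<otimes> w l)"
    by (rule ev_finsum[OF assms(1) fL]) (use assms in auto)
  also have "\<dots> = ev p (\<lambda>k. w (h k))"
    by (rule ev_cong[OF assms(1)]) (use assms fL in \<open>auto intro!: ev_delta\<close>)
  finally show ?thesis .
qed

lemma mult_closed:
  assumes "p \<in> fin_funs R (carrier G)" "q \<in> fin_funs R (carrier G)"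
    "\<And>i j. i \<in> carrier G \<Longrightarrow> j \<in> carrier G \<Longrightarrow> i \<otimes>\<^bsub>G\<^esub> j \<in> carrier G"
  shows "p \<otimes>\<^bsub>monoid_alg R G\<^esub> q \<in> fin_funs R (carrier G)"
    "supp R (p \<otimes>\<^bsub>monoid_alg R G\<^esub> q) \<subseteq> (\<lambda>(i, j). i \<otimes>\<^bsub>G\<^esub> j) ` (supp R p \<times> supp R q)"
proof -
  let ?A = "(\<lambda>(i, j). i \<otimes>\<^bsub>G\<^esub> j) ` (supp R p \<times> supp R q)"
  have z: "(p \<otimes>\<^bsub>monoid_alg R G\<^esub> q) k = \<zero>" if "k \<notin> ?A" for k
    unfolding mult_ev[OF assms(1,2)]
    by (rule ev_zero[OF assms(1)], rule ev_zero[OF assms(2)]) (use that in \<open>auto simp: delta_def\<close>)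
  then show "supp R (p \<otimes>\<^bsub>monoid_alg R G\<^esub> q) \<subseteq> ?A" by (auto simp: supp_def)
  show "p \<otimes>\<^bsub>monoid_alg R G\<^esub> q \<in> fin_funs R (carrier G)"
  proof (rule fin_funsI[where A = ?A])
    show "(p \<otimes>\<^bsub>monoid_alg R G\<^esub> q) k \<in> carrier R" for k
      unfolding mult_ev[OF assms(1,2)]
      by (rule ev_closed[OF assms(1)], rule ev_closed[OF assms(2)]) simp
    show "?A \<subseteq> carrier G"
      using assms(3) fin_funsD(3)[OF assms(1)] fin_funsD(3)[OF assms(2)] by (auto simp: subset_iff)
  qed (use assms z in \<open>auto simp: fin_funsD\<close>)
qed

lemma ev_mult:
  assumes p: "p \<in> fin_funs R (carrier G)" and q: "q \<in> fin_funs R (carrier G)"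
    and G: "\<And>i j. i \<in> carrier G \<Longrightarrow> j \<in> carrier G \<Longrightarrow> i \<otimes>\<^bsub>G\<^esub> j \<in> carrier G"
    and w: "\<And>l. w l \<in> carrier R"
  shows "ev (p \<otimes>\<^bsub>monoid_alg R G\<^esub> q) w = ev p (\<lambda>i. ev q (\<lambda>j. w (i \<otimes>\<^bsub>G\<^esub> j)))"
proof -
  let ?L = "(\<lambda>(i, j). i \<otimes>\<^bsub>G\<^esub> j) ` (supp R p \<times> supp R q)"
  note mc = mult_closed[OF p q G]
  have fL: "finite ?L" using p q by (simp add: fin_funsD)
  have evq: "ev q (\<lambda>j. delta (i \<otimes>\<^bsub>G\<^esub> j) l) \<in> carrier R" for i l
    by (rule ev_closed[OF q]) simp
  have "ev (p \<otimes>\<^bsub>monoid_alg R G\<^esub> q) w = (\<Oplus>l\<in>?L. (p \<otimes>\<^bsub>monoid_alg R G\<^esub> q) l \<otimes> w l)"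
    by (rule ev_superset[OF mc(1) fL mc(2)]) (use w in auto)
  also have "\<dots> = (\<Oplus>l\<in>?L. ev p (\<lambda>i. ev q (\<lambda>j. delta (i \<otimes>\<^bsub>G\<^esub> j) l)) \<otimes> w l)"
    by (simp add: mult_ev[OF p q])
  also have "\<dots> = ev p (\<lambda>i. \<Oplus>l\<in>?L. ev q (\<lambda>j. delta (i \<otimes>\<^bsub>G\<^esub> j) l) \<otimes> w l)"
    by (rule ev_finsum[OF p fL]) (use w evq in auto)
  also have "\<dots> = ev p (\<lambda>i. ev q (\<lambda>j. w (i \<otimes>\<^bsub>G\<^esub> j)))"
  proof (rule ev_cong[OF p])
    fix i assume i: "i \<in> supp R p"
    have "(\<Oplus>l\<in>?L. ev q (\<lambda>j. delta (i \<otimes>\<^bsub>G\<^esub> j) l) \<otimes> w l) =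
        ev q (\<lambda>j. \<Oplus>l\<in>?L. delta (i \<otimes>\<^bsub>G\<^esub> j) l \<otimes> w l)"
      by (rule ev_finsum[OF q fL]) (use w in auto)
    also have "\<dots> = ev q (\<lambda>j. w (i \<otimes>\<^bsub>G\<^esub> j))"
      by (rule ev_cong[OF q]) (use w fL i in \<open>auto intro!: ev_delta\<close>)
    finally show "(\<Oplus>l\<in>?L. ev q (\<lambda>j. delta (i \<otimes>\<^bsub>G\<^esub> j) l) \<otimes> w l) =
        ev q (\<lambda>j. w (i \<otimes>\<^bsub>G\<^esub> j))" .
    show "ev q (\<lambda>j. w (i \<otimes>\<^bsub>G\<^esub> j)) \<in> carrier R"
      by (rule ev_closed[OF q]) (use w in auto)
  qed
  finally show ?thesis .
qed

lemma ev_delta_id: "p \<in> fin_funs R K \<Longrightarrow> ev p (\<lambda>k. delta k l) = p l"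
proof -
  assume p: "p \<in> fin_funs R K"
  have "ev p (\<lambda>k. delta k l) = (\<Oplus>k\<in>insert l (supp R p). p k \<otimes> delta k l)"
    by (rule ev_superset[OF p]) (use p in \<open>auto simp: fin_funsD\<close>)
  also have "\<dots> = (\<Oplus>k\<in>insert l (supp R p). if k = l then p k else \<zero>)"
    by (rule finsum_cong') (use p in \<open>auto simp: fin_funsD delta_def\<close>)
  also have "\<dots> = p l"
    by (rule add.finprod_singleton_swap) (use p in \<open>auto simp: fin_funsD\<close>)
  finally show ?thesis .
qed

lemma monoid_alg_simps:
  "carrier (monoid_alg R G) = fin_funs R (carrier G)"
  "\<zero>\<^bsub>monoid_alg R G\<^esub> = (\<lambda>k. \<zero>)"
  "p \<oplus>\<^bsub>monoid_alg R G\<^esub> q = (\<lambda>k. p k \<oplus> q k)"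
  "r \<odot>\<^bsub>monoid_alg R G\<^esub> p = (\<lambda>k. r \<otimes> p k)"
  "\<one>\<^bsub>monoid_alg R G\<^esub> = basis_elt R \<one>\<^bsub>G\<^esub>"
  by (simp_all add: monoid_alg_def basis_elt_def)

lemma fin_funs_add: "p \<in> fin_funs R K \<Longrightarrow> q \<in> fin_funs R K \<Longrightarrow> (\<lambda>k. p k \<oplus> q k) \<in> fin_funs R K"
  by (rule fin_funsI[where A = "supp R p \<union> supp R q"])
    (auto simp: fin_funsD dest: fin_funsD(3), auto simp: supp_def)

lemma fin_funs_smult: "r \<in> carrier R \<Longrightarrow> p \<in> fin_funs R K \<Longrightarrow> (\<lambda>k. r \<otimes> p k) \<in> fin_funs R K"
  by (rule fin_funsI[where A = "supp R p"])
    (auto simp: fin_funsD dest: fin_funsD(3), auto simp: supp_def)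

lemma fin_funs_zero: "(\<lambda>k. \<zero>) \<in> fin_funs R K"
  by (rule fin_funsI[where A = "{}"]) auto

lemma monoid_alg_module: "module R (monoid_alg R G)"
proof (rule moduleI)
  show "cring R" ..
  show "abelian_group (monoid_alg R G)"
  proof (rule abelian_groupI)
    fix p assume p: "p \<in> carrier (monoid_alg R G)"
    show "\<exists>q\<in>carrier (monoid_alg R G). q \<oplus>\<^bsub>monoid_alg R G\<^esub> p = \<zero>\<^bsub>monoid_alg R G\<^esub>"
    proof (rule bexI[of _ "\<lambda>k. \<ominus> p k"])
      show "(\<lambda>k. \<ominus> p k) \<in> carrier (monoid_alg R G)"
        unfolding monoid_alg_simps
        by (rule fin_funsI[where A = "supp R p"])
          (use p in \<open>auto simp: monoid_alg_simps fin_funsD dest: fin_funsD(3)\<close>, auto simp: supp_def)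
    qed (use p in \<open>auto simp: monoid_alg_simps fin_funsD l_neg\<close>)
  qed (auto simp: monoid_alg_simps fin_funs_add fin_funs_zero fin_funsD fun_eq_iff a_ac)
qed (auto simp: monoid_alg_simps fin_funs_smult fin_funsD fun_eq_iff l_distr r_distr m_assoc)

lemma monoid_alg_algebra:
  assumes "comm_monoid G"
  shows "algebra R (monoid_alg R G)"
proof -
  interpret G: comm_monoid G by fact
  interpret A: module R "monoid_alg R G" by (rule monoid_alg_module)
  let ?A = "monoid_alg R G"
  have comm: "p \<otimes>\<^bsub>?A\<^esub> q = q \<otimes>\<^bsub>?A\<^esub> p" if "p \<in> carrier ?A" "q \<in> carrier ?A" for p q
  proof
    fix l
    have p: "p \<in> fin_funs R (carrier G)" and q: "q \<in> fin_funs R (carrier G)"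
      using that by (auto simp: monoid_alg_simps)
    have "(p \<otimes>\<^bsub>?A\<^esub> q) l = ev q (\<lambda>j. ev p (\<lambda>i. delta (i \<otimes>\<^bsub>G\<^esub> j) l))"
      unfolding mult_ev[OF p q] by (rule ev_swap[OF p q]) simp
    also have "\<dots> = ev q (\<lambda>j. ev p (\<lambda>i. delta (j \<otimes>\<^bsub>G\<^esub> i) l))"
    proof (rule ev_cong[OF q])
      fix j assume "j \<in> supp R q"
      then show "ev p (\<lambda>i. delta (i \<otimes>\<^bsub>G\<^esub> j) l) = ev p (\<lambda>i. delta (j \<otimes>\<^bsub>G\<^esub> i) l)"
        using fin_funsD(3)[OF p] fin_funsD(3)[OF q]
        by (intro ev_cong[OF p]) (auto simp: G.m_comm subset_iff)
    qed (auto intro: ev_closed[OF p])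
    also have "\<dots> = (q \<otimes>\<^bsub>?A\<^esub> p) l"
      by (simp add: mult_ev[OF q p])
    finally show "(p \<otimes>\<^bsub>?A\<^esub> q) l = (q \<otimes>\<^bsub>?A\<^esub> p) l" .
  qed
  have closed: "p \<otimes>\<^bsub>?A\<^esub> q \<in> carrier ?A" if "p \<in> carrier ?A" "q \<in> carrier ?A" for p q
    using that mult_closed(1)[of p G q] by (simp add: monoid_alg_simps)
  have one: "\<one>\<^bsub>?A\<^esub> \<in> carrier ?A"
    by (simp add: monoid_alg_simps basis_elt_closed)
  have "cring ?A"
  proof (rule cringI)
    show "abelian_group ?A" ..
    show "Group.comm_monoid ?A"
    proof (rule comm_monoidI)
      fix p q r assume pqr: "p \<in> carrier ?A" "q \<in> carrier ?A" "r \<in> carrier ?A"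
      then have p: "p \<in> fin_funs R (carrier G)" and q: "q \<in> fin_funs R (carrier G)"
        and r: "r \<in> fin_funs R (carrier G)" by (auto simp: monoid_alg_simps)
      show "p \<otimes>\<^bsub>?A\<^esub> q \<otimes>\<^bsub>?A\<^esub> r = p \<otimes>\<^bsub>?A\<^esub> (q \<otimes>\<^bsub>?A\<^esub> r)"
      proof
        fix l
        have pq: "p \<otimes>\<^bsub>?A\<^esub> q \<in> fin_funs R (carrier G)" and qr: "q \<otimes>\<^bsub>?A\<^esub> r \<in> fin_funs R (carrier G)"
          using closed pqr by (auto simp: monoid_alg_simps)
        have "(p \<otimes>\<^bsub>?A\<^esub> q \<otimes>\<^bsub>?A\<^esub> r) l =
            ev p (\<lambda>i. ev q (\<lambda>j. ev r (\<lambda>k. delta (i \<otimes>\<^bsub>G\<^esub> j \<otimes>\<^bsub>G\<^esub> k) l)))"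
          unfolding mult_ev[OF pq r] by (rule ev_mult[OF p q]) (auto intro: ev_closed[OF r])
        also have "\<dots> = ev p (\<lambda>i. ev q (\<lambda>j. ev r (\<lambda>k. delta (i \<otimes>\<^bsub>G\<^esub> (j \<otimes>\<^bsub>G\<^esub> k)) l)))"
          using fin_funsD(3)[OF p] fin_funsD(3)[OF q] fin_funsD(3)[OF r]
          by (intro ev_cong[OF p] ev_cong[OF q] ev_cong[OF r] ev_closed[OF q] ev_closed[OF r])
            (auto simp: G.m_assoc subset_iff)
        also have "\<dots> = ev p (\<lambda>i. ev (q \<otimes>\<^bsub>?A\<^esub> r) (\<lambda>m. delta (i \<otimes>\<^bsub>G\<^esub> m) l))"
          by (subst ev_mult[OF q r]) auto
        also have "\<dots> = (p \<otimes>\<^bsub>?A\<^esub> (q \<otimes>\<^bsub>?A\<^esub> r)) l"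
          by (simp add: mult_ev[OF p qr])
        finally show "(p \<otimes>\<^bsub>?A\<^esub> q \<otimes>\<^bsub>?A\<^esub> r) l = (p \<otimes>\<^bsub>?A\<^esub> (q \<otimes>\<^bsub>?A\<^esub> r)) l" .
      qed
    next
      fix p assume "p \<in> carrier ?A"
      then have p: "p \<in> fin_funs R (carrier G)" by (simp add: monoid_alg_simps)
      show "\<one>\<^bsub>?A\<^esub> \<otimes>\<^bsub>?A\<^esub> p = p"
      proof
        fix l
        have "(\<one>\<^bsub>?A\<^esub> \<otimes>\<^bsub>?A\<^esub> p) l = ev p (\<lambda>j. delta (\<one>\<^bsub>G\<^esub> \<otimes>\<^bsub>G\<^esub> j) l)"
          unfolding monoid_alg_simps mult_ev[OF basis_elt_closed[OF G.one_closed] p]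
          by (rule ev_basis_elt) (auto intro: ev_closed[OF p])
        also have "\<dots> = ev p (\<lambda>j. delta j l)"
          using fin_funsD(3)[OF p] by (intro ev_cong[OF p]) (auto simp: subset_iff)
        finally show "(\<one>\<^bsub>?A\<^esub> \<otimes>\<^bsub>?A\<^esub> p) l = p l"
          by (simp add: ev_delta_id[OF p])
      qed
    qed (use comm closed one in auto)
    fix p q r assume pqr: "p \<in> carrier ?A" "q \<in> carrier ?A" "r \<in> carrier ?A"
    then have p: "p \<in> fin_funs R (carrier G)" and q: "q \<in> fin_funs R (carrier G)"
      and r: "r \<in> fin_funs R (carrier G)" by (auto simp: monoid_alg_simps)
    show "(p \<oplus>\<^bsub>?A\<^esub> q) \<otimes>\<^bsub>?A\<^esub> r = p \<otimes>\<^bsub>?A\<^esub> r \<oplus>\<^bsub>?A\<^esub> q \<otimes>\<^bsub>?A\<^esub> r"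
      unfolding monoid_alg_simps fun_eq_iff mult_ev[OF fin_funs_add[OF p q] r] mult_ev[OF p r]
        mult_ev[OF q r]
      by (intro allI ev_add[OF p q] ev_closed[OF r]) simp
  qed
  moreover have "(a \<odot>\<^bsub>?A\<^esub> p) \<otimes>\<^bsub>?A\<^esub> q = a \<odot>\<^bsub>?A\<^esub> (p \<otimes>\<^bsub>?A\<^esub> q)"
    if "a \<in> carrier R" "p \<in> carrier ?A" "q \<in> carrier ?A" for a p q
  proof -
    have p: "p \<in> fin_funs R (carrier G)" and q: "q \<in> fin_funs R (carrier G)"
      using that by (auto simp: monoid_alg_simps)
    show ?thesis
      unfolding monoid_alg_simps fun_eq_iff mult_ev[OF fin_funs_smult[OF that(1) p] q] mult_ev[OF p q]
      by (intro allI ev_smult[OF p that(1)] ev_closed[OF q]) simp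
  qed
  ultimately show ?thesis
    by (intro algebra.intro A.module_axioms algebra_axioms.intro) auto
qed

lemma push_push:
  assumes "p \<in> fin_funs R K"
  shows "push R h' (push R h p) = push R (\<lambda>k. h' (h k)) p"
  by (simp add: fun_eq_iff push_ev[OF push_closed[OF assms subset_UNIV]] ev_push[OF assms]
      push_ev[OF assms])

lemma push_cong:
  assumes "p \<in> fin_funs R K" "\<And>k. k \<in> supp R p \<Longrightarrow> h k = h' k"
  shows "push R h p = push R h' p"
  unfolding fun_eq_iff push_ev[OF assms(1)]
  by (intro allI ev_cong[OF assms(1)]) (auto simp: assms(2))

lemma push_basis_elt: "push R h (basis_elt R k) = basis_elt R (h k)"
  unfolding fun_eq_iff push_ev[OF basis_elt_closed[OF UNIV_I]]
  by (auto simp: ev_basis_elt) (auto simp: delta_def basis_elt_def)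

lemma push_lin:
  assumes "h ` carrier G \<subseteq> carrier H"
  shows "push R h \<in> lin_maps R (monoid_alg R G) (monoid_alg R H)"
  unfolding lin_maps_def
  by (auto simp: monoid_alg_simps push_closed[OF _ assms] fun_eq_iff push_ev
        push_ev[OF fin_funs_add] push_ev[OF fin_funs_smult] ev_add ev_smult)

lemma push_ring_hom:
  assumes "comm_monoid G" "comm_monoid H" "h \<in> Group.hom G H" "h \<one>\<^bsub>G\<^esub> = \<one>\<^bsub>H\<^esub>"
  shows "push R h \<in> ring_hom (monoid_alg R G) (monoid_alg R H)"
proof -
  interpret G: comm_monoid G by fact
  interpret H: comm_monoid H by fact
  have hc: "h ` carrier G \<subseteq> carrier H" using assms(3) by (auto simp: hom_def)
  have lin: "push R h \<in> lin_maps R (monoid_alg R G) (monoid_alg R H)" by (rule push_lin[OF hc])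
  show ?thesis
  proof (rule ring_hom_memI)
    fix p q assume pq: "p \<in> carrier (monoid_alg R G)" "q \<in> carrier (monoid_alg R G)"
    show "push R h p \<in> carrier (monoid_alg R H)"
      "push R h (p \<oplus>\<^bsub>monoid_alg R G\<^esub> q) = push R h p \<oplus>\<^bsub>monoid_alg R H\<^esub> push R h q"
      using lin pq by (auto simp: lin_maps_def)
    have p: "p \<in> fin_funs R (carrier G)" and q: "q \<in> fin_funs R (carrier G)"
      using pq by (auto simp: monoid_alg_simps)
    show "push R h (p \<otimes>\<^bsub>monoid_alg R G\<^esub> q) = push R h p \<otimes>\<^bsub>monoid_alg R H\<^esub> push R h q"
    proof
      fix l
      have "push R h (p \<otimes>\<^bsub>monoid_alg R G\<^esub> q) l = ev p (\<lambda>i. ev q (\<lambda>j. delta (h (i \<otimes>\<^bsub>G\<^esub> j)) l))"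
        by (subst push_ev[OF mult_closed(1)[OF p q]]) (auto intro!: ev_mult[OF p q])
      also have "\<dots> = ev p (\<lambda>i. ev q (\<lambda>j. delta (h i \<otimes>\<^bsub>H\<^esub> h j) l))"
        using fin_funsD(3)[OF p] fin_funsD(3)[OF q]
        by (intro ev_cong[OF p] ev_cong[OF q] ev_closed[OF q])
          (auto simp: hom_mult[OF assms(3)] subset_iff)
      also have "\<dots> = ev p (\<lambda>i. ev (push R h q) (\<lambda>j. delta (h i \<otimes>\<^bsub>H\<^esub> j) l))"
        by (simp add: ev_push[OF q])
      also have "\<dots> = ev (push R h p) (\<lambda>i. ev (push R h q) (\<lambda>j. delta (i \<otimes>\<^bsub>H\<^esub> j) l))"
        by (rule ev_push[OF p, symmetric]) (auto intro: ev_closed[OF push_closed[OF q hc]])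
      also have "\<dots> = (push R h p \<otimes>\<^bsub>monoid_alg R H\<^esub> push R h q) l"
        by (simp add: mult_ev[OF push_closed[OF p hc] push_closed[OF q hc]])
      finally show "push R h (p \<otimes>\<^bsub>monoid_alg R G\<^esub> q) l =
          (push R h p \<otimes>\<^bsub>monoid_alg R H\<^esub> push R h q) l" .
    qed
  qed (simp add: monoid_alg_simps push_basis_elt assms(4))
qed

end

lemma (in abelian_group) coset_mem_iff:
  assumes "subgroup K (add_monoid G)" "x \<in> carrier G"
  shows "K +> x = K \<longleftrightarrow> x \<in> K"
proof -
  interpret K: additive_subgroup K G by (simp add: additive_subgroup_def assms)
  show ?thesis
    using assms a_coset_join1[of K x] a_coset_join2[of x K]
    by (metis K.additive_subgroup_axioms a_coset_join1 a_coset_join2)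
qed

lemma monomials_comm_monoid: "comm_monoid (monomials V)"
  by (rule comm_monoidI) (auto simp: monomials_def ac_simps)

context cring
begin

lemma poly_alg_algebra: "algebra R (poly_alg R M)"
  unfolding poly_alg_def by (rule monoid_alg_algebra[OF monomials_comm_monoid])

lemma var_closed: "m \<in> carrier M \<Longrightarrow> var R m \<in> carrier (poly_alg R M)"
  by (simp add: poly_alg_def var_def monoid_alg_simps basis_elt_closed monomials_def)

lemma sym_rels_closed:
  assumes "module R M"
  shows "sym_rels R M \<subseteq> carrier (poly_alg R M)"
proof -
  interpret M: module R M by fact
  interpret P: algebra R "poly_alg R M" by (rule poly_alg_algebra)
  show ?thesis
    by (auto simp: sym_rels_def var_closed intro!: P.minus_closed P.M.a_closed P.smult_closed)
qed

lemma sym_ideal_ideal: "module R M \<Longrightarrow> ideal (sym_ideal R M) (poly_alg R M)"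
  unfolding sym_ideal_def
  by (intro ring.genideal_ideal sym_rels_closed cring.axioms(1)
      algebra.M_cring[OF poly_alg_algebra])

lemma sym_subst_ring_hom:
  assumes "g \<in> carrier M \<rightarrow> carrier N"
  shows "push R (image_mset g) \<in> ring_hom (poly_alg R M) (poly_alg R N)"
  unfolding poly_alg_def
  by (rule push_ring_hom[OF monomials_comm_monoid monomials_comm_monoid])
    (use assms in \<open>auto simp: monomials_def hom_def Pi_iff subset_iff\<close>)

lemma sym_subst_lin:
  assumes "g \<in> carrier M \<rightarrow> carrier N"
  shows "push R (image_mset g) \<in> lin_maps R (poly_alg R M) (poly_alg R N)"
  unfolding poly_alg_def
  by (rule push_lin) (use assms in \<open>auto simp: monomials_def Pi_iff subset_iff\<close>)

lemma sym_subst_var: "push R (image_mset g) (var R m) = var R (g m)"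
  by (simp add: var_def push_basis_elt)

lemma sym_subst_ideal:
  assumes M: "module R M" and N: "module R N" and g: "g \<in> lin_maps R M N"
    and p: "p \<in> sym_ideal R M"
  shows "push R (image_mset g) p \<in> sym_ideal R N"
proof -
  interpret M: module R M by fact
  interpret N: module R N by fact
  interpret PM: cring "poly_alg R M" by (rule algebra.M_cring[OF poly_alg_algebra])
  interpret PN: cring "poly_alg R N" by (rule algebra.M_cring[OF poly_alg_algebra])
  have gc: "g \<in> carrier M \<rightarrow> carrier N" using g by (simp add: lin_maps_def)
  let ?h = "push R (image_mset g)"
  interpret h: ring_hom_ring "poly_alg R M" "poly_alg R N" ?h
    by (rule ring_hom_ringI2[OF PM.ring_axioms PN.ring_axioms sym_subst_ring_hom[OF gc]])
  let ?J = "{p \<in> carrier (poly_alg R M). ?h p \<in> sym_ideal R N}"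
  interpret I: ideal "sym_ideal R N" "poly_alg R N" by (rule sym_ideal_ideal[OF N])
  have "ideal ?J (poly_alg R M)"
  proof (rule idealI)
    show "subgroup ?J (add_monoid (poly_alg R M))"
      using I.a_inv_closed by (intro PM.add.subgroupI) (auto simp flip: a_inv_def)
  qed (use PM.ring_axioms in \<open>auto simp: I.I_l_closed I.I_r_closed\<close>)
  moreover have "sym_rels R M \<subseteq> ?J"
  proof
    fix x assume x: "x \<in> sym_rels R M"
    have hlin: "?h (r \<odot>\<^bsub>poly_alg R M\<^esub> q) = r \<odot>\<^bsub>poly_alg R N\<^esub> ?h q"
      if "r \<in> carrier R" "q \<in> carrier (poly_alg R M)" for r q
      using sym_subst_lin[OF gc] that by (simp add: lin_maps_def)
    from x have "?h x \<in> sym_rels R N"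
      unfolding sym_rels_def
    proof (elim UnE CollectE exE conjE)
      fix m n assume mn: "x = var R (m \<oplus>\<^bsub>M\<^esub> n) \<ominus>\<^bsub>poly_alg R M\<^esub> (var R m \<oplus>\<^bsub>poly_alg R M\<^esub> var R n)"
        "m \<in> carrier M" "n \<in> carrier M"
      then have "?h x = var R (g m \<oplus>\<^bsub>N\<^esub> g n) \<ominus>\<^bsub>poly_alg R N\<^esub> (var R (g m) \<oplus>\<^bsub>poly_alg R N\<^esub> var R (g n))"
        using g by (simp add: var_closed sym_subst_var a_minus_def lin_maps_def)
      then show "?h x \<in> {var R (m \<oplus>\<^bsub>N\<^esub> n) \<ominus>\<^bsub>poly_alg R N\<^esub> (var R m \<oplus>\<^bsub>poly_alg R N\<^esub> var R n) | m n.
            m \<in> carrier N \<and> n \<in> carrier N} \<union>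
          {var R (r \<odot>\<^bsub>N\<^esub> m) \<ominus>\<^bsub>poly_alg R N\<^esub> (r \<odot>\<^bsub>poly_alg R N\<^esub> var R m) | r m.
            r \<in> carrier R \<and> m \<in> carrier N}"
        using gc mn by blast
    next
      fix r m assume rm: "x = var R (r \<odot>\<^bsub>M\<^esub> m) \<ominus>\<^bsub>poly_alg R M\<^esub> (r \<odot>\<^bsub>poly_alg R M\<^esub> var R m)"
        "r \<in> carrier R" "m \<in> carrier M"
      then have "?h x = var R (r \<odot>\<^bsub>N\<^esub> g m) \<ominus>\<^bsub>poly_alg R N\<^esub> (r \<odot>\<^bsub>poly_alg R N\<^esub> var R (g m))"
        using g module.smult_closed[OF algebra.module[OF poly_alg_algebra] rm(2) var_closed[OF rm(3)]]
        by (simp add: var_closed sym_subst_var a_minus_def lin_maps_def hlin)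
      then show "?h x \<in> {var R (m \<oplus>\<^bsub>N\<^esub> n) \<ominus>\<^bsub>poly_alg R N\<^esub> (var R m \<oplus>\<^bsub>poly_alg R N\<^esub> var R n) | m n.
            m \<in> carrier N \<and> n \<in> carrier N} \<union>
          {var R (r \<odot>\<^bsub>N\<^esub> m) \<ominus>\<^bsub>poly_alg R N\<^esub> (r \<odot>\<^bsub>poly_alg R N\<^esub> var R m) | r m.
            r \<in> carrier R \<and> m \<in> carrier N}"
        using gc rm by blast
    qed
    then have "?h x \<in> sym_ideal R N"
      unfolding sym_ideal_def using PN.genideal_self[OF sym_rels_closed[OF N]] by blast
    then show "x \<in> ?J" using x sym_rels_closed[OF M] by blast
  qed
  ultimately have "sym_ideal R M \<subseteq> ?J"
    unfolding sym_ideal_def by (rule PM.genideal_minimal)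
  then show ?thesis using p by blast
qed

lemma sym_class_eq_iff:
  assumes "module R M" "p \<in> carrier (poly_alg R M)" "q \<in> carrier (poly_alg R M)"
  shows "sym_class R M p = sym_class R M q \<longleftrightarrow> p \<ominus>\<^bsub>poly_alg R M\<^esub> q \<in> sym_ideal R M"
proof -
  interpret PM: cring "poly_alg R M" by (rule algebra.M_cring[OF poly_alg_algebra])
  show ?thesis
    unfolding sym_class_def
    using PM.quotient_eq_iff_same_a_r_cos[OF sym_ideal_ideal[OF assms(1)] assms(2,3)] by simp
qed

lemma sym_map_class:
  assumes M: "module R M" and N: "module R N" and g: "g \<in> lin_maps R M N"
    and p: "p \<in> carrier (poly_alg R M)"
  shows "sym_map R N g (sym_class R M p) = sym_class R N (push R (image_mset g) p)"
proof -
  interpret PM: cring "poly_alg R M" by (rule algebra.M_cring[OF poly_alg_algebra])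
  interpret PN: cring "poly_alg R N" by (rule algebra.M_cring[OF poly_alg_algebra])
  interpret I: ideal "sym_ideal R M" "poly_alg R M" by (rule sym_ideal_ideal[OF M])
  have gc: "g \<in> carrier M \<rightarrow> carrier N" using g by (simp add: lin_maps_def)
  let ?h = "push R (image_mset g)"
  interpret h: ring_hom_ring "poly_alg R M" "poly_alg R N" ?h
    by (rule ring_hom_ringI2[OF PM.ring_axioms PN.ring_axioms sym_subst_ring_hom[OF gc]])
  have "sym_class R N (?h q) = sym_class R N (?h p)" if q: "q \<in> sym_class R M p" for q
  proof -
    obtain i where i: "i \<in> sym_ideal R M" "q = i \<oplus>\<^bsub>poly_alg R M\<^esub> p"
      using q by (auto simp: sym_class_def a_r_coset_def')
    have ic: "i \<in> carrier (poly_alg R M)" using i by (simp add: I.a_Hcarr)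
    have "?h q \<ominus>\<^bsub>poly_alg R N\<^esub> ?h p = ?h i"
      using i ic p by (simp add: PN.minus_eq PN.a_assoc PN.r_neg)
    then show ?thesis
      using sym_subst_ideal[OF M N g i(1)] i ic p by (simp add: sym_class_eq_iff[OF N])
  qed
  moreover have "p \<in> sym_class R M p"
    unfolding sym_class_def by (rule I.a_rcos_self[OF p])
  ultimately show ?thesis unfolding sym_map_def by blast
qed

lemma sym_alg_carrier: "carrier (sym_alg R M) = sym_class R M ` carrier (poly_alg R M)"
  by (auto simp: sym_alg_def quot_def ring.defs FactRing_def A_RCOSETS_def' sym_class_def)

lemma sym_kernel_iff:
  assumes M: "module R M" and N: "module R N" and g: "g \<in> lin_maps R M N"
    and p: "p \<in> carrier (poly_alg R M)"
  shows "sym_class R M p \<in> sym_kernel R M N g \<longleftrightarrow> push R (image_mset g) p \<in> sym_ideal R N"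
proof -
  interpret PN: cring "poly_alg R N" by (rule algebra.M_cring[OF poly_alg_algebra])
  interpret I: ideal "sym_ideal R N" "poly_alg R N" by (rule sym_ideal_ideal[OF N])
  have gc: "g \<in> carrier M \<rightarrow> carrier N" using g by (simp add: lin_maps_def)
  have "push R (image_mset g) p \<in> carrier (poly_alg R N)"
    using sym_subst_lin[OF gc] p by (auto simp: lin_maps_def)
  moreover have "\<zero>\<^bsub>sym_alg R N\<^esub> = sym_ideal R N"
    by (simp add: sym_alg_def quot_def ring.defs FactRing_def)
  ultimately show ?thesis
    using p PN.coset_mem_iff[OF I.a_subgroup, folded sym_class_def]
    by (simp add: sym_kernel_def a_kernel_def' sym_alg_carrier sym_map_class[OF M N g p])
qed

end

context cring
begin

definition index_monoid :: "nat \<Rightarrow> nat monoid"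
  where "index_monoid n = \<lparr>carrier = {..<n}, monoid.mult = (\<lambda>i j. 0), one = 0\<rparr>"

text \<open>The free module of rank \<open>n\<close>; only its module structure matters.\<close>

definition std_free :: "nat \<Rightarrow> ('a, nat \<Rightarrow> 'a) module"
  where "std_free n = monoid_alg R (index_monoid n)"

lemma std_free_carrier: "carrier (std_free n) = fin_funs R {..<n}"
  by (simp add: std_free_def monoid_alg_simps index_monoid_def)

lemma std_free_simps:
  "\<zero>\<^bsub>std_free n\<^esub> = (\<lambda>k. \<zero>)"
  "p \<oplus>\<^bsub>std_free n\<^esub> q = (\<lambda>k. p k \<oplus> q k)"
  "r \<odot>\<^bsub>std_free n\<^esub> p = (\<lambda>k. r \<otimes> p k)"
  by (simp_all add: std_free_def monoid_alg_simps)

lemma std_free_module: "module R (std_free n)"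
  unfolding std_free_def by (rule monoid_alg_module)

lemma std_free_finsum:
  assumes "finite A" "\<And>b. b \<in> A \<Longrightarrow> u b \<in> carrier (std_free n)"
  shows "finsum (std_free n) u A k = (\<Oplus>b\<in>A. u b k)"
proof -
  interpret M: module R "std_free n" by (rule std_free_module)
  show ?thesis
    using assms
  proof (induction A rule: finite_induct)
    case empty
    then show ?case by (simp add: std_free_simps)
  next
    case (insert b A)
    have "finsum (std_free n) u (insert b A) k = u b k \<oplus> (\<Oplus>b\<in>A. u b k)"
    proof -
      have "finsum (std_free n) u (insert b A) = u b \<oplus>\<^bsub>std_free n\<^esub> finsum (std_free n) u A"
        by (rule M.M.finsum_insert) (use insert in auto)
      then show ?thesis using insert by (simp add: std_free_simps(2))
    qed
    also have "\<dots> = (\<Oplus>b\<in>insert b A. u b k)"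
    proof (rule finsum_insert[symmetric])
      have uc: "u x k \<in> carrier R" if "x \<in> insert b A" for x
        using insert.prems[OF that] unfolding std_free_carrier by (rule fin_funsD(1))
      then show "(\<lambda>b. u b k) \<in> A \<rightarrow> carrier R" "u b k \<in> carrier R" by blast+
    qed (use insert in auto)
    finally show ?case .
  qed
qed

lemma free_std_free: "free_module R (std_free n)"
proof -
  interpret M: module R "std_free n" by (rule std_free_module)
  have "\<exists>B. is_basis R (std_free n) B"
  proof (cases "\<one> = \<zero>")
    case True
    then have "carrier R = {\<zero>}" using carrier_one_zero by auto
    then have z: "fin_funs R K = {\<lambda>k. \<zero>}" for K :: "'k set"
      by (auto simp: fin_funs_def supp_def fun_eq_iff image_subset_iff)
    have "is_basis R (std_free n) {}"
      unfolding is_basis_def std_free_carrier z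
      by (auto simp: bij_betw_def supp_def std_free_simps)
    then show ?thesis ..
  next
    case False
    let ?B = "basis_elt R ` {..<n} :: (nat \<Rightarrow> 'a) set"
    let ?h = "\<lambda>c. \<Oplus>\<^bsub>std_free n\<^esub>b\<in>supp R c. c b \<odot>\<^bsub>std_free n\<^esub> b"
    have inj: "inj_on (basis_elt R :: nat \<Rightarrow> nat \<Rightarrow> 'a) UNIV"
      using False by (auto simp: inj_on_def basis_elt_def fun_eq_iff split: if_splits)
    have Bc: "?B \<subseteq> carrier (std_free n)"
      by (auto simp: std_free_carrier basis_elt_closed)
    have hval: "?h c k = (if k < n then c (basis_elt R k) else \<zero>)"
      if c: "c \<in> fin_funs R ?B" for c k
    proof -
      have "?h c k = (\<Oplus>b\<in>supp R c. c b \<otimes> b k)"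
      proof (subst std_free_finsum)
        fix b assume "b \<in> supp R c"
        then have "b \<in> carrier (std_free n)" using fin_funsD(3)[OF c] Bc by blast
        then show "c b \<odot>\<^bsub>std_free n\<^esub> b \<in> carrier (std_free n)"
          by (rule M.smult_closed[OF fin_funsD(1)[OF c]])
      qed (simp_all only: std_free_simps(3) fin_funsD(2)[OF c])
      also have "\<dots> = ev c (\<lambda>b. b k)" by (simp add: ev_def)
      also have "\<dots> = (\<Oplus>b\<in>?B. c b \<otimes> b k)"
        by (rule ev_superset[OF c]) (use fin_funsD[OF c] in \<open>auto simp: basis_elt_def\<close>)
      also have "\<dots> = (\<Oplus>i\<in>{..<n}. c (basis_elt R i) \<otimes> basis_elt R i k)"
        by (rule finsum_reindex[OF _ inj_on_subset[OF inj subset_UNIV]])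
          (use fin_funsD[OF c] in \<open>auto simp: basis_elt_def\<close>)
      also have "\<dots> = (\<Oplus>i\<in>{..<n}. if i = k then c (basis_elt R i) else \<zero>)"
        by (rule finsum_cong') (use fin_funsD[OF c] in \<open>auto simp: basis_elt_def\<close>)
      also have "\<dots> = (if k < n then c (basis_elt R k) else \<zero>)"
      proof (cases "k < n")
        case True
        then show ?thesis
          using fin_funsD[OF c] by (simp add: add.finprod_singleton_swap)
      next
        case False
        then show ?thesis by (auto intro!: add.finprod_one_eqI)
      qed
      finally show ?thesis .
    qed
    have "bij_betw ?h (fin_funs R ?B) (carrier (std_free n))"
    proof (rule bij_betwI')
      fix c d assume cd: "c \<in> fin_funs R ?B" "d \<in> fin_funs R ?B"
      show "?h c = ?h d \<longleftrightarrow> c = d"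
      proof
        assume eq: "?h c = ?h d"
        show "c = d"
        proof
          fix b show "c b = d b"
          proof (cases "b \<in> ?B")
            case True
            then obtain k where k: "k < n" "b = basis_elt R k" by auto
            have "c (basis_elt R k) = d (basis_elt R k)"
              using hval[OF cd(1), of k] hval[OF cd(2), of k] k(1) eq by (simp only: if_True)
            then show ?thesis using k(2) by (simp only:)
          next
            case False
            then show ?thesis using fin_funs_outside[OF cd(1)] fin_funs_outside[OF cd(2)] by simp
          qed
        qed
      qed simp
    next
      fix c assume c: "c \<in> fin_funs R ?B"
      show "?h c \<in> carrier (std_free n)"
      proof (rule M.M.finsum_closed, rule funcsetI)
        fix b assume "b \<in> supp R c"
        then have "b \<in> carrier (std_free n)" using fin_funsD(3)[OF c] Bc by blast
        then show "c b \<odot>\<^bsub>std_free n\<^esub> b \<in> carrier (std_free n)"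
          by (rule M.smult_closed[OF fin_funsD(1)[OF c]])
      qed
    next
      fix v assume v: "v \<in> carrier (std_free n)"
      then have v': "v \<in> fin_funs R {..<n}" by (simp add: std_free_carrier)
      let ?c = "\<lambda>b. if b \<in> ?B then v (inv_into UNIV (basis_elt R) b) else \<zero>"
      have c: "?c \<in> fin_funs R ?B"
        by (rule fin_funsI[where A = ?B]) (use fin_funsD[OF v'] in auto)
      have "?h ?c = v"
      proof
        fix k
        have "?h ?c k = (if k < n then ?c (basis_elt R k) else \<zero>)" by (rule hval[OF c])
        also have "\<dots> = v k"
          using fin_funs_outside[OF v', of k] inv_into_f_f[OF inj, of k] by simp
        finally show "?h ?c k = v k" .
      qed
      then show "\<exists>c\<in>fin_funs R ?B. v = ?h c" by (intro bexI[OF _ c]) (rule sym)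
    qed
    then show ?thesis using Bc unfolding is_basis_def by blast
  qed
  then show ?thesis by (simp add: free_module_def std_free_module)
qed

lemma lincomb_superset:
  assumes "module R G" "c \<in> fin_funs R B" "B \<subseteq> carrier G" "finite A" "supp R c \<subseteq> A" "A \<subseteq> B"
  shows "(\<Oplus>\<^bsub>G\<^esub>b\<in>supp R c. c b \<odot>\<^bsub>G\<^esub> b) = (\<Oplus>\<^bsub>G\<^esub>b\<in>A. c b \<odot>\<^bsub>G\<^esub> b)"
proof -
  interpret G: module R G by fact
  show ?thesis
    by (rule G.M.add.finprod_mono_neutral_cong_left)
      (use assms in \<open>auto simp: supp_def fin_funsD subset_iff\<close>)
qed

lemma lincomb_lin:
  assumes "module R G" "B \<subseteq> carrier G"
  shows
    "c \<in> fin_funs R B \<Longrightarrow> d \<in> fin_funs R B \<Longrightarrow>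
      (\<Oplus>\<^bsub>G\<^esub>b\<in>supp R (\<lambda>b. c b \<oplus> d b). (c b \<oplus> d b) \<odot>\<^bsub>G\<^esub> b) =
      (\<Oplus>\<^bsub>G\<^esub>b\<in>supp R c. c b \<odot>\<^bsub>G\<^esub> b) \<oplus>\<^bsub>G\<^esub> (\<Oplus>\<^bsub>G\<^esub>b\<in>supp R d. d b \<odot>\<^bsub>G\<^esub> b)"
    "r \<in> carrier R \<Longrightarrow> c \<in> fin_funs R B \<Longrightarrow>
      (\<Oplus>\<^bsub>G\<^esub>b\<in>supp R (\<lambda>b. r \<otimes> c b). (r \<otimes> c b) \<odot>\<^bsub>G\<^esub> b) =
      r \<odot>\<^bsub>G\<^esub> (\<Oplus>\<^bsub>G\<^esub>b\<in>supp R c. c b \<odot>\<^bsub>G\<^esub> b)"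
proof -
  interpret G: module R G by fact
  {
    assume c: "c \<in> fin_funs R B" and d: "d \<in> fin_funs R B"
    let ?A = "supp R c \<union> supp R d"
    have A: "finite ?A" "?A \<subseteq> B" using fin_funsD[OF c] fin_funsD[OF d] by auto
    have s: "supp R (\<lambda>b. c b \<oplus> d b) \<subseteq> ?A" by (auto simp: supp_def)
    show "(\<Oplus>\<^bsub>G\<^esub>b\<in>supp R (\<lambda>b. c b \<oplus> d b). (c b \<oplus> d b) \<odot>\<^bsub>G\<^esub> b) =
      (\<Oplus>\<^bsub>G\<^esub>b\<in>supp R c. c b \<odot>\<^bsub>G\<^esub> b) \<oplus>\<^bsub>G\<^esub> (\<Oplus>\<^bsub>G\<^esub>b\<in>supp R d. d b \<odot>\<^bsub>G\<^esub> b)"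
      unfolding lincomb_superset[OF assms(1) fin_funs_add[OF c d] assms(2) A(1) s A(2)]
        lincomb_superset[OF assms(1) c assms(2) A(1) Un_upper1 A(2)]
        lincomb_superset[OF assms(1) d assms(2) A(1) Un_upper2 A(2)]
      by (subst G.M.finsum_addf[symmetric])
        (use A assms(2) fin_funsD[OF c] fin_funsD[OF d] in
          \<open>auto simp: G.smult_l_distr subset_iff simp del: G.M.finsum_addf intro!: G.M.finsum_cong'\<close>)
  }
  {
    assume r: "r \<in> carrier R" and c: "c \<in> fin_funs R B"
    have s: "supp R (\<lambda>b. r \<otimes> c b) \<subseteq> supp R c" using r by (auto simp: supp_def)
    show "(\<Oplus>\<^bsub>G\<^esub>b\<in>supp R (\<lambda>b. r \<otimes> c b). (r \<otimes> c b) \<odot>\<^bsub>G\<^esub> b) =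
      r \<odot>\<^bsub>G\<^esub> (\<Oplus>\<^bsub>G\<^esub>b\<in>supp R c. c b \<odot>\<^bsub>G\<^esub> b)"
      unfolding lincomb_superset[OF assms(1) fin_funs_smult[OF r c] assms(2) fin_funsD(2)[OF c] s fin_funsD(3)[OF c]]
      by (subst G.finsum_smult_ldistr)
        (use assms(2) fin_funsD[OF c] r in
          \<open>auto simp: G.smult_assoc1 subset_iff intro!: G.M.finsum_cong'\<close>)
  }
qed

text \<open>Every finite subset of a free module lies in a finitely generated free direct summand.\<close>

lemma free_module_retract:
  assumes "free_module R G" "finite X" "X \<subseteq> carrier G"
  obtains n \<pi> j where "\<pi> \<in> lin_maps R G (std_free n)" "j \<in> lin_maps R (std_free n) G"
    "\<And>x. x \<in> X \<Longrightarrow> j (\<pi> x) = x"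
proof -
  interpret G: module R G using assms by (simp add: free_module_def)
  have modG: "module R G" ..
  let ?h = "\<lambda>c. \<Oplus>\<^bsub>G\<^esub>b\<in>supp R c. c b \<odot>\<^bsub>G\<^esub> b"
  from assms(1) obtain B where B: "B \<subseteq> carrier G" "bij_betw ?h (fin_funs R B) (carrier G)"
    by (auto simp: free_module_def is_basis_def)
  define crd where "crd = inv_into (fin_funs R B) ?h"
  have crd: "crd x \<in> fin_funs R B" "?h (crd x) = x" if "x \<in> carrier G" for x
    using that B(2) unfolding crd_def bij_betw_def
    by (auto intro: inv_into_into f_inv_into_f[where f = ?h])
  have crd_eq: "crd x = c" if "x = ?h c" "c \<in> fin_funs R B" for x c
    using that B(2) unfolding crd_def bij_betw_def by (auto intro: inv_into_f_f)
  have crd_add: "crd (x \<oplus>\<^bsub>G\<^esub> y) = (\<lambda>b. crd x b \<oplus> crd y b)" if "x \<in> carrier G" "y \<in> carrier G" for x y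
  proof (rule crd_eq)
    show "x \<oplus>\<^bsub>G\<^esub> y = ?h (\<lambda>b. crd x b \<oplus> crd y b)"
      using that by (subst lincomb_lin(1)[OF modG B(1)]) (auto simp: crd)
  qed (use crd that in \<open>auto intro: fin_funs_add\<close>)
  have crd_smult: "crd (r \<odot>\<^bsub>G\<^esub> x) = (\<lambda>b. r \<otimes> crd x b)" if "r \<in> carrier R" "x \<in> carrier G" for r x
  proof (rule crd_eq)
    show "r \<odot>\<^bsub>G\<^esub> x = ?h (\<lambda>b. r \<otimes> crd x b)"
      using that by (subst lincomb_lin(2)[OF modG B(1)]) (auto simp: crd)
  qed (use crd that in \<open>auto intro: fin_funs_smult\<close>)
  define C where "C = (\<Union>x\<in>X. supp R (crd x))"
  have C: "finite C" "C \<subseteq> B"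
    using assms(2,3) crd(1) by (auto simp: C_def dest: fin_funsD(2) fin_funsD(3))
  obtain e where e: "bij_betw e {..<card C} C"
    using ex_bij_betw_nat_finite[OF C(1)] by (auto simp: atLeast0LessThan)
  then have eB: "e i \<in> carrier G" if "i < card C" for i
    using that C(2) B(1) by (auto simp: bij_betw_def)
  define \<pi> where "\<pi> x = (\<lambda>i. if i < card C then crd x (e i) else \<zero>)" for x
  define j where "j v = (\<Oplus>\<^bsub>G\<^esub>i\<in>{..<card C}. v i \<odot>\<^bsub>G\<^esub> e i)" for v
  show ?thesis
  proof
    show "\<pi> \<in> lin_maps R G (std_free (card C))"
      unfolding lin_maps_def
    proof (intro CollectI conjI ballI funcsetI)
      fix x assume "x \<in> carrier G"
      then show "\<pi> x \<in> carrier (std_free (card C))"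
        unfolding std_free_carrier
        by (intro fin_funsI[where A = "{..<card C}"]) (auto simp: \<pi>_def dest!: crd(1) fin_funsD(1))
    qed (auto simp: \<pi>_def std_free_simps fun_eq_iff crd_add crd_smult)
    show "j \<in> lin_maps R (std_free (card C)) G"
      unfolding lin_maps_def
    proof (intro CollectI conjI ballI funcsetI)
      fix v w assume v: "v \<in> carrier (std_free (card C))" and w: "w \<in> carrier (std_free (card C))"
      then show "j (v \<oplus>\<^bsub>std_free (card C)\<^esub> w) = j v \<oplus>\<^bsub>G\<^esub> j w"
        unfolding j_def
        by (subst G.M.finsum_addf[symmetric])
          (auto simp: std_free_simps std_free_carrier fin_funsD eB G.smult_l_distr
            simp del: G.M.finsum_addf
            intro!: G.M.finsum_cong')
    next
      fix v assume "v \<in> carrier (std_free (card C))"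
      then show "j v \<in> carrier G"
        unfolding j_def by (auto simp: std_free_carrier fin_funsD eB intro!: G.M.finsum_closed)
    next
      fix r v assume "r \<in> carrier R" "v \<in> carrier (std_free (card C))"
      then show "j (r \<odot>\<^bsub>std_free (card C)\<^esub> v) = r \<odot>\<^bsub>G\<^esub> j v"
        unfolding j_def
        by (subst G.finsum_smult_ldistr)
          (auto simp: std_free_simps std_free_carrier fin_funsD eB G.smult_assoc1
            intro!: G.M.finsum_cong')
    qed
    fix x assume x: "x \<in> X"
    then have xG: "x \<in> carrier G" using assms(3) by auto
    note cx = crd[OF xG]
    have "j (\<pi> x) = (\<Oplus>\<^bsub>G\<^esub>i\<in>{..<card C}. crd x (e i) \<odot>\<^bsub>G\<^esub> e i)"
      unfolding j_def \<pi>_def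
      by (rule G.M.finsum_cong') (use fin_funsD[OF cx(1)] eB in auto)
    also have "\<dots> = (\<Oplus>\<^bsub>G\<^esub>b\<in>e ` {..<card C}. crd x b \<odot>\<^bsub>G\<^esub> b)"
    proof (rule G.M.finsum_reindex[symmetric], rule funcsetI)
      fix b assume "b \<in> e ` {..<card C}"
      then have "b \<in> carrier G" using eB by auto
      then show "crd x b \<odot>\<^bsub>G\<^esub> b \<in> carrier G"
        by (rule G.smult_closed[OF fin_funsD(1)[OF cx(1)]])
    qed (use e in \<open>simp add: bij_betw_def\<close>)
    also have "\<dots> = ?h (crd x)"
      using e x by (subst lincomb_superset[OF modG cx(1) B(1) C(1) _ C(2)]) (auto simp: bij_betw_def C_def)
    finally show "j (\<pi> x) = x" by (simp add: cx(2))
  qed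
qed

lemma rees_ideal_subset_sym_kernel:
  fixes G :: "('a, 'g) module" and M :: "('a, 'm) module"
  assumes M: "module R M" and G: "free_module R G" and g: "g \<in> lin_maps R M G"
  shows "rees_ideal R M \<subseteq> sym_kernel R M G g"
proof
  fix X assume X: "X \<in> rees_ideal R M"
  have modG: "module R G" using G by (simp add: free_module_def)
  interpret M: module R M by fact
  interpret G: module R G by (rule modG)
  have gc: "g m \<in> carrier G" if "m \<in> carrier M" for m
    using g that by (auto simp: lin_maps_def)
  have comp: "(\<lambda>m. \<pi> (g m)) \<in> lin_maps R M (std_free n)"
    if "\<pi> \<in> lin_maps R G (std_free n)" for \<pi> n
    using g that by (auto simp: lin_maps_def Pi_iff)
  have ker: "X \<in> sym_kernel R M (std_free n) g'" if "g' \<in> lin_maps R M (std_free n)" for g' n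
    using X that free_std_free unfolding rees_ideal_def by blast
  obtain n0 \<pi>0 where "\<pi>0 \<in> lin_maps R G (std_free n0)"
    using free_module_retract[OF G finite.emptyI] by blast
  from ker[OF comp[OF this]] have "X \<in> carrier (sym_alg R M)"
    by (simp add: sym_kernel_def a_kernel_def')
  then obtain p where p: "p \<in> carrier (poly_alg R M)" "X = sym_class R M p"
    by (auto simp: sym_alg_carrier)
  then have pf: "p \<in> fin_funs R {\<mu>. set_mset \<mu> \<subseteq> carrier M}"
    by (simp add: poly_alg_def monoid_alg_simps monomials_def)
  have "finite (g ` (\<Union>\<mu>\<in>supp R p. set_mset \<mu>))" "g ` (\<Union>\<mu>\<in>supp R p. set_mset \<mu>) \<subseteq> carrier G"
    using fin_funsD[OF pf] gc by auto
  then obtain n \<pi> j where pj: "\<pi> \<in> lin_maps R G (std_free n)" "j \<in> lin_maps R (std_free n) G"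
    "\<And>x. x \<in> g ` (\<Union>\<mu>\<in>supp R p. set_mset \<mu>) \<Longrightarrow> j (\<pi> x) = x"
    using free_module_retract[OF G] by metis
  let ?q = "push R (image_mset (\<lambda>m. \<pi> (g m))) p"
  have "?q \<in> sym_ideal R (std_free n)"
    using ker[OF comp[OF pj(1)]] sym_kernel_iff[OF M std_free_module comp[OF pj(1)] p(1)] p(2) by simp
  then have "push R (image_mset j) ?q \<in> sym_ideal R G"
    by (rule sym_subst_ideal[OF std_free_module modG pj(2)])
  also have "push R (image_mset j) ?q = push R (image_mset g) p"
    unfolding push_push[OF pf]
  proof (rule push_cong[OF pf])
    fix \<mu> assume \<mu>: "\<mu> \<in> supp R p"
    then have "j (\<pi> (g m)) = g m" if "m \<in># \<mu>" for m
      using that by (intro pj(3) imageI UN_I[OF \<mu>])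
    then show "image_mset j (image_mset (\<lambda>m. \<pi> (g m)) \<mu>) = image_mset g \<mu>"
      by (auto simp: multiset.map_comp intro!: image_mset_cong)
  qed
  finally show "X \<in> sym_kernel R M G g"
    using sym_kernel_iff[OF M modG g p(1)] p(2) by simp
qed

end

end

theory Submission
  imports Defs
begin

text \<open>
  A map from \<open>M\<close> to a free module is, on finitely many elements, a finite list of functionals, and each
  of these extends along \<open>f\<close> because \<open>f\<^sup>*\<close> is onto; so \<open>f\<close> is versal, and \<open>ker Sym(f)\<close> is contained
  in \<open>ker Sym(g)\<close> for every \<open>g\<close>.

  Let \<open>R\<close> be Noetherian and let \<open>\<phi>\<^sub>1, \<dots>, \<phi>\<^sub>k\<close> generate \<open>M\<^sup>*\<close>. Then \<open>m \<mapsto> \<Sum>\<^sub>i \<phi>\<^sub>i(m) X\<^sub>i\<close> embeds the Rees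
  algebra of \<open>M\<close> into \<open>R[X\<^sub>1, \<dots>, X\<^sub>k]\<close>. The functionals of \<open>M\<close> are the solutions of a finite linear
  system over \<open>R\<close>, whose solutions in a flat algebra \<open>S\<close> are spanned by those in \<open>R\<close>; hence the
  \<open>\<phi>\<^sub>i\<close> also generate the \<open>S\<close>-dual of \<open>S \<otimes> M\<close>, and the Rees algebra of \<open>S \<otimes> M\<close> embeds into
  \<open>S[X\<^sub>1, \<dots>, X\<^sub>k]\<close>. By flatness so does the base change of the Rees algebra of \<open>M\<close>, and the two images agree because both are
  generated over \<open>S\<close> by the forms \<open>\<Sum>\<^sub>i \<phi>\<^sub>i(m) X\<^sub>i\<close>.
\<close>

section \<open>Linear maps, submodules and quotients\<close>

text \<open>\<open>flat_module\<close> tests only injections between modules carried by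
  \<open>nat \<Rightarrow> 'a\<close>, while the Rees algebra of \<open>M\<close> lives in another
  type, so the definition does not apply directly to its embedding into the polynomial ring.
  Flatness is therefore invoked once, for the image of a matrix inside R^l, and turned into a
  statement on linear equations: solutions in R that span all solutions of a finite system also span
  its solutions in \<open>S\<close>. This criterion serves twice, for the dual of \<open>M\<close>
  and for the injectivity of the tensored embedding; both times Noetherianity supplies the finite
  spanning set.

  The forms in the X_i come from the map M to R^k with coordinates phi_i, followed by the
  identification of Sym(R^k) with R[X_1, ..., X_k]. In the polynomial ring every element has
  explicit coefficients, which is what the equations require.

  A further obstacle is that \<open>tensor_kernel\<close> is defined as a span of bilinearity
  relations and is not visibly an ideal, so the ring structure of the base change has to be
  justified. The same embedding does this, since it exhibits \<open>tensor_kernel\<close> as the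
  kernel of an algebra map.\<close>

lemma lin_mapsI:
  assumes "\<And>x. x \<in> carrier M \<Longrightarrow> h x \<in> carrier N"
    and "\<And>x y. x \<in> carrier M \<Longrightarrow> y \<in> carrier M \<Longrightarrow> h (x \<oplus>\<^bsub>M\<^esub> y) = h x \<oplus>\<^bsub>N\<^esub> h y"
    and "\<And>r x. r \<in> carrier R \<Longrightarrow> x \<in> carrier M \<Longrightarrow> h (r \<odot>\<^bsub>M\<^esub> x) = r \<odot>\<^bsub>N\<^esub> h x"
  shows "h \<in> lin_maps R M N"
  using assms by (auto simp: lin_maps_def)

lemma lin_mapsD:
  assumes "h \<in> lin_maps R M N"
  shows "x \<in> carrier M \<Longrightarrow> h x \<in> carrier N"
    and "x \<in> carrier M \<Longrightarrow> y \<in> carrier M \<Longrightarrow> h (x \<oplus>\<^bsub>M\<^esub> y) = h x \<oplus>\<^bsub>N\<^esub> h y"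
    and "r \<in> carrier R \<Longrightarrow> x \<in> carrier M \<Longrightarrow> h (r \<odot>\<^bsub>M\<^esub> x) = r \<odot>\<^bsub>N\<^esub> h x"
  using assms by (auto simp: lin_maps_def)

lemma lin_maps_comp:
  assumes "g \<in> lin_maps R M N" "h \<in> lin_maps R N P"
  shows "(\<lambda>x. h (g x)) \<in> lin_maps R M P"
  by (rule lin_mapsI) (simp_all add: lin_mapsD[OF assms(1)] lin_mapsD[OF assms(2)])

lemma lin_maps_zero:
  assumes "module R M" "module R N" "h \<in> lin_maps R M N"
  shows "h \<zero>\<^bsub>M\<^esub> = \<zero>\<^bsub>N\<^esub>"
proof -
  interpret M: module R M by fact
  interpret N: module R N by fact
  have "h (\<zero>\<^bsub>R\<^esub> \<odot>\<^bsub>M\<^esub> \<zero>\<^bsub>M\<^esub>) = \<zero>\<^bsub>R\<^esub> \<odot>\<^bsub>N\<^esub> h \<zero>\<^bsub>M\<^esub>"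
    by (rule lin_mapsD(3)[OF assms(3)]) simp_all
  then show ?thesis using lin_mapsD(1)[OF assms(3)] by simp
qed

lemma lin_maps_a_inv:
  assumes "module R M" "module R N" "h \<in> lin_maps R M N" "x \<in> carrier M"
  shows "h (\<ominus>\<^bsub>M\<^esub> x) = \<ominus>\<^bsub>N\<^esub> h x"
proof -
  interpret M: module R M by fact
  interpret N: module R N by fact
  have "h ((\<ominus>\<^bsub>R\<^esub> \<one>\<^bsub>R\<^esub>) \<odot>\<^bsub>M\<^esub> x) = (\<ominus>\<^bsub>R\<^esub> \<one>\<^bsub>R\<^esub>) \<odot>\<^bsub>N\<^esub> h x"
    by (rule lin_mapsD(3)[OF assms(3)]) (simp_all add: assms)
  then show ?thesis using lin_mapsD(1)[OF assms(3)] assms(4)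
    by (simp add: M.smult_l_minus N.smult_l_minus)
qed

lemma lin_maps_minus:
  assumes "module R M" "module R N" "h \<in> lin_maps R M N" "x \<in> carrier M" "y \<in> carrier M"
  shows "h (x \<ominus>\<^bsub>M\<^esub> y) = h x \<ominus>\<^bsub>N\<^esub> h y"
proof -
  interpret M: module R M by fact
  show ?thesis
    using assms by (simp add: a_minus_def lin_mapsD[OF assms(3)] lin_maps_a_inv[OF assms(1-3)])
qed

lemma lin_maps_finsum:
  assumes "module R M" "module R N" "h \<in> lin_maps R M N" "finite A" "\<And>i. i \<in> A \<Longrightarrow> u i \<in> carrier M"
  shows "h (\<Oplus>\<^bsub>M\<^esub>i\<in>A. u i) = (\<Oplus>\<^bsub>N\<^esub>i\<in>A. h (u i))"
proof -
  interpret M: module R M by fact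
  interpret N: module R N by fact
  from assms(4,5) show ?thesis
  proof (induction A rule: finite_induct)
    case empty
    then show ?case by (simp add: lin_maps_zero[OF assms(1-3)])
  next
    case (insert a A)
    have "h (\<Oplus>\<^bsub>M\<^esub>i\<in>insert a A. u i) = h (u a \<oplus>\<^bsub>M\<^esub> (\<Oplus>\<^bsub>M\<^esub>i\<in>A. u i))"
      using insert by (subst M.M.finsum_insert) auto
    also have "\<dots> = h (u a) \<oplus>\<^bsub>N\<^esub> (\<Oplus>\<^bsub>N\<^esub>i\<in>A. h (u i))"
      using insert by (subst lin_mapsD(2)[OF assms(3)]) (auto intro!: M.M.finsum_closed)
    also have "\<dots> = (\<Oplus>\<^bsub>N\<^esub>i\<in>insert a A. h (u i))"
      using insert lin_mapsD(1)[OF assms(3)] by (subst N.M.finsum_insert) auto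
    finally show ?case .
  qed
qed

lemma (in module) submoduleI':
  assumes "H \<subseteq> carrier M" "\<zero>\<^bsub>M\<^esub> \<in> H" "\<And>a b. a \<in> H \<Longrightarrow> b \<in> H \<Longrightarrow> a \<oplus>\<^bsub>M\<^esub> b \<in> H"
    "\<And>a x. a \<in> carrier R \<Longrightarrow> x \<in> H \<Longrightarrow> a \<odot>\<^bsub>M\<^esub> x \<in> H"
  shows "submodule H R M"
proof (rule submoduleI)
  fix a assume a: "a \<in> H"
  have "(\<ominus> \<one>) \<odot>\<^bsub>M\<^esub> a \<in> H" using a by (intro assms(4)) auto
  then show "\<ominus>\<^bsub>M\<^esub> a \<in> H" using a assms(1) by (simp add: smult_l_minus subset_iff)
qed (use assms in auto)

lemma submoduleD:
  assumes "module R M" "submodule H R M"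
  shows "H \<subseteq> carrier M" "\<zero>\<^bsub>M\<^esub> \<in> H" "a \<in> H \<Longrightarrow> b \<in> H \<Longrightarrow> a \<oplus>\<^bsub>M\<^esub> b \<in> H"
    "r \<in> carrier R \<Longrightarrow> a \<in> H \<Longrightarrow> r \<odot>\<^bsub>M\<^esub> a \<in> H"
    "a \<in> H \<Longrightarrow> \<ominus>\<^bsub>M\<^esub> a \<in> H" "a \<in> H \<Longrightarrow> b \<in> H \<Longrightarrow> a \<ominus>\<^bsub>M\<^esub> b \<in> H"
  using module.submoduleE[OF assms] subgroup.one_closed[OF submodule.axioms(1)[OF assms(2)]]
  by (auto simp: a_minus_def)

lemma submodule_vimage:
  assumes "module R M" "module R N" "h \<in> lin_maps R M N" "submodule H R N"
  shows "submodule {x \<in> carrier M. h x \<in> H} R M"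
proof -
  interpret M: module R M by fact
  show ?thesis
    by (rule M.submoduleI')
      (auto simp: lin_mapsD[OF assms(3)] lin_maps_zero[OF assms(1-3)] submoduleD[OF assms(2,4)])
qed

lemma submodule_image:
  assumes "module R M" "module R N" "h \<in> lin_maps R M N" "submodule H R M"
  shows "submodule (h ` H) R N"
proof -
  interpret N: module R N by fact
  note H = submoduleD[OF assms(1,4)]
  show ?thesis
  proof (rule N.submoduleI')
    show "h ` H \<subseteq> carrier N" using H(1) lin_mapsD(1)[OF assms(3)] by blast
    show "\<zero>\<^bsub>N\<^esub> \<in> h ` H" using H(2) lin_maps_zero[OF assms(1-3)] by (metis imageI)
  next
    fix a b assume "a \<in> h ` H" "b \<in> h ` H"
    then obtain x y where "x \<in> H" "y \<in> H" "a = h x" "b = h y" by blast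
    then show "a \<oplus>\<^bsub>N\<^esub> b \<in> h ` H"
      using H(1,3) lin_mapsD(2)[OF assms(3), of x y] by (metis imageI subsetD)
  next
    fix r a assume "r \<in> carrier R" "a \<in> h ` H"
    then obtain x where "x \<in> H" "a = h x" by blast
    then show "r \<odot>\<^bsub>N\<^esub> a \<in> h ` H"
      using \<open>r \<in> carrier R\<close> H(1,4) lin_mapsD(3)[OF assms(3), of r x] by (metis imageI subsetD)
  qed
qed

lemma submodule_zero: "module R M \<Longrightarrow> submodule {\<zero>\<^bsub>M\<^esub>} R M"
proof -
  assume "module R M"
  then interpret M: module R M .
  show ?thesis by (rule M.submoduleI') auto
qed

lemma submodule_span_self: "A \<subseteq> submodule_span R M A"
  by (auto simp: submodule_span_def)

lemma submodule_span_minimal: "submodule H R M \<Longrightarrow> A \<subseteq> H \<Longrightarrow> submodule_span R M A \<subseteq> H"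
  by (auto simp: submodule_span_def)

lemma submodule_submodule_span:
  assumes "module R M" "A \<subseteq> carrier M"
  shows "submodule (submodule_span R M A) R M"
proof -
  interpret M: module R M by fact
  show ?thesis
    unfolding submodule_span_def
    by (rule M.submoduleI')
      (use assms M.carrier_is_submodule in \<open>auto simp: submoduleD[OF assms(1)]\<close>)
qed

text \<open>The equalizer of two linear maps is a submodule, so it contains the span of every set on
  which they agree.\<close>

lemma lin_maps_eq_on_span:
  assumes "module R M" "module R N" "h \<in> lin_maps R M N" "h' \<in> lin_maps R M N"
    "submodule_span R M A = carrier M" "A \<subseteq> carrier M" "\<And>x. x \<in> A \<Longrightarrow> h x = h' x" "x \<in> carrier M"
  shows "h x = h' x"
proof -
  interpret M: module R M by fact
  have "submodule {x \<in> carrier M. h x = h' x} R M"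
    by (rule M.submoduleI')
      (auto simp: lin_mapsD[OF assms(3)] lin_mapsD[OF assms(4)]
        lin_maps_zero[OF assms(1-3)] lin_maps_zero[OF assms(1,2,4)])
  from submodule_span_minimal[OF this] show ?thesis using assms(5-8) by auto
qed

lemma submodule_abelian_subgroup:
  assumes "module R A" "submodule K R A"
  shows "abelian_subgroup K A"
proof -
  interpret A: module R A by fact
  show ?thesis
    by (rule abelian_subgroupI3)
      (auto simp: additive_subgroup_def submodule.axioms(1)[OF assms(2)] A.M.abelian_group_axioms)
qed

text \<open>Quotients, base changes and restrictions of scalars are records built on the additive
  group of another record; this transfers the group axioms across the change of the remaining
  fields.\<close>

lemma abelian_group_cong:
  assumes "abelian_group A" "carrier B = carrier A" "\<zero>\<^bsub>B\<^esub> = \<zero>\<^bsub>A\<^esub>" "add B = add A"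
  shows "abelian_group B"
proof -
  interpret A: abelian_group A by fact
  show ?thesis
    by (rule abelian_groupI) (simp_all add: assms A.a_ac A.l_neg bexI[of _ "\<ominus>\<^bsub>A\<^esub> _"])
qed

lemma quot_carrier: "carrier (quot A K) = (\<lambda>x. K +>\<^bsub>A\<^esub> x) ` carrier A"
  by (auto simp: quot_def ring.defs FactRing_def A_RCOSETS_def')

lemma quot_simps:
  "\<zero>\<^bsub>quot A K\<^esub> = K" "\<one>\<^bsub>quot A K\<^esub> = K +>\<^bsub>A\<^esub> \<one>\<^bsub>A\<^esub>"
  "X \<oplus>\<^bsub>quot A K\<^esub> Y = X <+>\<^bsub>A\<^esub> Y" "X \<otimes>\<^bsub>quot A K\<^esub> Y = rcoset_mult A K X Y"
  "r \<odot>\<^bsub>quot A K\<^esub> X = (\<Union>x\<in>X. K +>\<^bsub>A\<^esub> (r \<odot>\<^bsub>A\<^esub> x))"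
  by (simp_all add: quot_def ring.defs FactRing_def)

lemma coset_eq_iff:
  assumes "module R A" "submodule K R A" "x \<in> carrier A" "y \<in> carrier A"
  shows "K +>\<^bsub>A\<^esub> x = K +>\<^bsub>A\<^esub> y \<longleftrightarrow> x \<ominus>\<^bsub>A\<^esub> y \<in> K"
proof -
  interpret K: abelian_subgroup K A by (rule submodule_abelian_subgroup[OF assms(1,2)])
  show ?thesis
    using K.a_rcos_module[OF assms(4,3)] K.a_rcos_self[OF assms(3)]
      K.a_repr_independence[OF _ assms(4) K.a_subgroup]
    unfolding a_minus_def by metis
qed

lemma coset_eq_zero_iff:
  assumes "module R A" "submodule K R A" "x \<in> carrier A"
  shows "K +>\<^bsub>A\<^esub> x = K \<longleftrightarrow> x \<in> K"
proof -
  interpret A: module R A by fact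
  show ?thesis by (rule A.M.coset_mem_iff[OF submodule.axioms(1)[OF assms(2)] assms(3)])
qed

text \<open>The union over representatives in the scalar action of \<open>quot\<close> collapses to
  a single coset because \<open>r\<close> maps \<open>K\<close> into itself.\<close>

lemma quot_smult:
  assumes "module R A" "submodule K R A" "r \<in> carrier R" "x \<in> carrier A"
  shows "r \<odot>\<^bsub>quot A K\<^esub> (K +>\<^bsub>A\<^esub> x) = K +>\<^bsub>A\<^esub> (r \<odot>\<^bsub>A\<^esub> x)"
proof -
  interpret A: module R A by fact
  interpret K: abelian_subgroup K A by (rule submodule_abelian_subgroup[OF assms(1,2)])
  have "K +>\<^bsub>A\<^esub> (r \<odot>\<^bsub>A\<^esub> y) = K +>\<^bsub>A\<^esub> (r \<odot>\<^bsub>A\<^esub> x)" if y: "y \<in> K +>\<^bsub>A\<^esub> x" for y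
  proof -
    obtain k where k: "k \<in> K" "y = k \<oplus>\<^bsub>A\<^esub> x" using y by (auto simp: a_r_coset_def')
    have kc: "k \<in> carrier A" using k by (simp add: K.a_Hcarr)
    have "r \<odot>\<^bsub>A\<^esub> y \<ominus>\<^bsub>A\<^esub> r \<odot>\<^bsub>A\<^esub> x = r \<odot>\<^bsub>A\<^esub> k"
      using k kc assms by (simp add: A.smult_r_distr A.M.minus_eq A.M.a_assoc A.M.r_neg)
    then show ?thesis
      using k kc assms by (subst coset_eq_iff[OF assms(1,2)]) (auto intro: submoduleD(4)[OF assms(1,2)])
  qed
  then show ?thesis using K.a_rcos_self[OF assms(4)] unfolding quot_simps by blast
qed

lemma quot_add:
  assumes "module R A" "submodule K R A" "x \<in> carrier A" "y \<in> carrier A"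
  shows "(K +>\<^bsub>A\<^esub> x) \<oplus>\<^bsub>quot A K\<^esub> (K +>\<^bsub>A\<^esub> y) = K +>\<^bsub>A\<^esub> (x \<oplus>\<^bsub>A\<^esub> y)"
proof -
  interpret K: abelian_subgroup K A by (rule submodule_abelian_subgroup[OF assms(1,2)])
  show ?thesis using assms by (simp add: quot_simps K.a_rcos_sum)
qed

lemma quot_module:
  assumes "module R A" "submodule K R A"
  shows "module R (quot A K)"
proof -
  interpret A: module R A by fact
  interpret K: abelian_subgroup K A by (rule submodule_abelian_subgroup[OF assms])
  show ?thesis
  proof (rule moduleI)
    show "cring R" ..
    have "abelian_group (A Quot K)"
      by (rule comm_group_abelian_groupI)
        (simp add: FactRing_def K.a_factorgroup_is_comm_group[unfolded A_FactGroup_def'])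
    then show "abelian_group (quot A K)"
      by (rule abelian_group_cong) (simp_all add: quot_def ring.defs)
  qed (auto simp: quot_carrier quot_smult[OF assms] quot_add[OF assms] A.smult_l_distr
        A.smult_r_distr A.smult_assoc1)
qed

lemma coset_lin: "module R A \<Longrightarrow> submodule K R A \<Longrightarrow> (\<lambda>x. K +>\<^bsub>A\<^esub> x) \<in> lin_maps R A (quot A K)"
  by (rule lin_mapsI) (auto simp: quot_carrier quot_smult quot_add)

lemma quot_lin:
  assumes "module R A" "submodule K R A" "h0 \<in> lin_maps R A B"
    "\<And>x. x \<in> carrier A \<Longrightarrow> h (K +>\<^bsub>A\<^esub> x) = h0 x"
  shows "h \<in> lin_maps R (quot A K) B"
proof -
  interpret A: module R A by fact
  show ?thesis
    by (rule lin_mapsI)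
      (auto simp: quot_carrier quot_smult[OF assms(1,2)] quot_add[OF assms(1,2)] assms(4)
        lin_mapsD[OF assms(3)])
qed

text \<open>A linear map that kills \<open>K\<close> is constant on each coset, so
  \<open>the_elem\<close> picks a well-defined value. This evaluates
  \<open>tensor_lift\<close>.\<close>

lemma the_elem_coset:
  assumes "module R A" "module R B" "submodule K R A" "h \<in> lin_maps R A B"
    "\<And>x. x \<in> K \<Longrightarrow> h x = \<zero>\<^bsub>B\<^esub>" "x \<in> carrier A"
  shows "the_elem (h ` (K +>\<^bsub>A\<^esub> x)) = h x"
proof -
  interpret A: module R A by fact
  interpret B: module R B by fact
  interpret K: abelian_subgroup K A by (rule submodule_abelian_subgroup[OF assms(1,3)])
  have "h y = h x" if y: "y \<in> K +>\<^bsub>A\<^esub> x" for y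
  proof -
    obtain k where k: "k \<in> K" "y = k \<oplus>\<^bsub>A\<^esub> x" using y by (auto simp: a_r_coset_def')
    then show ?thesis using assms(5)[OF k(1)] assms(6) K.a_Hcarr[OF k(1)]
      by (simp add: lin_mapsD[OF assms(4)])
  qed
  then have "h ` (K +>\<^bsub>A\<^esub> x) = {h x}" using K.a_rcos_self[OF assms(6)] by blast
  then show ?thesis by simp
qed

section \<open>Algebras\<close>

definition alg_hom :: "('a, 'r) ring_scheme \<Rightarrow> ('a, 'm, 'x) module_scheme \<Rightarrow>
    ('a, 'n, 'y) module_scheme \<Rightarrow> ('m \<Rightarrow> 'n) set"
  where "alg_hom R A B = ring_hom A B \<inter> lin_maps R A B"

lemma alg_homD:
  assumes "h \<in> alg_hom R A B"
  shows "h \<in> lin_maps R A B" "h \<in> ring_hom A B" "h \<one>\<^bsub>A\<^esub> = \<one>\<^bsub>B\<^esub>"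
    "x \<in> carrier A \<Longrightarrow> y \<in> carrier A \<Longrightarrow> h (x \<otimes>\<^bsub>A\<^esub> y) = h x \<otimes>\<^bsub>B\<^esub> h y"
  using assms by (auto simp: alg_hom_def ring_hom_def)

lemma alg_homI:
  assumes "h \<in> lin_maps R A B" "h \<one>\<^bsub>A\<^esub> = \<one>\<^bsub>B\<^esub>"
    "\<And>x y. x \<in> carrier A \<Longrightarrow> y \<in> carrier A \<Longrightarrow> h (x \<otimes>\<^bsub>A\<^esub> y) = h x \<otimes>\<^bsub>B\<^esub> h y"
  shows "h \<in> alg_hom R A B"
  using assms by (auto simp: alg_hom_def ring_hom_def lin_maps_def)

lemma alg_hom_comp:
  assumes "g \<in> alg_hom R A B" "h \<in> alg_hom R B C"
  shows "(\<lambda>x. h (g x)) \<in> alg_hom R A C"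
  by (rule alg_homI)
    (simp_all add: lin_maps_comp[OF alg_homD(1)[OF assms(1)] alg_homD(1)[OF assms(2)]]
      alg_homD[OF assms(1)] alg_homD[OF assms(2)] lin_mapsD[OF alg_homD(1)[OF assms(1)]])

lemma cring_cong:
  assumes "cring A" "carrier B = carrier A" "\<zero>\<^bsub>B\<^esub> = \<zero>\<^bsub>A\<^esub>" "add B = add A"
    "\<one>\<^bsub>B\<^esub> = \<one>\<^bsub>A\<^esub>" "monoid.mult B = monoid.mult A"
  shows "cring B"
proof -
  interpret A: cring A by fact
  show ?thesis
  proof (rule cringI)
    show "abelian_group B"
      by (rule abelian_group_cong[OF A.abelian_group_axioms]) (simp_all add: assms)
    show "Group.comm_monoid B"
      by (rule comm_monoidI) (simp_all add: assms A.m_ac)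
  qed (simp_all add: assms A.l_distr)
qed

text \<open>In an algebra a scalar \<open>a\<close> acts as ring multiplication by \<open>a\<close>
  times one, so absorption by the ring gives closure under scalars.\<close>

lemma ideal_submodule:
  assumes "algebra R A" "ideal K A"
  shows "submodule K R A"
proof -
  interpret A: algebra R A by fact
  interpret K: ideal K A by fact
  show ?thesis
  proof (rule A.submoduleI')
    fix a x assume a: "a \<in> carrier R" and x: "x \<in> K"
    have xc: "x \<in> carrier A" using x by (rule K.a_Hcarr)
    have "(a \<odot>\<^bsub>A\<^esub> \<one>\<^bsub>A\<^esub>) \<otimes>\<^bsub>A\<^esub> x \<in> K" using a x by (intro K.I_l_closed) auto
    then show "a \<odot>\<^bsub>A\<^esub> x \<in> K" using a xc by (simp add: A.smult_assoc2)
  qed (use K.a_subset in auto)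
qed

lemma quot_mult:
  assumes "ideal K A" "x \<in> carrier A" "y \<in> carrier A"
  shows "(K +>\<^bsub>A\<^esub> x) \<otimes>\<^bsub>quot A K\<^esub> (K +>\<^bsub>A\<^esub> y) = K +>\<^bsub>A\<^esub> (x \<otimes>\<^bsub>A\<^esub> y)"
  using ideal.rcoset_mult_add[OF assms] by (simp add: quot_simps)

lemma quot_algebra:
  assumes "algebra R A" "ideal K A"
  shows "algebra R (quot A K)"
proof -
  interpret A: algebra R A by fact
  interpret K: ideal K A by fact
  note K' = A.module ideal_submodule[OF assms]
  interpret Q: module R "quot A K" by (rule quot_module[OF K'])
  have "cring (quot A K)"
    by (rule cring_cong[OF K.quotient_is_cring[OF A.M_cring]]) (simp_all add: quot_def ring.defs)
  then show ?thesis
    by (intro algebra.intro Q.module_axioms algebra_axioms.intro)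
      (auto simp: quot_carrier quot_smult[OF K'] quot_mult[OF assms(2)] A.smult_assoc2)
qed

lemma coset_alg_hom:
  assumes "algebra R A" "ideal K A"
  shows "(\<lambda>x. K +>\<^bsub>A\<^esub> x) \<in> alg_hom R A (quot A K)"
proof -
  interpret A: algebra R A by fact
  show ?thesis
    by (intro alg_homI coset_lin ideal_submodule[OF assms] A.module)
      (simp_all add: quot_mult[OF assms(2)] quot_simps(2))
qed

lemma quot_alg_hom:
  assumes "algebra R A" "ideal K A" "h0 \<in> alg_hom R A B"
    "\<And>x. x \<in> carrier A \<Longrightarrow> h (K +>\<^bsub>A\<^esub> x) = h0 x"
  shows "h \<in> alg_hom R (quot A K) B"
proof -
  interpret A: algebra R A by fact
  show ?thesis
  proof (rule alg_homI)
    show "h \<in> lin_maps R (quot A K) B"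
      by (rule quot_lin[OF A.module ideal_submodule[OF assms(1,2)] alg_homD(1)[OF assms(3)] assms(4)])
  qed (auto simp: quot_carrier quot_mult[OF assms(2)] quot_simps(2) assms(4) alg_homD[OF assms(3)])
qed

lemma alg_hom_kernel:
  assumes "algebra R A" "algebra R B" "h \<in> alg_hom R A B"
  shows "ideal (a_kernel A B h) A"
proof -
  interpret A: algebra R A by fact
  interpret B: algebra R B by fact
  interpret h: ring_hom_ring A B h
    by (rule ring_hom_ringI2[OF cring.axioms(1)[OF A.M_cring] cring.axioms(1)[OF B.M_cring] alg_homD(2)[OF assms(3)]])
  show ?thesis by (rule h.kernel_is_ideal)
qed

text \<open>The isomorphism is given by the common value of \<open>h\<close> on a coset, which is
  the shape of \<open>rees_nat_surj\<close>.\<close>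

lemma alg_first_iso:
  assumes "algebra R A" "algebra R B" "h \<in> alg_hom R A B"
  shows "(\<lambda>X. the_elem (h ` X)) \<in> alg_iso R (quot A (a_kernel A B h)) (B\<lparr>carrier := h ` carrier A\<rparr>)"
proof -
  interpret A: algebra R A by fact
  interpret B: algebra R B by fact
  interpret h: ring_hom_ring A B h
    by (rule ring_hom_ringI2[OF cring.axioms(1)[OF A.M_cring] cring.axioms(1)[OF B.M_cring] alg_homD(2)[OF assms(3)]])
  let ?K = "a_kernel A B h"
  have K: "submodule ?K R A" by (rule ideal_submodule[OF assms(1) h.kernel_is_ideal])
  have "(\<lambda>X. the_elem (h ` X)) \<in> ring_iso (quot A ?K) (B\<lparr>carrier := h ` carrier A\<rparr>)"
    using h.FactRing_iso_set_aux by (simp add: ring_iso_def ring_hom_def quot_def ring.defs)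
  moreover have "(\<lambda>X. the_elem (h ` X)) \<in> lin_maps R (quot A ?K) (B\<lparr>carrier := h ` carrier A\<rparr>)"
  proof (rule quot_lin[OF A.module K])
    show "h \<in> lin_maps R A (B\<lparr>carrier := h ` carrier A\<rparr>)"
      using alg_homD(1)[OF assms(3)] by (auto simp: lin_maps_def)
  qed (rule h.the_elem_simp)
  ultimately show ?thesis by (simp add: alg_iso_def)
qed

lemma self_module_simps [simp]:
  "carrier (self_module R) = carrier R" "\<zero>\<^bsub>self_module R\<^esub> = \<zero>\<^bsub>R\<^esub>"
  "x \<oplus>\<^bsub>self_module R\<^esub> y = x \<oplus>\<^bsub>R\<^esub> y" "r \<odot>\<^bsub>self_module R\<^esub> x = r \<otimes>\<^bsub>R\<^esub> x"
  by (simp_all add: self_module_def ring.defs)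

section \<open>Linear extension on monoid algebras\<close>

definition lin_ext :: "('a, 'r) ring_scheme \<Rightarrow> ('a, 'm, 'x) module_scheme \<Rightarrow> ('k \<Rightarrow> 'm) \<Rightarrow> ('k \<Rightarrow> 'a) \<Rightarrow> 'm"
  where "lin_ext R A u p = (\<Oplus>\<^bsub>A\<^esub>k\<in>supp R p. p k \<odot>\<^bsub>A\<^esub> u k)"

context cring
begin

lemma self_module_module: "module R (self_module R)"
proof (rule moduleI)
  show "abelian_group (self_module R)"
    by (rule abelian_group_cong[OF abelian_group_axioms]) (simp_all add: self_module_def ring.defs)
qed (simp_all add: l_distr r_distr m_assoc is_cring)

lemma self_module_finsum: "finite A \<Longrightarrow> (\<And>i. i \<in> A \<Longrightarrow> u i \<in> carrier R) \<Longrightarrow>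
  finsum (self_module R) u A = finsum R u A"
proof -
  interpret S: module R "self_module R" by (rule self_module_module)
  show "finsum (self_module R) u A = finsum R u A"
    if "finite A" "\<And>i. i \<in> A \<Longrightarrow> u i \<in> carrier R"
    using that
  proof (induction A rule: finite_induct)
    case (insert a A)
    then show ?case by (subst S.M.finsum_insert) (auto simp: finsum_insert)
  qed simp
qed

lemma fin_funs_mono: "p \<in> fin_funs R K \<Longrightarrow> K \<subseteq> L \<Longrightarrow> p \<in> fin_funs R L"
  by (auto simp: fin_funs_def)

lemma fin_funs_supp: "p \<in> fin_funs R K \<Longrightarrow> supp R p \<subseteq> L \<Longrightarrow> p \<in> fin_funs R L"
  by (auto simp: fin_funs_def)

text \<open>Resetting one nonzero value to zero shrinks the support by one point, and the part split
  off is a multiple of a basis element.\<close>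

lemma fin_funs_induct [consumes 1, case_names zero add]:
  assumes "p \<in> fin_funs R K" "P (\<lambda>k. \<zero>)"
    "\<And>k r q. k \<in> K \<Longrightarrow> r \<in> carrier R \<Longrightarrow> q \<in> fin_funs R K \<Longrightarrow> P q \<Longrightarrow>
      P (\<lambda>j. (r \<otimes> basis_elt R k j) \<oplus> q j)"
  shows "P p"
  using assms(1)
proof (induction "card (supp R p)" arbitrary: p)
  case 0
  then have "supp R p = {}" by (simp add: fin_funsD)
  then have "p = (\<lambda>k. \<zero>)" by (auto simp: supp_def)
  then show ?case using assms(2) by simp
next
  case (Suc n)
  then have "supp R p \<noteq> {}" by auto
  then obtain k where k: "k \<in> supp R p" by auto
  let ?q = "p(k := \<zero>)"
  have s: "supp R ?q = supp R p - {k}" by (auto simp: supp_def)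
  have q: "?q \<in> fin_funs R K"
    by (rule fin_funsI[where A = "supp R p"])
      (use fin_funsD[OF Suc.prems] in \<open>auto simp: supp_def\<close>)
  have Pq: "P ?q" using Suc(2) k fin_funsD(2)[OF Suc.prems] by (intro Suc(1)[OF _ q]) (simp add: s)
  have "k \<in> K" "p k \<in> carrier R" using k fin_funsD[OF Suc.prems] by auto
  from assms(3)[OF this q Pq] have "P (\<lambda>j. (p k \<otimes> basis_elt R k j) \<oplus> ?q j)" .
  also have "(\<lambda>j. (p k \<otimes> basis_elt R k j) \<oplus> ?q j) = p"
    using fin_funsD(1)[OF Suc.prems] by (auto simp: basis_elt_def)
  finally show ?case .
qed

lemma lin_ext_superset:
  assumes "module R A" "p \<in> fin_funs R K" "u \<in> Z \<rightarrow> carrier A" "finite Z" "supp R p \<subseteq> Z"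
  shows "lin_ext R A u p = (\<Oplus>\<^bsub>A\<^esub>k\<in>Z. p k \<odot>\<^bsub>A\<^esub> u k)"
proof -
  interpret A: module R A by fact
  show ?thesis
    unfolding lin_ext_def
    by (rule A.M.add.finprod_mono_neutral_cong_left)
      (use assms in \<open>auto simp: supp_def fin_funsD Pi_iff\<close>)
qed

lemma lin_ext_lin:
  assumes "module R A" "u \<in> carrier G \<rightarrow> carrier A"
  shows "lin_ext R A u \<in> lin_maps R (monoid_alg R G) A"
proof (rule lin_mapsI)
  interpret A: module R A by fact
  fix p assume "p \<in> carrier (monoid_alg R G)"
  then have p: "p \<in> fin_funs R (carrier G)" by (simp add: monoid_alg_simps)
  have us: "u \<in> supp R p \<rightarrow> carrier A" using assms(2) fin_funsD(3)[OF p] by auto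
  show "lin_ext R A u p \<in> carrier A"
    unfolding lin_ext_def using us fin_funsD(1)[OF p] by (intro A.M.finsum_closed) auto
  {
    fix r assume r: "r \<in> carrier R"
    have "lin_ext R A u (\<lambda>k. r \<otimes> p k) = (\<Oplus>\<^bsub>A\<^esub>k\<in>supp R p. (r \<otimes> p k) \<odot>\<^bsub>A\<^esub> u k)"
      by (rule lin_ext_superset[OF assms(1) fin_funs_smult[OF r p] us fin_funsD(2)[OF p]])
        (use r in \<open>auto simp: supp_def\<close>)
    also have "\<dots> = (\<Oplus>\<^bsub>A\<^esub>k\<in>supp R p. r \<odot>\<^bsub>A\<^esub> (p k \<odot>\<^bsub>A\<^esub> u k))"
      by (rule A.M.finsum_cong') (use r us fin_funsD(1)[OF p] in \<open>auto simp: A.smult_assoc1 Pi_iff\<close>)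
    also have "\<dots> = r \<odot>\<^bsub>A\<^esub> lin_ext R A u p"
      unfolding lin_ext_def
      by (rule A.finsum_smult_ldistr[symmetric])
        (use r us fin_funsD[OF p] in \<open>auto simp: Pi_iff\<close>)
    finally show "lin_ext R A u (r \<odot>\<^bsub>monoid_alg R G\<^esub> p) = r \<odot>\<^bsub>A\<^esub> lin_ext R A u p"
      by (simp add: monoid_alg_simps)
  }
  fix q assume "q \<in> carrier (monoid_alg R G)"
  then have q: "q \<in> fin_funs R (carrier G)" by (simp add: monoid_alg_simps)
  let ?Z = "supp R p \<union> supp R q"
  have Z: "finite ?Z" "u \<in> ?Z \<rightarrow> carrier A"
    using us assms(2) fin_funsD[OF p] fin_funsD[OF q] by auto
  have "lin_ext R A u (\<lambda>k. p k \<oplus> q k) = (\<Oplus>\<^bsub>A\<^esub>k\<in>?Z. (p k \<oplus> q k) \<odot>\<^bsub>A\<^esub> u k)"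
    by (rule lin_ext_superset[OF assms(1) fin_funs_add[OF p q] Z(2,1)]) (auto simp: supp_def)
  also have "\<dots> = (\<Oplus>\<^bsub>A\<^esub>k\<in>?Z. p k \<odot>\<^bsub>A\<^esub> u k \<oplus>\<^bsub>A\<^esub> q k \<odot>\<^bsub>A\<^esub> u k)"
    by (rule A.M.finsum_cong')
      (use Z fin_funsD(1)[OF p] fin_funsD(1)[OF q] in \<open>auto simp: A.smult_l_distr Pi_iff\<close>)
  also have "\<dots> = (\<Oplus>\<^bsub>A\<^esub>k\<in>?Z. p k \<odot>\<^bsub>A\<^esub> u k) \<oplus>\<^bsub>A\<^esub> (\<Oplus>\<^bsub>A\<^esub>k\<in>?Z. q k \<odot>\<^bsub>A\<^esub> u k)"
    by (rule A.M.finsum_addf) (use Z fin_funsD(1)[OF p] fin_funsD(1)[OF q] in \<open>auto simp: Pi_iff\<close>)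
  also have "(\<Oplus>\<^bsub>A\<^esub>k\<in>?Z. p k \<odot>\<^bsub>A\<^esub> u k) = lin_ext R A u p"
    by (rule lin_ext_superset[OF assms(1) p Z(2,1), symmetric]) simp
  also have "(\<Oplus>\<^bsub>A\<^esub>k\<in>?Z. q k \<odot>\<^bsub>A\<^esub> u k) = lin_ext R A u q"
    by (rule lin_ext_superset[OF assms(1) q Z(2,1), symmetric]) simp
  finally show "lin_ext R A u (p \<oplus>\<^bsub>monoid_alg R G\<^esub> q) = lin_ext R A u p \<oplus>\<^bsub>A\<^esub> lin_ext R A u q"
    by (simp add: monoid_alg_simps)
qed

lemma lin_ext_basis_elt:
  assumes "module R A" "u k \<in> carrier A"
  shows "lin_ext R A u (basis_elt R k) = u k"
proof -
  interpret A: module R A by fact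
  have "lin_ext R A u (basis_elt R k) = (\<Oplus>\<^bsub>A\<^esub>j\<in>{k}. basis_elt R k j \<odot>\<^bsub>A\<^esub> u j)"
    by (rule lin_ext_superset[OF assms(1) basis_elt_closed[OF UNIV_I]])
      (use assms(2) in \<open>auto simp: supp_def basis_elt_def\<close>)
  then show ?thesis using assms(2) by (simp add: basis_elt_def)
qed

lemma monoid_alg_basis_mem:
  "k \<in> carrier G \<Longrightarrow> basis_elt R k \<in> carrier (monoid_alg R G)"
  by (simp add: monoid_alg_simps basis_elt_closed)

text \<open>The index set \<open>K\<close> may be smaller than the monoid, so that the lemma also
  covers homogeneous polynomials of a fixed degree.\<close>

lemma lin_maps_monoid_alg_mem:
  assumes "module R A" "h \<in> lin_maps R (monoid_alg R G) A" "submodule J R A" "K \<subseteq> carrier G"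
    "\<And>k. k \<in> K \<Longrightarrow> h (basis_elt R k) \<in> J" "p \<in> fin_funs R K"
  shows "h p \<in> J"
  using assms(6)
proof (induction p rule: fin_funs_induct)
  interpret A: module R A by fact
  interpret P: module R "monoid_alg R G" by (rule monoid_alg_module)
  case zero
  then show ?case
    using lin_maps_zero[OF P.module_axioms assms(1,2)] submoduleD(2)[OF assms(1,3)]
    by (simp add: monoid_alg_simps)
next
  interpret P: module R "monoid_alg R G" by (rule monoid_alg_module)
  case (add k r q)
  have b: "basis_elt R k \<in> carrier (monoid_alg R G)" using add assms(4) by (auto intro: monoid_alg_basis_mem)
  have q: "q \<in> carrier (monoid_alg R G)" using fin_funs_mono[OF add(3) assms(4)] by (simp add: monoid_alg_simps)
  have "h (r \<odot>\<^bsub>monoid_alg R G\<^esub> basis_elt R k \<oplus>\<^bsub>monoid_alg R G\<^esub> q) = r \<odot>\<^bsub>A\<^esub> h (basis_elt R k) \<oplus>\<^bsub>A\<^esub> h q"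
    using b q add(2) by (simp add: lin_mapsD[OF assms(2)])
  then show ?case
    using add assms(5) by (auto simp: monoid_alg_simps intro!: submoduleD[OF assms(1,3)])
qed

lemma lin_maps_monoid_alg_eq:
  assumes "module R A" "h \<in> lin_maps R (monoid_alg R G) A" "h' \<in> lin_maps R (monoid_alg R G) A"
    "K \<subseteq> carrier G" "\<And>k. k \<in> K \<Longrightarrow> h (basis_elt R k) = h' (basis_elt R k)" "p \<in> fin_funs R K"
  shows "h p = h' p"
proof -
  interpret A: module R A by fact
  interpret P: module R "monoid_alg R G" by (rule monoid_alg_module)
  have sub: "submodule {x \<in> carrier (monoid_alg R G). h x = h' x} R (monoid_alg R G)"
    by (rule P.submoduleI')
      (auto simp: lin_mapsD[OF assms(2)] lin_mapsD[OF assms(3)]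
        lin_maps_zero[OF P.module_axioms assms(1,2)] lin_maps_zero[OF P.module_axioms assms(1,3)])
  \<comment> \<open>The membership lemma is applied to the identity map and the equalizer of
    \<open>h\<close> and \<open>h'\<close>.\<close>
  have "id p \<in> {x \<in> carrier (monoid_alg R G). h x = h' x}"
  proof (rule lin_maps_monoid_alg_mem[OF P.module_axioms _ sub assms(4) _ assms(6)])
    show "id \<in> lin_maps R (monoid_alg R G) (monoid_alg R G)" by (rule lin_mapsI) simp_all
  qed (use assms(4,5) in \<open>auto intro: monoid_alg_basis_mem\<close>)
  then show ?thesis by simp
qed

lemma basis_elt_mult: "basis_elt R i \<otimes>\<^bsub>monoid_alg R G\<^esub> basis_elt R j = basis_elt R (i \<otimes>\<^bsub>G\<^esub> j)"
  unfolding fun_eq_iff mult_ev[OF basis_elt_closed[OF UNIV_I] basis_elt_closed[OF UNIV_I]]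
  by (simp add: ev_basis_elt) (auto simp: delta_def basis_elt_def)

lemma lin_ext_alg_hom:
  assumes "comm_monoid G" "algebra R A" "u \<in> carrier G \<rightarrow> carrier A"
    "\<And>i j. i \<in> carrier G \<Longrightarrow> j \<in> carrier G \<Longrightarrow> u (i \<otimes>\<^bsub>G\<^esub> j) = u i \<otimes>\<^bsub>A\<^esub> u j" "u \<one>\<^bsub>G\<^esub> = \<one>\<^bsub>A\<^esub>"
  shows "lin_ext R A u \<in> alg_hom R (monoid_alg R G) A"
proof -
  interpret G: comm_monoid G by fact
  interpret A: algebra R A by fact
  interpret P: algebra R "monoid_alg R G" by (rule monoid_alg_algebra[OF assms(1)])
  note A.smult_assoc2 [simp]
  have A2: "r \<odot>\<^bsub>A\<^esub> (x \<otimes>\<^bsub>A\<^esub> y) = x \<otimes>\<^bsub>A\<^esub> (r \<odot>\<^bsub>A\<^esub> y)"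
    if "r \<in> carrier R" "x \<in> carrier A" "y \<in> carrier A" for r x y
    using that by (metis A.smult_assoc2 A.smult_closed A.m_comm)
  have P2: "r \<odot>\<^bsub>monoid_alg R G\<^esub> (x \<otimes>\<^bsub>monoid_alg R G\<^esub> y) = x \<otimes>\<^bsub>monoid_alg R G\<^esub> (r \<odot>\<^bsub>monoid_alg R G\<^esub> y)"
    if "r \<in> carrier R" "x \<in> carrier (monoid_alg R G)" "y \<in> carrier (monoid_alg R G)" for r x y
    using that by (metis P.smult_assoc2 P.smult_closed P.m_comm)
  let ?h = "lin_ext R A u"
  have lin: "?h \<in> lin_maps R (monoid_alg R G) A" by (rule lin_ext_lin[OF A.module assms(3)])
  have uc: "u k \<in> carrier A" if "k \<in> carrier G" for k using assms(3) that by auto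
  have bas: "?h (basis_elt R k) = u k" if "k \<in> carrier G" for k
    by (rule lin_ext_basis_elt[where u = u and k = k, OF A.module uc[OF that]])
  \<comment> \<open>Multiplicativity is checked one factor at a time: with a basis element on the
    right, both sides are linear in \<open>p\<close>, which leaves products of basis elements.
    Afterwards the right factor varies with \<open>p\<close> fixed.\<close>
  have 1: "?h (p \<otimes>\<^bsub>monoid_alg R G\<^esub> basis_elt R j) = ?h p \<otimes>\<^bsub>A\<^esub> u j"
    if p: "p \<in> carrier (monoid_alg R G)" and j: "j \<in> carrier G" for p j
  proof (rule lin_maps_monoid_alg_eq[where K = "carrier G" and p = p
        and h = "\<lambda>p. ?h (p \<otimes>\<^bsub>monoid_alg R G\<^esub> basis_elt R j)" and h' = "\<lambda>p. ?h p \<otimes>\<^bsub>A\<^esub> u j", OF A.module])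
    show "(\<lambda>p. ?h (p \<otimes>\<^bsub>monoid_alg R G\<^esub> basis_elt R j)) \<in> lin_maps R (monoid_alg R G) A"
      using monoid_alg_basis_mem[OF j]
      by (intro lin_maps_comp[OF lin_mapsI lin]) (simp_all add: P.l_distr P.smult_assoc2)
    show "(\<lambda>p. ?h p \<otimes>\<^bsub>A\<^esub> u j) \<in> lin_maps R (monoid_alg R G) A"
      using uc[OF j] by (intro lin_mapsI) (simp_all add: lin_mapsD[OF lin] A.l_distr)
    show "p \<in> fin_funs R (carrier G)" using p by (simp add: monoid_alg_simps)
  qed (use j in \<open>auto simp: basis_elt_mult bas assms(4)\<close>)
  show ?thesis
  proof (rule alg_homI[OF lin])
    show "?h \<one>\<^bsub>monoid_alg R G\<^esub> = \<one>\<^bsub>A\<^esub>" by (simp add: monoid_alg_simps bas assms(5))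
    fix p q assume p: "p \<in> carrier (monoid_alg R G)" and q: "q \<in> carrier (monoid_alg R G)"
    show "?h (p \<otimes>\<^bsub>monoid_alg R G\<^esub> q) = ?h p \<otimes>\<^bsub>A\<^esub> ?h q"
    proof (rule lin_maps_monoid_alg_eq[where K = "carrier G" and p = q
          and h = "\<lambda>q. ?h (p \<otimes>\<^bsub>monoid_alg R G\<^esub> q)" and h' = "\<lambda>q. ?h p \<otimes>\<^bsub>A\<^esub> ?h q", OF A.module])
      show "(\<lambda>q. ?h (p \<otimes>\<^bsub>monoid_alg R G\<^esub> q)) \<in> lin_maps R (monoid_alg R G) A"
        using p by (intro lin_maps_comp[OF lin_mapsI lin]) (simp_all add: P.r_distr P2)
      show "(\<lambda>q. ?h p \<otimes>\<^bsub>A\<^esub> ?h q) \<in> lin_maps R (monoid_alg R G) A"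
        using p by (intro lin_mapsI) (simp_all add: lin_mapsD[OF lin] A.r_distr A2)
      show "q \<in> fin_funs R (carrier G)" using q by (simp add: monoid_alg_simps)
    qed (use p in \<open>auto simp: bas 1\<close>)
  qed
qed

end

section \<open>Evaluation of polynomials\<close>

text \<open>Repeated entries become powers, so that the product runs over a set and the lemmas on
  \<open>finprod\<close> apply.\<close>

definition mset_prod :: "('b, 'x) monoid_scheme \<Rightarrow> ('i \<Rightarrow> 'b) \<Rightarrow> 'i multiset \<Rightarrow> 'b"
  where "mset_prod G u \<mu> = (\<Otimes>\<^bsub>G\<^esub>x\<in>set_mset \<mu>. u x [^]\<^bsub>G\<^esub> count \<mu> x)"

context comm_monoid
begin

lemma mset_prod_superset:
  assumes "finite Z" "set_mset \<mu> \<subseteq> Z" "u \<in> Z \<rightarrow> carrier G"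
  shows "mset_prod G u \<mu> = (\<Otimes>x\<in>Z. u x [^] count \<mu> x)"
  unfolding mset_prod_def
  by (rule finprod_mono_neutral_cong_left)
    (use assms in \<open>auto simp: Pi_iff not_in_iff\<close>)

lemma mset_prod_closed: "u \<in> set_mset \<mu> \<rightarrow> carrier G \<Longrightarrow> mset_prod G u \<mu> \<in> carrier G"
  unfolding mset_prod_def by (rule finprod_closed) auto

lemma mset_prod_empty: "mset_prod G u {#} = \<one>"
  by (simp add: mset_prod_def)

lemma mset_prod_single: "u x \<in> carrier G \<Longrightarrow> mset_prod G u {#x#} = u x"
  by (simp add: mset_prod_def)

lemma mset_prod_union:
  assumes "u \<in> set_mset \<mu> \<rightarrow> carrier G" "u \<in> set_mset \<nu> \<rightarrow> carrier G"
  shows "mset_prod G u (\<mu> + \<nu>) = mset_prod G u \<mu> \<otimes> mset_prod G u \<nu>"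
proof -
  let ?Z = "set_mset \<mu> \<union> set_mset \<nu>"
  have u: "u \<in> ?Z \<rightarrow> carrier G" using assms by auto
  have "mset_prod G u (\<mu> + \<nu>) = (\<Otimes>x\<in>?Z. u x [^] count \<mu> x \<otimes> u x [^] count \<nu> x)"
    unfolding mset_prod_superset[OF _ equalityD1[OF set_mset_union] u, simplified]
    by (rule finprod_cong') (use u in \<open>auto simp: nat_pow_mult Pi_iff\<close>)
  also have "\<dots> = mset_prod G u \<mu> \<otimes> mset_prod G u \<nu>"
    using u by (subst (1 2) mset_prod_superset[where Z = ?Z]) (auto simp: finprod_multf Pi_iff)
  finally show ?thesis .
qed

end

definition poly_eval :: "('a, 'r) ring_scheme \<Rightarrow> ('a, 'n, 'x) module_scheme \<Rightarrow> ('i \<Rightarrow> 'n) \<Rightarrow>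
    ('i multiset \<Rightarrow> 'a) \<Rightarrow> 'n"
  where "poly_eval R A u = lin_ext R A (mset_prod A u)"

context cring
begin

abbreviation pol :: "'i set \<Rightarrow> ('a, 'i multiset \<Rightarrow> 'a) module"
  where "pol V \<equiv> monoid_alg R (monomials V)"

lemma pol_algebra: "algebra R (pol V)"
  by (rule monoid_alg_algebra[OF monomials_comm_monoid])

lemma pol_carrier: "carrier (pol V) = fin_funs R {\<mu>. set_mset \<mu> \<subseteq> V}"
  by (simp add: monoid_alg_simps monomials_def)

lemma poly_eval_alg_hom:
  assumes "algebra R A" "u \<in> V \<rightarrow> carrier A"
  shows "poly_eval R A u \<in> alg_hom R (pol V) A"
proof -
  interpret A: algebra R A by fact
  have uc: "u \<in> set_mset \<mu> \<rightarrow> carrier A" if "\<mu> \<in> carrier (monomials V)" for \<mu>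
    using that assms(2) by (auto simp: monomials_def)
  show ?thesis
    unfolding poly_eval_def
  proof (rule lin_ext_alg_hom[OF monomials_comm_monoid assms(1)])
    fix i j assume ij: "i \<in> carrier (monomials V)" "j \<in> carrier (monomials V)"
    then have "mset_prod A u (i + j) = mset_prod A u i \<otimes>\<^bsub>A\<^esub> mset_prod A u j"
      by (intro A.mset_prod_union uc)
    then show "mset_prod A u (i \<otimes>\<^bsub>monomials V\<^esub> j) = mset_prod A u i \<otimes>\<^bsub>A\<^esub> mset_prod A u j"
      by (simp add: monomials_def)
  qed (auto simp: A.mset_prod_empty monomials_def intro!: A.mset_prod_closed[OF uc, unfolded monomials_def])
qed

lemma poly_eval_var:
  assumes "algebra R A" "u m \<in> carrier A"
  shows "poly_eval R A u (var R m) = u m"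
proof -
  interpret A: algebra R A by fact
  show ?thesis
    unfolding poly_eval_def var_def
    using lin_ext_basis_elt[OF A.module, of "mset_prod A u" "{#m#}"] assms(2)
    by (simp add: A.mset_prod_single)
qed

lemma basis_elt_add_mset: "basis_elt R (add_mset m \<mu>) = var R m \<otimes>\<^bsub>pol V\<^esub> basis_elt R \<mu>"
  by (simp add: var_def basis_elt_mult) (simp add: monomials_def)

text \<open>Monomials are products of variables, so induction on the multiset reduces everything to
  variables. \<open>V\<close> is kept apart from the full set \<open>W\<close> of variables because
  some maps agree only on the finitely many variables that occur in \<open>p\<close>.\<close>

lemma pol_hom_eq:
  assumes "algebra R A" "h \<in> alg_hom R (pol W) A" "h' \<in> alg_hom R (pol W) A" "V \<subseteq> W"
    "\<And>m. m \<in> V \<Longrightarrow> h (var R m) = h' (var R m)" "p \<in> fin_funs R {\<mu>. set_mset \<mu> \<subseteq> V}"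
  shows "h p = h' p"
proof -
  interpret A: algebra R A by fact
  have "h (basis_elt R \<mu>) = h' (basis_elt R \<mu>)" if "set_mset \<mu> \<subseteq> V" for \<mu>
    using that
  proof (induction \<mu>)
    case empty
    have "basis_elt R {#} = \<one>\<^bsub>pol W\<^esub>" by (simp add: monoid_alg_simps monomials_def)
    then show ?case using assms(2,3) by (simp add: alg_homD(3))
  next
    case (add m \<mu>)
    then have c: "var R m \<in> carrier (pol W)" "basis_elt R \<mu> \<in> carrier (pol W)"
      using assms(4) by (auto simp: var_def monomials_def intro!: monoid_alg_basis_mem)
    show ?case
      unfolding basis_elt_add_mset[where V = W]
      using add assms(5) by (simp add: alg_homD(4)[OF assms(2) c] alg_homD(4)[OF assms(3) c])
  qed
  with assms(4) show ?thesis
    by (intro lin_maps_monoid_alg_eq[OF A.module alg_homD(1)[OF assms(2)] alg_homD(1)[OF assms(3)] _ _ assms(6)])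
      (auto simp: monomials_def)
qed

section \<open>Symmetric algebras\<close>

lemma sym_subst_alg_hom:
  assumes "g \<in> carrier M \<rightarrow> carrier N"
  shows "push R (image_mset g) \<in> alg_hom R (poly_alg R M) (poly_alg R N)"
  by (simp add: alg_hom_def sym_subst_ring_hom[OF assms] sym_subst_lin[OF assms])

text \<open>The kernel of \<open>h\<close> is an ideal, and linearity of m \<mapsto> h(X_m) says
  that the kernel contains the generating relations. This is how maps out of Sym(M) are shown to be
  well defined.\<close>

lemma poly_hom_sym_ideal:
  assumes "module R M" "algebra R A" "h \<in> alg_hom R (poly_alg R M) A"
    "(\<lambda>m. h (var R m)) \<in> lin_maps R M A" "p \<in> sym_ideal R M"
  shows "h p = \<zero>\<^bsub>A\<^esub>"
proof -
  interpret M: module R M by fact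
  interpret A: algebra R A by fact
  interpret P: algebra R "poly_alg R M" by (rule poly_alg_algebra)
  note hlin = alg_homD(1)[OF assms(3)]
  have "sym_rels R M \<subseteq> a_kernel (poly_alg R M) A h"
  proof
    fix x assume x: "x \<in> sym_rels R M"
    then have "h x = \<zero>\<^bsub>A\<^esub>"
      unfolding sym_rels_def
      by (auto simp: var_closed lin_maps_minus[OF P.module A.module hlin] lin_mapsD[OF hlin]
          lin_mapsD[OF assms(4)] A.M.minus_eq A.M.r_neg)
    then show "x \<in> a_kernel (poly_alg R M) A h"
      using x sym_rels_closed[OF assms(1)] by (auto simp: a_kernel_def')
  qed
  then have "sym_ideal R M \<subseteq> a_kernel (poly_alg R M) A h"
    unfolding sym_ideal_def
    by (intro ring.genideal_minimal[OF cring.axioms(1)[OF P.M_cring]]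
        alg_hom_kernel[OF poly_alg_algebra assms(2,3)])
  then show ?thesis using assms(5) by (auto simp: a_kernel_def')
qed

lemma sym_alg_algebra: "module R M \<Longrightarrow> algebra R (sym_alg R M)"
  unfolding sym_alg_def by (rule quot_algebra[OF poly_alg_algebra sym_ideal_ideal])

lemma sym_class_alg_hom:
  "module R M \<Longrightarrow> sym_class R M \<in> alg_hom R (poly_alg R M) (sym_alg R M)"
  using coset_alg_hom[OF poly_alg_algebra sym_ideal_ideal, of M]
  by (simp add: sym_alg_def sym_class_def[abs_def])

lemma sym_class_var_lin:
  assumes "module R M"
  shows "(\<lambda>m. sym_class R M (var R m)) \<in> lin_maps R M (sym_alg R M)"
proof -
  interpret M: module R M by fact
  interpret P: algebra R "poly_alg R M" by (rule poly_alg_algebra)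
  note lin = lin_mapsD[OF alg_homD(1)[OF sym_class_alg_hom[OF assms]]]
  have rel: "x \<in> sym_ideal R M" if "x \<in> sym_rels R M" for x
    using that ring.genideal_self[OF cring.axioms(1)[OF P.M_cring] sym_rels_closed[OF assms]]
    by (auto simp: sym_ideal_def)
  show ?thesis
  proof (rule lin_mapsI)
    fix m assume m: "m \<in> carrier M"
    then show "sym_class R M (var R m) \<in> carrier (sym_alg R M)"
      by (intro lin(1) var_closed)
    {
      fix n assume n: "n \<in> carrier M"
      have "sym_class R M (var R (m \<oplus>\<^bsub>M\<^esub> n)) = sym_class R M (var R m \<oplus>\<^bsub>poly_alg R M\<^esub> var R n)"
        using m n
        by (subst sym_class_eq_iff[OF assms]) (simp_all add: var_closed, rule rel, unfold sym_rels_def, blast)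
      then show "sym_class R M (var R (m \<oplus>\<^bsub>M\<^esub> n)) =
          sym_class R M (var R m) \<oplus>\<^bsub>sym_alg R M\<^esub> sym_class R M (var R n)"
        using m n by (simp add: lin var_closed)
    }
    fix r assume r: "r \<in> carrier R"
    have "sym_class R M (var R (r \<odot>\<^bsub>M\<^esub> m)) = sym_class R M (r \<odot>\<^bsub>poly_alg R M\<^esub> var R m)"
      using m r
      by (subst sym_class_eq_iff[OF assms]) (simp_all add: var_closed, rule rel, unfold sym_rels_def, blast)
    then show "sym_class R M (var R (r \<odot>\<^bsub>M\<^esub> m)) = r \<odot>\<^bsub>sym_alg R M\<^esub> sym_class R M (var R m)"
      using m r by (simp add: lin var_closed)
  qed
qed

lemma sym_map_alg_hom:
  assumes "module R M" "module R N" "g \<in> lin_maps R M N"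
  shows "sym_map R N g \<in> alg_hom R (sym_alg R M) (sym_alg R N)"
proof -
  have g: "g \<in> carrier M \<rightarrow> carrier N" using assms(3) by (auto dest: lin_mapsD(1))
  show ?thesis
    unfolding sym_alg_def[of R M]
    by (rule quot_alg_hom[OF poly_alg_algebra sym_ideal_ideal[OF assms(1)]
          alg_hom_comp[OF sym_subst_alg_hom[OF g] sym_class_alg_hom[OF assms(2)]]])
      (simp add: sym_map_class[OF assms, unfolded sym_class_def[of R M]])
qed

section \<open>Versality and the kernel of Sym(f)\<close>

lemma versal_rees_ideal:
  fixes M :: "('a, 'm) module" and F :: "('a, 'f) module"
  assumes "module R M" "free_module R F" "f \<in> lin_maps R M F" "versal TYPE(nat \<Rightarrow> 'a) R M F f"
  shows "rees_ideal R M = sym_kernel R M F f"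
proof
  show "rees_ideal R M \<subseteq> sym_kernel R M F f"
    by (rule rees_ideal_subset_sym_kernel[OF assms(1-3)])
  have F: "module R F" using assms(2) by (simp add: free_module_def)
  show "sym_kernel R M F f \<subseteq> rees_ideal R M"
    unfolding rees_ideal_def
  proof (clarify)
    fix X and G :: "('a, nat \<Rightarrow> 'a) module" and g
    assume X: "X \<in> sym_kernel R M F f" and G: "free_module R G" and g: "g \<in> lin_maps R M G"
    have mG: "module R G" using G by (simp add: free_module_def)
    \<comment> \<open>With g = h f on \<open>M\<close>, Sym(g) is Sym(h) after Sym(f), so whatever
      Sym(f) kills is killed by Sym(g). The targets in the definition of \<open>rees_ideal\<close>
      have the carrier type for which versality is assumed.\<close>
    obtain h where h: "h \<in> lin_maps R F G" "\<And>m. m \<in> carrier M \<Longrightarrow> g m = h (f m)"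
      using assms(4) G g unfolding versal_def by blast
    obtain p where p: "p \<in> carrier (poly_alg R M)" "X = sym_class R M p"
      using X by (auto simp: sym_kernel_def a_kernel_def' sym_alg_carrier)
    have pf: "p \<in> fin_funs R {\<mu>. set_mset \<mu> \<subseteq> carrier M}"
      using p(1) by (simp add: poly_alg_def pol_carrier)
    have "push R (image_mset f) p \<in> sym_ideal R F"
      using X p sym_kernel_iff[OF assms(1) F assms(3) p(1)] by simp
    then have "push R (image_mset h) (push R (image_mset f) p) \<in> sym_ideal R G"
      by (rule sym_subst_ideal[OF F mG h(1)])
    also have "push R (image_mset h) (push R (image_mset f) p) = push R (image_mset g) p"
      unfolding push_push[OF pf]
      by (rule push_cong[OF pf])
        (use fin_funsD(3)[OF pf] in
          \<open>auto simp: multiset.map_comp subset_iff intro!: image_mset_cong h(2)[symmetric]\<close>)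
    finally show "X \<in> sym_kernel R M G g"
      using sym_kernel_iff[OF assms(1) mG g p(1)] p(2) by simp
  qed
qed

lemma dual_epi_versal:
  fixes M :: "('a, 'm) module" and F :: "('a, 'f) module"
  assumes M: "fin_gen_module R M" and F: "free_module R F" and f: "f \<in> lin_maps R M F"
    and surj: "dual_map M f ` dual R F = dual R M"
  shows "versal TYPE('g) R M F f"
  unfolding versal_def
proof (intro allI impI, elim conjE)
  fix G :: "('a, 'g) module" and g assume G: "free_module R G" and g: "g \<in> lin_maps R M G"
  have mM: "module R M" and mF: "module R F" and mG: "module R G"
    using M F G by (simp_all add: fin_gen_module_def free_module_def)
  obtain A where A: "finite A" "A \<subseteq> carrier M" "submodule_span R M A = carrier M"
    using M by (auto simp: fin_gen_module_def)
  have "finite (g ` A)" "g ` A \<subseteq> carrier G" using A lin_mapsD(1)[OF g] by auto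
  then obtain n \<pi> j where pj: "\<pi> \<in> lin_maps R G (std_free n)" "j \<in> lin_maps R (std_free n) G"
    "\<And>x. x \<in> g ` A \<Longrightarrow> j (\<pi> x) = x"
    using free_module_retract[OF G] by metis
  \<comment> \<open>The retraction fixes only the images of the finitely many generators; both sides
    are linear in \<open>m\<close>, so it fixes the image of every element of \<open>M\<close>.
    Finite generation enters here.\<close>
  have jpg: "j (\<pi> (g m)) = g m" if "m \<in> carrier M" for m
    by (rule lin_maps_eq_on_span[OF mM mG lin_maps_comp[OF lin_maps_comp[OF g pj(1)] pj(2)] g A(3,2) _ that])
      (auto intro: pj(3))
  have coord: "(\<lambda>v. v i) \<in> lin_maps R (std_free n) (self_module R)" for i
    by (rule lin_mapsI) (auto simp: std_free_simps std_free_carrier fin_funsD)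
  have "\<exists>\<psi>. \<psi> \<in> lin_maps R F (self_module R) \<and> (\<forall>m\<in>carrier M. \<psi> (f m) = \<pi> (g m) i)" for i
  proof -
    note lin = lin_maps_comp[OF lin_maps_comp[OF g pj(1)] coord[of i]]
    interpret M: module R M by (rule mM)
    \<comment> \<open>Elements of \<open>dual\<close> are undefined off the carrier, so the
      coordinate functional has to be restricted before surjectivity of the dual map applies to
      it.\<close>
    have "restrict (\<lambda>m. \<pi> (g m) i) (carrier M) \<in> dual R M"
      unfolding dual_def using lin_mapsD[OF lin] by (auto intro!: lin_mapsI)
    then obtain \<psi> where \<psi>: "\<psi> \<in> dual R F" "restrict (\<lambda>m. \<pi> (g m) i) (carrier M) = dual_map M f \<psi>"
      using surj by blast
    have "\<psi> (f m) = \<pi> (g m) i" if "m \<in> carrier M" for m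
      using fun_cong[OF \<psi>(2), of m] that by (simp add: dual_map_def compose_def)
    with \<psi>(1) show ?thesis by (auto simp: dual_def)
  qed
  then obtain \<psi> where \<psi>: "\<And>i. \<psi> i \<in> lin_maps R F (self_module R)"
    "\<And>i m. m \<in> carrier M \<Longrightarrow> \<psi> i (f m) = \<pi> (g m) i" by metis
  \<comment> \<open>The extended coordinates form one map from \<open>F\<close> to R^n, set to zero
    beyond \<open>n\<close> to stay in the carrier; followed by \<open>j\<close> it is the required
    factor of \<open>g\<close>.\<close>
  define v where "v x = (\<lambda>i. if i < n then \<psi> i x else \<zero>)" for x
  have v: "v \<in> lin_maps R F (std_free n)"
  proof (rule lin_mapsI)
    fix x assume x: "x \<in> carrier F"
    show "v x \<in> carrier (std_free n)"
      unfolding std_free_carrier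
      by (rule fin_funsI[where A = "{..<n}"]) (use lin_mapsD(1)[OF \<psi>(1) x] in \<open>auto simp: v_def\<close>)
  qed (auto simp: v_def std_free_simps lin_mapsD[OF \<psi>(1)])
  have "v (f m) = \<pi> (g m)" if "m \<in> carrier M" for m
  proof
    fix i
    have "\<pi> (g m) \<in> fin_funs R {..<n}"
      using lin_mapsD(1)[OF lin_maps_comp[OF g pj(1)] that] by (simp add: std_free_carrier)
    then show "v (f m) i = \<pi> (g m) i" using that by (auto simp: v_def \<psi>(2) dest: fin_funs_outside)
  qed
  then show "\<exists>h\<in>lin_maps R F G. \<forall>m\<in>carrier M. g m = h (f m)"
    using jpg by (intro bexI[OF _ lin_maps_comp[OF v pj(2)]]) auto
qed

text \<open>Since \<open>rees_ideal\<close> equals the kernel of Sym(f), this is the first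
  isomorphism theorem for Sym(f).\<close>

lemma versal_rees_nat_surj:
  fixes M :: "('a, 'm) module" and F :: "('a, 'f) module"
  assumes "module R M" "free_module R F" "f \<in> lin_maps R M F" "versal TYPE(nat \<Rightarrow> 'a) R M F f"
  shows "rees_nat_surj R F f \<in> alg_iso R (rees_alg R M) (rees_alg_map R M F f)"
proof -
  have F: "module R F" using assms(2) by (simp add: free_module_def)
  show ?thesis
    using alg_first_iso[OF sym_alg_algebra[OF assms(1)] sym_alg_algebra[OF F] sym_map_alg_hom[OF assms(1) F assms(3)]]
    by (simp add: rees_nat_surj_def[abs_def] rees_alg_def rees_alg_map_def versal_rees_ideal[OF assms]
        sym_kernel_def)
qed

end

section \<open>Linear combinations of linear maps\<close>

lemma lin_maps_smult_const:
  assumes "module R M" "module R N" "\<phi> \<in> lin_maps R M (self_module R)" "y \<in> carrier N"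
  shows "(\<lambda>m. \<phi> m \<odot>\<^bsub>N\<^esub> y) \<in> lin_maps R M N"
proof -
  interpret M: module R M by fact
  interpret N: module R N by fact
  show ?thesis
    by (rule lin_mapsI)
      (use lin_mapsD[OF assms(3)] assms(4) in \<open>simp_all add: N.smult_l_distr N.smult_assoc1\<close>)
qed

lemma lin_maps_cong:
  assumes "module R M" "h \<in> lin_maps R M N" "\<And>m. m \<in> carrier M \<Longrightarrow> h' m = h m"
  shows "h' \<in> lin_maps R M N"
proof -
  interpret M: module R M by fact
  show ?thesis by (rule lin_mapsI) (simp_all add: lin_mapsD[OF assms(2)] assms(3))
qed

lemma lin_maps_sum:
  assumes "module R M" "module R N" "finite I" "\<And>i. i \<in> I \<Longrightarrow> h i \<in> lin_maps R M N"
  shows "(\<lambda>m. \<Oplus>\<^bsub>N\<^esub>i\<in>I. h i m) \<in> lin_maps R M N"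
proof -
  interpret N: module R N by fact
  note h = lin_mapsD[OF assms(4)]
  show ?thesis
  proof (rule lin_mapsI)
    fix x assume x: "x \<in> carrier M"
    show "(\<Oplus>\<^bsub>N\<^esub>i\<in>I. h i x) \<in> carrier N" using x h(1) by (intro N.M.finsum_closed) auto
    {
      fix y assume y: "y \<in> carrier M"
      have "(\<Oplus>\<^bsub>N\<^esub>i\<in>I. h i (x \<oplus>\<^bsub>M\<^esub> y)) = (\<Oplus>\<^bsub>N\<^esub>i\<in>I. h i x \<oplus>\<^bsub>N\<^esub> h i y)"
        using x y h by (intro N.M.finsum_cong') auto
      also have "\<dots> = (\<Oplus>\<^bsub>N\<^esub>i\<in>I. h i x) \<oplus>\<^bsub>N\<^esub> (\<Oplus>\<^bsub>N\<^esub>i\<in>I. h i y)"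
        using x y h by (intro N.M.finsum_addf) auto
      finally show "(\<Oplus>\<^bsub>N\<^esub>i\<in>I. h i (x \<oplus>\<^bsub>M\<^esub> y)) = (\<Oplus>\<^bsub>N\<^esub>i\<in>I. h i x) \<oplus>\<^bsub>N\<^esub> (\<Oplus>\<^bsub>N\<^esub>i\<in>I. h i y)" .
    }
    fix r assume r: "r \<in> carrier R"
    have "(\<Oplus>\<^bsub>N\<^esub>i\<in>I. h i (r \<odot>\<^bsub>M\<^esub> x)) = (\<Oplus>\<^bsub>N\<^esub>i\<in>I. r \<odot>\<^bsub>N\<^esub> h i x)"
      using x r h by (intro N.M.finsum_cong') auto
    also have "\<dots> = r \<odot>\<^bsub>N\<^esub> (\<Oplus>\<^bsub>N\<^esub>i\<in>I. h i x)"
      using x r h assms(3) by (intro N.finsum_smult_ldistr[symmetric]) auto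
    finally show "(\<Oplus>\<^bsub>N\<^esub>i\<in>I. h i (r \<odot>\<^bsub>M\<^esub> x)) = r \<odot>\<^bsub>N\<^esub> (\<Oplus>\<^bsub>N\<^esub>i\<in>I. h i x)" .
  qed
qed

section \<open>The Rees ideal through generators of the dual\<close>

context cring
begin

text \<open>The polynomial ring has one variable for each natural number, so that the target does
  not depend on \<open>k\<close>.\<close>

definition form :: "nat \<Rightarrow> (nat \<Rightarrow> 'm \<Rightarrow> 'a) \<Rightarrow> 'm \<Rightarrow> nat multiset \<Rightarrow> 'a"
  where "form k \<phi> m = (\<Oplus>\<^bsub>pol UNIV\<^esub>i\<in>{..<k}. \<phi> i m \<odot>\<^bsub>pol UNIV\<^esub> var R i)"

lemma var_pol: "i \<in> V \<Longrightarrow> var R i \<in> carrier (pol V)"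
  by (simp add: var_def monomials_def monoid_alg_basis_mem)

lemma form_lin:
  assumes "module R M" "\<And>i. i < k \<Longrightarrow> \<phi> i \<in> lin_maps R M (self_module R)"
  shows "form k \<phi> \<in> lin_maps R M (pol UNIV)"
  unfolding form_def[abs_def]
  by (intro lin_maps_sum lin_maps_smult_const assms monoid_alg_module) (auto intro: assms var_pol)

definition rees_eval :: "nat \<Rightarrow> (nat \<Rightarrow> 'm \<Rightarrow> 'a) \<Rightarrow> ('m multiset \<Rightarrow> 'a) \<Rightarrow> nat multiset \<Rightarrow> 'a"
  where "rees_eval k \<phi> = poly_eval R (pol UNIV) (form k \<phi>)"

lemma rees_eval:
  assumes "module R M" "\<And>i. i < k \<Longrightarrow> \<phi> i \<in> lin_maps R M (self_module R)"
  shows "rees_eval k \<phi> \<in> alg_hom R (poly_alg R M) (pol UNIV)"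
    and "m \<in> carrier M \<Longrightarrow> rees_eval k \<phi> (var R m) = form k \<phi> m"
  using lin_mapsD(1)[OF form_lin[OF assms]]
  by (auto simp: rees_eval_def poly_alg_def intro!: poly_eval_alg_hom poly_eval_var pol_algebra)

text \<open>The functionals \<phi>_i are the coordinates of one map from \<open>N\<close> to R^k,
  and \<open>rees_eval\<close> factors through Sym of that map, so it vanishes on polynomials
  representing elements of the Rees ideal. Conversely, by \<open>gen\<close> a map \<open>g\<close>
  to a free module has the form m \<mapsto> \<Sum> \<phi>_i(m) y_i on the finitely many elements
  that occur in \<open>p\<close>, so Sym(g) of the class of \<open>p\<close> is obtained from
  \<open>rees_eval\<close> by substituting the class of y_i for X_i. Generation of the dual is a
  hypothesis, so that the lemma applies both over R to \<open>M\<close> and over \<open>S\<close> to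
  its base change.\<close>

lemma rees_ideal_iff:
  fixes N :: "('a, 'n) module"
  assumes N: "module R N" and \<phi>: "\<And>i. i < k \<Longrightarrow> \<phi> i \<in> lin_maps R N (self_module R)"
    and gen: "\<And>\<psi>. \<psi> \<in> lin_maps R N (self_module R) \<Longrightarrow>
      \<exists>c. (\<forall>i<k. c i \<in> carrier R) \<and> (\<forall>m\<in>carrier N. \<psi> m = (\<Oplus>i\<in>{..<k}. \<phi> i m \<otimes> c i))"
    and p: "p \<in> carrier (poly_alg R N)"
  shows "sym_class R N p \<in> rees_ideal R N \<longleftrightarrow> rees_eval k \<phi> p = \<zero>\<^bsub>pol UNIV\<^esub>"
proof
  interpret N: module R N by (rule N)
  interpret P: algebra R "pol UNIV" by (rule pol_algebra)
  note \<theta> = rees_eval[OF N \<phi>]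
  assume "sym_class R N p \<in> rees_ideal R N"
  define f where "f m = (\<lambda>i. if i < k then \<phi> i m else \<zero>)" for m
  have f: "f \<in> lin_maps R N (std_free k)"
  proof (rule lin_mapsI)
    fix x assume x: "x \<in> carrier N"
    show "f x \<in> carrier (std_free k)"
      unfolding std_free_carrier
      by (rule fin_funsI[where A = "{..<k}"]) (use lin_mapsD(1)[OF \<phi> x] in \<open>auto simp: f_def\<close>)
  qed (auto simp: f_def std_free_simps lin_mapsD[OF \<phi>])
  then have fc: "f \<in> carrier N \<rightarrow> carrier (std_free k)" by (auto dest: lin_mapsD(1))
  have coord: "(\<lambda>v. v i) \<in> lin_maps R (std_free k) (self_module R)" for i
    by (rule lin_mapsI) (auto simp: std_free_simps std_free_carrier fin_funsD)
  \<comment> \<open>The same evaluation for R^k with its coordinate functionals: X_v goes to \<Sum>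
    v_i X_i. It kills the relations of Sym(R^k) and composes with \<open>f\<close> to the evaluation
    on \<open>N\<close>.\<close>
  note \<theta>' = rees_eval[OF std_free_module coord, where k = k]
  have "sym_class R N p \<in> sym_kernel R N (std_free k) f"
    using \<open>sym_class R N p \<in> _\<close> f free_std_free unfolding rees_ideal_def by blast
  then have "push R (image_mset f) p \<in> sym_ideal R (std_free k)"
    using sym_kernel_iff[OF N std_free_module f p] by simp
  then have "rees_eval k (\<lambda>i v. v i) (push R (image_mset f) p) = \<zero>\<^bsub>pol UNIV\<^esub>"
  proof (rule poly_hom_sym_ideal[OF std_free_module pol_algebra \<theta>'(1), rotated])
    show "(\<lambda>v. rees_eval k (\<lambda>i v. v i) (var R v)) \<in> lin_maps R (std_free k) (pol UNIV)"
      by (rule lin_maps_cong[OF std_free_module form_lin[where \<phi> = "\<lambda>i v. v i", OF std_free_module coord] \<theta>'(2)])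
  qed
  also have "rees_eval k (\<lambda>i v. v i) (push R (image_mset f) p) = rees_eval k \<phi> p"
  proof (rule pol_hom_eq[OF pol_algebra _ \<theta>(1)[unfolded poly_alg_def] subset_refl])
    show "(\<lambda>p. rees_eval k (\<lambda>i v. v i) (push R (image_mset f) p)) \<in> alg_hom R (pol (carrier N)) (pol UNIV)"
      using alg_hom_comp[OF sym_subst_alg_hom[OF fc] \<theta>'(1)] by (simp add: poly_alg_def)
    show "p \<in> fin_funs R {\<mu>. set_mset \<mu> \<subseteq> carrier N}" using p by (simp add: poly_alg_def pol_carrier)
    fix m assume m: "m \<in> carrier N"
    have "form k (\<lambda>i v. v i) (f m) = form k \<phi> m"
      unfolding form_def using lin_mapsD(1)[OF \<phi> m]
      by (intro P.M.finsum_cong') (auto simp: f_def var_pol)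
    then show "rees_eval k (\<lambda>i v. v i) (push R (image_mset f) (var R m)) = rees_eval k \<phi> (var R m)"
      using m lin_mapsD(1)[OF f m] by (simp add: sym_subst_var \<theta> \<theta>')
  qed
  finally show "rees_eval k \<phi> p = \<zero>\<^bsub>pol UNIV\<^esub>" .
next
  interpret N: module R N by (rule N)
  interpret P: algebra R "pol UNIV" by (rule pol_algebra)
  note \<theta> = rees_eval[OF N \<phi>]
  assume 0: "rees_eval k \<phi> p = \<zero>\<^bsub>pol UNIV\<^esub>"
  have pf: "p \<in> fin_funs R {\<mu>. set_mset \<mu> \<subseteq> carrier N}" using p by (simp add: poly_alg_def pol_carrier)
  \<comment> \<open>The elements of \<open>N\<close> that occur in \<open>p\<close>. The retraction
    onto a free module of finite rank is available only for the images of such a finite set.\<close>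
  define V where "V = (\<Union>\<mu>\<in>supp R p. set_mset \<mu>)"
  have V: "finite V" "V \<subseteq> carrier N" "p \<in> fin_funs R {\<mu>. set_mset \<mu> \<subseteq> V}"
    using fin_funsD(2,3)[OF pf] by (auto simp: V_def intro!: fin_funs_supp[OF pf])
  show "sym_class R N p \<in> rees_ideal R N"
    unfolding rees_ideal_def
  proof clarify
    fix G :: "('a, nat \<Rightarrow> 'a) module" and g
    assume G: "free_module R G" and g: "g \<in> lin_maps R N G"
    have mG: "module R G" using G by (simp add: free_module_def)
    interpret G: module R G by (rule mG)
    have "finite (g ` V)" "g ` V \<subseteq> carrier G" using V lin_mapsD(1)[OF g] by auto
    then obtain n \<pi> j where pj: "\<pi> \<in> lin_maps R G (std_free n)" "j \<in> lin_maps R (std_free n) G"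
      "\<And>x. x \<in> g ` V \<Longrightarrow> j (\<pi> x) = x"
      using free_module_retract[OF G] by metis
    have coord: "(\<lambda>v. v l) \<in> lin_maps R (std_free n) (self_module R)" for l
      by (rule lin_mapsI) (auto simp: std_free_simps std_free_carrier fin_funsD)
    have "\<forall>l. \<exists>c. (\<forall>i<k. c i \<in> carrier R) \<and>
        (\<forall>m\<in>carrier N. \<pi> (g m) l = (\<Oplus>i\<in>{..<k}. \<phi> i m \<otimes> c i))"
      by (intro allI gen lin_maps_comp[OF lin_maps_comp[OF g pj(1)] coord])
    then obtain c where c: "\<And>l i. i < k \<Longrightarrow> c l i \<in> carrier R"
      "\<And>l m. m \<in> carrier N \<Longrightarrow> \<pi> (g m) l = (\<Oplus>i\<in>{..<k}. \<phi> i m \<otimes> c l i)" by metis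
    \<comment> \<open>Row \<open>i\<close> of the coefficients that express the coordinates of \<pi>
      g through the functionals, read as a vector in R^n, so that \<pi>(g m) = \<Sum> \<phi>_i(m)
      w_i.\<close>
    define w where "w i = (\<lambda>l. if l < n then c l i else \<zero>)" for i
    have w: "w i \<in> carrier (std_free n)" if "i < k" for i
      unfolding std_free_carrier
      by (rule fin_funsI[where A = "{..<n}"]) (use c(1)[OF that] in \<open>auto simp: w_def\<close>)
    \<comment> \<open>The value zero from \<open>k\<close> on keeps the substitution defined on
      every variable of \<open>pol UNIV\<close>.\<close>
    define y where "y i = (if i < k then j (w i) else \<zero>\<^bsub>G\<^esub>)" for i
    have y: "y i \<in> carrier G" for i using w lin_mapsD(1)[OF pj(2)] by (simp add: y_def)
    interpret F: module R "std_free n" by (rule std_free_module)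
    have gm: "g m = (\<Oplus>\<^bsub>G\<^esub>i\<in>{..<k}. \<phi> i m \<odot>\<^bsub>G\<^esub> y i)" if m: "m \<in> V" for m
    proof -
      have mN: "m \<in> carrier N" using m V by auto
      have \<phi>m: "\<phi> i m \<in> carrier R" if "i < k" for i using lin_mapsD(1)[OF \<phi>[OF that] mN] by simp
      have "\<pi> (g m) = (\<Oplus>\<^bsub>std_free n\<^esub>i\<in>{..<k}. \<phi> i m \<odot>\<^bsub>std_free n\<^esub> w i)"
      proof
        fix l
        have "\<pi> (g m) \<in> fin_funs R {..<n}"
          using lin_mapsD(1)[OF lin_maps_comp[OF g pj(1)] mN] by (simp add: std_free_carrier)
        then have "\<pi> (g m) l = (if l < n then \<Oplus>i\<in>{..<k}. \<phi> i m \<otimes> c l i else \<zero>)"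
          using c(2)[OF mN] by (auto dest: fin_funs_outside)
        also have "\<dots> = (\<Oplus>i\<in>{..<k}. \<phi> i m \<otimes> w i l)"
          using \<phi>m c(1) by (auto simp: w_def intro!: finsum_cong' add.finprod_one_eqI[symmetric])
        also have "\<dots> = (\<Oplus>\<^bsub>std_free n\<^esub>i\<in>{..<k}. \<phi> i m \<odot>\<^bsub>std_free n\<^esub> w i) l"
          by (subst std_free_finsum) (use \<phi>m w in \<open>auto simp: std_free_simps(3)[symmetric]\<close>,
            simp add: std_free_simps)
        finally show "\<pi> (g m) l = (\<Oplus>\<^bsub>std_free n\<^esub>i\<in>{..<k}. \<phi> i m \<odot>\<^bsub>std_free n\<^esub> w i) l" .
      qed
      then have "j (\<pi> (g m)) = (\<Oplus>\<^bsub>G\<^esub>i\<in>{..<k}. j (\<phi> i m \<odot>\<^bsub>std_free n\<^esub> w i))"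
        using \<phi>m w by (simp only:) (rule lin_maps_finsum[OF std_free_module mG pj(2)], auto)
      also have "\<dots> = (\<Oplus>\<^bsub>G\<^esub>i\<in>{..<k}. \<phi> i m \<odot>\<^bsub>G\<^esub> y i)"
        using \<phi>m w y by (intro G.M.finsum_cong') (auto simp: lin_mapsD[OF pj(2)] y_def)
      finally show ?thesis using pj(3) m by simp
    qed
    note sG = sym_class_alg_hom[OF mG] and vG = sym_class_var_lin[OF mG]
    have SG: "algebra R (sym_alg R G)" by (rule sym_alg_algebra[OF mG])
    interpret SG: algebra R "sym_alg R G" by (rule SG)
    \<comment> \<open>The substitution X_i \<mapsto> class of y_i; composed with
      \<open>rees_eval\<close> it agrees with Sym(g) on the variables in \<open>V\<close>.\<close>
    define e where "e = poly_eval R (sym_alg R G) (\<lambda>i. sym_class R G (var R (y i)))"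
    have yc: "sym_class R G (var R (y i)) \<in> carrier (sym_alg R G)" for i
      by (rule lin_mapsD(1)[OF vG y])
    have e: "e \<in> alg_hom R (pol UNIV) (sym_alg R G)"
      unfolding e_def by (rule poly_eval_alg_hom[OF SG]) (use yc in auto)
    have evar: "e (var R i) = sym_class R G (var R (y i))" for i
      unfolding e_def by (rule poly_eval_var[OF SG]) (rule yc)
    have gc: "g \<in> carrier N \<rightarrow> carrier G" using lin_mapsD(1)[OF g] by auto
    have "sym_class R G (push R (image_mset g) p) = e (rees_eval k \<phi> p)"
    proof (rule pol_hom_eq[OF SG _ _ V(2) _ V(3)])
      show "(\<lambda>p. sym_class R G (push R (image_mset g) p)) \<in> alg_hom R (pol (carrier N)) (sym_alg R G)"
        using alg_hom_comp[OF sym_subst_alg_hom[OF gc] sG] by (simp add: poly_alg_def)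
      show "(\<lambda>p. e (rees_eval k \<phi> p)) \<in> alg_hom R (pol (carrier N)) (sym_alg R G)"
        using alg_hom_comp[OF \<theta>(1) e] by (simp add: poly_alg_def)
      fix m assume m: "m \<in> V"
      then have mN: "m \<in> carrier N" using V by auto
      have \<phi>m: "\<phi> i m \<in> carrier R" if "i < k" for i using lin_mapsD(1)[OF \<phi>[OF that] mN] by simp
      have "e (form k \<phi> m) = (\<Oplus>\<^bsub>sym_alg R G\<^esub>i\<in>{..<k}. e (\<phi> i m \<odot>\<^bsub>pol UNIV\<^esub> var R i))"
        unfolding form_def using \<phi>m
        by (intro lin_maps_finsum[OF P.module SG.module alg_homD(1)[OF e]]) (auto simp: var_pol)
      also have "\<dots> = (\<Oplus>\<^bsub>sym_alg R G\<^esub>i\<in>{..<k}. sym_class R G (var R (\<phi> i m \<odot>\<^bsub>G\<^esub> y i)))"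
        using \<phi>m y yc
        by (intro SG.M.finsum_cong')
          (auto simp: var_pol lin_mapsD[OF alg_homD(1)[OF e]] evar lin_mapsD[OF vG])
      also have "\<dots> = sym_class R G (var R (g m))"
        unfolding gm[OF m] using \<phi>m y
        by (intro lin_maps_finsum[OF mG SG.module vG, symmetric]) auto
      finally show "sym_class R G (push R (image_mset g) (var R m)) = e (rees_eval k \<phi> (var R m))"
        using mN by (simp add: sym_subst_var \<theta>(2))
    qed
    also have "\<dots> = \<zero>\<^bsub>sym_alg R G\<^esub>"
      unfolding 0 by (rule lin_maps_zero[OF P.module SG.module alg_homD(1)[OF e]])
    finally have "sym_class R G (push R (image_mset g) p) = sym_ideal R G"
      by (simp add: sym_alg_def quot_simps)
    moreover have "push R (image_mset g) p \<in> carrier (poly_alg R G)"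
      by (rule lin_mapsD(1)[OF alg_homD(1)[OF sym_subst_alg_hom[OF gc]] p])
    ultimately have "push R (image_mset g) p \<in> sym_ideal R G"
      using coset_eq_zero_iff[OF algebra.module[OF poly_alg_algebra]
          ideal_submodule[OF poly_alg_algebra sym_ideal_ideal[OF mG]]]
      by (simp add: sym_class_def)
    then show "sym_class R N p \<in> sym_kernel R N G g"
      using sym_kernel_iff[OF N mG g p] by simp
  qed
qed

end

section \<open>Tensor products\<close>

definition tensor_lift :: "('a, 'r) ring_scheme \<Rightarrow> ('a, 'c) module \<Rightarrow> ('m \<times> 'n \<Rightarrow> 'c) \<Rightarrow>
    ('m \<times> 'n \<Rightarrow> 'a) set \<Rightarrow> 'c"
  where "tensor_lift R C u X = the_elem (lin_ext R C u ` X)"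

definition bilinear :: "('a, 'r) ring_scheme \<Rightarrow> ('a, 'm) module \<Rightarrow> ('a, 'n) module \<Rightarrow>
    ('a, 'c) module \<Rightarrow> ('m \<times> 'n \<Rightarrow> 'c) \<Rightarrow> bool"
  where "bilinear R A B C u \<longleftrightarrow>
    (\<forall>b\<in>carrier B. (\<lambda>a. u (a, b)) \<in> lin_maps R A C) \<and>
    (\<forall>a\<in>carrier A. (\<lambda>b. u (a, b)) \<in> lin_maps R B C)"

context cring
begin

lemma pair_alg_module: "module R (pair_alg R A B)"
  unfolding pair_alg_def by (rule monoid_alg_module)

lemma pair_alg_carrier: "carrier (pair_alg R A B) = fin_funs R (carrier A \<times> carrier B)"
  by (simp add: pair_alg_def monoid_alg_simps DirProd_def)

lemma pair_alg_basis:
  "a \<in> carrier A \<Longrightarrow> b \<in> carrier B \<Longrightarrow> basis_elt R (a, b) \<in> carrier (pair_alg R A B)"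
  by (simp add: pair_alg_carrier basis_elt_closed)

lemma tensor_rels_closed:
  assumes "module R A" "module R B"
  shows "tensor_rels R A B \<subseteq> carrier (pair_alg R A B)"
proof -
  interpret A: module R A by fact
  interpret B: module R B by fact
  interpret P: module R "pair_alg R A B" by (rule pair_alg_module)
  show ?thesis
    by (auto simp: tensor_rels_def intro!: P.M.minus_closed P.M.a_closed P.smult_closed pair_alg_basis)
qed

lemma tensor_kernel_submodule:
  assumes "module R A" "module R B"
  shows "submodule (tensor_kernel R A B) R (pair_alg R A B)"
  unfolding tensor_kernel_def
  by (rule submodule_submodule_span[OF pair_alg_module tensor_rels_closed[OF assms]])

lemma tensor_module:
  assumes "module R A" "module R B"
  shows "module R (tensor R A B)"
  unfolding tensor_def by (rule quot_module[OF pair_alg_module tensor_kernel_submodule[OF assms]])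

lemma tensor_class_lin:
  assumes "module R A" "module R B"
  shows "tensor_class R A B \<in> lin_maps R (pair_alg R A B) (tensor R A B)"
  using coset_lin[OF pair_alg_module tensor_kernel_submodule[OF assms]]
  by (simp add: tensor_def tensor_class_def[abs_def])

lemma tensor_carrier: "carrier (tensor R A B) = tensor_class R A B ` carrier (pair_alg R A B)"
  by (simp add: tensor_def quot_carrier tensor_class_def)

lemma tensor_class_zero_iff:
  assumes "module R A" "module R B" "p \<in> carrier (pair_alg R A B)"
  shows "tensor_class R A B p = \<zero>\<^bsub>tensor R A B\<^esub> \<longleftrightarrow> p \<in> tensor_kernel R A B"
  using coset_eq_zero_iff[OF pair_alg_module tensor_kernel_submodule[OF assms(1,2)] assms(3)]
  by (simp add: tensor_def quot_simps tensor_class_def)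

text \<open>Bilinearity on basis elements says that \<open>h\<close> kills each of the four families
  of relations, hence their span. It is phrased for a given linear \<open>h\<close> so as to serve
  both \<open>lin_ext\<close> and the substitution behind \<open>tensor_map\<close>.\<close>

lemma bilinear_basis_kernel:
  assumes "module R A" "module R B" "module R C" "h \<in> lin_maps R (pair_alg R A B) C"
    "bilinear R A B C (\<lambda>k. h (basis_elt R k))" "p \<in> tensor_kernel R A B"
  shows "h p = \<zero>\<^bsub>C\<^esub>"
proof -
  interpret A: module R A by fact
  interpret B: module R B by fact
  interpret C: module R C by fact
  interpret P: module R "pair_alg R A B" by (rule pair_alg_module)
  have l: "(\<lambda>a. h (basis_elt R (a, b))) \<in> lin_maps R A C" if "b \<in> carrier B" for b
    using assms(5) that by (simp add: bilinear_def)
  have r: "(\<lambda>b. h (basis_elt R (a, b))) \<in> lin_maps R B C" if "a \<in> carrier A" for a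
    using assms(5) that by (simp add: bilinear_def)
  have z: "h (u \<ominus>\<^bsub>pair_alg R A B\<^esub> v) = \<zero>\<^bsub>C\<^esub>"
    if "u \<in> carrier (pair_alg R A B)" "v \<in> carrier (pair_alg R A B)" "h u = h v" for u v
    using that lin_mapsD(1)[OF assms(4) that(2)]
    unfolding lin_maps_minus[OF P.module_axioms C.module_axioms assms(4) that(1,2)]
    by (simp add: C.M.minus_eq C.M.r_neg)
  note simps = pair_alg_basis lin_mapsD(2,3)[OF assms(4)]
  have "tensor_rels R A B \<subseteq> {p \<in> carrier (pair_alg R A B). h p \<in> {\<zero>\<^bsub>C\<^esub>}}"
  proof
    fix x assume x: "x \<in> tensor_rels R A B"
    then have "h x = \<zero>\<^bsub>C\<^esub>"
      unfolding tensor_rels_def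
    proof (elim UnE CollectE exE conjE)
      fix a a' b
      assume "x = basis_elt R (a \<oplus>\<^bsub>A\<^esub> a', b) \<ominus>\<^bsub>pair_alg R A B\<^esub>
          (basis_elt R (a, b) \<oplus>\<^bsub>pair_alg R A B\<^esub> basis_elt R (a', b))"
        "a \<in> carrier A" "a' \<in> carrier A" "b \<in> carrier B"
      then show "h x = \<zero>\<^bsub>C\<^esub>" by (simp only:, intro z) (simp_all add: simps lin_mapsD(2)[OF l])
    next
      fix a b b'
      assume "x = basis_elt R (a, b \<oplus>\<^bsub>B\<^esub> b') \<ominus>\<^bsub>pair_alg R A B\<^esub>
          (basis_elt R (a, b) \<oplus>\<^bsub>pair_alg R A B\<^esub> basis_elt R (a, b'))"
        "a \<in> carrier A" "b \<in> carrier B" "b' \<in> carrier B"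
      then show "h x = \<zero>\<^bsub>C\<^esub>" by (simp only:, intro z) (simp_all add: simps lin_mapsD(2)[OF r])
    next
      fix s a b
      assume "x = basis_elt R (s \<odot>\<^bsub>A\<^esub> a, b) \<ominus>\<^bsub>pair_alg R A B\<^esub>
          (s \<odot>\<^bsub>pair_alg R A B\<^esub> basis_elt R (a, b))"
        "s \<in> carrier R" "a \<in> carrier A" "b \<in> carrier B"
      then show "h x = \<zero>\<^bsub>C\<^esub>" by (simp only:, intro z) (simp_all add: simps lin_mapsD(3)[OF l])
    next
      fix s a b
      assume "x = basis_elt R (a, s \<odot>\<^bsub>B\<^esub> b) \<ominus>\<^bsub>pair_alg R A B\<^esub>
          (s \<odot>\<^bsub>pair_alg R A B\<^esub> basis_elt R (a, b))"
        "s \<in> carrier R" "a \<in> carrier A" "b \<in> carrier B"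
      then show "h x = \<zero>\<^bsub>C\<^esub>" by (simp only:, intro z) (simp_all add: simps lin_mapsD(3)[OF r])
    qed
    then show "x \<in> {p \<in> carrier (pair_alg R A B). h p \<in> {\<zero>\<^bsub>C\<^esub>}}"
      using x tensor_rels_closed[OF assms(1,2)] by blast
  qed
  then have "tensor_kernel R A B \<subseteq> {p \<in> carrier (pair_alg R A B). h p \<in> {\<zero>\<^bsub>C\<^esub>}}"
    unfolding tensor_kernel_def
    by (rule submodule_span_minimal[OF submodule_vimage[OF P.module_axioms C.module_axioms assms(4)
            submodule_zero[OF C.module_axioms]]])
  then show ?thesis using assms(6) by blast
qed

lemma pure_tensor_bilinear:
  assumes "module R A" "module R B"
  shows "bilinear R A B (tensor R A B) (\<lambda>(a, b). pure_tensor R A B a b)"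
proof -
  interpret A: module R A by fact
  interpret B: module R B by fact
  interpret P: module R "pair_alg R A B" by (rule pair_alg_module)
  note lin = lin_mapsD[OF tensor_class_lin[OF assms]]
  have eq: "tensor_class R A B x = tensor_class R A B y"
    if "x \<ominus>\<^bsub>pair_alg R A B\<^esub> y \<in> tensor_rels R A B" "x \<in> carrier (pair_alg R A B)" "y \<in> carrier (pair_alg R A B)" for x y
  proof -
    have "x \<ominus>\<^bsub>pair_alg R A B\<^esub> y \<in> tensor_kernel R A B"
      using that(1) unfolding tensor_kernel_def by (rule subsetD[OF submodule_span_self])
    then show ?thesis
      using that(2,3) by (simp add: tensor_class_def coset_eq_iff[OF pair_alg_module tensor_kernel_submodule[OF assms]])
  qed
  show ?thesis
    unfolding bilinear_def prod.case pure_tensor_def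
  proof (intro conjI ballI lin_mapsI)
    fix a b a' assume *: "a \<in> carrier A" "b \<in> carrier B" "a' \<in> carrier A"
    have "tensor_class R A B (basis_elt R (a \<oplus>\<^bsub>A\<^esub> a', b)) =
      tensor_class R A B (basis_elt R (a, b) \<oplus>\<^bsub>pair_alg R A B\<^esub> basis_elt R (a', b))"
      by (rule eq, unfold tensor_rels_def, use * in blast) (use * in \<open>auto intro: pair_alg_basis\<close>)
    then show "tensor_class R A B (basis_elt R (a \<oplus>\<^bsub>A\<^esub> a', b)) =
      tensor_class R A B (basis_elt R (a, b)) \<oplus>\<^bsub>tensor R A B\<^esub> tensor_class R A B (basis_elt R (a', b))"
      using * by (simp add: lin pair_alg_basis)
  next
    fix a b b' assume *: "a \<in> carrier A" "b \<in> carrier B" "b' \<in> carrier B"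
    have "tensor_class R A B (basis_elt R (a, b \<oplus>\<^bsub>B\<^esub> b')) =
      tensor_class R A B (basis_elt R (a, b) \<oplus>\<^bsub>pair_alg R A B\<^esub> basis_elt R (a, b'))"
      by (rule eq, unfold tensor_rels_def, use * in blast) (use * in \<open>auto intro: pair_alg_basis\<close>)
    then show "tensor_class R A B (basis_elt R (a, b \<oplus>\<^bsub>B\<^esub> b')) =
      tensor_class R A B (basis_elt R (a, b)) \<oplus>\<^bsub>tensor R A B\<^esub> tensor_class R A B (basis_elt R (a, b'))"
      using * by (simp add: lin pair_alg_basis)
  next
    fix a b r assume *: "a \<in> carrier A" "b \<in> carrier B" "r \<in> carrier R"
    have "tensor_class R A B (basis_elt R (r \<odot>\<^bsub>A\<^esub> a, b)) =
      tensor_class R A B (r \<odot>\<^bsub>pair_alg R A B\<^esub> basis_elt R (a, b))"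
      by (rule eq, unfold tensor_rels_def, use * in blast) (use * in \<open>auto intro: pair_alg_basis\<close>)
    then show "tensor_class R A B (basis_elt R (r \<odot>\<^bsub>A\<^esub> a, b)) =
      r \<odot>\<^bsub>tensor R A B\<^esub> tensor_class R A B (basis_elt R (a, b))"
      using * by (simp add: lin pair_alg_basis)
    have "tensor_class R A B (basis_elt R (a, r \<odot>\<^bsub>B\<^esub> b)) =
      tensor_class R A B (r \<odot>\<^bsub>pair_alg R A B\<^esub> basis_elt R (a, b))"
      by (rule eq, unfold tensor_rels_def, use * in blast) (use * in \<open>auto intro: pair_alg_basis\<close>)
    then show "tensor_class R A B (basis_elt R (a, r \<odot>\<^bsub>B\<^esub> b)) =
      r \<odot>\<^bsub>tensor R A B\<^esub> tensor_class R A B (basis_elt R (a, b))"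
      using * by (simp add: lin pair_alg_basis)
  qed (simp_all add: lin pair_alg_basis)
qed

lemma pure_tensor_lin:
  assumes "module R A" "module R B"
  shows "b \<in> carrier B \<Longrightarrow> (\<lambda>a. pure_tensor R A B a b) \<in> lin_maps R A (tensor R A B)"
    and "a \<in> carrier A \<Longrightarrow> (\<lambda>b. pure_tensor R A B a b) \<in> lin_maps R B (tensor R A B)"
  using pure_tensor_bilinear[OF assms] by (auto simp: bilinear_def)

lemma pure_tensor_closed:
  assumes "module R A" "module R B" "a \<in> carrier A" "b \<in> carrier B"
  shows "pure_tensor R A B a b \<in> carrier (tensor R A B)"
  by (rule lin_mapsD(1)[OF pure_tensor_lin(1)[OF assms(1,2,4)] assms(3)])

lemma lin_ext_bilinear:
  assumes "module R A" "module R B" "module R C" "bilinear R A B C u"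
  shows "lin_ext R C u \<in> lin_maps R (pair_alg R A B) C"
    and "p \<in> tensor_kernel R A B \<Longrightarrow> lin_ext R C u p = \<zero>\<^bsub>C\<^esub>"
    and "a \<in> carrier A \<Longrightarrow> b \<in> carrier B \<Longrightarrow> lin_ext R C u (basis_elt R (a, b)) = u (a, b)"
proof -
  interpret A: module R A by fact
  interpret B: module R B by fact
  have u: "u k \<in> carrier C" if "k \<in> carrier A \<times> carrier B" for k
    using that assms(4) by (auto simp: bilinear_def dest: lin_mapsD(1))
  show lin: "lin_ext R C u \<in> lin_maps R (pair_alg R A B) C"
    unfolding pair_alg_def by (rule lin_ext_lin[OF assms(3)]) (use u in \<open>auto simp: DirProd_def\<close>)
  have b: "lin_ext R C u (basis_elt R (a, b)) = u (a, b)" if "a \<in> carrier A" "b \<in> carrier B" for a b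
    by (rule lin_ext_basis_elt[where u = u and k = "(a, b)", OF assms(3) u]) (use that in simp)
  then show "a \<in> carrier A \<Longrightarrow> b \<in> carrier B \<Longrightarrow> lin_ext R C u (basis_elt R (a, b)) = u (a, b)" .
  have "bilinear R A B C (\<lambda>k. lin_ext R C u (basis_elt R k))"
    unfolding bilinear_def
  proof (intro conjI ballI)
    fix y assume y: "y \<in> carrier B"
    then have "(\<lambda>a. u (a, y)) \<in> lin_maps R A C" using assms(4) by (simp add: bilinear_def)
    then show "(\<lambda>a. lin_ext R C u (basis_elt R (a, y))) \<in> lin_maps R A C"
      by (rule lin_maps_cong[OF assms(1)]) (rule b[OF _ y])
  next
    fix x assume x: "x \<in> carrier A"
    then have "(\<lambda>b. u (x, b)) \<in> lin_maps R B C" using assms(4) by (simp add: bilinear_def)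
    then show "(\<lambda>b. lin_ext R C u (basis_elt R (x, b))) \<in> lin_maps R B C"
      by (rule lin_maps_cong[OF assms(2)]) (rule b[OF x])
  qed
  then show "p \<in> tensor_kernel R A B \<Longrightarrow> lin_ext R C u p = \<zero>\<^bsub>C\<^esub>"
    by (rule bilinear_basis_kernel[OF assms(1-3) lin])
qed

lemma tensor_lift_class:
  assumes "module R A" "module R B" "module R C" "bilinear R A B C u" "p \<in> carrier (pair_alg R A B)"
  shows "tensor_lift R C u (tensor_class R A B p) = lin_ext R C u p"
  unfolding tensor_lift_def tensor_class_def
  by (rule the_elem_coset[OF pair_alg_module assms(3) tensor_kernel_submodule[OF assms(1,2)]
        lin_ext_bilinear(1,2)[OF assms(1-4)] assms(5)])

lemma tensor_lift_lin:
  assumes "module R A" "module R B" "module R C" "bilinear R A B C u"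
  shows "tensor_lift R C u \<in> lin_maps R (tensor R A B) C"
  unfolding tensor_def
  by (rule quot_lin[OF pair_alg_module tensor_kernel_submodule[OF assms(1,2)] lin_ext_bilinear(1)[OF assms]])
    (rule tensor_lift_class[OF assms, unfolded tensor_class_def])

lemma tensor_lift_pure:
  assumes "module R A" "module R B" "module R C" "bilinear R A B C u" "a \<in> carrier A" "b \<in> carrier B"
  shows "tensor_lift R C u (pure_tensor R A B a b) = u (a, b)"
  unfolding pure_tensor_def
  using assms by (subst tensor_lift_class[OF assms(1-4)]) (auto simp: pair_alg_basis lin_ext_bilinear(3))

text \<open>Pure tensors are the classes of basis elements and therefore generate; this replaces
  induction over sums of pure tensors.\<close>

lemma tensor_mem:
  assumes "module R A" "module R B" "module R C" "h \<in> lin_maps R (tensor R A B) C" "submodule J R C"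
    "\<And>a b. a \<in> carrier A \<Longrightarrow> b \<in> carrier B \<Longrightarrow> h (pure_tensor R A B a b) \<in> J"
    "x \<in> carrier (tensor R A B)"
  shows "h x \<in> J"
proof -
  obtain p where p: "p \<in> carrier (pair_alg R A B)" "x = tensor_class R A B p"
    using assms(7) by (auto simp: tensor_carrier)
  have "h (tensor_class R A B p) \<in> J"
    by (rule lin_maps_monoid_alg_mem[where K = "carrier A \<times> carrier B" and G = "A \<times>\<times> B",
          OF assms(3) lin_maps_comp[OF tensor_class_lin[OF assms(1,2), unfolded pair_alg_def] assms(4)] assms(5)])
      (use p(1) assms(6) in \<open>auto simp: DirProd_def pair_alg_carrier pure_tensor_def\<close>)
  then show ?thesis by (simp add: p)
qed

lemma tensor_eq:
  assumes "module R A" "module R B" "module R C" "h \<in> lin_maps R (tensor R A B) C"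
    "h' \<in> lin_maps R (tensor R A B) C"
    "\<And>a b. a \<in> carrier A \<Longrightarrow> b \<in> carrier B \<Longrightarrow> h (pure_tensor R A B a b) = h' (pure_tensor R A B a b)"
    "x \<in> carrier (tensor R A B)"
  shows "h x = h' x"
proof -
  obtain p where p: "p \<in> carrier (pair_alg R A B)" "x = tensor_class R A B p"
    using assms(7) by (auto simp: tensor_carrier)
  note cl = tensor_class_lin[OF assms(1,2), unfolded pair_alg_def]
  have "h (tensor_class R A B p) = h' (tensor_class R A B p)"
    by (rule lin_maps_monoid_alg_eq[where K = "carrier A \<times> carrier B" and G = "A \<times>\<times> B",
          OF assms(3) lin_maps_comp[OF cl assms(4)] lin_maps_comp[OF cl assms(5)]])
      (use p(1) assms(6) in \<open>auto simp: DirProd_def pair_alg_carrier pure_tensor_def\<close>)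
  then show ?thesis by (simp add: p)
qed

text \<open>\<open>tensor_map\<close> is a union over all representatives. The relations are sent to
  zero because pure tensors in the target are bilinear, so all representatives give the same
  coset.\<close>

lemma tensor_map_class:
  assumes "module R A" "module R B" "module R A'" "module R B'"
    "f \<in> lin_maps R A A'" "g \<in> lin_maps R B B'"
  shows "p \<in> carrier (pair_alg R A B) \<Longrightarrow>
      tensor_map R A' B' f g (tensor_class R A B p) = tensor_class R A' B' (push R (map_prod f g) p)"
    and "tensor_map R A' B' f g \<in> lin_maps R (tensor R A B) (tensor R A' B')"
    and "a \<in> carrier A \<Longrightarrow> b \<in> carrier B \<Longrightarrow>
      tensor_map R A' B' f g (pure_tensor R A B a b) = pure_tensor R A' B' (f a) (g b)"
proof -
  interpret P: module R "pair_alg R A B" by (rule pair_alg_module)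
  interpret K: abelian_subgroup "tensor_kernel R A B" "pair_alg R A B"
    by (rule submodule_abelian_subgroup[OF pair_alg_module tensor_kernel_submodule[OF assms(1,2)]])
  let ?h = "\<lambda>p. tensor_class R A' B' (push R (map_prod f g) p)"
  have "push R (map_prod f g) \<in> lin_maps R (pair_alg R A B) (pair_alg R A' B')"
    unfolding pair_alg_def
    by (rule push_lin) (use lin_mapsD(1)[OF assms(5)] lin_mapsD(1)[OF assms(6)] in \<open>auto simp: DirProd_def\<close>)
  then have lin: "?h \<in> lin_maps R (pair_alg R A B) (tensor R A' B')"
    by (rule lin_maps_comp[OF _ tensor_class_lin[OF assms(3,4)]])
  have bas: "?h (basis_elt R (a, b)) = pure_tensor R A' B' (f a) (g b)" for a b
    by (simp add: push_basis_elt pure_tensor_def)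
  have "bilinear R A B (tensor R A' B') (\<lambda>k. ?h (basis_elt R k))"
    unfolding bilinear_def bas
    using lin_maps_comp[OF assms(5) pure_tensor_lin(1)[OF assms(3,4)]] lin_mapsD(1)[OF assms(6)]
      lin_maps_comp[OF assms(6) pure_tensor_lin(2)[OF assms(3,4)]] lin_mapsD(1)[OF assms(5)] by blast
  note ker = bilinear_basis_kernel[OF assms(1,2) tensor_module[OF assms(3,4)] lin this]
  have eq: "?h q = ?h p" if p: "p \<in> carrier (pair_alg R A B)" and q: "q \<in> tensor_class R A B p" for p q
  proof -
    interpret T: module R "tensor R A' B'" by (rule tensor_module[OF assms(3,4)])
    obtain k where k: "k \<in> tensor_kernel R A B" "q = k \<oplus>\<^bsub>pair_alg R A B\<^esub> p"
      using q by (auto simp: tensor_class_def a_r_coset_def')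
    then show ?thesis using ker[OF k(1)] p K.a_Hcarr[OF k(1)] by (simp add: lin_mapsD[OF lin])
  qed
  have self: "p \<in> tensor_class R A B p" if "p \<in> carrier (pair_alg R A B)" for p
    using K.a_rcos_self[OF that] by (simp add: tensor_class_def)
  have cl: "tensor_map R A' B' f g (tensor_class R A B p) = ?h p" if "p \<in> carrier (pair_alg R A B)" for p
    unfolding tensor_map_def using eq[OF that] self[OF that] by blast
  then show "p \<in> carrier (pair_alg R A B) \<Longrightarrow> tensor_map R A' B' f g (tensor_class R A B p) = ?h p" .
  show "tensor_map R A' B' f g \<in> lin_maps R (tensor R A B) (tensor R A' B')"
    unfolding tensor_def[of R A B]
    by (rule quot_lin[OF pair_alg_module tensor_kernel_submodule[OF assms(1,2)] lin])
      (rule cl[unfolded tensor_class_def[of R A B]])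
  show "a \<in> carrier A \<Longrightarrow> b \<in> carrier B \<Longrightarrow>
      tensor_map R A' B' f g (pure_tensor R A B a b) = pure_tensor R A' B' (f a) (g b)"
    by (simp add: pure_tensor_def[of R A B] cl pair_alg_basis bas)
qed

end

section \<open>Restriction of scalars and base change\<close>

text \<open>Through this the R-linear results on tensor products and polynomial algebras can take
  \<open>S\<close>-modules and \<open>S\<close>-algebras as targets.\<close>

definition restrict_scalars :: "('a, 's, 'x) module_scheme \<Rightarrow> ('s, 'm) module \<Rightarrow> ('a, 'm) module"
  where "restrict_scalars S A = ring.extend (ring.truncate A)
    \<lparr>smult = (\<lambda>r x. (r \<odot>\<^bsub>S\<^esub> \<one>\<^bsub>S\<^esub>) \<odot>\<^bsub>A\<^esub> x)\<rparr>"

lemma restrict_scalars_simps [simp]: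
  "carrier (restrict_scalars S A) = carrier A" "\<zero>\<^bsub>restrict_scalars S A\<^esub> = \<zero>\<^bsub>A\<^esub>"
  "\<one>\<^bsub>restrict_scalars S A\<^esub> = \<one>\<^bsub>A\<^esub>"
  "add (restrict_scalars S A) = add A" "monoid.mult (restrict_scalars S A) = monoid.mult A"
  "r \<odot>\<^bsub>restrict_scalars S A\<^esub> x = (r \<odot>\<^bsub>S\<^esub> \<one>\<^bsub>S\<^esub>) \<odot>\<^bsub>A\<^esub> x"
  by (simp_all add: restrict_scalars_def ring.defs)

lemma base_change_simps:
  "carrier (base_change R S M) = carrier (tensor R S M)" "\<zero>\<^bsub>base_change R S M\<^esub> = \<zero>\<^bsub>tensor R S M\<^esub>"
  "\<one>\<^bsub>base_change R S M\<^esub> = \<one>\<^bsub>tensor R S M\<^esub>"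
  "add (base_change R S M) = add (tensor R S M)"
  "monoid.mult (base_change R S M) = monoid.mult (tensor R S M)"
  "s \<odot>\<^bsub>base_change R S M\<^esub> x = tensor_map R S M (\<lambda>t. s \<otimes>\<^bsub>S\<^esub> t) id x"
  by (simp_all add: base_change_def ring.defs)

context algebra
begin

lemma restrict_scalars_module:
  assumes "module M A"
  shows "module R (restrict_scalars M A)"
proof -
  interpret A: module M A by fact
  show ?thesis
  proof (rule moduleI)
    show "abelian_group (restrict_scalars M A)"
      by (rule abelian_group_cong[OF A.M.abelian_group_axioms]) simp_all
    fix a b x assume "a \<in> carrier R" "b \<in> carrier R" "x \<in> carrier (restrict_scalars M A)"
    moreover from this have "(a \<otimes> b) \<odot>\<^bsub>M\<^esub> \<one>\<^bsub>M\<^esub> = (a \<odot>\<^bsub>M\<^esub> \<one>\<^bsub>M\<^esub>) \<otimes>\<^bsub>M\<^esub> (b \<odot>\<^bsub>M\<^esub> \<one>\<^bsub>M\<^esub>)"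
      by (simp add: smult_assoc1 smult_assoc2)
    ultimately show "(a \<otimes> b) \<odot>\<^bsub>restrict_scalars M A\<^esub> x =
        a \<odot>\<^bsub>restrict_scalars M A\<^esub> (b \<odot>\<^bsub>restrict_scalars M A\<^esub> x)"
      by (simp add: A.smult_assoc1)
  qed (auto simp: R_cring smult_l_distr A.smult_l_distr A.smult_r_distr)
qed

lemma restrict_scalars_algebra:
  assumes "algebra M A"
  shows "algebra R (restrict_scalars M A)"
proof -
  interpret A: algebra M A by fact
  interpret B: module R "restrict_scalars M A" by (rule restrict_scalars_module[OF A.module])
  have "cring (restrict_scalars M A)" by (rule cring_cong[OF A.M_cring]) simp_all
  then show ?thesis
    by (intro algebra.intro B.module_axioms algebra_axioms.intro) (auto simp: A.smult_assoc2)
qed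

lemma restrict_scalars_lin: "h \<in> lin_maps M A B \<Longrightarrow> h \<in> lin_maps R (restrict_scalars M A) (restrict_scalars M B)"
  by (rule lin_mapsI) (auto simp: lin_mapsD)

lemma restrict_scalars_alg_hom:
  "h \<in> alg_hom M A B \<Longrightarrow> h \<in> alg_hom R (restrict_scalars M A) (restrict_scalars M B)"
  by (rule alg_homI) (auto simp: alg_homD restrict_scalars_lin)

end

section \<open>Noetherian rings and flatness\<close>

lemma (in abelian_monoid) finsum_finsum_swap:
  assumes "finite A" "finite B" "\<And>i j. i \<in> A \<Longrightarrow> j \<in> B \<Longrightarrow> u i j \<in> carrier G"
  shows "(\<Oplus>i\<in>A. \<Oplus>j\<in>B. u i j) = (\<Oplus>j\<in>B. \<Oplus>i\<in>A. u i j)"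
  using assms
proof (induction A rule: finite_induct)
  case empty
  then show ?case by (simp add: finsum_zero)
next
  case (insert x A)
  have c: "(\<Oplus>i\<in>A. u i j) \<in> carrier G" if "j \<in> B" for j
    using insert that by (intro finsum_closed) auto
  have "(\<Oplus>i\<in>insert x A. \<Oplus>j\<in>B. u i j) = (\<Oplus>j\<in>B. u x j) \<oplus> (\<Oplus>i\<in>A. \<Oplus>j\<in>B. u i j)"
    using insert by (intro finsum_insert) (auto intro!: finsum_closed)
  also have "\<dots> = (\<Oplus>j\<in>B. u x j) \<oplus> (\<Oplus>j\<in>B. \<Oplus>i\<in>A. u i j)"
    using insert by simp
  also have "\<dots> = (\<Oplus>j\<in>B. u x j \<oplus> (\<Oplus>i\<in>A. u i j))"
    using insert c by (intro finsum_addf[symmetric]) auto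
  also have "\<dots> = (\<Oplus>j\<in>B. \<Oplus>i\<in>insert x A. u i j)"
    using insert c by (intro finsum_cong') (auto intro!: finsum_insert[symmetric] finsum_closed)
  finally show ?case .
qed

lemma (in abelian_group) minus_eq_zeroD:
  assumes "x \<ominus> y = \<zero>" "x \<in> carrier G" "y \<in> carrier G"
  shows "x = y"
proof -
  have "x = (x \<ominus> y) \<oplus> y" using assms(2,3) by (simp add: minus_eq a_assoc l_neg)
  then show ?thesis using assms by simp
qed

lemma span_finite_lincomb:
  fixes k :: nat
  assumes "module R M" "\<And>u. u < k \<Longrightarrow> w u \<in> carrier M" "x \<in> submodule_span R M (w ` {..<k})"
  shows "\<exists>c. (\<forall>u<k. c u \<in> carrier R) \<and> x = (\<Oplus>\<^bsub>M\<^esub>u\<in>{..<k}. c u \<odot>\<^bsub>M\<^esub> w u)"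
proof -
  interpret M: module R M by fact
  let ?H = "{x. \<exists>c. (\<forall>u<k. c u \<in> carrier R) \<and> x = (\<Oplus>\<^bsub>M\<^esub>u\<in>{..<k}. c u \<odot>\<^bsub>M\<^esub> w u)}"
  have "submodule ?H R M"
  proof (rule M.submoduleI')
    show "?H \<subseteq> carrier M" using assms(2) by (auto intro!: M.M.finsum_closed)
    have "\<zero>\<^bsub>M\<^esub> = (\<Oplus>\<^bsub>M\<^esub>u\<in>{..<k}. \<zero>\<^bsub>R\<^esub> \<odot>\<^bsub>M\<^esub> w u)"
      using assms(2) by (intro M.M.add.finprod_one_eqI[symmetric]) auto
    then show "\<zero>\<^bsub>M\<^esub> \<in> ?H" by (intro CollectI exI[of _ "\<lambda>u. \<zero>\<^bsub>R\<^esub>"]) auto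
  next
    fix a b assume "a \<in> ?H" "b \<in> ?H"
    then obtain c d where c: "\<And>u. u < k \<Longrightarrow> c u \<in> carrier R" "a = (\<Oplus>\<^bsub>M\<^esub>u\<in>{..<k}. c u \<odot>\<^bsub>M\<^esub> w u)"
      and d: "\<And>u. u < k \<Longrightarrow> d u \<in> carrier R" "b = (\<Oplus>\<^bsub>M\<^esub>u\<in>{..<k}. d u \<odot>\<^bsub>M\<^esub> w u)" by blast
    have "a \<oplus>\<^bsub>M\<^esub> b = (\<Oplus>\<^bsub>M\<^esub>u\<in>{..<k}. c u \<odot>\<^bsub>M\<^esub> w u \<oplus>\<^bsub>M\<^esub> d u \<odot>\<^bsub>M\<^esub> w u)"
      unfolding c(2) d(2) using c(1) d(1) assms(2) by (intro M.M.finsum_addf[symmetric]) auto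
    also have "\<dots> = (\<Oplus>\<^bsub>M\<^esub>u\<in>{..<k}. (c u \<oplus>\<^bsub>R\<^esub> d u) \<odot>\<^bsub>M\<^esub> w u)"
      using c(1) d(1) assms(2) by (intro M.M.finsum_cong') (auto simp: M.smult_l_distr)
    finally show "a \<oplus>\<^bsub>M\<^esub> b \<in> ?H"
      using c(1) d(1) by (intro CollectI exI[of _ "\<lambda>u. c u \<oplus>\<^bsub>R\<^esub> d u"]) auto
  next
    fix r a assume r: "r \<in> carrier R" and "a \<in> ?H"
    then obtain c where c: "\<And>u. u < k \<Longrightarrow> c u \<in> carrier R" "a = (\<Oplus>\<^bsub>M\<^esub>u\<in>{..<k}. c u \<odot>\<^bsub>M\<^esub> w u)" by blast
    have "r \<odot>\<^bsub>M\<^esub> a = (\<Oplus>\<^bsub>M\<^esub>u\<in>{..<k}. r \<odot>\<^bsub>M\<^esub> (c u \<odot>\<^bsub>M\<^esub> w u))"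
      unfolding c(2) using c(1) assms(2) r by (intro M.finsum_smult_ldistr) auto
    also have "\<dots> = (\<Oplus>\<^bsub>M\<^esub>u\<in>{..<k}. (r \<otimes>\<^bsub>R\<^esub> c u) \<odot>\<^bsub>M\<^esub> w u)"
      using c(1) r assms(2) by (intro M.M.finsum_cong') (auto simp: M.smult_assoc1)
    finally show "r \<odot>\<^bsub>M\<^esub> a \<in> ?H"
      using c(1) r by (intro CollectI exI[of _ "\<lambda>u. r \<otimes>\<^bsub>R\<^esub> c u"]) auto
  qed
  moreover have "w ` {..<k} \<subseteq> ?H"
  proof (rule image_subsetI)
    fix j assume j: "j \<in> {..<k}"
    have "(\<Oplus>\<^bsub>M\<^esub>u\<in>{..<k}. (if j = u then \<one>\<^bsub>R\<^esub> else \<zero>\<^bsub>R\<^esub>) \<odot>\<^bsub>M\<^esub> w u) =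
        (\<Oplus>\<^bsub>M\<^esub>u\<in>{..<k}. if j = u then w u else \<zero>\<^bsub>M\<^esub>)"
      using assms(2) by (intro M.M.finsum_cong') auto
    also have "\<dots> = w j" using j assms(2) by (intro M.M.finsum_singleton) auto
    finally show "w j \<in> ?H"
      by (intro CollectI exI[of _ "\<lambda>u. if j = u then \<one>\<^bsub>R\<^esub> else \<zero>\<^bsub>R\<^esub>"]) auto
  qed
  ultimately have "submodule_span R M (w ` {..<k}) \<subseteq> ?H" by (rule submodule_span_minimal)
  with assms(3) show ?thesis by auto
qed

context cring
begin

lemma std_free_coord: "(\<lambda>v. v i) \<in> lin_maps R (std_free n) (self_module R)"
  by (rule lin_mapsI) (auto simp: std_free_simps std_free_carrier fin_funsD)

text \<open>Induction on the rank. The last coordinates of elements of \<open>H\<close> form an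
  ideal, which is finitely generated; lift its generators to a finite \<open>L\<close> in
  \<open>H\<close>. The elements of \<open>H\<close> with last coordinate zero form a submodule of
  R^n, generated by a finite \<open>B\<close> by induction. Any element of \<open>H\<close> differs
  from one in the span of \<open>L\<close> and \<open>B\<close> by an element with last coordinate
  zero.\<close>

lemma noetherian_submodule_fg:
  assumes "noetherian_ring R" "submodule H R (std_free n)"
  shows "\<exists>A. finite A \<and> A \<subseteq> H \<and> H \<subseteq> submodule_span R (std_free n) A"
  using assms(2)
proof (induction n arbitrary: H)
  case 0
  have "fin_funs R {..<0::nat} = {\<lambda>k. \<zero>}"
    by (auto simp: fin_funs_def supp_def)
  then have "H \<subseteq> {\<zero>\<^bsub>std_free 0\<^esub>}"
    using submoduleD(1)[OF std_free_module 0] by (simp add: std_free_carrier std_free_simps)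
  then show ?case
    using submoduleD(2)[OF std_free_module submodule_submodule_span[OF std_free_module[of 0] empty_subsetI]]
    by (intro exI[of _ "{}"]) auto
next
  case (Suc n)
  let ?F = "std_free (Suc n)"
  \<comment> \<open>R^n sits in R^(n+1) with the same operations, as the functions that vanish at
    the index \<open>n\<close>; only the carriers differ.\<close>
  have sub: "carrier (std_free n) \<subseteq> carrier ?F"
    by (auto simp: std_free_carrier intro: fin_funs_mono)
  have ops: "add (std_free n) = add ?F" "smult (std_free n) = smult ?F" "\<zero>\<^bsub>std_free n\<^esub> = \<zero>\<^bsub>?F\<^esub>"
    by (auto simp: fun_eq_iff std_free_simps)
  interpret F: module R ?F by (rule std_free_module)
  interpret E: module R "std_free n" by (rule std_free_module)
  note H = submoduleD[OF std_free_module Suc.prems]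
  \<comment> \<open>Stated for every submodule, because it is used both for \<open>H\<close> and for
    the span of \<open>L \<union> B\<close>.\<close>
  have ideal: "ideal ((\<lambda>x. x n) ` J) R" if J: "submodule J R ?F" for J
  proof -
    have "submodule ((\<lambda>x. x n) ` J) R (self_module R)"
      by (rule submodule_image[OF std_free_module self_module_module std_free_coord J])
    note J' = submoduleD[OF self_module_module this, simplified]
    show ?thesis
    proof (rule idealI)
      show "subgroup ((\<lambda>x. x n) ` J) (add_monoid R)"
      proof (rule add.subgroupI)
        show "(\<lambda>x. x n) ` J \<noteq> {}" using J'(2) by blast
        fix a assume a: "a \<in> (\<lambda>x. x n) ` J"
        then have "(\<ominus> \<one>) \<otimes> a \<in> (\<lambda>x. x n) ` J" by (intro J'(4)) auto
        moreover have "a \<in> carrier R" using a J'(1) by blast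
        ultimately show "\<ominus> a \<in> (\<lambda>x. x n) ` J" by (simp add: l_minus)
      qed (use J'(1,3) in auto)
      fix a x assume "a \<in> (\<lambda>x. x n) ` J" "x \<in> carrier R"
      then show "x \<otimes> a \<in> (\<lambda>x. x n) ` J" "a \<otimes> x \<in> (\<lambda>x. x n) ` J"
        using J'(1,4) m_comm by (metis subsetD)+
    qed (rule ring_axioms)
  qed
  obtain A0 where A0: "A0 \<subseteq> carrier R" "finite A0" "(\<lambda>x. x n) ` H = Idl A0"
    using noetherian_ring.finetely_gen[OF assms(1) ideal[OF Suc.prems]] by auto
  have "A0 \<subseteq> (\<lambda>x. x n) ` H" using genideal_self[OF A0(1)] A0(3) by simp
  then obtain L where L: "L \<subseteq> H" "finite L" "A0 = (\<lambda>x. x n) ` L"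
    using finite_subset_image[OF A0(2)] by metis
  let ?H0 = "{x \<in> H. x n = \<zero>}"
  have H0c: "?H0 \<subseteq> carrier (std_free n)"
  proof
    fix x assume x: "x \<in> ?H0"
    then have xf: "x \<in> fin_funs R {..<Suc n}" using H(1) by (auto simp: std_free_carrier)
    have "supp R x \<subseteq> {..<n}"
      using fin_funsD(3)[OF xf] x by (auto simp: supp_def less_Suc_eq)
    then show "x \<in> carrier (std_free n)" using fin_funs_supp[OF xf] by (simp add: std_free_carrier)
  qed
  have "submodule ?H0 R (std_free n)"
    by (rule E.submoduleI'[OF H0c]) (use H in \<open>auto simp: ops\<close>, auto simp: std_free_simps)
  from Suc.IH[OF this] obtain B where B: "finite B" "B \<subseteq> ?H0" "?H0 \<subseteq> submodule_span R (std_free n) B"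
    by blast
  have LB: "L \<union> B \<subseteq> H" using L B by auto
  have LBc: "L \<union> B \<subseteq> carrier ?F" using LB H(1) by auto
  let ?J = "submodule_span R ?F (L \<union> B)"
  have J: "submodule ?J R ?F" by (rule submodule_submodule_span[OF std_free_module LBc])
  note J' = submoduleD[OF std_free_module J]
  have JH: "?J \<subseteq> H" by (rule submodule_span_minimal[OF Suc.prems LB])
  have "submodule (?J \<inter> carrier (std_free n)) R (std_free n)"
    using J'(2-4) E.M.zero_closed E.M.a_closed E.smult_closed
    by (intro E.submoduleI') (auto simp: ops)
  moreover have "B \<subseteq> ?J \<inter> carrier (std_free n)"
    using B(2) H0c submodule_span_self[of "L \<union> B" R ?F] by blast
  ultimately have "submodule_span R (std_free n) B \<subseteq> ?J"
    using submodule_span_minimal by blast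
  then have H0J: "?H0 \<subseteq> ?J" using B(3) by blast
  have "Idl A0 \<subseteq> (\<lambda>x. x n) ` ?J"
    by (rule genideal_minimal[OF ideal[OF J]])
      (use L(3) submodule_span_self[of "L \<union> B" R ?F] in blast)
  have "x \<in> ?J" if x: "x \<in> H" for x
  proof -
    have "x n \<in> Idl A0" using x A0(3) by blast
    then obtain y where y: "y \<in> ?J" "x n = y n" using \<open>Idl A0 \<subseteq> _\<close> by blast
    have xc: "x \<in> carrier ?F" and yc: "y \<in> carrier ?F" using x y JH H(1) by auto
    have "(\<lambda>z. z n) (x \<ominus>\<^bsub>?F\<^esub> y) = x n \<ominus>\<^bsub>self_module R\<^esub> y n"
      by (rule lin_maps_minus[OF std_free_module self_module_module std_free_coord xc yc])
    also have "\<dots> = \<zero>"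
    proof -
      interpret S: module R "self_module R" by (rule self_module_module)
      have "y n \<in> carrier (self_module R)" using lin_mapsD(1)[OF std_free_coord yc] .
      then show ?thesis unfolding y(2) by (simp add: S.M.minus_eq S.M.r_neg del: self_module_simps(1,3))
    qed
    finally have "x \<ominus>\<^bsub>?F\<^esub> y \<in> ?J" using H0J H(6) x y JH by blast
    then have "(x \<ominus>\<^bsub>?F\<^esub> y) \<oplus>\<^bsub>?F\<^esub> y \<in> ?J" using y(1) by (rule J'(3))
    then show ?thesis using xc yc by (simp add: F.M.minus_eq F.M.a_assoc F.M.l_neg)
  qed
  then show ?case using LB L(2) B(1) by (intro exI[of _ "L \<union> B"]) auto
qed

lemma noetherian_submodule_generators:
  assumes "noetherian_ring R" "submodule H R (std_free n)"
  obtains k :: nat and w where "\<And>u. u < k \<Longrightarrow> w u \<in> H"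
    "\<And>x. x \<in> H \<Longrightarrow> \<exists>c. (\<forall>u<k. c u \<in> carrier R) \<and> (\<forall>i. x i = (\<Oplus>u\<in>{..<k}. c u \<otimes> w u i))"
proof -
  obtain A where A: "finite A" "A \<subseteq> H" "H \<subseteq> submodule_span R (std_free n) A"
    using noetherian_submodule_fg[OF assms] by blast
  obtain k :: nat and w where w: "A = w ` {..<k}"
    using A(1) by (auto simp: finite_conv_nat_seg_image lessThan_def)
  have wH: "w u \<in> H" if "u < k" for u using A(2) w that by auto
  then have wc: "w u \<in> carrier (std_free n)" if "u < k" for u
    using submoduleD(1)[OF std_free_module assms(2)] that by blast
  interpret F: module R "std_free n" by (rule std_free_module)
  show ?thesis
  proof (rule that[OF wH])
    fix x assume "x \<in> H"
    then obtain c where c: "\<And>u. u < k \<Longrightarrow> c u \<in> carrier R"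
      "x = (\<Oplus>\<^bsub>std_free n\<^esub>u\<in>{..<k}. c u \<odot>\<^bsub>std_free n\<^esub> w u)"
      using span_finite_lincomb[where w = w and k = k and x = x, OF std_free_module wc] A(3) w by blast
    have "x i = (\<Oplus>u\<in>{..<k}. (c u \<odot>\<^bsub>std_free n\<^esub> w u) i)" for i
      unfolding c(2) by (rule std_free_finsum) (use c(1) wc in auto)
    then show "\<exists>c. (\<forall>u<k. c u \<in> carrier R) \<and> (\<forall>i. x i = (\<Oplus>u\<in>{..<k}. c u \<otimes> w u i))"
      using c(1) by (intro exI[of _ c]) (simp add: std_free_simps)
  qed
qed

section \<open>The equational criterion of flatness\<close>

lemma std_free_expand:
  assumes "y \<in> carrier (std_free l)"
  shows "y = (\<Oplus>\<^bsub>std_free l\<^esub>j\<in>{..<l}. y j \<odot>\<^bsub>std_free l\<^esub> basis_elt R j)"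
proof
  interpret F: module R "std_free l" by (rule std_free_module)
  have y: "y \<in> fin_funs R {..<l}" using assms by (simp add: std_free_carrier)
  have b: "basis_elt R j \<in> carrier (std_free l)" if "j < l" for j
    using that by (simp add: std_free_carrier basis_elt_closed)
  fix i
  have "(\<Oplus>\<^bsub>std_free l\<^esub>j\<in>{..<l}. y j \<odot>\<^bsub>std_free l\<^esub> basis_elt R j) i =
      (\<Oplus>j\<in>{..<l}. (y j \<odot>\<^bsub>std_free l\<^esub> basis_elt R j) i)"
    by (rule std_free_finsum) (use b fin_funsD(1)[OF y] in auto)
  also have "\<dots> = (\<Oplus>j\<in>{..<l}. if j = i then y j else \<zero>)"
    using fin_funsD(1)[OF y] by (intro finsum_cong') (auto simp: std_free_simps basis_elt_def)
  also have "\<dots> = y i"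
  proof (cases "i < l")
    case True
    then show ?thesis using fin_funsD(1)[OF y] by (intro add.finprod_singleton_swap) auto
  next
    case False
    then show ?thesis using fin_funs_outside[OF y] by (auto intro!: add.finprod_one_eqI)
  qed
  finally show "y i = (\<Oplus>\<^bsub>std_free l\<^esub>j\<in>{..<l}. y j \<odot>\<^bsub>std_free l\<^esub> basis_elt R j) i" by simp
qed

text \<open>Arbitrary sequences in \<open>Q\<close> stand in for n-tuples: conditions are imposed on
  the indices below \<open>n\<close> only, so no support has to be tracked.\<close>

definition seq_module :: "('a, 'q, 'x) module_scheme \<Rightarrow> ('a, nat \<Rightarrow> 'q) module"
  where "seq_module Q = \<lparr>carrier = {z. \<forall>i. z i \<in> carrier Q}, monoid.mult = undefined, one = undefined,
    ring.zero = (\<lambda>i. \<zero>\<^bsub>Q\<^esub>), add = (\<lambda>y z i. y i \<oplus>\<^bsub>Q\<^esub> z i), smult = (\<lambda>r z i. r \<odot>\<^bsub>Q\<^esub> z i)\<rparr>"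

lemma seq_module_simps:
  "carrier (seq_module Q) = {z. \<forall>i. z i \<in> carrier Q}" "\<zero>\<^bsub>seq_module Q\<^esub> = (\<lambda>i. \<zero>\<^bsub>Q\<^esub>)"
  "y \<oplus>\<^bsub>seq_module Q\<^esub> z = (\<lambda>i. y i \<oplus>\<^bsub>Q\<^esub> z i)" "r \<odot>\<^bsub>seq_module Q\<^esub> z = (\<lambda>i. r \<odot>\<^bsub>Q\<^esub> z i)"
  by (simp_all add: seq_module_def)

lemma seq_module_module:
  assumes "module R Q"
  shows "module R (seq_module Q)"
proof -
  interpret Q: module R Q by fact
  show ?thesis
  proof (rule moduleI)
    show "abelian_group (seq_module Q)"
    proof (rule abelian_groupI)
      fix x assume "x \<in> carrier (seq_module Q)"
      then show "\<exists>y\<in>carrier (seq_module Q). y \<oplus>\<^bsub>seq_module Q\<^esub> x = \<zero>\<^bsub>seq_module Q\<^esub>"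
        by (intro bexI[of _ "\<lambda>i. \<ominus>\<^bsub>Q\<^esub> x i"]) (auto simp: seq_module_simps Q.M.l_neg)
    qed (auto simp: seq_module_simps Q.M.a_ac)
  qed (auto simp: seq_module_simps Q.smult_l_distr Q.smult_r_distr Q.smult_assoc1 is_cring)
qed

lemma seq_module_coord: "(\<lambda>z. z i) \<in> lin_maps R (seq_module Q) Q"
  by (rule lin_mapsI) (auto simp: seq_module_simps)

text \<open>The equational criterion of flatness, obtained from the inclusion into \<open>R\<^sup>l\<close> of the image of
  the matrix \<open>a\<close>.\<close>

lemma flat_solutions:
  fixes Q :: "('a, 'q) module" and k l n :: nat
  assumes flat: "flat_module R Q"
    and a: "\<And>j i. j < l \<Longrightarrow> i < n \<Longrightarrow> a j i \<in> carrier R"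
    and v: "\<And>i. i < n \<Longrightarrow> v i \<in> carrier Q"
    and sol: "\<And>j. j < l \<Longrightarrow> (\<Oplus>\<^bsub>Q\<^esub>i\<in>{..<n}. a j i \<odot>\<^bsub>Q\<^esub> v i) = \<zero>\<^bsub>Q\<^esub>"
    and w: "\<And>u i. u < k \<Longrightarrow> w u i \<in> carrier R"
    and gen: "\<And>x. x \<in> carrier (std_free n) \<Longrightarrow> (\<And>j. j < l \<Longrightarrow> (\<Oplus>i\<in>{..<n}. a j i \<otimes> x i) = \<zero>) \<Longrightarrow>
      \<exists>c. (\<forall>u<k. c u \<in> carrier R) \<and> (\<forall>i. x i = (\<Oplus>u\<in>{..<k}. c u \<otimes> w u i))"
  shows "\<exists>d. (\<forall>u. d u \<in> carrier Q) \<and> (\<forall>i<n. v i = (\<Oplus>\<^bsub>Q\<^esub>u\<in>{..<k}. w u i \<odot>\<^bsub>Q\<^esub> d u))"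
proof -
  have mQ: "module R Q" using flat by (simp add: flat_module_def)
  interpret Q: module R Q by (rule mQ)
  interpret F: module R "std_free n" by (rule std_free_module)
  interpret L: module R "std_free l" by (rule std_free_module)
  have mS: "module R (seq_module Q)" by (rule seq_module_module[OF mQ])
  interpret S: module R "seq_module Q" by (rule mS)
  \<comment> \<open>The map R^n to R^l with matrix \<open>a\<close>; by \<open>gen\<close> its
    kernel lies in the span of the vectors w_u.\<close>
  define A where "A x = (\<lambda>j. if j < l then \<Oplus>i\<in>{..<n}. a j i \<otimes> x i else \<zero>)" for x
  have xc: "x i \<in> carrier R" if "x \<in> carrier (std_free n)" for x i
    using lin_mapsD(1)[OF std_free_coord that] by simp
  have Aj': "(\<lambda>x. \<Oplus>\<^bsub>self_module R\<^esub>i\<in>{..<n}. x i \<odot>\<^bsub>self_module R\<^esub> a j i) \<in> lin_maps R (std_free n) (self_module R)" if "j < l" for j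
    using a that
    by (intro lin_maps_sum lin_maps_smult_const std_free_module self_module_module std_free_coord) auto
  have Aj: "(\<lambda>x. \<Oplus>i\<in>{..<n}. a j i \<otimes> x i) \<in> lin_maps R (std_free n) (self_module R)" if "j < l" for j
  proof (rule lin_maps_cong[OF std_free_module Aj'[OF that]])
    fix x assume x: "x \<in> carrier (std_free n)"
    show "(\<Oplus>i\<in>{..<n}. a j i \<otimes> x i) = (\<Oplus>\<^bsub>self_module R\<^esub>i\<in>{..<n}. x i \<odot>\<^bsub>self_module R\<^esub> a j i)"
      using xc[OF x] a[OF that] by (subst self_module_finsum) (auto simp: m_comm intro!: finsum_cong')
  qed
  have A: "A \<in> lin_maps R (std_free n) (std_free l)"
  proof (rule lin_mapsI)
    fix x assume x: "x \<in> carrier (std_free n)"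
    show "A x \<in> carrier (std_free l)"
      unfolding std_free_carrier
      by (rule fin_funsI[where A = "{..<l}"]) (use lin_mapsD(1)[OF Aj x] in \<open>auto simp: A_def\<close>)
  next
    fix x y assume "x \<in> carrier (std_free n)" "y \<in> carrier (std_free n)"
    then show "A (x \<oplus>\<^bsub>std_free n\<^esub> y) = A x \<oplus>\<^bsub>std_free l\<^esub> A y"
      using lin_mapsD(2)[OF Aj] unfolding A_def by (auto simp: std_free_simps(2)[of l])
  next
    fix r x assume "r \<in> carrier R" "x \<in> carrier (std_free n)"
    then show "A (r \<odot>\<^bsub>std_free n\<^esub> x) = r \<odot>\<^bsub>std_free l\<^esub> A x"
      using lin_mapsD(3)[OF Aj] unfolding A_def by (auto simp: std_free_simps(3)[of l])
  qed
  \<comment> \<open>The image of the matrix, which has the carrier type on which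
    \<open>flat_module\<close> tests injections. Its inclusion in R^l stays injective after
    tensoring with \<open>Q\<close>.\<close>
  define N where "N = (std_free l)\<lparr>carrier := A ` carrier (std_free n)\<rparr>"
  have Nsub: "submodule (A ` carrier (std_free n)) R (std_free l)"
    by (rule submodule_image[OF std_free_module std_free_module A F.carrier_is_submodule])
  have mN: "module R N"
    unfolding N_def by (rule submodule.submodule_is_module[OF Nsub std_free_module])
  have incl: "(\<lambda>x. x) \<in> lin_maps R N (std_free l)"
    using submoduleD(1)[OF std_free_module Nsub] by (intro lin_mapsI) (auto simp: N_def)
  have A': "A \<in> lin_maps R (std_free n) N"
    by (rule lin_mapsI) (auto simp: N_def lin_mapsD[OF A])
  have idQ: "id \<in> lin_maps R Q Q" by (rule lin_mapsI) auto
  \<comment> \<open>The sequences that satisfy the conclusion. The aim is to show that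
    \<open>v\<close> vanishes in the quotient by \<open>T\<close>.\<close>
  define T where "T = {z \<in> carrier (seq_module Q). \<exists>d\<in>carrier (seq_module Q).
      \<forall>i<n. z i = (\<Oplus>\<^bsub>Q\<^esub>u\<in>{..<k}. w u i \<odot>\<^bsub>Q\<^esub> d u)}"
  have smul: "(\<lambda>z. r \<odot>\<^bsub>Q\<^esub> z i) \<in> lin_maps R (seq_module Q) Q" if "r \<in> carrier R" for r i
    using that Q.smult_assoc1 m_comm
    by (intro lin_mapsI) (auto simp: seq_module_simps Q.smult_r_distr simp flip: Q.smult_assoc1)
  have comb: "(\<lambda>d. \<Oplus>\<^bsub>Q\<^esub>u\<in>{..<k}. w u i \<odot>\<^bsub>Q\<^esub> d u) \<in> lin_maps R (seq_module Q) Q" for i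
    by (intro lin_maps_sum mS mQ smul w) auto
  have T: "submodule T R (seq_module Q)"
  proof (rule S.submoduleI')
    show "\<zero>\<^bsub>seq_module Q\<^esub> \<in> T"
      using lin_maps_zero[OF mS mQ comb] S.M.zero_closed
      by (auto simp: T_def seq_module_simps(2) intro!: bexI[of _ "\<zero>\<^bsub>seq_module Q\<^esub>"])
  next
    fix x y assume "x \<in> T" "y \<in> T"
    then obtain d e where *: "x \<in> carrier (seq_module Q)" "y \<in> carrier (seq_module Q)"
      "d \<in> carrier (seq_module Q)" "e \<in> carrier (seq_module Q)"
      "\<And>i. i < n \<Longrightarrow> x i = (\<Oplus>\<^bsub>Q\<^esub>u\<in>{..<k}. w u i \<odot>\<^bsub>Q\<^esub> d u)"
      "\<And>i. i < n \<Longrightarrow> y i = (\<Oplus>\<^bsub>Q\<^esub>u\<in>{..<k}. w u i \<odot>\<^bsub>Q\<^esub> e u)" by (auto simp: T_def)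
    have "(x \<oplus>\<^bsub>seq_module Q\<^esub> y) i = (\<Oplus>\<^bsub>Q\<^esub>u\<in>{..<k}. w u i \<odot>\<^bsub>Q\<^esub> (d \<oplus>\<^bsub>seq_module Q\<^esub> e) u)" if "i < n" for i
      using lin_mapsD(2)[OF comb *(3,4)] *(5,6)[OF that] by (simp add: seq_module_simps(3)[of Q x y])
    then show "x \<oplus>\<^bsub>seq_module Q\<^esub> y \<in> T"
      using * by (auto simp: T_def intro!: bexI[of _ "d \<oplus>\<^bsub>seq_module Q\<^esub> e"])
  next
    fix r x assume r: "r \<in> carrier R" and "x \<in> T"
    then obtain d where *: "x \<in> carrier (seq_module Q)" "d \<in> carrier (seq_module Q)"
      "\<And>i. i < n \<Longrightarrow> x i = (\<Oplus>\<^bsub>Q\<^esub>u\<in>{..<k}. w u i \<odot>\<^bsub>Q\<^esub> d u)" by (auto simp: T_def)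
    have "(r \<odot>\<^bsub>seq_module Q\<^esub> x) i = (\<Oplus>\<^bsub>Q\<^esub>u\<in>{..<k}. w u i \<odot>\<^bsub>Q\<^esub> (r \<odot>\<^bsub>seq_module Q\<^esub> d) u)" if "i < n" for i
      using lin_mapsD(3)[OF comb r *(2)] *(3)[OF that] by (simp add: seq_module_simps(4)[of Q r x])
    then show "r \<odot>\<^bsub>seq_module Q\<^esub> x \<in> T"
      using * r by (auto simp: T_def intro!: bexI[of _ "r \<odot>\<^bsub>seq_module Q\<^esub> d"])
  qed (auto simp: T_def)
  let ?C = "quot (seq_module Q) T"
  have mC: "module R ?C" by (rule quot_module[OF mS T])
  \<comment> \<open>The pairing of x in R^n and s in \<open>Q\<close> into the quotient by
    \<open>T\<close>. It vanishes whenever A x = 0, so it descends to a bilinear map on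
    \<open>Q\<close> and the image of \<open>A\<close>, hence to the tensor product.\<close>
  define b where "b x s = T +>\<^bsub>seq_module Q\<^esub> (\<lambda>i. x i \<odot>\<^bsub>Q\<^esub> s)" for x s
  have b1: "(\<lambda>s. b x s) \<in> lin_maps R Q ?C" if "x \<in> carrier (std_free n)" for x
    unfolding b_def
    using xc[OF that] m_comm
    by (intro lin_maps_comp[OF lin_mapsI coset_lin[OF mS T]])
      (auto simp: seq_module_simps Q.smult_r_distr simp flip: Q.smult_assoc1)
  have b2: "(\<lambda>x. b x s) \<in> lin_maps R (std_free n) ?C" if "s \<in> carrier Q" for s
    unfolding b_def
    using xc that
    by (intro lin_maps_comp[OF lin_mapsI coset_lin[OF mS T]])
      (auto simp: seq_module_simps std_free_simps Q.smult_l_distr Q.smult_assoc1)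
  interpret C: module R ?C by (rule mC)
  have b0: "b x s = \<zero>\<^bsub>?C\<^esub>" if x: "x \<in> carrier (std_free n)" and s: "s \<in> carrier Q" and Ax: "A x = \<zero>\<^bsub>std_free l\<^esub>" for x s
  proof -
    have "(\<Oplus>i\<in>{..<n}. a j i \<otimes> x i) = \<zero>" if "j < l" for j
      using fun_cong[OF Ax, of j] that by (simp add: A_def std_free_simps)
    from gen[OF x this] obtain c where c: "\<And>u. u < k \<Longrightarrow> c u \<in> carrier R"
      "\<And>i. x i = (\<Oplus>u\<in>{..<k}. c u \<otimes> w u i)" by metis
    \<comment> \<open>Since x is a combination of the w_u with coefficients c_u, the sequence of the
      x_i s is one of the w_u with coefficients c_u s. The value zero beyond \<open>k\<close> makes
      these coefficients a sequence in \<open>Q\<close>.\<close>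
    have "x i \<odot>\<^bsub>Q\<^esub> s = (\<Oplus>\<^bsub>Q\<^esub>u\<in>{..<k}. w u i \<odot>\<^bsub>Q\<^esub> (if u < k then c u \<odot>\<^bsub>Q\<^esub> s else \<zero>\<^bsub>Q\<^esub>))" for i
    proof -
      have lin: "(\<lambda>r. r \<odot>\<^bsub>Q\<^esub> s) \<in> lin_maps R (self_module R) Q"
        by (rule lin_mapsI) (auto simp: s Q.smult_l_distr Q.smult_assoc1)
      have "x i \<odot>\<^bsub>Q\<^esub> s = (\<Oplus>\<^bsub>self_module R\<^esub>u\<in>{..<k}. c u \<otimes> w u i) \<odot>\<^bsub>Q\<^esub> s"
        using c(1) w by (subst self_module_finsum) (auto simp: c(2))
      also have "\<dots> = (\<Oplus>\<^bsub>Q\<^esub>u\<in>{..<k}. (c u \<otimes> w u i) \<odot>\<^bsub>Q\<^esub> s)"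
        using c(1) w by (intro lin_maps_finsum[OF self_module_module mQ lin]) auto
      also have "\<dots> = (\<Oplus>\<^bsub>Q\<^esub>u\<in>{..<k}. w u i \<odot>\<^bsub>Q\<^esub> (if u < k then c u \<odot>\<^bsub>Q\<^esub> s else \<zero>\<^bsub>Q\<^esub>))"
        using c(1) w s m_comm by (intro Q.M.finsum_cong') (auto simp flip: Q.smult_assoc1)
      finally show ?thesis .
    qed
    then have "(\<lambda>i. x i \<odot>\<^bsub>Q\<^esub> s) \<in> T"
      using xc[OF x] s c(1) w
      by (auto simp: T_def seq_module_simps intro!: Q.M.finsum_closed exI[of _ "\<lambda>u. if u < k then c u \<odot>\<^bsub>Q\<^esub> s else \<zero>\<^bsub>Q\<^esub>"])
    then show ?thesis
      using coset_eq_zero_iff[OF mS T] xc[OF x] s by (simp add: b_def quot_simps seq_module_simps)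
  qed
  have bA: "b x s = b y s" if "x \<in> carrier (std_free n)" "y \<in> carrier (std_free n)" "s \<in> carrier Q" "A x = A y" for x y s
  proof -
    have "A (x \<ominus>\<^bsub>std_free n\<^esub> y) = \<zero>\<^bsub>std_free l\<^esub>"
      using that lin_mapsD(1)[OF A]
      by (simp add: lin_maps_minus[OF std_free_module std_free_module A] L.M.minus_eq L.M.r_neg)
    then have "b (x \<ominus>\<^bsub>std_free n\<^esub> y) s = \<zero>\<^bsub>?C\<^esub>" using that by (intro b0) auto
    then have "b x s \<ominus>\<^bsub>?C\<^esub> b y s = \<zero>\<^bsub>?C\<^esub>"
      using lin_maps_minus[OF std_free_module mC b2[OF that(3)] that(1,2)] by simp
    then show ?thesis
      by (rule C.M.minus_eq_zeroD[OF _ lin_mapsD(1)[OF b2[OF that(3)] that(1)]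
            lin_mapsD(1)[OF b2[OF that(3)] that(2)]])
  qed
  \<comment> \<open>A set-theoretic section of \<open>A\<close>. It need not be linear; by
    \<open>bA\<close> the pairing does not depend on the chosen preimage.\<close>
  define \<sigma> where "\<sigma> = inv_into (carrier (std_free n)) A"
  have \<sigma>: "\<sigma> y \<in> carrier (std_free n)" "A (\<sigma> y) = y" if "y \<in> carrier N" for y
    using that inv_into_into[of y A "carrier (std_free n)"] f_inv_into_f[of y A "carrier (std_free n)"]
    by (simp_all add: \<sigma>_def N_def)
  interpret N: module R N by (rule mN)
  have bil: "bilinear R Q N ?C (\<lambda>(s, y). b (\<sigma> y) s)"
    unfolding bilinear_def prod.case
  proof (intro conjI ballI)
    fix y assume "y \<in> carrier N"
    then show "(\<lambda>s. b (\<sigma> y) s) \<in> lin_maps R Q ?C" by (intro b1 \<sigma>)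
  next
    fix s assume s: "s \<in> carrier Q"
    note lin = lin_mapsD[OF b2[OF s]]
    show "(\<lambda>y. b (\<sigma> y) s) \<in> lin_maps R N ?C"
    proof (rule lin_mapsI)
      fix y z assume yz: "y \<in> carrier N" "z \<in> carrier N"
      show "b (\<sigma> y) s \<in> carrier ?C" using yz \<sigma> lin by auto
      have "b (\<sigma> (y \<oplus>\<^bsub>N\<^esub> z)) s = b (\<sigma> y \<oplus>\<^bsub>std_free n\<^esub> \<sigma> z) s"
        using yz \<sigma> s by (intro bA) (auto simp: lin_mapsD[OF A'])
      then show "b (\<sigma> (y \<oplus>\<^bsub>N\<^esub> z)) s = b (\<sigma> y) s \<oplus>\<^bsub>?C\<^esub> b (\<sigma> z) s"
        using yz \<sigma> lin by simp
    next
      fix r y assume ry: "r \<in> carrier R" "y \<in> carrier N"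
      have "b (\<sigma> (r \<odot>\<^bsub>N\<^esub> y)) s = b (r \<odot>\<^bsub>std_free n\<^esub> \<sigma> y) s"
        using ry \<sigma> s by (intro bA) (auto simp: lin_mapsD[OF A'])
      then show "b (\<sigma> (r \<odot>\<^bsub>N\<^esub> y)) s = r \<odot>\<^bsub>?C\<^esub> b (\<sigma> y) s"
        using ry \<sigma> lin by simp
    qed
  qed
  have e: "basis_elt R i \<in> carrier (std_free n)" if "i < n" for i
    using that by (simp add: std_free_carrier basis_elt_closed)
  have f: "basis_elt R j \<in> carrier (std_free l)" if "j < l" for j
    using that by (simp add: std_free_carrier basis_elt_closed)
  have Ae: "A (basis_elt R i) j = a j i" if "i < n" "j < l" for i j
  proof -
    have "A (basis_elt R i) j = (\<Oplus>i'\<in>{..<n}. if i' = i then a j i' else \<zero>)"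
      using that a by (auto simp: A_def basis_elt_def intro!: finsum_cong')
    also have "\<dots> = a j i" using that a by (intro add.finprod_singleton_swap) auto
    finally show ?thesis .
  qed
  have mT: "module R (tensor R Q N)" and mT': "module R (tensor R Q (std_free l))"
    by (intro tensor_module mQ mN std_free_module)+
  interpret T: module R "tensor R Q N" by (rule mT)
  interpret T': module R "tensor R Q (std_free l)" by (rule mT')
  let ?p = "pure_tensor R Q N" and ?p' = "pure_tensor R Q (std_free l)"
  note pc = pure_tensor_closed[OF mQ mN] and pc' = pure_tensor_closed[OF mQ std_free_module]
  note p'1 = pure_tensor_lin(1)[OF mQ std_free_module] and p'2 = pure_tensor_lin(2)[OF mQ std_free_module]
  note tm = tensor_map_class[OF mQ mN mQ std_free_module idQ incl]
  \<comment> \<open>The element \<Sum>_i v_i \<otimes> A e_i. In the tensor product with R^l it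
    becomes \<Sum>_j (\<Sum>_i a_ji v_i) \<otimes> e_j, which is zero by \<open>sol\<close>;
    flatness then gives t = 0 already over the image \<open>N\<close>.\<close>
  define t where "t = (\<Oplus>\<^bsub>tensor R Q N\<^esub>i\<in>{..<n}. ?p (v i) (A (basis_elt R i)))"
  have tc: "t \<in> carrier (tensor R Q N)"
    unfolding t_def using v e lin_mapsD(1)[OF A'] by (intro T.M.finsum_closed) (auto intro!: pc)
  have "tensor_map R Q (std_free l) id (\<lambda>x. x) t =
      (\<Oplus>\<^bsub>tensor R Q (std_free l)\<^esub>i\<in>{..<n}. tensor_map R Q (std_free l) id (\<lambda>x. x) (?p (v i) (A (basis_elt R i))))"
    unfolding t_def using v e lin_mapsD(1)[OF A']
    by (intro lin_maps_finsum[OF mT mT' tm(2)]) (auto intro!: pc)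
  also have "\<dots> = (\<Oplus>\<^bsub>tensor R Q (std_free l)\<^esub>i\<in>{..<n}. \<Oplus>\<^bsub>tensor R Q (std_free l)\<^esub>j\<in>{..<l}. ?p' (a j i \<odot>\<^bsub>Q\<^esub> v i) (basis_elt R j))"
  proof (rule T'.M.finsum_cong'[OF refl])
    show "(\<lambda>i. \<Oplus>\<^bsub>tensor R Q (std_free l)\<^esub>j\<in>{..<l}. ?p' (a j i \<odot>\<^bsub>Q\<^esub> v i) (basis_elt R j))
        \<in> {..<n} \<rightarrow> carrier (tensor R Q (std_free l))"
      using a v f by (auto intro!: T'.M.finsum_closed pc')
    fix i assume "i \<in> {..<n}"
    then have i: "i < n" by simp
    have "tensor_map R Q (std_free l) id (\<lambda>x. x) (?p (v i) (A (basis_elt R i))) = ?p' (v i) (A (basis_elt R i))"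
      using tm(3)[OF v[OF i] lin_mapsD(1)[OF A' e[OF i]]] by simp
    also have "\<dots> = ?p' (v i) (\<Oplus>\<^bsub>std_free l\<^esub>j\<in>{..<l}. A (basis_elt R i) j \<odot>\<^bsub>std_free l\<^esub> basis_elt R j)"
      using std_free_expand[OF lin_mapsD(1)[OF A e[OF i]]] by simp
    also have "\<dots> = ?p' (v i) (\<Oplus>\<^bsub>std_free l\<^esub>j\<in>{..<l}. a j i \<odot>\<^bsub>std_free l\<^esub> basis_elt R j)"
      using i a f by (intro arg_cong[where f = "?p' (v i)"] L.M.finsum_cong') (auto simp: Ae)
    also have "\<dots> = (\<Oplus>\<^bsub>tensor R Q (std_free l)\<^esub>j\<in>{..<l}. ?p' (v i) (a j i \<odot>\<^bsub>std_free l\<^esub> basis_elt R j))"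
      using i a f by (intro lin_maps_finsum[OF std_free_module mT' p'2[OF v[OF i]]]) auto
    also have "\<dots> = (\<Oplus>\<^bsub>tensor R Q (std_free l)\<^esub>j\<in>{..<l}. ?p' (a j i \<odot>\<^bsub>Q\<^esub> v i) (basis_elt R j))"
      using i a f v
      by (intro T'.M.finsum_cong') (auto simp: lin_mapsD(3)[OF p'2] lin_mapsD(3)[OF p'1] intro!: pc')
    finally show "tensor_map R Q (std_free l) id (\<lambda>x. x) (?p (v i) (A (basis_elt R i))) =
        (\<Oplus>\<^bsub>tensor R Q (std_free l)\<^esub>j\<in>{..<l}. ?p' (a j i \<odot>\<^bsub>Q\<^esub> v i) (basis_elt R j))" .
  qed
  also have "\<dots> = (\<Oplus>\<^bsub>tensor R Q (std_free l)\<^esub>j\<in>{..<l}. \<Oplus>\<^bsub>tensor R Q (std_free l)\<^esub>i\<in>{..<n}. ?p' (a j i \<odot>\<^bsub>Q\<^esub> v i) (basis_elt R j))"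
    using a v f by (intro T'.M.finsum_finsum_swap) (auto intro!: pc')
  also have "\<dots> = \<zero>\<^bsub>tensor R Q (std_free l)\<^esub>"
  proof (rule T'.M.add.finprod_one_eqI)
    fix j assume "j \<in> {..<l}"
    then have j: "j < l" by simp
    have "(\<Oplus>\<^bsub>tensor R Q (std_free l)\<^esub>i\<in>{..<n}. ?p' (a j i \<odot>\<^bsub>Q\<^esub> v i) (basis_elt R j)) =
        ?p' (\<Oplus>\<^bsub>Q\<^esub>i\<in>{..<n}. a j i \<odot>\<^bsub>Q\<^esub> v i) (basis_elt R j)"
      using a v j by (intro lin_maps_finsum[OF mQ mT' p'1[OF f[OF j]], symmetric]) auto
    also have "\<dots> = \<zero>\<^bsub>tensor R Q (std_free l)\<^esub>"
      unfolding sol[OF j] by (rule lin_maps_zero[OF mQ mT' p'1[OF f[OF j]]])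
    finally show "(\<Oplus>\<^bsub>tensor R Q (std_free l)\<^esub>i\<in>{..<n}. ?p' (a j i \<odot>\<^bsub>Q\<^esub> v i) (basis_elt R j)) =
        \<zero>\<^bsub>tensor R Q (std_free l)\<^esub>" .
  qed
  finally have "tensor_map R Q (std_free l) id (\<lambda>x. x) t =
      tensor_map R Q (std_free l) id (\<lambda>x. x) \<zero>\<^bsub>tensor R Q N\<^esub>"
    by (simp add: lin_maps_zero[OF mT mT' tm(2)])
  moreover have "inj_on (tensor_map R Q (std_free l) id (\<lambda>x. x)) (carrier (tensor R Q N))"
    using flat incl mN std_free_module unfolding flat_module_def by (simp add: inj_on_def)
  ultimately have t0: "t = \<zero>\<^bsub>tensor R Q N\<^esub>" using tc by (auto dest: inj_onD)
  let ?g = "tensor_lift R ?C (\<lambda>(s, y). b (\<sigma> y) s)"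
  note glin = tensor_lift_lin[OF mQ mN mC bil]
  let ?B = "\<lambda>i l. basis_elt R i l \<odot>\<^bsub>Q\<^esub> v i"
  have Bc: "?B i \<in> carrier (seq_module Q)" if "i < n" for i
    using that v by (auto simp: seq_module_simps basis_elt_def)
  \<comment> \<open>A sequence whose entries below \<open>n\<close> are those of \<open>v\<close>.
    The map induced by \<open>b\<close> sends \<open>t\<close> to its class modulo \<open>T\<close>,
    so t = 0 forces it into \<open>T\<close>.\<close>
  define Z where "Z = (\<Oplus>\<^bsub>seq_module Q\<^esub>i\<in>{..<n}. ?B i)"
  have Zc: "Z \<in> carrier (seq_module Q)" unfolding Z_def using Bc by (intro S.M.finsum_closed) auto
  have "\<zero>\<^bsub>?C\<^esub> = ?g t" unfolding t0 by (rule lin_maps_zero[OF mT mC glin, symmetric])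
  also have "\<dots> = (\<Oplus>\<^bsub>?C\<^esub>i\<in>{..<n}. ?g (?p (v i) (A (basis_elt R i))))"
    unfolding t_def using v e lin_mapsD(1)[OF A']
    by (intro lin_maps_finsum[OF mT mC glin]) (auto intro!: pc)
  also have "\<dots> = (\<Oplus>\<^bsub>?C\<^esub>i\<in>{..<n}. b (basis_elt R i) (v i))"
  proof (rule C.M.finsum_cong'[OF refl])
    fix i assume "i \<in> {..<n}"
    then have i: "i < n" by simp
    have "?g (?p (v i) (A (basis_elt R i))) = b (\<sigma> (A (basis_elt R i))) (v i)"
      using tensor_lift_pure[OF mQ mN mC bil v[OF i] lin_mapsD(1)[OF A' e[OF i]]] by simp
    also have "\<dots> = b (basis_elt R i) (v i)"
      using v[OF i] e[OF i] \<sigma>[OF lin_mapsD(1)[OF A' e[OF i]]] by (intro bA) auto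
    finally show "?g (?p (v i) (A (basis_elt R i))) = b (basis_elt R i) (v i)" .
  qed (use v e lin_mapsD(1)[OF b1] in auto)
  also have "\<dots> = T +>\<^bsub>seq_module Q\<^esub> Z"
    unfolding Z_def b_def using Bc
    by (intro lin_maps_finsum[OF mS mC coset_lin[OF mS T], symmetric]) auto
  finally have "Z \<in> T" using coset_eq_zero_iff[OF mS T Zc] by (simp add: quot_simps)
  moreover have "Z i = v i" if "i < n" for i
  proof -
    have "Z i = (\<Oplus>\<^bsub>Q\<^esub>i'\<in>{..<n}. ?B i' i)"
      unfolding Z_def using Bc by (intro lin_maps_finsum[OF mS mQ seq_module_coord]) auto
    also have "\<dots> = (\<Oplus>\<^bsub>Q\<^esub>i'\<in>{..<n}. if i' = i then v i' else \<zero>\<^bsub>Q\<^esub>)"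
      using v by (intro Q.M.finsum_cong') (auto simp: basis_elt_def)
    also have "\<dots> = v i" using v that by (intro Q.M.add.finprod_singleton_swap) auto
    finally show ?thesis .
  qed
  ultimately obtain d where "d \<in> carrier (seq_module Q)"
    "\<And>i. i < n \<Longrightarrow> v i = (\<Oplus>\<^bsub>Q\<^esub>u\<in>{..<k}. w u i \<odot>\<^bsub>Q\<^esub> d u)"
    by (auto simp: T_def)
  then show ?thesis by (auto simp: seq_module_simps)
qed

end

section \<open>Base change\<close>

lemma (in algebra) smult_one_mult:
  "r \<in> carrier R \<Longrightarrow> x \<in> carrier M \<Longrightarrow> (r \<odot>\<^bsub>M\<^esub> \<one>\<^bsub>M\<^esub>) \<otimes>\<^bsub>M\<^esub> x = r \<odot>\<^bsub>M\<^esub> x"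
  by (simp add: smult_assoc2)

lemma (in algebra) mult_smult_right:
  assumes "r \<in> carrier R" "x \<in> carrier M" "y \<in> carrier M"
  shows "x \<otimes>\<^bsub>M\<^esub> (r \<odot>\<^bsub>M\<^esub> y) = r \<odot>\<^bsub>M\<^esub> (x \<otimes>\<^bsub>M\<^esub> y)"
  using assms by (metis smult_assoc2 smult_closed m_comm)

lemma (in algebra) mult_left_lin: "x \<in> carrier M \<Longrightarrow> (\<lambda>y. x \<otimes>\<^bsub>M\<^esub> y) \<in> lin_maps R M M"
  by (rule lin_mapsI) (auto simp: mult_smult_right r_distr)

lemma (in algebra) mult_right_lin: "y \<in> carrier M \<Longrightarrow> (\<lambda>x. x \<otimes>\<^bsub>M\<^esub> y) \<in> lin_maps R M M"
  by (rule lin_mapsI) (auto simp: smult_assoc2 l_distr)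

lemma (in module) smult_lin: "r \<in> carrier R \<Longrightarrow> (\<lambda>x. r \<odot>\<^bsub>M\<^esub> x) \<in> lin_maps R M M"
proof (rule lin_mapsI)
  fix s x assume *: "r \<in> carrier R" "s \<in> carrier R" "x \<in> carrier M"
  then show "r \<odot>\<^bsub>M\<^esub> (s \<odot>\<^bsub>M\<^esub> x) = s \<odot>\<^bsub>M\<^esub> (r \<odot>\<^bsub>M\<^esub> x)"
    using R.m_comm[of r s] by (simp flip: smult_assoc1)
qed (simp_all add: smult_r_distr)

lemma (in algebra) restrict_scalars_submodule:
  assumes "module M A" "submodule J M A"
  shows "submodule J R (restrict_scalars M A)"
proof -
  interpret B: module R "restrict_scalars M A" by (rule restrict_scalars_module[OF assms(1)])
  show ?thesis
    by (rule B.submoduleI') (use submoduleD[OF assms] in auto)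
qed

lemma (in algebra) restrict_scalars_self:
  assumes "h \<in> lin_maps R N (restrict_scalars M (self_module M))"
  shows "h \<in> lin_maps R N M"
  using lin_mapsD[OF assms] by (intro lin_mapsI) (auto simp: smult_one_mult)

context cring
begin

context
  fixes S :: "('a, 's) module"
  assumes S: "algebra R S"
begin

interpretation S: algebra R S by (rule S)

lemma base_change_smult_lin:
  assumes "module R N" "s \<in> carrier S"
  shows "(\<lambda>x. s \<odot>\<^bsub>base_change R S N\<^esub> x) \<in> lin_maps R (tensor R S N) (tensor R S N)"
    and "t \<in> carrier S \<Longrightarrow> m \<in> carrier N \<Longrightarrow>
      s \<odot>\<^bsub>base_change R S N\<^esub> pure_tensor R S N t m = pure_tensor R S N (s \<otimes>\<^bsub>S\<^esub> t) m"
proof -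
  have "id \<in> lin_maps R N N" by (rule lin_mapsI) auto
  note * = tensor_map_class[OF S.module assms(1) S.module assms(1) S.mult_left_lin[OF assms(2)] this]
  show "(\<lambda>x. s \<odot>\<^bsub>base_change R S N\<^esub> x) \<in> lin_maps R (tensor R S N) (tensor R S N)"
    using *(2) by (simp add: base_change_simps[abs_def] fun_eq_iff)
  show "t \<in> carrier S \<Longrightarrow> m \<in> carrier N \<Longrightarrow>
      s \<odot>\<^bsub>base_change R S N\<^esub> pure_tensor R S N t m = pure_tensor R S N (s \<otimes>\<^bsub>S\<^esub> t) m"
    using *(3) by (simp add: base_change_simps)
qed

text \<open>This links the R-action on \<open>tensor\<close> with the \<open>S\<close>-action on
  \<open>base_change\<close>; by it an \<open>S\<close>-linear map on the base change is R-linear on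
  the tensor product.\<close>

lemma base_change_smult_base:
  assumes "module R N" "r \<in> carrier R" "x \<in> carrier (tensor R S N)"
  shows "(r \<odot>\<^bsub>S\<^esub> \<one>\<^bsub>S\<^esub>) \<odot>\<^bsub>base_change R S N\<^esub> x = r \<odot>\<^bsub>tensor R S N\<^esub> x"
proof -
  have r: "r \<odot>\<^bsub>S\<^esub> \<one>\<^bsub>S\<^esub> \<in> carrier S" using assms(2) by simp
  note T = tensor_module[OF S.module assms(1)]
  show ?thesis
  proof (rule tensor_eq[OF S.module assms(1) T base_change_smult_lin(1)[OF assms(1) r]
        module.smult_lin[OF T assms(2)] _ assms(3)])
    fix a b assume "a \<in> carrier S" "b \<in> carrier N"
    then show "(r \<odot>\<^bsub>S\<^esub> \<one>\<^bsub>S\<^esub>) \<odot>\<^bsub>base_change R S N\<^esub> pure_tensor R S N a b =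
        r \<odot>\<^bsub>tensor R S N\<^esub> pure_tensor R S N a b"
      using assms(2) base_change_smult_lin(2)[OF assms(1) r] lin_mapsD(3)[OF pure_tensor_lin(1)[OF S.module assms(1)]]
      by (simp add: S.smult_one_mult)
  qed
qed

lemma base_change_module:
  assumes "module R N"
  shows "module S (base_change R S N)"
proof -
  have mT: "module R (tensor R S N)" by (rule tensor_module[OF S.module assms])
  interpret T: module R "tensor R S N" by (rule mT)
  note lin = base_change_smult_lin[OF assms]
  note pl = pure_tensor_lin[OF S.module assms] and pc = pure_tensor_closed[OF S.module assms]
  note teq = tensor_eq[OF S.module assms mT]
  show ?thesis
  proof (rule moduleI)
    show "abelian_group (base_change R S N)"
      by (rule abelian_group_cong[OF T.M.abelian_group_axioms]) (simp_all add: base_change_simps)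
    fix a x assume a: "a \<in> carrier S" and x: "x \<in> carrier (base_change R S N)"
    have x': "x \<in> carrier (tensor R S N)" using x by (simp add: base_change_simps)
    show "a \<odot>\<^bsub>base_change R S N\<^esub> x \<in> carrier (base_change R S N)"
      using lin_mapsD(1)[OF lin(1)[OF a] x'] by (simp add: base_change_simps(1))
    {
      fix y assume "y \<in> carrier (base_change R S N)"
      then show "a \<odot>\<^bsub>base_change R S N\<^esub> (x \<oplus>\<^bsub>base_change R S N\<^esub> y) =
          a \<odot>\<^bsub>base_change R S N\<^esub> x \<oplus>\<^bsub>base_change R S N\<^esub> a \<odot>\<^bsub>base_change R S N\<^esub> y"
        using lin_mapsD(2)[OF lin(1)[OF a] x'] by (simp add: base_change_simps(1,4))
    }
    fix b assume b: "b \<in> carrier S"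
    have ab: "a \<oplus>\<^bsub>S\<^esub> b \<in> carrier S" "a \<otimes>\<^bsub>S\<^esub> b \<in> carrier S" using a b by auto
    have add: "(\<lambda>x. a \<odot>\<^bsub>base_change R S N\<^esub> x \<oplus>\<^bsub>tensor R S N\<^esub> b \<odot>\<^bsub>base_change R S N\<^esub> x)
        \<in> lin_maps R (tensor R S N) (tensor R S N)"
      using lin_mapsD[OF lin(1)[OF a]] lin_mapsD[OF lin(1)[OF b]]
      by (intro lin_mapsI) (simp_all add: T.M.a_ac T.smult_r_distr)
    have "(a \<oplus>\<^bsub>S\<^esub> b) \<odot>\<^bsub>base_change R S N\<^esub> x =
        a \<odot>\<^bsub>base_change R S N\<^esub> x \<oplus>\<^bsub>tensor R S N\<^esub> b \<odot>\<^bsub>base_change R S N\<^esub> x"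
    proof (rule teq[OF lin(1)[OF ab(1)] add _ x'])
      fix t m assume tm: "t \<in> carrier S" "m \<in> carrier N"
      show "(a \<oplus>\<^bsub>S\<^esub> b) \<odot>\<^bsub>base_change R S N\<^esub> pure_tensor R S N t m =
        a \<odot>\<^bsub>base_change R S N\<^esub> pure_tensor R S N t m \<oplus>\<^bsub>tensor R S N\<^esub>
        b \<odot>\<^bsub>base_change R S N\<^esub> pure_tensor R S N t m"
        using a b tm by (simp add: lin(2) S.l_distr lin_mapsD(2)[OF pl(1)])
    qed
    then show "(a \<oplus>\<^bsub>S\<^esub> b) \<odot>\<^bsub>base_change R S N\<^esub> x =
        a \<odot>\<^bsub>base_change R S N\<^esub> x \<oplus>\<^bsub>base_change R S N\<^esub> b \<odot>\<^bsub>base_change R S N\<^esub> x"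
      by (simp add: base_change_simps(4))
    show "(a \<otimes>\<^bsub>S\<^esub> b) \<odot>\<^bsub>base_change R S N\<^esub> x =
        a \<odot>\<^bsub>base_change R S N\<^esub> (b \<odot>\<^bsub>base_change R S N\<^esub> x)"
      by (rule teq[OF lin(1)[OF ab(2)] lin_maps_comp[OF lin(1)[OF b] lin(1)[OF a]] _ x'])
        (use a b in \<open>simp add: lin(2) S.m_assoc\<close>)
  next
    fix x assume "x \<in> carrier (base_change R S N)"
    then have x: "x \<in> carrier (tensor R S N)" by (simp add: base_change_simps)
    have "id \<in> lin_maps R (tensor R S N) (tensor R S N)" by (rule lin_mapsI) auto
    from teq[OF lin(1)[OF S.one_closed] this _ x]
    show "\<one>\<^bsub>S\<^esub> \<odot>\<^bsub>base_change R S N\<^esub> x = x" by (simp add: lin(2))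
  qed (rule S.M_cring)
qed

lemma base_change_lin_restrict:
  fixes C :: "('s, 'c) module"
  assumes "module R N" "module S C" "h \<in> lin_maps S (base_change R S N) C"
  shows "h \<in> lin_maps R (tensor R S N) (restrict_scalars S C)"
proof (rule lin_mapsI)
  fix r x assume rx: "r \<in> carrier R" "x \<in> carrier (tensor R S N)"
  then show "h (r \<odot>\<^bsub>tensor R S N\<^esub> x) = r \<odot>\<^bsub>restrict_scalars S C\<^esub> h x"
    using lin_mapsD(3)[OF assms(3), of "r \<odot>\<^bsub>S\<^esub> \<one>\<^bsub>S\<^esub>" x]
    by (simp add: base_change_smult_base[OF assms(1)] base_change_simps(1))
qed (use lin_mapsD(1,2)[OF assms(3)] in \<open>simp_all add: base_change_simps(1,4)\<close>)

lemma base_change_unit_lin: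
  fixes C :: "('s, 'c) module"
  assumes "module R N" "module S C" "h \<in> lin_maps S (base_change R S N) C"
  shows "(\<lambda>m. h (pure_tensor R S N \<one>\<^bsub>S\<^esub> m)) \<in> lin_maps R N (restrict_scalars S C)"
  by (rule lin_maps_comp[OF pure_tensor_lin(2)[OF S.module assms(1) S.one_closed]
        base_change_lin_restrict[OF assms]])

text \<open>As an \<open>S\<close>-module the base change is generated by the tensors with first
  factor one.\<close>

lemma base_change_eq:
  fixes C :: "('s, 'c) module"
  assumes "module R N" "module S C" "h \<in> lin_maps S (base_change R S N) C"
    "h' \<in> lin_maps S (base_change R S N) C"
    "\<And>m. m \<in> carrier N \<Longrightarrow> h (pure_tensor R S N \<one>\<^bsub>S\<^esub> m) = h' (pure_tensor R S N \<one>\<^bsub>S\<^esub> m)"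
    "x \<in> carrier (base_change R S N)"
  shows "h x = h' x"
proof (rule tensor_eq[OF S.module assms(1) S.restrict_scalars_module[OF assms(2)]
      base_change_lin_restrict[OF assms(1-3)] base_change_lin_restrict[OF assms(1,2,4)]])
  fix s m assume sm: "s \<in> carrier S" "m \<in> carrier N"
  have "pure_tensor R S N s m = s \<odot>\<^bsub>base_change R S N\<^esub> pure_tensor R S N \<one>\<^bsub>S\<^esub> m"
    using sm by (simp add: base_change_smult_lin(2)[OF assms(1)])
  moreover have "pure_tensor R S N \<one>\<^bsub>S\<^esub> m \<in> carrier (base_change R S N)"
    using sm by (simp add: base_change_simps(1) pure_tensor_closed[OF S.module assms(1)])
  ultimately show "h (pure_tensor R S N s m) = h' (pure_tensor R S N s m)"
    using sm assms(5) by (simp add: lin_mapsD(3)[OF assms(3)] lin_mapsD(3)[OF assms(4)])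
qed (use assms(6) in \<open>simp add: base_change_simps\<close>)

text \<open>One half of the adjunction between base change and restriction of scalars;
  \<open>base_change_unit_lin\<close> is the other half.\<close>

definition base_lift :: "('s, 'c) module \<Rightarrow> ('m \<Rightarrow> 'c) \<Rightarrow> ('s \<times> 'm \<Rightarrow> 'a) set \<Rightarrow> 'c"
  where "base_lift C u = tensor_lift R (restrict_scalars S C) (\<lambda>(s, m). s \<odot>\<^bsub>C\<^esub> u m)"

lemma base_lift_bilinear:
  assumes "module R N" "module S C" "u \<in> lin_maps R N (restrict_scalars S C)"
  shows "bilinear R S N (restrict_scalars S C) (\<lambda>(s, m). s \<odot>\<^bsub>C\<^esub> u m)"
  unfolding bilinear_def prod.case
proof (intro conjI ballI)
  interpret C: module S C by fact
  fix m assume "m \<in> carrier N"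
  then have um: "u m \<in> carrier C" using lin_mapsD(1)[OF assms(3)] by simp
  show "(\<lambda>s. s \<odot>\<^bsub>C\<^esub> u m) \<in> lin_maps R S (restrict_scalars S C)"
  proof (rule lin_mapsI)
    fix r s assume "r \<in> carrier R" "s \<in> carrier S"
    then show "(r \<odot>\<^bsub>S\<^esub> s) \<odot>\<^bsub>C\<^esub> u m = r \<odot>\<^bsub>restrict_scalars S C\<^esub> (s \<odot>\<^bsub>C\<^esub> u m)"
      using um C.smult_assoc1[of "r \<odot>\<^bsub>S\<^esub> \<one>\<^bsub>S\<^esub>" s "u m"] by (simp add: S.smult_one_mult)
  qed (use um in \<open>simp_all add: C.smult_l_distr\<close>)
next
  interpret C: module S C by fact
  fix s assume s: "s \<in> carrier S"
  have "(\<lambda>x. s \<odot>\<^bsub>C\<^esub> x) \<in> lin_maps R (restrict_scalars S C) (restrict_scalars S C)"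
    by (rule S.restrict_scalars_lin[OF C.smult_lin[OF s]])
  then show "(\<lambda>m. s \<odot>\<^bsub>C\<^esub> u m) \<in> lin_maps R N (restrict_scalars S C)"
    by (rule lin_maps_comp[OF assms(3)])
qed

lemma base_lift:
  assumes "module R N" "module S C" "u \<in> lin_maps R N (restrict_scalars S C)"
  shows "base_lift C u \<in> lin_maps S (base_change R S N) C"
    and "s \<in> carrier S \<Longrightarrow> m \<in> carrier N \<Longrightarrow> base_lift C u (pure_tensor R S N s m) = s \<odot>\<^bsub>C\<^esub> u m"
proof -
  interpret C: module S C by fact
  note mC = S.restrict_scalars_module[OF assms(2)]
  note bil = base_lift_bilinear[OF assms]
  have lin: "base_lift C u \<in> lin_maps R (tensor R S N) (restrict_scalars S C)"
    unfolding base_lift_def by (rule tensor_lift_lin[OF S.module assms(1) mC bil])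
  have pure: "base_lift C u (pure_tensor R S N s m) = s \<odot>\<^bsub>C\<^esub> u m"
    if "s \<in> carrier S" "m \<in> carrier N" for s m
    using tensor_lift_pure[OF S.module assms(1) mC bil that] by (simp add: base_lift_def)
  then show "s \<in> carrier S \<Longrightarrow> m \<in> carrier N \<Longrightarrow> base_lift C u (pure_tensor R S N s m) = s \<odot>\<^bsub>C\<^esub> u m" .
  show "base_lift C u \<in> lin_maps S (base_change R S N) C"
  proof (rule lin_mapsI)
    fix s x assume s: "s \<in> carrier S" and x: "x \<in> carrier (base_change R S N)"
    show "base_lift C u (s \<odot>\<^bsub>base_change R S N\<^esub> x) = s \<odot>\<^bsub>C\<^esub> base_lift C u x"
    proof (rule tensor_eq[OF S.module assms(1) mC lin_maps_comp[OF base_change_smult_lin(1)[OF assms(1) s] lin]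
          lin_maps_comp[OF lin S.restrict_scalars_lin[OF C.smult_lin[OF s]]]])
      fix t m assume tm: "t \<in> carrier S" "m \<in> carrier N"
      then have "u m \<in> carrier C" using lin_mapsD(1)[OF assms(3)] by simp
      then show "base_lift C u (s \<odot>\<^bsub>base_change R S N\<^esub> pure_tensor R S N t m) =
          s \<odot>\<^bsub>C\<^esub> base_lift C u (pure_tensor R S N t m)"
        using tm s by (simp add: base_change_smult_lin(2)[OF assms(1) s] pure C.smult_assoc1)
    qed (use x in \<open>simp add: base_change_simps(1)\<close>)
  qed (use lin_mapsD(1,2)[OF lin] in \<open>simp_all add: base_change_simps(1,4)\<close>)
qed

end

section \<open>Finite expansions of tensors and maps induced on quotients\<close>

lemma lin_ext_basis_elt_id:
  assumes "p \<in> carrier (monoid_alg R G)"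
  shows "lin_ext R (monoid_alg R G) (basis_elt R) p = p"
proof -
  interpret P: module R "monoid_alg R G" by (rule monoid_alg_module)
  have b: "basis_elt R \<in> carrier G \<rightarrow> carrier (monoid_alg R G)" by (auto intro: monoid_alg_basis_mem)
  show ?thesis
  proof (rule lin_maps_monoid_alg_eq[where K = "carrier G", OF P.module_axioms lin_ext_lin[OF P.module_axioms b]])
    show "(\<lambda>p. p) \<in> lin_maps R (monoid_alg R G) (monoid_alg R G)" by (rule lin_mapsI) auto
    fix k assume "k \<in> carrier G"
    then show "lin_ext R (monoid_alg R G) (basis_elt R) (basis_elt R k) = basis_elt R k"
      using b by (intro lin_ext_basis_elt[OF P.module_axioms]) auto
  qed (use assms in \<open>simp_all add: monoid_alg_simps\<close>)
qed

text \<open>A representative is a finite combination of pairs, and its coefficients are absorbed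
  into the first factors.\<close>

lemma tensor_expand:
  assumes "module R A" "module R B" "x \<in> carrier (tensor R A B)"
  shows "\<exists>n s y. (\<forall>i<n. s i \<in> carrier A \<and> y i \<in> carrier B) \<and>
    x = (\<Oplus>\<^bsub>tensor R A B\<^esub>i\<in>{..<n::nat}. pure_tensor R A B (s i) (y i))"
proof -
  interpret A: module R A by fact
  interpret T: module R "tensor R A B" by (rule tensor_module[OF assms(1,2)])
  interpret P: module R "pair_alg R A B" by (rule pair_alg_module)
  obtain p where p: "p \<in> carrier (pair_alg R A B)" "x = tensor_class R A B p"
    using assms(3) by (auto simp: tensor_carrier)
  have pf: "p \<in> fin_funs R (carrier A \<times> carrier B)" using p(1) by (simp add: pair_alg_carrier)
  have ab: "fst k \<in> carrier A" "snd k \<in> carrier B" "p k \<in> carrier R" if "k \<in> supp R p" for k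
    using fin_funsD[OF pf] that by auto
  have "lin_ext R (pair_alg R A B) (basis_elt R) p = p"
    using p(1) unfolding pair_alg_def by (rule lin_ext_basis_elt_id)
  then have "x = tensor_class R A B (\<Oplus>\<^bsub>pair_alg R A B\<^esub>k\<in>supp R p. p k \<odot>\<^bsub>pair_alg R A B\<^esub> basis_elt R k)"
    by (simp add: p(2) lin_ext_def)
  also have "\<dots> = (\<Oplus>\<^bsub>tensor R A B\<^esub>k\<in>supp R p. tensor_class R A B (p k \<odot>\<^bsub>pair_alg R A B\<^esub> basis_elt R k))"
    using ab fin_funsD(2)[OF pf]
    by (intro lin_maps_finsum[OF P.module_axioms T.module_axioms tensor_class_lin[OF assms(1,2)]])
      (auto intro!: P.smult_closed pair_alg_basis simp: prod.collapse[symmetric] simp del: prod.collapse)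
  also have "\<dots> = (\<Oplus>\<^bsub>tensor R A B\<^esub>k\<in>supp R p. pure_tensor R A B (p k \<odot>\<^bsub>A\<^esub> fst k) (snd k))"
  proof (rule T.M.finsum_cong'[OF refl])
    show "(\<lambda>k. pure_tensor R A B (p k \<odot>\<^bsub>A\<^esub> fst k) (snd k)) \<in> supp R p \<rightarrow> carrier (tensor R A B)"
      using ab by (auto intro!: pure_tensor_closed[OF assms(1,2)])
    fix k assume "k \<in> supp R p"
    note k = ab[OF this]
    have "basis_elt R k \<in> carrier (pair_alg R A B)" using pair_alg_basis[OF k(1,2)] by simp
    then show "tensor_class R A B (p k \<odot>\<^bsub>pair_alg R A B\<^esub> basis_elt R k) =
        pure_tensor R A B (p k \<odot>\<^bsub>A\<^esub> fst k) (snd k)"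
      using k by (simp add: lin_mapsD(3)[OF tensor_class_lin[OF assms(1,2)]] pure_tensor_def[symmetric]
          lin_mapsD(3)[OF pure_tensor_lin(1)[OF assms(1,2)]]) (simp add: pure_tensor_def)
  qed
  finally have x: "x = (\<Oplus>\<^bsub>tensor R A B\<^esub>k\<in>supp R p. pure_tensor R A B (p k \<odot>\<^bsub>A\<^esub> fst k) (snd k))" .
  obtain e where e: "bij_betw e {..<card (supp R p)} (supp R p)"
    using ex_bij_betw_nat_finite[OF fin_funsD(2)[OF pf]] by (auto simp: atLeast0LessThan)
  then have e': "supp R p = e ` {..<card (supp R p)}" "inj_on e {..<card (supp R p)}"
    by (auto simp: bij_betw_def)
  have "x = (\<Oplus>\<^bsub>tensor R A B\<^esub>i\<in>{..<card (supp R p)}. pure_tensor R A B (p (e i) \<odot>\<^bsub>A\<^esub> fst (e i)) (snd (e i)))"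
    unfolding x
    by (subst e'(1), rule T.M.finsum_reindex[OF _ e'(2)])
      (use ab in \<open>auto simp flip: e'(1) intro!: pure_tensor_closed[OF assms(1,2)]\<close>)
  moreover have "e i \<in> supp R p" if "i < card (supp R p)" for i using e that by (auto simp: bij_betw_def)
  ultimately show ?thesis
    using ab by (intro exI[of _ "card (supp R p)"] exI[of _ "\<lambda>i. p (e i) \<odot>\<^bsub>A\<^esub> fst (e i)"]
        exI[of _ "\<lambda>i. snd (e i)"]) auto
qed

end

text \<open>The values are defined by chosen preimages; the inclusion of kernels makes them
  independent of the choice.\<close>

lemma lin_maps_factor:
  assumes "module R A" "module R B" "module R C" "p \<in> lin_maps R A B" "p ` carrier A = carrier B"
    "h \<in> lin_maps R A C" "\<And>x. x \<in> carrier A \<Longrightarrow> p x = \<zero>\<^bsub>B\<^esub> \<Longrightarrow> h x = \<zero>\<^bsub>C\<^esub>"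
  shows "\<exists>g\<in>lin_maps R B C. \<forall>x\<in>carrier A. g (p x) = h x"
proof -
  interpret A: module R A by fact
  interpret B: module R B by fact
  interpret C: module R C by fact
  note p = lin_mapsD[OF assms(4)] and h = lin_mapsD[OF assms(6)]
  define g where "g y = h (inv_into (carrier A) p y)" for y
  have g: "g (p x) = h x" if x: "x \<in> carrier A" for x
  proof -
    let ?z = "inv_into (carrier A) p (p x)"
    have z: "?z \<in> carrier A" "p ?z = p x" using x by (auto intro: inv_into_into f_inv_into_f)
    have "p (?z \<ominus>\<^bsub>A\<^esub> x) = p x \<ominus>\<^bsub>B\<^esub> p x"
      using lin_maps_minus[OF assms(1,2,4) z(1) x] z(2) by simp
    then have "p (?z \<ominus>\<^bsub>A\<^esub> x) = \<zero>\<^bsub>B\<^esub>" using p(1)[OF x] by (simp add: B.M.minus_eq B.M.r_neg)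
    then have "h ?z \<ominus>\<^bsub>C\<^esub> h x = \<zero>\<^bsub>C\<^esub>"
      using assms(7)[of "?z \<ominus>\<^bsub>A\<^esub> x"] x z(1) lin_maps_minus[OF assms(1,3,6) z(1) x] by simp
    then show ?thesis unfolding g_def by (rule C.M.minus_eq_zeroD[OF _ h(1)[OF z(1)] h(1)[OF x]])
  qed
  have surj: "\<exists>x\<in>carrier A. y = p x" if "y \<in> carrier B" for y using assms(5) that by blast
  have "g \<in> lin_maps R B C"
  proof (rule lin_mapsI)
    fix y assume "y \<in> carrier B"
    then obtain x where x: "x \<in> carrier A" "y = p x" using surj by blast
    then show "g y \<in> carrier C" using g h(1) by simp
    {
      fix y' assume "y' \<in> carrier B"
      then obtain x' where x': "x' \<in> carrier A" "y' = p x'" using surj by blast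
      show "g (y \<oplus>\<^bsub>B\<^esub> y') = g y \<oplus>\<^bsub>C\<^esub> g y'"
        using g[of "x \<oplus>\<^bsub>A\<^esub> x'"] x x' g by (simp add: p h)
    }
    fix r assume "r \<in> carrier R"
    then show "g (r \<odot>\<^bsub>B\<^esub> y) = r \<odot>\<^bsub>C\<^esub> g y"
      using g[of "r \<odot>\<^bsub>A\<^esub> x"] x g by (simp add: p h)
  qed
  then show ?thesis using g by blast
qed

lemma alg_hom_factor:
  assumes "algebra R A" "algebra R B" "algebra R C" "p \<in> alg_hom R A B" "p ` carrier A = carrier B"
    "h \<in> alg_hom R A C" "\<And>x. x \<in> carrier A \<Longrightarrow> p x = \<zero>\<^bsub>B\<^esub> \<Longrightarrow> h x = \<zero>\<^bsub>C\<^esub>"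
  shows "\<exists>g\<in>alg_hom R B C. \<forall>x\<in>carrier A. g (p x) = h x"
proof -
  interpret A: algebra R A by fact
  interpret B: algebra R B by fact
  interpret C: algebra R C by fact
  obtain g where g: "g \<in> lin_maps R B C" "\<And>x. x \<in> carrier A \<Longrightarrow> g (p x) = h x"
    using lin_maps_factor[OF A.module B.module C.module alg_homD(1)[OF assms(4)] assms(5) alg_homD(1)[OF assms(6)]]
      assms(7) by blast
  have "g \<in> alg_hom R B C"
  proof (rule alg_homI[OF g(1)])
    show "g \<one>\<^bsub>B\<^esub> = \<one>\<^bsub>C\<^esub>"
      using g(2)[OF A.one_closed] by (simp add: alg_homD(3)[OF assms(4)] alg_homD(3)[OF assms(6)])
    fix y y' assume "y \<in> carrier B" "y' \<in> carrier B"
    then obtain x x' where "x \<in> carrier A" "y = p x" "x' \<in> carrier A" "y' = p x'" using assms(5) by blast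
    then show "g (y \<otimes>\<^bsub>B\<^esub> y') = g y \<otimes>\<^bsub>C\<^esub> g y'"
      using g(2)[of "x \<otimes>\<^bsub>A\<^esub> x'"] g(2) by (simp add: alg_homD(4)[OF assms(4)] alg_homD(4)[OF assms(6)])
  qed
  with g(2) show ?thesis by blast
qed

section \<open>Rees algebras as subalgebras of polynomial rings\<close>

context cring
begin

definition rees_cls :: "('a, 'n) module \<Rightarrow> ('n multiset \<Rightarrow> 'a) \<Rightarrow> ('n multiset \<Rightarrow> 'a) set set"
  where "rees_cls N p = rees_class R N (sym_class R N p)"

text \<open>\<open>rees_eval\<close> induces an algebra map on the symmetric algebra whose kernel is
  \<open>rees_ideal\<close>. This provides the algebra structure on the Rees algebra and reduces
  vanishing in it to vanishing of a polynomial.\<close>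

lemma rees_quotient:
  fixes N :: "('a, 'n) module"
  assumes N: "module R N" and \<phi>: "\<And>i. i < k \<Longrightarrow> \<phi> i \<in> lin_maps R N (self_module R)"
    and gen: "\<And>\<psi>. \<psi> \<in> lin_maps R N (self_module R) \<Longrightarrow>
      \<exists>c. (\<forall>i<k. c i \<in> carrier R) \<and> (\<forall>m\<in>carrier N. \<psi> m = (\<Oplus>i\<in>{..<k}. \<phi> i m \<otimes> c i))"
  shows "algebra R (rees_alg R N)"
    and "rees_cls N \<in> alg_hom R (poly_alg R N) (rees_alg R N)"
    and "carrier (rees_alg R N) = rees_cls N ` carrier (poly_alg R N)"
    and "p \<in> carrier (poly_alg R N) \<Longrightarrow>
      rees_cls N p = \<zero>\<^bsub>rees_alg R N\<^esub> \<longleftrightarrow> rees_eval k \<phi> p = \<zero>\<^bsub>pol UNIV\<^esub>"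
proof -
  note \<theta> = rees_eval[OF N \<phi>]
  note SN = sym_alg_algebra[OF N] and PN = poly_alg_algebra[of N]
  note sc = sym_class_alg_hom[OF N]
  interpret N: module R N by (rule N)
  interpret SN: algebra R "sym_alg R N" by (rule SN)
  have ker: "rees_eval k \<phi> p = \<zero>\<^bsub>pol UNIV\<^esub>" if "p \<in> carrier (poly_alg R N)" "sym_class R N p = \<zero>\<^bsub>sym_alg R N\<^esub>" for p
  proof (rule poly_hom_sym_ideal[OF N pol_algebra \<theta>(1)])
    show "(\<lambda>m. rees_eval k \<phi> (var R m)) \<in> lin_maps R N (pol UNIV)"
      by (rule lin_maps_cong[OF N form_lin[OF N \<phi>] \<theta>(2)])
    show "p \<in> sym_ideal R N"
      using that coset_eq_zero_iff[OF algebra.module[OF PN] ideal_submodule[OF PN sym_ideal_ideal[OF N]]]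
      by (simp add: sym_class_def sym_alg_def quot_simps)
  qed
  obtain \<theta>' where \<theta>': "\<theta>' \<in> alg_hom R (sym_alg R N) (pol UNIV)"
    "\<And>p. p \<in> carrier (poly_alg R N) \<Longrightarrow> \<theta>' (sym_class R N p) = rees_eval k \<phi> p"
    using alg_hom_factor[OF PN SN pol_algebra sc sym_alg_carrier[symmetric] \<theta>(1) ker] by blast
  \<comment> \<open>The zero map to the free module of rank zero shows that the intersection
    defining \<open>rees_ideal\<close> is over a nonempty family, hence stays within the
    carrier.\<close>
  have "rees_ideal R N \<subseteq> carrier (sym_alg R N)"
  proof -
    have "(\<lambda>m. \<zero>\<^bsub>std_free 0\<^esub>) \<in> lin_maps R N (std_free 0)"
    proof -
      interpret F: module R "std_free 0" by (rule std_free_module)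
      show ?thesis by (rule lin_mapsI) auto
    qed
    from rees_ideal_subset_sym_kernel[OF N free_std_free this] show ?thesis
      by (auto simp: sym_kernel_def a_kernel_def')
  qed
  then have "rees_ideal R N = a_kernel (sym_alg R N) (pol UNIV) \<theta>'"
    using rees_ideal_iff[OF N \<phi> gen] \<theta>'(2) by (auto simp: a_kernel_def' sym_alg_carrier)
  then have I: "ideal (rees_ideal R N) (sym_alg R N)"
    using alg_hom_kernel[OF SN pol_algebra \<theta>'(1)] by simp
  show "algebra R (rees_alg R N)" unfolding rees_alg_def by (rule quot_algebra[OF SN I])
  show "rees_cls N \<in> alg_hom R (poly_alg R N) (rees_alg R N)"
    using alg_hom_comp[OF sc coset_alg_hom[OF SN I]]
    by (simp add: rees_cls_def[abs_def] rees_alg_def rees_class_def)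
  show "carrier (rees_alg R N) = rees_cls N ` carrier (poly_alg R N)"
    by (auto simp: rees_alg_def quot_carrier sym_alg_carrier rees_cls_def rees_class_def)
  assume p: "p \<in> carrier (poly_alg R N)"
  then have "rees_cls N p = \<zero>\<^bsub>rees_alg R N\<^esub> \<longleftrightarrow> sym_class R N p \<in> rees_ideal R N"
    using coset_eq_zero_iff[OF SN.module ideal_submodule[OF SN I]]
    by (simp add: rees_cls_def rees_class_def rees_alg_def quot_simps sym_alg_carrier)
  then show "rees_cls N p = \<zero>\<^bsub>rees_alg R N\<^esub> \<longleftrightarrow> rees_eval k \<phi> p = \<zero>\<^bsub>pol UNIV\<^esub>"
    using rees_ideal_iff[OF N \<phi> gen p] by simp
qed

section \<open>Injectivity of a tensored embedding\<close>

lemma noetherian_solutions: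
  assumes "noetherian_ring R" "\<And>j i. j < l \<Longrightarrow> i < n \<Longrightarrow> a j i \<in> carrier R"
  obtains k :: nat and w where "\<And>u. u < k \<Longrightarrow> w u \<in> carrier (std_free n)"
    "\<And>u j. u < k \<Longrightarrow> j < l \<Longrightarrow> (\<Oplus>i\<in>{..<n}. a j i \<otimes> w u i) = \<zero>"
    "\<And>x. x \<in> carrier (std_free n) \<Longrightarrow> (\<And>j. j < l \<Longrightarrow> (\<Oplus>i\<in>{..<n}. a j i \<otimes> x i) = \<zero>) \<Longrightarrow>
      \<exists>c. (\<forall>u<k. c u \<in> carrier R) \<and> (\<forall>i. x i = (\<Oplus>u\<in>{..<k}. c u \<otimes> w u i))"
proof -
  interpret F: module R "std_free n" by (rule std_free_module)
  interpret S: module R "self_module R" by (rule self_module_module)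
  have xc: "x i \<in> carrier R" if "x \<in> carrier (std_free n)" for x i
    using lin_mapsD(1)[OF std_free_coord that] by simp
  define A where "A j x = (\<Oplus>\<^bsub>self_module R\<^esub>i\<in>{..<n}. x i \<odot>\<^bsub>self_module R\<^esub> a j i)" for j x
  have lin: "A j \<in> lin_maps R (std_free n) (self_module R)" if "j < l" for j
    unfolding A_def[abs_def] using assms(2) that
    by (intro lin_maps_sum lin_maps_smult_const std_free_module self_module_module std_free_coord) auto
  have eq: "A j x = (\<Oplus>i\<in>{..<n}. a j i \<otimes> x i)" if "j < l" "x \<in> carrier (std_free n)" for j x
    unfolding A_def using xc[OF that(2)] assms(2)[OF that(1)]
    by (subst self_module_finsum) (auto simp: m_comm intro!: finsum_cong')
  \<comment> \<open>The solution set is a common kernel of functionals on R^n, hence a submodule to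
    which finite generation applies.\<close>
  define H where "H = {x \<in> carrier (std_free n). \<forall>j<l. A j x = \<zero>}"
  have sub: "submodule H R (std_free n)"
    unfolding H_def
    by (rule F.submoduleI')
      (auto simp: lin_mapsD[OF lin] lin_maps_zero[OF std_free_module self_module_module lin])
  obtain k :: nat and w where
    w: "\<And>u. u < k \<Longrightarrow> w u \<in> H"
    "\<And>x. x \<in> H \<Longrightarrow> \<exists>c. (\<forall>u<k. c u \<in> carrier R) \<and> (\<forall>i. x i = (\<Oplus>u\<in>{..<k}. c u \<otimes> w u i))"
    by (rule noetherian_submodule_generators[OF assms(1) sub]) blast
  show ?thesis
  proof (rule that)
    show "w u \<in> carrier (std_free n)" if "u < k" for u using w(1)[OF that] by (simp add: H_def)
    show "(\<Oplus>i\<in>{..<n}. a j i \<otimes> w u i) = \<zero>" if "u < k" "j < l" for u j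
      using w(1)[OF that(1)] that(2) eq[of j "w u"] by (simp add: H_def)
    show "\<exists>c. (\<forall>u<k. c u \<in> carrier R) \<and> (\<forall>i. x i = (\<Oplus>u\<in>{..<k}. c u \<otimes> w u i))"
      if "x \<in> carrier (std_free n)" "\<And>j. j < l \<Longrightarrow> (\<Oplus>i\<in>{..<n}. a j i \<otimes> x i) = \<zero>" for x
      using that eq[of _ x] by (intro w(2)) (simp add: H_def)
  qed
qed

text \<open>The maps \<open>g \<mu>\<close> are the coordinates of \<open>Q \<otimes> N \<rightarrow> Q \<otimes> R[G]\<close>, the map obtained by
  tensoring the injection \<open>h\<close> with \<open>Q\<close>.\<close>

lemma flat_tensor_inj:
  fixes Q :: "('a, 'q) module" and N :: "('a, 'n) module"
  assumes noeth: "noetherian_ring R" and flat: "flat_module R Q" and N: "module R N"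
    and h: "h \<in> lin_maps R N (monoid_alg R G)"
    and inj: "\<And>y. y \<in> carrier N \<Longrightarrow> h y = \<zero>\<^bsub>monoid_alg R G\<^esub> \<Longrightarrow> y = \<zero>\<^bsub>N\<^esub>"
    and z: "z \<in> carrier (tensor R Q N)"
    and g: "\<And>\<mu>. g \<mu> \<in> lin_maps R (tensor R Q N) Q"
    and gp: "\<And>\<mu> s y. s \<in> carrier Q \<Longrightarrow> y \<in> carrier N \<Longrightarrow> g \<mu> (pure_tensor R Q N s y) = h y \<mu> \<odot>\<^bsub>Q\<^esub> s"
    and 0: "\<And>\<mu>. g \<mu> z = \<zero>\<^bsub>Q\<^esub>"
  shows "z = \<zero>\<^bsub>tensor R Q N\<^esub>"
proof -
  have mQ: "module R Q" using flat by (simp add: flat_module_def)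
  interpret Q: module R Q by (rule mQ)
  interpret N: module R N by (rule N)
  have mT: "module R (tensor R Q N)" by (rule tensor_module[OF mQ N])
  interpret T: module R "tensor R Q N" by (rule mT)
  let ?p = "pure_tensor R Q N"
  note pc = pure_tensor_closed[OF mQ N] and pl1 = pure_tensor_lin(1)[OF mQ N] and pl2 = pure_tensor_lin(2)[OF mQ N]
  from tensor_expand[OF mQ N z] obtain n :: nat and s y
    where sy': "\<forall>i<n. s i \<in> carrier Q \<and> y i \<in> carrier N"
    and zs: "z = (\<Oplus>\<^bsub>tensor R Q N\<^esub>i\<in>{..<n}. ?p (s i) (y i))"
    by (elim exE conjE) blast
  have sy: "s i \<in> carrier Q" "y i \<in> carrier N" if "i < n" for i using sy' that by auto
  have hf: "h (y i) \<in> fin_funs R (carrier G)" if "i < n" for i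
    using lin_mapsD(1)[OF h sy(2)[OF that]] by (simp add: monoid_alg_simps)
  note hc = fin_funsD(1)[OF hf]
  \<comment> \<open>With z = \<Sum> s_i \<otimes> y_i, the vanishing of all coordinates says that
    the tuple of the s_i solves the linear system whose coefficients are the coordinates of the
    h(y_i).\<close>
  have sum0: "(\<Oplus>\<^bsub>Q\<^esub>i\<in>{..<n}. h (y i) \<mu> \<odot>\<^bsub>Q\<^esub> s i) = \<zero>\<^bsub>Q\<^esub>" for \<mu>
  proof -
    have "\<zero>\<^bsub>Q\<^esub> = g \<mu> (\<Oplus>\<^bsub>tensor R Q N\<^esub>i\<in>{..<n}. ?p (s i) (y i))" using 0 zs by simp
    also have "\<dots> = (\<Oplus>\<^bsub>Q\<^esub>i\<in>{..<n}. g \<mu> (?p (s i) (y i)))"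
      using sy by (intro lin_maps_finsum[OF mT mQ g]) (auto intro!: pc)
    also have "\<dots> = (\<Oplus>\<^bsub>Q\<^esub>i\<in>{..<n}. h (y i) \<mu> \<odot>\<^bsub>Q\<^esub> s i)"
      using sy hc by (intro Q.M.finsum_cong') (auto simp: gp)
    finally show ?thesis by simp
  qed
  \<comment> \<open>Only the coordinates in the supports of the h(y_i) give nontrivial equations, so
    a system with finitely many rows \<open>a\<close> is enough.\<close>
  have "finite (\<Union>i\<in>{..<n}. supp R (h (y i)))" using fin_funsD(2)[OF hf] by auto
  then obtain l :: nat and e where e: "(\<Union>i\<in>{..<n}. supp R (h (y i))) = e ` {..<l}"
    by (auto simp: finite_conv_nat_seg_image lessThan_def)
  define a where "a j i = h (y i) (e j)" for j i
  have a: "a j i \<in> carrier R" if "j < l" "i < n" for j i using hc that by (simp add: a_def)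
  obtain k :: nat and w where w: "\<And>u. u < k \<Longrightarrow> w u \<in> carrier (std_free n)"
    "\<And>u j. u < k \<Longrightarrow> j < l \<Longrightarrow> (\<Oplus>i\<in>{..<n}. a j i \<otimes> w u i) = \<zero>"
    "\<And>x. x \<in> carrier (std_free n) \<Longrightarrow> (\<And>j. j < l \<Longrightarrow> (\<Oplus>i\<in>{..<n}. a j i \<otimes> x i) = \<zero>) \<Longrightarrow>
      \<exists>c. (\<forall>u<k. c u \<in> carrier R) \<and> (\<forall>i. x i = (\<Oplus>u\<in>{..<k}. c u \<otimes> w u i))"
    by (rule noetherian_solutions[where a = a and l = l and n = n, OF noeth a]) blast+
  have wc: "w u i \<in> carrier R" if "u < k" for u i
    using lin_mapsD(1)[OF std_free_coord w(1)[OF that]] by simp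
  have sol: "(\<Oplus>\<^bsub>Q\<^esub>i\<in>{..<n}. a j i \<odot>\<^bsub>Q\<^esub> s i) = \<zero>\<^bsub>Q\<^esub>" if "j < l" for j
    unfolding a_def by (rule sum0)
  have "\<exists>d. (\<forall>u. d u \<in> carrier Q) \<and> (\<forall>i<n. s i = (\<Oplus>\<^bsub>Q\<^esub>u\<in>{..<k}. w u i \<odot>\<^bsub>Q\<^esub> d u))"
    by (rule flat_solutions[where a = a and l = l, OF flat]) (fact a sy(1) sol wc w(3))+
  then obtain d where d': "\<forall>u. d u \<in> carrier Q" "\<forall>i<n. s i = (\<Oplus>\<^bsub>Q\<^esub>u\<in>{..<k}. w u i \<odot>\<^bsub>Q\<^esub> d u)"
    by (elim exE conjE) blast
  have d: "d u \<in> carrier Q" "i < n \<Longrightarrow> s i = (\<Oplus>\<^bsub>Q\<^esub>u\<in>{..<k}. w u i \<odot>\<^bsub>Q\<^esub> d u)" for u i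
    using d' by auto
  \<comment> \<open>Each w_u solves the system over R, so \<open>h\<close> sends \<Sum>_i w_u(i) y_i
    to an element with all coordinates zero; injectivity of \<open>h\<close> makes the sum itself
    zero.\<close>
  have rel: "(\<Oplus>\<^bsub>N\<^esub>i\<in>{..<n}. w u i \<odot>\<^bsub>N\<^esub> y i) = \<zero>\<^bsub>N\<^esub>" if u: "u < k" for u
  proof (rule inj)
    show "(\<Oplus>\<^bsub>N\<^esub>i\<in>{..<n}. w u i \<odot>\<^bsub>N\<^esub> y i) \<in> carrier N"
      using wc[OF u] sy by (intro N.M.finsum_closed) auto
    interpret P: module R "monoid_alg R G" by (rule monoid_alg_module)
    have hsum: "h (\<Oplus>\<^bsub>N\<^esub>i\<in>{..<n}. w u i \<odot>\<^bsub>N\<^esub> y i) = (\<Oplus>\<^bsub>monoid_alg R G\<^esub>i\<in>{..<n}. h (w u i \<odot>\<^bsub>N\<^esub> y i))"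
      using wc[OF u] sy by (intro lin_maps_finsum[OF N P.module_axioms h]) auto
    have coord: "(\<lambda>p. p \<mu>) \<in> lin_maps R (monoid_alg R G) (self_module R)" for \<mu>
      by (rule lin_mapsI) (auto simp: monoid_alg_simps fin_funsD)
    show "h (\<Oplus>\<^bsub>N\<^esub>i\<in>{..<n}. w u i \<odot>\<^bsub>N\<^esub> y i) = \<zero>\<^bsub>monoid_alg R G\<^esub>"
      unfolding hsum monoid_alg_simps(2)
    proof
      fix \<mu>
      have "(\<Oplus>\<^bsub>monoid_alg R G\<^esub>i\<in>{..<n}. h (w u i \<odot>\<^bsub>N\<^esub> y i)) \<mu> = (\<Oplus>\<^bsub>self_module R\<^esub>i\<in>{..<n}. h (w u i \<odot>\<^bsub>N\<^esub> y i) \<mu>)"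
        using wc[OF u] sy lin_mapsD(1)[OF h]
        by (intro lin_maps_finsum[OF P.module_axioms self_module_module coord]) auto
      also have "\<dots> = (\<Oplus>i\<in>{..<n}. h (w u i \<odot>\<^bsub>N\<^esub> y i) \<mu>)"
      proof (rule self_module_finsum)
        fix i assume "i \<in> {..<n}"
        then have "h (w u i \<odot>\<^bsub>N\<^esub> y i) \<in> carrier (monoid_alg R G)"
          using wc[OF u] sy by (intro lin_mapsD(1)[OF h]) auto
        then show "h (w u i \<odot>\<^bsub>N\<^esub> y i) \<mu> \<in> carrier R" by (simp add: monoid_alg_simps fin_funsD)
      qed simp
      also have "\<dots> = (\<Oplus>i\<in>{..<n}. h (y i) \<mu> \<otimes> w u i)"
        using wc[OF u] sy hc by (intro finsum_cong') (auto simp: lin_mapsD(3)[OF h] monoid_alg_simps m_comm)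
      also have "\<dots> = \<zero>"
      proof (cases "\<mu> \<in> e ` {..<l}")
        case True
        then show ?thesis using w(2)[OF u] by (auto simp: a_def)
      next
        case False
        then have "h (y i) \<mu> = \<zero>" if "i < n" for i using e that by (auto simp: supp_def)
        then show ?thesis using wc[OF u] by (intro add.finprod_one_eqI) auto
      qed
      finally show "(\<Oplus>\<^bsub>monoid_alg R G\<^esub>i\<in>{..<n}. h (w u i \<odot>\<^bsub>N\<^esub> y i)) \<mu> = \<zero>" .
    qed
  qed
  \<comment> \<open>Substituting s_i = \<Sum>_u w_u(i) d_u and moving the scalars across the tensor
    sign regroups \<open>z\<close> as \<Sum>_u d_u \<otimes> (\<Sum>_i w_u(i) y_i), in which every
    second factor is zero.\<close>
  have "z = (\<Oplus>\<^bsub>tensor R Q N\<^esub>i\<in>{..<n}. \<Oplus>\<^bsub>tensor R Q N\<^esub>u\<in>{..<k}. ?p (d u) (w u i \<odot>\<^bsub>N\<^esub> y i))"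
    unfolding zs
  proof (rule T.M.finsum_cong'[OF refl])
    show "(\<lambda>i. \<Oplus>\<^bsub>tensor R Q N\<^esub>u\<in>{..<k}. ?p (d u) (w u i \<odot>\<^bsub>N\<^esub> y i)) \<in> {..<n} \<rightarrow> carrier (tensor R Q N)"
      using wc d sy by (auto intro!: T.M.finsum_closed pc)
    fix i assume "i \<in> {..<n}"
    then have i: "i < n" by simp
    have "?p (s i) (y i) = ?p (\<Oplus>\<^bsub>Q\<^esub>u\<in>{..<k}. w u i \<odot>\<^bsub>Q\<^esub> d u) (y i)" using d(2)[OF i] by simp
    also have "\<dots> = (\<Oplus>\<^bsub>tensor R Q N\<^esub>u\<in>{..<k}. ?p (w u i \<odot>\<^bsub>Q\<^esub> d u) (y i))"
      using wc d by (intro lin_maps_finsum[OF mQ mT pl1[OF sy(2)[OF i]]]) auto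
    also have "\<dots> = (\<Oplus>\<^bsub>tensor R Q N\<^esub>u\<in>{..<k}. ?p (d u) (w u i \<odot>\<^bsub>N\<^esub> y i))"
      using wc d sy(2)[OF i]
      by (intro T.M.finsum_cong') (auto simp: lin_mapsD(3)[OF pl1] lin_mapsD(3)[OF pl2] intro!: pc)
    finally show "?p (s i) (y i) = (\<Oplus>\<^bsub>tensor R Q N\<^esub>u\<in>{..<k}. ?p (d u) (w u i \<odot>\<^bsub>N\<^esub> y i))" .
  qed
  also have "\<dots> = (\<Oplus>\<^bsub>tensor R Q N\<^esub>u\<in>{..<k}. \<Oplus>\<^bsub>tensor R Q N\<^esub>i\<in>{..<n}. ?p (d u) (w u i \<odot>\<^bsub>N\<^esub> y i))"
    using wc d sy by (intro T.M.finsum_finsum_swap) (auto intro!: pc)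
  also have "\<dots> = \<zero>\<^bsub>tensor R Q N\<^esub>"
  proof (rule T.M.add.finprod_one_eqI)
    fix u assume "u \<in> {..<k}"
    then have u: "u < k" by simp
    have "(\<Oplus>\<^bsub>tensor R Q N\<^esub>i\<in>{..<n}. ?p (d u) (w u i \<odot>\<^bsub>N\<^esub> y i)) = ?p (d u) (\<Oplus>\<^bsub>N\<^esub>i\<in>{..<n}. w u i \<odot>\<^bsub>N\<^esub> y i)"
      using wc[OF u] sy by (intro lin_maps_finsum[OF N mT pl2[OF d(1)], symmetric]) auto
    also have "\<dots> = \<zero>\<^bsub>tensor R Q N\<^esub>"
      unfolding rel[OF u] by (rule lin_maps_zero[OF N mT pl2[OF d(1)]])
    finally show "(\<Oplus>\<^bsub>tensor R Q N\<^esub>i\<in>{..<n}. ?p (d u) (w u i \<odot>\<^bsub>N\<^esub> y i)) = \<zero>\<^bsub>tensor R Q N\<^esub>" .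
  qed
  finally show ?thesis .
qed

end

section \<open>Isomorphism of algebras with a common image\<close>

lemma lin_map_inj:
  assumes "module R M" "module R N" "h \<in> lin_maps R M N"
    "\<And>x. x \<in> carrier M \<Longrightarrow> h x = \<zero>\<^bsub>N\<^esub> \<Longrightarrow> x = \<zero>\<^bsub>M\<^esub>"
  shows "inj_on h (carrier M)"
proof (rule inj_onI)
  interpret M: module R M by fact
  interpret N: module R N by fact
  fix x y assume xy: "x \<in> carrier M" "y \<in> carrier M" "h x = h y"
  have "h (x \<ominus>\<^bsub>M\<^esub> y) = h y \<ominus>\<^bsub>N\<^esub> h y"
    using lin_maps_minus[OF assms(1-3) xy(1,2)] xy(3) by simp
  also have "\<dots> = \<zero>\<^bsub>N\<^esub>" using lin_mapsD(1)[OF assms(3) xy(2)] by (simp add: N.M.minus_eq N.M.r_neg)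
  finally have "x \<ominus>\<^bsub>M\<^esub> y = \<zero>\<^bsub>M\<^esub>" using xy by (intro assms(4)) auto
  then show "x = y" by (rule M.M.minus_eq_zeroD[OF _ xy(1,2)])
qed

text \<open>The map is \<open>\<alpha>\<close> followed by the inverse of \<open>\<beta>\<close> on
  the common image, and each required identity is tested after applying the injective
  \<open>\<beta>\<close>. The conclusion keeps the equation relating \<phi> to the embeddings, since
  specific values of the isomorphism are later computed from it.\<close>

lemma alg_iso_of_embeddings:
  assumes A: "algebra S A" and B: "algebra S B"
    and \<alpha>: "\<alpha> \<in> alg_hom S A P" "inj_on \<alpha> (carrier A)"
    and \<beta>: "\<beta> \<in> alg_hom S B P" "inj_on \<beta> (carrier B)"
    and im: "\<alpha> ` carrier A = \<beta> ` carrier B"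
  shows "\<exists>\<phi>\<in>alg_iso S A B. \<forall>x\<in>carrier A. \<beta> (\<phi> x) = \<alpha> x"
proof -
  interpret A: algebra S A by (rule A)
  interpret B: algebra S B by (rule B)
  define \<phi> where "\<phi> x = inv_into (carrier B) \<beta> (\<alpha> x)" for x
  have \<phi>: "\<phi> x \<in> carrier B" "\<beta> (\<phi> x) = \<alpha> x" if "x \<in> carrier A" for x
  proof -
    have "\<alpha> x \<in> \<beta> ` carrier B" using im that by blast
    then show "\<phi> x \<in> carrier B" "\<beta> (\<phi> x) = \<alpha> x"
      unfolding \<phi>_def by (rule inv_into_into, rule f_inv_into_f)
  qed
  have eq: "\<phi> x = y" if "x \<in> carrier A" "y \<in> carrier B" "\<beta> y = \<alpha> x" for x y
    using inj_onD[OF \<beta>(2)] \<phi>[OF that(1)] that(2,3) by metis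
  note a = lin_mapsD[OF alg_homD(1)[OF \<alpha>(1)]] alg_homD(3,4)[OF \<alpha>(1)]
  note b = lin_mapsD[OF alg_homD(1)[OF \<beta>(1)]] alg_homD(3,4)[OF \<beta>(1)]
  have "\<phi> \<in> lin_maps S A B"
    by (rule lin_mapsI) (auto simp: a b \<phi> intro!: eq)
  moreover have "\<phi> \<in> ring_iso A B"
  proof (rule ring_iso_memI)
    show "bij_betw \<phi> (carrier A) (carrier B)"
    proof (rule bij_betwI')
      fix x y assume xy: "x \<in> carrier A" "y \<in> carrier A"
      show "\<phi> x = \<phi> y \<longleftrightarrow> x = y"
        using \<phi>(2)[OF xy(1)] \<phi>(2)[OF xy(2)] inj_onD[OF \<alpha>(2) _ xy] by metis
    next
      fix y assume "y \<in> carrier B"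
      then have "\<beta> y \<in> \<alpha> ` carrier A" using im by blast
      then obtain x where "x \<in> carrier A" "\<beta> y = \<alpha> x" by blast
      then show "\<exists>x\<in>carrier A. y = \<phi> x" using eq[OF _ \<open>y \<in> carrier B\<close>] by metis
    qed (rule \<phi>)
  qed (auto simp: a b \<phi> intro!: eq)
  ultimately show ?thesis using \<phi>(2) by (auto simp: alg_iso_def)
qed

lemma (in algebra) restrict_scalars_finsum:
  assumes "module M A" "finite I" "\<And>i. i \<in> I \<Longrightarrow> u i \<in> carrier A"
  shows "finsum (restrict_scalars M A) u I = finsum A u I"
proof -
  interpret A: module M A by fact
  interpret B: module R "restrict_scalars M A" by (rule restrict_scalars_module[OF assms(1)])
  from assms(2,3) show ?thesis
  proof (induction I rule: finite_induct)
    case (insert a I)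
    then show ?case
      by (subst B.M.finsum_insert, auto)
  qed simp
qed

section \<open>Generators of the dual of a base change\<close>

context cring
begin

text \<open>Write \<open>M\<close> as R^n modulo a submodule \<open>K\<close> generated by a_1, ...,
  a_l. A linear map from \<open>M\<close> to a module is the tuple of its values on the generators,
  subject to the equations given by the a_j. Over R the solutions are spanned by finitely many w_u,
  which define the \<phi>_u; by the equational criterion the same w_u span the solutions in
  \<open>S\<close>. The conclusions are joined in one lemma because a single list of functionals
  must generate both duals.\<close>

lemma noetherian_dual_generators:
  fixes S :: "('a, 's) module" and M :: "('a, 'm) module"
  assumes noeth: "noetherian_ring R" and M: "fin_gen_module R M" and S: "algebra R S"
    and flat: "flat_module R S"
  obtains k :: nat and \<phi> where "\<And>i. i < k \<Longrightarrow> \<phi> i \<in> lin_maps R M (self_module R)"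
    "\<And>\<psi>. \<psi> \<in> lin_maps R M (self_module R) \<Longrightarrow>
      \<exists>c. (\<forall>i<k. c i \<in> carrier R) \<and> (\<forall>m\<in>carrier M. \<psi> m = (\<Oplus>i\<in>{..<k}. \<phi> i m \<otimes> c i))"
    "\<And>\<psi>. \<psi> \<in> lin_maps S (base_change R S M) (self_module S) \<Longrightarrow>
      \<exists>c. (\<forall>i<k. c i \<in> carrier S) \<and> (\<forall>x\<in>carrier (base_change R S M). \<psi> x =
        (\<Oplus>\<^bsub>S\<^esub>i\<in>{..<k}. base_lift S (self_module S) (\<lambda>m. \<phi> i m \<odot>\<^bsub>S\<^esub> \<one>\<^bsub>S\<^esub>) x \<otimes>\<^bsub>S\<^esub> c i))"
proof -
  interpret S: algebra R S by (rule S)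
  have cS: "cring S" by (rule S.M_cring)
  have mM: "module R M" using M by (simp add: fin_gen_module_def)
  interpret M: module R M by (rule mM)
  note mR = self_module_module
  obtain A where A: "finite A" "A \<subseteq> carrier M" "submodule_span R M A = carrier M"
    using M by (auto simp: fin_gen_module_def)
  obtain n :: nat and m where m: "A = m ` {..<n}"
    using A(1) by (auto simp: finite_conv_nat_seg_image lessThan_def)
  have mc: "m i \<in> carrier M" if "i < n" for i using A(2) m that by auto
  interpret F: module R "std_free n" by (rule std_free_module)
  have e: "basis_elt R i \<in> carrier (std_free n)" if "i < n" for i
    using that by (simp add: std_free_carrier basis_elt_closed)
  have xc: "x i \<in> carrier R" if "x \<in> carrier (std_free n)" for x i
    using lin_mapsD(1)[OF std_free_coord that] by simp
  define \<pi> where "\<pi> c = (\<Oplus>\<^bsub>M\<^esub>i\<in>{..<n}. c i \<odot>\<^bsub>M\<^esub> m i)" for c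
  have \<pi>: "\<pi> \<in> lin_maps R (std_free n) M"
    unfolding \<pi>_def[abs_def]
    by (intro lin_maps_sum lin_maps_smult_const std_free_module mM std_free_coord mc) auto
  have \<pi>e: "\<pi> (basis_elt R i) = m i" if "i < n" for i
  proof -
    have "\<pi> (basis_elt R i) = (\<Oplus>\<^bsub>M\<^esub>i'\<in>{..<n}. if i' = i then m i' else \<zero>\<^bsub>M\<^esub>)"
      unfolding \<pi>_def using mc by (intro M.M.finsum_cong') (auto simp: basis_elt_def)
    also have "\<dots> = m i" using mc that by (intro M.M.add.finprod_singleton_swap) auto
    finally show ?thesis .
  qed
  have \<pi>surj: "\<pi> ` carrier (std_free n) = carrier M"
  proof
    show "\<pi> ` carrier (std_free n) \<subseteq> carrier M" using lin_mapsD(1)[OF \<pi>] by blast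
    have "m i \<in> \<pi> ` carrier (std_free n)" if "i < n" for i
      using \<pi>e[OF that] e[OF that] by (metis imageI)
    then have "A \<subseteq> \<pi> ` carrier (std_free n)" by (auto simp: m)
    then show "carrier M \<subseteq> \<pi> ` carrier (std_free n)"
      using submodule_span_minimal[OF submodule_image[OF std_free_module mM \<pi> F.carrier_is_submodule]] A(3)
      by blast
  qed
  \<comment> \<open>The relations among the generators of \<open>M\<close>; Noetherianity makes them
    finitely generated, so that the linear system has finitely many rows.\<close>
  define K where "K = {c \<in> carrier (std_free n). \<pi> c \<in> {\<zero>\<^bsub>M\<^esub>}}"
  have K: "submodule K R (std_free n)"
    unfolding K_def by (rule submodule_vimage[OF std_free_module mM \<pi> submodule_zero[OF mM]])
  obtain l :: nat and a where a: "\<And>j. j < l \<Longrightarrow> a j \<in> K"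
    "\<And>x. x \<in> K \<Longrightarrow> \<exists>c. (\<forall>j<l. c j \<in> carrier R) \<and> (\<forall>i. x i = (\<Oplus>j\<in>{..<l}. c j \<otimes> a j i))"
    by (rule noetherian_submodule_generators[OF noeth K]) blast
  have aF: "a j \<in> carrier (std_free n)" "\<pi> (a j) = \<zero>\<^bsub>M\<^esub>" if "j < l" for j
    using a(1)[OF that] by (auto simp: K_def)
  have ac: "a j i \<in> carrier R" if "j < l" for i j by (rule xc[OF aF(1)[OF that]])
  obtain k :: nat and w where w: "\<And>u. u < k \<Longrightarrow> w u \<in> carrier (std_free n)"
    "\<And>u j. u < k \<Longrightarrow> j < l \<Longrightarrow> (\<Oplus>i\<in>{..<n}. a j i \<otimes> w u i) = \<zero>"
    "\<And>x. x \<in> carrier (std_free n) \<Longrightarrow> (\<And>j. j < l \<Longrightarrow> (\<Oplus>i\<in>{..<n}. a j i \<otimes> x i) = \<zero>) \<Longrightarrow>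
      \<exists>c. (\<forall>u<k. c u \<in> carrier R) \<and> (\<forall>i. x i = (\<Oplus>u\<in>{..<k}. c u \<otimes> w u i))"
    by (rule noetherian_solutions[where a = a and l = l and n = n, OF noeth ac]) blast+
  have wc: "w u i \<in> carrier R" if "u < k" for u i by (rule xc[OF w(1)[OF that]])
  \<comment> \<open>Pairing with the solution w_u is a functional on R^n that vanishes on the
    relations a_j, hence on \<open>K\<close>, so it descends to \<open>M\<close> with value w_u(i)
    on the i-th generator.\<close>
  have "\<exists>\<phi>\<in>lin_maps R M (self_module R). \<forall>i<n. \<phi> (m i) = w u i" if u: "u < k" for u
  proof -
    define h where "h c = (\<Oplus>\<^bsub>self_module R\<^esub>i\<in>{..<n}. c i \<odot>\<^bsub>self_module R\<^esub> w u i)" for c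
    have h: "h \<in> lin_maps R (std_free n) (self_module R)"
      unfolding h_def[abs_def] using wc[OF u]
      by (intro lin_maps_sum lin_maps_smult_const std_free_module mR std_free_coord) auto
    have heq: "h c = (\<Oplus>i\<in>{..<n}. c i \<otimes> w u i)" if "c \<in> carrier (std_free n)" for c
      unfolding h_def using xc[OF that] wc[OF u] by (subst self_module_finsum) auto
    have ker: "h x = \<zero>\<^bsub>self_module R\<^esub>" if x: "x \<in> carrier (std_free n)" "\<pi> x = \<zero>\<^bsub>M\<^esub>" for x
    proof -
      have "x \<in> K" using x by (simp add: K_def)
      then obtain c where c: "\<And>j. j < l \<Longrightarrow> c j \<in> carrier R" "\<And>i. x i = (\<Oplus>j\<in>{..<l}. c j \<otimes> a j i)"
        using a(2) by blast
      have "x = (\<Oplus>\<^bsub>std_free n\<^esub>j\<in>{..<l}. c j \<odot>\<^bsub>std_free n\<^esub> a j)"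
      proof
        fix i
        have "(\<Oplus>\<^bsub>std_free n\<^esub>j\<in>{..<l}. c j \<odot>\<^bsub>std_free n\<^esub> a j) i = (\<Oplus>j\<in>{..<l}. (c j \<odot>\<^bsub>std_free n\<^esub> a j) i)"
          by (rule std_free_finsum) (use c(1) aF in auto)
        then show "x i = (\<Oplus>\<^bsub>std_free n\<^esub>j\<in>{..<l}. c j \<odot>\<^bsub>std_free n\<^esub> a j) i"
          by (simp add: c(2) std_free_simps)
      qed
      then have "h x = (\<Oplus>\<^bsub>self_module R\<^esub>j\<in>{..<l}. h (c j \<odot>\<^bsub>std_free n\<^esub> a j))"
        using c(1) aF by (simp only:) (rule lin_maps_finsum[OF std_free_module mR h], auto)
      also have "\<dots> = \<zero>\<^bsub>self_module R\<^esub>"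
      proof -
        interpret Q: module R "self_module R" by (rule mR)
        show ?thesis
        proof (rule Q.M.add.finprod_one_eqI)
          fix j assume "j \<in> {..<l}"
          then have j: "j < l" by simp
          show "h (c j \<odot>\<^bsub>std_free n\<^esub> a j) = \<zero>\<^bsub>self_module R\<^esub>"
            using c(1)[OF j] by (simp add: lin_mapsD(3)[OF h _ aF(1)[OF j]] heq[OF aF(1)[OF j]] w(2)[OF u j])
        qed
      qed
      finally show ?thesis .
    qed
    obtain \<phi> where \<phi>: "\<phi> \<in> lin_maps R M (self_module R)" "\<And>x. x \<in> carrier (std_free n) \<Longrightarrow> \<phi> (\<pi> x) = h x"
      using lin_maps_factor[OF std_free_module mM mR \<pi> \<pi>surj h ker] by blast
    have "\<phi> (m i) = w u i" if i: "i < n" for i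
    proof -
      have "\<phi> (m i) = (\<Oplus>i'\<in>{..<n}. if i' = i then w u i' else \<zero>)"
        unfolding \<pi>e[OF i, symmetric] \<phi>(2)[OF e[OF i]] heq[OF e[OF i]]
        using wc[OF u] by (intro finsum_cong') (auto simp: basis_elt_def)
      also have "\<dots> = w u i" using wc[OF u] i by (intro add.finprod_singleton_swap) auto
      finally show ?thesis .
    qed
    with \<phi>(1) show ?thesis by blast
  qed
  then have "\<forall>u. \<exists>\<phi>. u < k \<longrightarrow> \<phi> \<in> lin_maps R M (self_module R) \<and> (\<forall>i<n. \<phi> (m i) = w u i)"
    by blast
  from choice[OF this] obtain \<phi>
    where "\<forall>u. u < k \<longrightarrow> \<phi> u \<in> lin_maps R M (self_module R) \<and> (\<forall>i<n. \<phi> u (m i) = w u i)" by blast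
  then have \<phi>: "\<phi> u \<in> lin_maps R M (self_module R)" "i < n \<Longrightarrow> \<phi> u (m i) = w u i" if "u < k" for u i
    using that by auto
  \<comment> \<open>An expansion that holds on the generators holds on \<open>M\<close>. The target
    is arbitrary, as values in R and values in \<open>S\<close> both occur below.\<close>
  have ext: "\<eta> x = (\<Oplus>\<^bsub>Q\<^esub>u\<in>{..<k}. \<phi> u x \<odot>\<^bsub>Q\<^esub> d u)"
    if Q: "module R Q" and \<eta>: "\<eta> \<in> lin_maps R M Q" and d: "\<And>u. u < k \<Longrightarrow> d u \<in> carrier Q"
      and gens: "\<And>i. i < n \<Longrightarrow> \<eta> (m i) = (\<Oplus>\<^bsub>Q\<^esub>u\<in>{..<k}. w u i \<odot>\<^bsub>Q\<^esub> d u)" and x: "x \<in> carrier M"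
    for Q :: "('a, 'q, 'z) module_scheme" and \<eta> d x
  proof (rule lin_maps_eq_on_span[OF mM Q \<eta> _ A(3,2) _ x])
    interpret Q: module R Q by (rule Q)
    show "(\<lambda>x. \<Oplus>\<^bsub>Q\<^esub>u\<in>{..<k}. \<phi> u x \<odot>\<^bsub>Q\<^esub> d u) \<in> lin_maps R M Q"
      by (intro lin_maps_sum lin_maps_smult_const mM Q \<phi> d) auto
    fix y assume "y \<in> A"
    then obtain i where i: "i < n" "y = m i" by (auto simp: m)
    have "(\<Oplus>\<^bsub>Q\<^esub>u\<in>{..<k}. w u i \<odot>\<^bsub>Q\<^esub> d u) = (\<Oplus>\<^bsub>Q\<^esub>u\<in>{..<k}. \<phi> u y \<odot>\<^bsub>Q\<^esub> d u)"
      unfolding i(2) using i wc d by (intro Q.M.finsum_cong') (auto simp: \<phi>(2))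
    then show "\<eta> y = (\<Oplus>\<^bsub>Q\<^esub>u\<in>{..<k}. \<phi> u y \<odot>\<^bsub>Q\<^esub> d u)" by (simp add: i(2) gens[OF i(1)])
  qed
  \<comment> \<open>The values of a linear map on the generators satisfy every relation a_j, so they
    solve the system in the target.\<close>
  have rel: "(\<Oplus>\<^bsub>Q\<^esub>i\<in>{..<n}. a j i \<odot>\<^bsub>Q\<^esub> \<eta> (m i)) = \<zero>\<^bsub>Q\<^esub>"
    if Q: "module R Q" and \<eta>: "\<eta> \<in> lin_maps R M Q" and j: "j < l" for Q :: "('a, 'q, 'z) module_scheme" and \<eta> j
  proof -
    interpret Q: module R Q by (rule Q)
    have "\<zero>\<^bsub>Q\<^esub> = \<eta> (\<pi> (a j))" using aF(2)[OF j] lin_maps_zero[OF mM Q \<eta>] by simp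
    also have "\<dots> = (\<Oplus>\<^bsub>Q\<^esub>i\<in>{..<n}. \<eta> (a j i \<odot>\<^bsub>M\<^esub> m i))"
      unfolding \<pi>_def using ac[OF j] mc by (intro lin_maps_finsum[OF mM Q \<eta>]) auto
    also have "\<dots> = (\<Oplus>\<^bsub>Q\<^esub>i\<in>{..<n}. a j i \<odot>\<^bsub>Q\<^esub> \<eta> (m i))"
      using ac[OF j] mc lin_mapsD(1)[OF \<eta>] by (intro Q.M.finsum_cong') (auto simp: lin_mapsD(3)[OF \<eta>])
    finally show ?thesis by simp
  qed
  show ?thesis
  proof (rule that)
    show "\<phi> i \<in> lin_maps R M (self_module R)" if "i < k" for i by (rule \<phi>(1)[OF that])
  next
    fix \<psi> assume \<psi>: "\<psi> \<in> lin_maps R M (self_module R)"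
    have \<psi>c: "\<psi> (m i) \<in> carrier R" if "i < n" for i using lin_mapsD(1)[OF \<psi> mc[OF that]] by simp
    define x where "x = (\<lambda>i. if i < n then \<psi> (m i) else \<zero>)"
    have x: "x \<in> carrier (std_free n)"
      unfolding std_free_carrier by (rule fin_funsI[where A = "{..<n}"]) (use \<psi>c in \<open>auto simp: x_def\<close>)
    have "(\<Oplus>i\<in>{..<n}. a j i \<otimes> x i) = \<zero>" if j: "j < l" for j
    proof -
      have "(\<Oplus>i\<in>{..<n}. a j i \<otimes> x i) = (\<Oplus>i\<in>{..<n}. a j i \<odot>\<^bsub>self_module R\<^esub> \<psi> (m i))"
        using ac[OF j] \<psi>c by (intro finsum_cong') (auto simp: x_def)
      also have "\<dots> = (\<Oplus>\<^bsub>self_module R\<^esub>i\<in>{..<n}. a j i \<odot>\<^bsub>self_module R\<^esub> \<psi> (m i))"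
        using ac[OF j] \<psi>c by (subst self_module_finsum) auto
      also have "\<dots> = \<zero>" using rel[OF mR \<psi> j] by simp
      finally show ?thesis .
    qed
    from w(3)[OF x this] obtain c where c: "\<And>u. u < k \<Longrightarrow> c u \<in> carrier R"
      "\<And>i. x i = (\<Oplus>u\<in>{..<k}. c u \<otimes> w u i)" by blast
    have cc: "\<And>u. u < k \<Longrightarrow> c u \<in> carrier (self_module R)" using c(1) by simp
    have "\<psi> (m i) = (\<Oplus>\<^bsub>self_module R\<^esub>u\<in>{..<k}. w u i \<odot>\<^bsub>self_module R\<^esub> c u)" if "i < n" for i
    proof -
      have "\<psi> (m i) = (\<Oplus>u\<in>{..<k}. c u \<otimes> w u i)" using c(2)[of i] that by (simp add: x_def)
      also have "\<dots> = (\<Oplus>u\<in>{..<k}. w u i \<odot>\<^bsub>self_module R\<^esub> c u)"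
        using c(1) wc by (intro finsum_cong') (auto simp: m_comm)
      also have "\<dots> = (\<Oplus>\<^bsub>self_module R\<^esub>u\<in>{..<k}. w u i \<odot>\<^bsub>self_module R\<^esub> c u)"
        using c(1) wc by (subst self_module_finsum) auto
      finally show ?thesis .
    qed
    then have ext': "\<psi> y = (\<Oplus>\<^bsub>self_module R\<^esub>u\<in>{..<k}. \<phi> u y \<odot>\<^bsub>self_module R\<^esub> c u)"
      if "y \<in> carrier M" for y
      using that cc by (intro ext[OF mR \<psi>])
    have "\<psi> y = (\<Oplus>u\<in>{..<k}. \<phi> u y \<otimes> c u)" if y: "y \<in> carrier M" for y
    proof -
      have "\<phi> u y \<in> carrier R" if "u < k" for u using lin_mapsD(1)[OF \<phi>(1)[OF that] y] by simp
      then show ?thesis unfolding ext'[OF y] using c(1) by (subst self_module_finsum) auto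
    qed
    with c(1) show "\<exists>c. (\<forall>i<k. c i \<in> carrier R) \<and> (\<forall>m\<in>carrier M. \<psi> m = (\<Oplus>i\<in>{..<k}. \<phi> i m \<otimes> c i))"
      by blast
  next
    fix \<psi> assume \<psi>: "\<psi> \<in> lin_maps S (base_change R S M) (self_module S)"
    have mS: "module S (self_module S)" by (rule cring.self_module_module[OF cS])
    interpret SS: module S "self_module S" by (rule mS)
    \<comment> \<open>An \<open>S\<close>-linear functional on the base change is determined by this
      R-linear map from \<open>M\<close> to \<open>S\<close>, so its values on the generators form a
      solution of the system in \<open>S\<close>.\<close>
    let ?\<eta> = "\<lambda>m. \<psi> (pure_tensor R S M \<one>\<^bsub>S\<^esub> m)"
    have \<eta>: "?\<eta> \<in> lin_maps R M S"
      by (rule S.restrict_scalars_self[OF base_change_unit_lin[OF S mM mS \<psi>]])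
    have "\<exists>d. (\<forall>u. d u \<in> carrier S) \<and> (\<forall>i<n. ?\<eta> (m i) = (\<Oplus>\<^bsub>S\<^esub>u\<in>{..<k}. w u i \<odot>\<^bsub>S\<^esub> d u))"
    proof (rule flat_solutions[where a = a and l = l and v = "\<lambda>i. ?\<eta> (m i)", OF flat])
      show "?\<eta> (m i) \<in> carrier S" if "i < n" for i by (rule lin_mapsD(1)[OF \<eta> mc[OF that]])
    qed (erule ac wc rel[OF S.module \<eta>] | rule w(3), assumption, blast)+
    then obtain d where d: "\<And>u. d u \<in> carrier S"
      "\<And>i. i < n \<Longrightarrow> ?\<eta> (m i) = (\<Oplus>\<^bsub>S\<^esub>u\<in>{..<k}. w u i \<odot>\<^bsub>S\<^esub> d u)" by blast
    let ?\<phi>S = "\<lambda>u. base_lift S (self_module S) (\<lambda>m. \<phi> u m \<odot>\<^bsub>S\<^esub> \<one>\<^bsub>S\<^esub>)"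
    have rS: "module R (restrict_scalars S (self_module S))" by (rule S.restrict_scalars_module[OF mS])
    have u1: "(\<lambda>m. \<phi> u m \<odot>\<^bsub>S\<^esub> \<one>\<^bsub>S\<^esub>) \<in> lin_maps R M (restrict_scalars S (self_module S))" if "u < k" for u
      using lin_maps_smult_const[OF mM rS \<phi>(1)[OF that], of "\<one>\<^bsub>S\<^esub>"] lin_mapsD(1)[OF \<phi>(1)[OF that]]
      by (auto simp: lin_maps_def)
    note \<phi>S = base_lift[OF S mM mS u1]
    have lin: "(\<lambda>x. \<Oplus>\<^bsub>self_module S\<^esub>u\<in>{..<k}. ?\<phi>S u x \<odot>\<^bsub>self_module S\<^esub> d u)
        \<in> lin_maps S (base_change R S M) (self_module S)"
      using \<phi>S(1) d by (intro lin_maps_sum lin_maps_smult_const base_change_module[OF S mM] mS) auto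
    have "\<psi> x = (\<Oplus>\<^bsub>S\<^esub>u\<in>{..<k}. ?\<phi>S u x \<otimes>\<^bsub>S\<^esub> d u)" if x: "x \<in> carrier (base_change R S M)" for x
    proof -
      have "\<psi> x = (\<Oplus>\<^bsub>self_module S\<^esub>u\<in>{..<k}. ?\<phi>S u x \<odot>\<^bsub>self_module S\<^esub> d u)"
      proof (rule base_change_eq[OF S mM mS \<psi> lin _ x])
        fix y assume y: "y \<in> carrier M"
        have \<phi>y: "\<phi> u y \<in> carrier R" if "u < k" for u using lin_mapsD(1)[OF \<phi>(1)[OF that] y] by simp
        have "?\<eta> y = (\<Oplus>\<^bsub>S\<^esub>u\<in>{..<k}. \<phi> u y \<odot>\<^bsub>S\<^esub> d u)"
          by (rule ext[OF S.module \<eta> d(1) d(2) y])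
        also have "\<dots> = (\<Oplus>\<^bsub>self_module S\<^esub>u\<in>{..<k}. \<phi> u y \<odot>\<^bsub>S\<^esub> d u)"
          using \<phi>y d by (intro cring.self_module_finsum[OF cS, symmetric]) auto
        also have "\<dots> = (\<Oplus>\<^bsub>self_module S\<^esub>u\<in>{..<k}. ?\<phi>S u (pure_tensor R S M \<one>\<^bsub>S\<^esub> y) \<odot>\<^bsub>self_module S\<^esub> d u)"
          using \<phi>y d y by (intro SS.M.finsum_cong') (auto simp: \<phi>S(2) S.smult_one_mult)
        finally show "?\<eta> y = (\<Oplus>\<^bsub>self_module S\<^esub>u\<in>{..<k}. ?\<phi>S u (pure_tensor R S M \<one>\<^bsub>S\<^esub> y) \<odot>\<^bsub>self_module S\<^esub> d u)" .
      qed
      also have "\<dots> = (\<Oplus>\<^bsub>S\<^esub>u\<in>{..<k}. ?\<phi>S u x \<odot>\<^bsub>self_module S\<^esub> d u)"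
        using lin_mapsD(1)[OF \<phi>S(1) x] d by (intro cring.self_module_finsum[OF cS]) auto
      finally show ?thesis by simp
    qed
    with d(1) show "\<exists>c. (\<forall>i<k. c i \<in> carrier S) \<and> (\<forall>x\<in>carrier (base_change R S M). \<psi> x =
        (\<Oplus>\<^bsub>S\<^esub>i\<in>{..<k}. ?\<phi>S i x \<otimes>\<^bsub>S\<^esub> c i))" by blast
  qed
qed

end

section \<open>The flat base change isomorphism\<close>

lemma (in algebra) smult_mult_smult:
  assumes "a \<in> carrier R" "b \<in> carrier R" "x \<in> carrier M" "y \<in> carrier M"
  shows "(a \<odot>\<^bsub>M\<^esub> x) \<otimes>\<^bsub>M\<^esub> (b \<odot>\<^bsub>M\<^esub> y) = (a \<otimes>\<^bsub>R\<^esub> b) \<odot>\<^bsub>M\<^esub> (x \<otimes>\<^bsub>M\<^esub> y)"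
proof -
  have "(a \<odot>\<^bsub>M\<^esub> x) \<otimes>\<^bsub>M\<^esub> (b \<odot>\<^bsub>M\<^esub> y) = a \<odot>\<^bsub>M\<^esub> (x \<otimes>\<^bsub>M\<^esub> (b \<odot>\<^bsub>M\<^esub> y))"
    using assms by (intro smult_assoc2) auto
  then show ?thesis using assms by (simp only: mult_smult_right smult_assoc1 m_closed)
qed

lemma homogeneous_submodule:
  assumes "cring R"
  shows "submodule {p \<in> carrier (poly_alg R M). \<forall>\<mu>\<in>supp R p. size \<mu> = n} R (poly_alg R M)"
    and "{p \<in> carrier (poly_alg R M). \<forall>\<mu>\<in>supp R p. size \<mu> = n} =
      fin_funs R {\<mu>. set_mset \<mu> \<subseteq> carrier M \<and> size \<mu> = n}"
proof -
  interpret cring R by fact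
  interpret P: algebra R "poly_alg R M" by (rule poly_alg_algebra)
  let ?H = "fin_funs R {\<mu>. set_mset \<mu> \<subseteq> carrier M \<and> size \<mu> = n}"
  have c: "carrier (poly_alg R M) = fin_funs R {\<mu>. set_mset \<mu> \<subseteq> carrier M}"
    by (simp add: poly_alg_def pol_carrier)
  show eq: "{p \<in> carrier (poly_alg R M). \<forall>\<mu>\<in>supp R p. size \<mu> = n} = ?H"
    unfolding c by (auto simp: fin_funs_def)
  show "submodule {p \<in> carrier (poly_alg R M). \<forall>\<mu>\<in>supp R p. size \<mu> = n} R (poly_alg R M)"
    unfolding eq
  proof (rule P.submoduleI')
    show "?H \<subseteq> carrier (poly_alg R M)" unfolding c by (auto intro: fin_funs_mono)
  qed (simp_all add: poly_alg_def monoid_alg_simps fin_funs_zero fin_funs_add fin_funs_smult)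
qed

context cring
begin

lemma rees_component_eq:
  "rees_component R M n = rees_cls M ` {p \<in> carrier (poly_alg R M). \<forall>\<mu>\<in>supp R p. size \<mu> = n}"
  by (auto simp: rees_component_def sym_component_def rees_cls_def)

lemma rees_gen_eq: "rees_gen R M m = rees_cls M (var R m)"
  by (simp add: rees_gen_def rees_cls_def)

text \<open>In the proof \<open>\<alpha>\<close> embeds the base change of the Rees algebra, and
  \<open>\<beta>\<close> the Rees algebra of the base change, into the polynomial ring over
  \<open>S\<close>. The isomorphism \<Phi> is pinned down by \<beta> \<Phi> = \<alpha>, so its
  values on generators and on graded pieces are read off from images in the polynomial ring.\<close>

lemma flat_base_change_rees:
  fixes S :: "('a, 's) module" and M :: "('a, 'm) module"
  assumes noeth: "noetherian_ring R" and M: "fin_gen_module R M" and S: "algebra R S"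
    and flat: "flat_module R S"
  shows "\<exists>\<Phi> \<in> alg_iso S (base_change R S (rees_alg R M)) (rees_alg S (base_change R S M)).
    (\<forall>m\<in>carrier M. \<Phi> (pure_tensor R S (rees_alg R M) \<one>\<^bsub>S\<^esub> (rees_gen R M m)) =
        rees_gen S (base_change R S M) (pure_tensor R S M \<one>\<^bsub>S\<^esub> m)) \<and>
    (\<forall>n. \<Phi> ` submodule_span S (base_change R S (rees_alg R M))
          {pure_tensor R S (rees_alg R M) s x | s x. s \<in> carrier S \<and> x \<in> rees_component R M n} =
        rees_component S (base_change R S M) n)"
proof -
  have cS: "cring S" by (rule algebra.M_cring[OF S])
  interpret SC: cring S by (rule cS)
  interpret S: algebra R S by (rule S)
  have mM: "module R M" using M by (simp add: fin_gen_module_def)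
  interpret M: module R M by (rule mM)
  have mSS: "module S (self_module S)" by (rule SC.self_module_module)
  define N where "N = base_change R S M"
  have mN: "module S N" unfolding N_def by (rule base_change_module[OF S mM])
  interpret N: module S N by (rule mN)
  obtain k :: nat and \<phi> where \<phi>: "\<And>i. i < k \<Longrightarrow> \<phi> i \<in> lin_maps R M (self_module R)"
    and gen: "\<And>\<psi>. \<psi> \<in> lin_maps R M (self_module R) \<Longrightarrow>
      \<exists>c. (\<forall>i<k. c i \<in> carrier R) \<and> (\<forall>m\<in>carrier M. \<psi> m = (\<Oplus>i\<in>{..<k}. \<phi> i m \<otimes> c i))"
    and genS0: "\<And>\<psi>. \<psi> \<in> lin_maps S (base_change R S M) (self_module S) \<Longrightarrow>
      \<exists>c. (\<forall>i<k. c i \<in> carrier S) \<and> (\<forall>x\<in>carrier (base_change R S M). \<psi> x =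
        (\<Oplus>\<^bsub>S\<^esub>i\<in>{..<k}. base_lift S (self_module S) (\<lambda>m. \<phi> i m \<odot>\<^bsub>S\<^esub> \<one>\<^bsub>S\<^esub>) x \<otimes>\<^bsub>S\<^esub> c i))"
    by (rule noetherian_dual_generators[OF noeth M S flat]) blast
  define \<phi>S where "\<phi>S i = base_lift S (self_module S) (\<lambda>m. \<phi> i m \<odot>\<^bsub>S\<^esub> \<one>\<^bsub>S\<^esub>)" for i
  have genS: "\<exists>c. (\<forall>i<k. c i \<in> carrier S) \<and>
      (\<forall>x\<in>carrier N. \<psi> x = (\<Oplus>\<^bsub>S\<^esub>i\<in>{..<k}. \<phi>S i x \<otimes>\<^bsub>S\<^esub> c i))"
    if "\<psi> \<in> lin_maps S N (self_module S)" for \<psi>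
    using genS0[OF that[unfolded N_def]] by (simp only: N_def \<phi>S_def)
  have "(\<lambda>m. \<phi> i m \<odot>\<^bsub>S\<^esub> \<one>\<^bsub>S\<^esub>) \<in> lin_maps R M (restrict_scalars S (self_module S))" if "i < k" for i
    using lin_maps_smult_const[OF mM S.restrict_scalars_module[OF mSS] \<phi>[OF that], of "\<one>\<^bsub>S\<^esub>"]
      lin_mapsD(1)[OF \<phi>[OF that]]
    by (auto simp: lin_maps_def)
  note \<phi>S' = base_lift[OF S mM mSS this]
  have \<phi>S: "\<phi>S i \<in> lin_maps S N (self_module S)" if "i < k" for i
    unfolding \<phi>S_def N_def by (rule \<phi>S'(1)[OF that])
  define one_t where "one_t m = pure_tensor R S M \<one>\<^bsub>S\<^esub> m" for m
  have one_t: "one_t m \<in> carrier N" if "m \<in> carrier M" for m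
    using pure_tensor_closed[OF S.module mM SC.one_closed that]
    by (simp add: one_t_def N_def base_change_simps)
  have \<phi>S1: "\<phi>S i (one_t m) = \<phi> i m \<odot>\<^bsub>S\<^esub> \<one>\<^bsub>S\<^esub>" if "i < k" "m \<in> carrier M" for i m
    using \<phi>S'(2)[OF that(1) SC.one_closed that(2)] lin_mapsD(1)[OF \<phi>[OF that(1)] that(2)]
    by (simp add: \<phi>S_def one_t_def)
  define RM where "RM = rees_alg R M"
  define RS where "RS = rees_alg S N"
  note qR = rees_quotient[OF mM \<phi> gen, folded RM_def]
  note qS = SC.rees_quotient[OF mN \<phi>S genS, folded RS_def]
  have aRM: "algebra R RM" and aRS: "algebra S RS" by (rule qR(1) qS(1), assumption+)+
  interpret RM: algebra R RM by (rule aRM)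
  interpret RS: algebra S RS by (rule aRS)
  have clR: "rees_cls M \<in> alg_hom R (poly_alg R M) RM" and cRM: "carrier RM = rees_cls M ` carrier (poly_alg R M)"
    by (rule qR(2) qR(3), assumption+)+
  have clS: "SC.rees_cls N \<in> alg_hom S (poly_alg S N) RS"
    and cRS: "carrier RS = SC.rees_cls N ` carrier (poly_alg S N)"
    by (rule qS(2) qS(3), assumption+)+
  have cl0: "rees_cls M p = \<zero>\<^bsub>RM\<^esub> \<longleftrightarrow> rees_eval k \<phi> p = \<zero>\<^bsub>pol UNIV\<^esub>" if "p \<in> carrier (poly_alg R M)" for p
    by (rule qR(4)[OF _ _ that])
  have clS0: "SC.rees_cls N p = \<zero>\<^bsub>RS\<^esub> \<longleftrightarrow> SC.rees_eval k \<phi>S p = \<zero>\<^bsub>SC.pol UNIV\<^esub>"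
    if "p \<in> carrier (poly_alg S N)" for p
    by (rule qS(4)[OF _ _ that])
  let ?P = "SC.pol (UNIV :: nat set)"
  let ?PR = "restrict_scalars S ?P"
  have aP: "algebra S ?P" by (rule SC.pol_algebra)
  interpret P: algebra S ?P by (rule aP)
  have aPR: "algebra R ?PR" by (rule S.restrict_scalars_algebra[OF aP])
  interpret PR: algebra R ?PR by (rule aPR)
  interpret RX: algebra R "pol (UNIV :: nat set)" by (rule pol_algebra)
  define \<theta> where "\<theta> = rees_eval k \<phi>"
  define \<theta>S where "\<theta>S = SC.rees_eval k \<phi>S"
  have \<theta>: "\<theta> \<in> alg_hom R (poly_alg R M) (pol UNIV)" "\<And>m. m \<in> carrier M \<Longrightarrow> \<theta> (var R m) = form k \<phi> m"
    unfolding \<theta>_def using rees_eval[OF mM \<phi>] by auto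
  have \<theta>S: "\<theta>S \<in> alg_hom S (poly_alg S N) ?P" "\<And>m. m \<in> carrier N \<Longrightarrow> \<theta>S (var S m) = SC.form k \<phi>S m"
    unfolding \<theta>S_def using SC.rees_eval[OF mN \<phi>S] by auto
  have formS: "SC.form k \<phi>S \<in> lin_maps S N ?P" by (rule SC.form_lin[OF mN \<phi>S])

  \<comment> \<open>The change of coefficients from R[X] to S[X]: monomials go to monomials and a
    coefficient r becomes r times the one of \<open>S\<close>.\<close>
  define cc where "cc = lin_ext R ?PR (basis_elt S)"
  have bP: "basis_elt S \<mu> \<in> carrier ?P" for \<mu> :: "nat multiset"
    by (rule SC.monoid_alg_basis_mem) (simp add: monomials_def)
  have cc: "cc \<in> alg_hom R (pol UNIV) ?PR"
    unfolding cc_def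
  proof (rule lin_ext_alg_hom[OF monomials_comm_monoid aPR])
    show "basis_elt S \<in> carrier (monomials UNIV) \<rightarrow> carrier ?PR" using bP by auto
  qed (simp_all add: SC.basis_elt_mult SC.monoid_alg_simps)
  have ccb: "cc (basis_elt R \<mu>) = basis_elt S \<mu>" for \<mu>
    unfolding cc_def by (rule lin_ext_basis_elt[OF PR.module]) (simp add: bP)
  have coordS: "(\<lambda>p. p \<mu>) \<in> lin_maps S ?P (self_module S)" for \<mu>
    by (rule lin_mapsI) (auto simp: SC.monoid_alg_simps SC.fin_funsD)
  have coordR: "(\<lambda>p. p \<mu>) \<in> lin_maps R ?PR S" for \<mu>
    by (rule S.restrict_scalars_self[OF S.restrict_scalars_lin[OF coordS]])
  have cc_coord: "cc p \<mu> = p \<mu> \<odot>\<^bsub>S\<^esub> \<one>\<^bsub>S\<^esub>" if "p \<in> carrier (pol UNIV)" for p \<mu>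
  proof (rule lin_maps_monoid_alg_eq[where K = "carrier (monomials UNIV)" and G = "monomials UNIV"
        and h = "\<lambda>p. cc p \<mu>" and h' = "\<lambda>p. p \<mu> \<odot>\<^bsub>S\<^esub> \<one>\<^bsub>S\<^esub>", OF S.module])
    show "(\<lambda>p. cc p \<mu>) \<in> lin_maps R (pol UNIV) S"
      by (rule lin_maps_comp[OF alg_homD(1)[OF cc] coordR])
    have "(\<lambda>p. p \<mu>) \<in> lin_maps R (pol UNIV) (self_module R)"
      by (rule lin_mapsI) (auto simp: monoid_alg_simps fin_funsD)
    then show "(\<lambda>p. p \<mu> \<odot>\<^bsub>S\<^esub> \<one>\<^bsub>S\<^esub>) \<in> lin_maps R (pol UNIV) S"
      by (rule lin_maps_smult_const[OF RX.module S.module _ SC.one_closed])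
    show "p \<in> fin_funs R (carrier (monomials UNIV))" using that by (simp add: monoid_alg_simps)
    fix \<nu> :: "nat multiset"
    show "cc (basis_elt R \<nu>) \<mu> = basis_elt R \<nu> \<mu> \<odot>\<^bsub>S\<^esub> \<one>\<^bsub>S\<^esub>"
      by (simp add: ccb) (simp add: basis_elt_def)
  qed simp

  let ?QR = "restrict_scalars S (poly_alg S N)"
  interpret Q: algebra S "poly_alg S N" by (rule SC.poly_alg_algebra)
  have aQR: "algebra R ?QR" by (rule S.restrict_scalars_algebra[OF SC.poly_alg_algebra])
  interpret QR: algebra R ?QR by (rule aQR)
  \<comment> \<open>The lift to polynomial algebras of the map m \<mapsto> 1 \<otimes> m: it changes
    coefficients to \<open>S\<close> and sends X_m to the variable of 1 \<otimes> m.\<close>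
  define \<iota> where "\<iota> = lin_ext R ?QR (\<lambda>\<mu>. basis_elt S (image_mset one_t \<mu>))"
  have bQ: "basis_elt S (image_mset one_t \<mu>) \<in> carrier (poly_alg S N)" if "set_mset \<mu> \<subseteq> carrier M" for \<mu>
    unfolding poly_alg_def
    by (rule SC.monoid_alg_basis_mem) (use one_t that in \<open>auto simp: monomials_def\<close>)
  have \<iota>b: "\<iota> (basis_elt R \<mu>) = basis_elt S (image_mset one_t \<mu>)" if "set_mset \<mu> \<subseteq> carrier M" for \<mu>
    unfolding \<iota>_def
    by (rule lin_ext_basis_elt[where u = "\<lambda>\<mu>. basis_elt S (image_mset one_t \<mu>)" and k = \<mu>, OF QR.module])
      (use bQ[OF that] in simp)
  have \<iota>: "\<iota> \<in> alg_hom R (poly_alg R M) ?QR"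
    unfolding \<iota>_def poly_alg_def[of R M]
  proof (rule lin_ext_alg_hom[OF monomials_comm_monoid aQR])
    show "(\<lambda>\<mu>. basis_elt S (image_mset one_t \<mu>)) \<in> carrier (monomials (carrier M)) \<rightarrow> carrier ?QR"
      using bQ by (auto simp: monomials_def)
    fix i j :: "'m multiset"
    show "basis_elt S (image_mset one_t (i \<otimes>\<^bsub>monomials (carrier M)\<^esub> j)) =
        basis_elt S (image_mset one_t i) \<otimes>\<^bsub>?QR\<^esub> basis_elt S (image_mset one_t j)"
      by (simp add: poly_alg_def SC.basis_elt_mult) (simp add: monomials_def)
    show "basis_elt S (image_mset one_t \<one>\<^bsub>monomials (carrier M)\<^esub>) = \<one>\<^bsub>?QR\<^esub>"
      by (simp add: poly_alg_def SC.monoid_alg_simps) (simp add: monomials_def)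
  qed
  have \<iota>v: "\<iota> (var R m) = var S (one_t m)" if "m \<in> carrier M" for m
    using \<iota>b[of "{#m#}"] that by (simp add: var_def)
  have form1: "cc (form k \<phi> m) = SC.form k \<phi>S (one_t m)" if m: "m \<in> carrier M" for m
  proof -
    have \<phi>m: "\<phi> i m \<in> carrier R" if "i < k" for i using lin_mapsD(1)[OF \<phi>[OF that] m] by simp
    have "cc (form k \<phi> m) = (\<Oplus>\<^bsub>?PR\<^esub>i\<in>{..<k}. cc (\<phi> i m \<odot>\<^bsub>pol UNIV\<^esub> var R i))"
      unfolding form_def using \<phi>m
      by (intro lin_maps_finsum[OF RX.module PR.module alg_homD(1)[OF cc]]) (auto simp: var_pol)
    also have "\<dots> = (\<Oplus>\<^bsub>?PR\<^esub>i\<in>{..<k}. \<phi>S i (one_t m) \<odot>\<^bsub>?P\<^esub> var S i)"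
      using \<phi>m m bP
      by (intro PR.M.finsum_cong')
        (auto simp: lin_mapsD(3)[OF alg_homD(1)[OF cc]] var_pol \<phi>S1, auto simp: var_def ccb)
    also have "\<dots> = (\<Oplus>\<^bsub>?P\<^esub>i\<in>{..<k}. \<phi>S i (one_t m) \<odot>\<^bsub>?P\<^esub> var S i)"
      using \<phi>m m bP by (intro S.restrict_scalars_finsum[OF P.module]) (auto simp: \<phi>S1 var_def)
    finally show ?thesis by (simp add: SC.form_def)
  qed
  \<comment> \<open>The square of the two evaluations over R and \<open>S\<close> commutes. It is
    checked on variables, where it says that the form of 1 \<otimes> m is the form of m with its
    coefficients moved to \<open>S\<close>.\<close>
  have cc\<theta>: "cc (\<theta> p) = \<theta>S (\<iota> p)" if p: "p \<in> carrier (poly_alg R M)" for p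
  proof (rule pol_hom_eq[where V = "carrier M" and W = "carrier M", OF aPR])
    show "(\<lambda>p. cc (\<theta> p)) \<in> alg_hom R (pol (carrier M)) ?PR"
      using alg_hom_comp[OF \<theta>(1) cc] by (simp add: poly_alg_def)
    show "(\<lambda>p. \<theta>S (\<iota> p)) \<in> alg_hom R (pol (carrier M)) ?PR"
      using alg_hom_comp[OF \<iota> S.restrict_scalars_alg_hom[OF \<theta>S(1)]] by (simp add: poly_alg_def)
    show "p \<in> fin_funs R {\<mu>. set_mset \<mu> \<subseteq> carrier M}" using p by (simp add: poly_alg_def pol_carrier)
    fix m assume "m \<in> carrier M"
    then show "cc (\<theta> (var R m)) = \<theta>S (\<iota> (var R m))" by (simp add: \<theta>(2) \<iota>v \<theta>S(2) one_t form1)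
  qed simp

  have ker\<theta>: "\<theta> p = \<zero>\<^bsub>pol UNIV\<^esub>" if "p \<in> carrier (poly_alg R M)" "rees_cls M p = \<zero>\<^bsub>RM\<^esub>" for p
    using cl0[OF that(1)] that(2) by (simp add: \<theta>_def)
  \<comment> \<open>The embedding of the Rees algebra of \<open>M\<close> into R[X] induced by
    \<theta>; followed by \<open>cc\<close> it becomes \<open>\<gamma>\<close>, whose
    \<open>S\<close>-linear extension is \<open>\<alpha>\<close>.\<close>
  obtain \<theta>' where \<theta>': "\<theta>' \<in> alg_hom R RM (pol UNIV)"
    "\<And>p. p \<in> carrier (poly_alg R M) \<Longrightarrow> \<theta>' (rees_cls M p) = \<theta> p"
    using alg_hom_factor[OF poly_alg_algebra aRM pol_algebra clR cRM[symmetric] \<theta>(1) ker\<theta>] by blast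
  have \<theta>'inj: "y = \<zero>\<^bsub>RM\<^esub>" if y: "y \<in> carrier RM" "\<theta>' y = \<zero>\<^bsub>pol UNIV\<^esub>" for y
  proof -
    obtain p where p: "p \<in> carrier (poly_alg R M)" "y = rees_cls M p" using y(1) cRM by blast
    then show ?thesis using y(2) \<theta>'(2)[OF p(1)] cl0[OF p(1)] by (simp add: \<theta>_def)
  qed
  define \<gamma> where "\<gamma> x = cc (\<theta>' x)" for x
  have \<gamma>: "\<gamma> \<in> alg_hom R RM ?PR" unfolding \<gamma>_def[abs_def] by (rule alg_hom_comp[OF \<theta>'(1) cc])
  have \<gamma>cls: "\<gamma> (rees_cls M p) = \<theta>S (\<iota> p)" if "p \<in> carrier (poly_alg R M)" for p
    by (simp add: \<gamma>_def \<theta>'(2)[OF that] cc\<theta>[OF that])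

  define \<alpha> where "\<alpha> = base_lift S ?P \<gamma>"
  define BC where "BC = base_change R S RM"
  have mBC: "module S BC" unfolding BC_def by (rule base_change_module[OF S RM.module])
  have mT: "module R (tensor R S RM)" by (rule tensor_module[OF S.module RM.module])
  have \<alpha>lin: "\<alpha> \<in> lin_maps S BC ?P"
    unfolding \<alpha>_def BC_def by (rule base_lift(1)[OF S RM.module P.module alg_homD(1)[OF \<gamma>]])
  have \<alpha>pure: "\<alpha> (pure_tensor R S RM s x) = s \<odot>\<^bsub>?P\<^esub> \<gamma> x" if "s \<in> carrier S" "x \<in> carrier RM" for s x
    unfolding \<alpha>_def by (rule base_lift(2)[OF S RM.module P.module alg_homD(1)[OF \<gamma>] that])
  have \<alpha>R: "\<alpha> \<in> lin_maps R (tensor R S RM) ?PR"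
    by (rule base_change_lin_restrict[OF S RM.module P.module \<alpha>lin[unfolded BC_def]])
  have \<gamma>c: "\<gamma> x \<in> carrier ?P" if "x \<in> carrier RM" for x
    using lin_mapsD(1)[OF alg_homD(1)[OF \<gamma>] that] by simp
  \<comment> \<open>The coefficient of \<alpha>(s \<otimes> y) at a monomial is that of \<theta>'(y)
    acting on s, so the coefficients of \<open>\<alpha>\<close> are the coordinate maps required by
    \<open>flat_tensor_inj\<close>.\<close>
  have \<alpha>0: "z = \<zero>\<^bsub>tensor R S RM\<^esub>" if z: "z \<in> carrier (tensor R S RM)" "\<alpha> z = \<zero>\<^bsub>?P\<^esub>" for z
  proof (rule flat_tensor_inj[where g = "\<lambda>\<mu> z. \<alpha> z \<mu>", OF noeth flat RM.module alg_homD(1)[OF \<theta>'(1)] \<theta>'inj z(1)])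
    show "(\<lambda>z. \<alpha> z \<mu>) \<in> lin_maps R (tensor R S RM) S" for \<mu>
      by (rule lin_maps_comp[OF \<alpha>R coordR])
    show "\<alpha> z \<mu> = \<zero>\<^bsub>S\<^esub>" for \<mu> using z(2) by (simp add: SC.monoid_alg_simps)
    fix \<mu> s y assume sy: "s \<in> carrier S" "y \<in> carrier RM"
    have ty: "\<theta>' y \<in> carrier (pol UNIV)" by (rule lin_mapsD(1)[OF alg_homD(1)[OF \<theta>'(1)] sy(2)])
    then have tyc: "\<theta>' y \<mu> \<in> carrier R" by (simp add: monoid_alg_simps fin_funsD)
    have "\<alpha> (pure_tensor R S RM s y) \<mu> = s \<otimes>\<^bsub>S\<^esub> (\<theta>' y \<mu> \<odot>\<^bsub>S\<^esub> \<one>\<^bsub>S\<^esub>)"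
      by (simp add: \<alpha>pure[OF sy] SC.monoid_alg_simps \<gamma>_def cc_coord[OF ty])
    also have "\<dots> = \<theta>' y \<mu> \<odot>\<^bsub>S\<^esub> s" using sy(1) tyc by (simp add: S.mult_smult_right)
    finally show "\<alpha> (pure_tensor R S RM s y) \<mu> = \<theta>' y \<mu> \<odot>\<^bsub>S\<^esub> s" .
  qed

  \<comment> \<open>\<open>tensor_kernel\<close> is shown to be an ideal as the kernel of an algebra
    map on the pair algebra. The map extends this assignment, which is multiplicative on the product
    monoid; it induces \<open>\<alpha>\<close>, and injectivity of \<open>\<alpha>\<close>
    identifies the kernel.\<close>
  define u where "u = (\<lambda>(s, x). s \<odot>\<^bsub>?P\<^esub> \<gamma> x)"
  have bil: "bilinear R S RM ?PR u"
    unfolding u_def by (rule base_lift_bilinear[OF S RM.module P.module alg_homD(1)[OF \<gamma>]])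
  have cmG: "comm_monoid (S \<times>\<times> RM)"
    by (rule comm_monoidI) (auto simp: DirProd_def SC.m_ac RM.m_ac)
  have aPA: "algebra R (pair_alg R S RM)" unfolding pair_alg_def by (rule monoid_alg_algebra[OF cmG])
  have uhom: "lin_ext R ?PR u \<in> alg_hom R (pair_alg R S RM) ?PR"
    unfolding pair_alg_def
  proof (rule lin_ext_alg_hom[OF cmG aPR])
    show "u \<in> carrier (S \<times>\<times> RM) \<rightarrow> carrier ?PR" using \<gamma>c by (auto simp: u_def DirProd_def)
    show "u \<one>\<^bsub>S \<times>\<times> RM\<^esub> = \<one>\<^bsub>?PR\<^esub>" using alg_homD(3)[OF \<gamma>] by (simp add: u_def DirProd_def)
    fix i j assume ij: "i \<in> carrier (S \<times>\<times> RM)" "j \<in> carrier (S \<times>\<times> RM)"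
    obtain s x t y where *: "i = (s, x)" "j = (t, y)" by (metis prod.exhaust)
    then have c: "s \<in> carrier S" "x \<in> carrier RM" "t \<in> carrier S" "y \<in> carrier RM"
      using ij by (auto simp: DirProd_def)
    have "u (i \<otimes>\<^bsub>S \<times>\<times> RM\<^esub> j) = (s \<otimes>\<^bsub>S\<^esub> t) \<odot>\<^bsub>?P\<^esub> (\<gamma> x \<otimes>\<^bsub>?P\<^esub> \<gamma> y)"
      using c alg_homD(4)[OF \<gamma>] by (simp add: * u_def DirProd_def)
    also have "\<dots> = (s \<odot>\<^bsub>?P\<^esub> \<gamma> x) \<otimes>\<^bsub>?P\<^esub> (t \<odot>\<^bsub>?P\<^esub> \<gamma> y)"
      using c \<gamma>c by (simp add: P.smult_mult_smult)
    finally show "u (i \<otimes>\<^bsub>S \<times>\<times> RM\<^esub> j) = u i \<otimes>\<^bsub>?PR\<^esub> u j" by (simp add: * u_def)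
  qed
  have \<alpha>class: "\<alpha> (tensor_class R S RM p) = lin_ext R ?PR u p" if "p \<in> carrier (pair_alg R S RM)" for p
    using tensor_lift_class[OF S.module RM.module PR.module bil that]
    by (simp add: \<alpha>_def base_lift_def[OF S] u_def)
  have "a_kernel (pair_alg R S RM) ?PR (lin_ext R ?PR u) = tensor_kernel R S RM"
  proof (intro subset_antisym subsetI)
    fix p assume "p \<in> a_kernel (pair_alg R S RM) ?PR (lin_ext R ?PR u)"
    then have p: "p \<in> carrier (pair_alg R S RM)" "lin_ext R ?PR u p = \<zero>\<^bsub>?P\<^esub>"
      by (auto simp: a_kernel_def')
    then have "tensor_class R S RM p = \<zero>\<^bsub>tensor R S RM\<^esub>"
      using \<alpha>class[OF p(1)] lin_mapsD(1)[OF tensor_class_lin[OF S.module RM.module] p(1)] by (intro \<alpha>0) auto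
    then show "p \<in> tensor_kernel R S RM" using tensor_class_zero_iff[OF S.module RM.module p(1)] by simp
  next
    fix p assume p: "p \<in> tensor_kernel R S RM"
    then have "p \<in> carrier (pair_alg R S RM)"
      using submoduleD(1)[OF pair_alg_module tensor_kernel_submodule[OF S.module RM.module]] by blast
    then show "p \<in> a_kernel (pair_alg R S RM) ?PR (lin_ext R ?PR u)"
      using lin_ext_bilinear(2)[OF S.module RM.module PR.module bil p] by (simp add: a_kernel_def')
  qed
  then have idl: "ideal (tensor_kernel R S RM) (pair_alg R S RM)"
    using alg_hom_kernel[OF aPA aPR uhom] by simp
  have aT: "algebra R (tensor R S RM)" unfolding tensor_def by (rule quot_algebra[OF aPA idl])
  interpret T: algebra R "tensor R S RM" by (rule aT)
  have \<alpha>hom: "\<alpha> \<in> alg_hom R (tensor R S RM) ?PR"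
    unfolding tensor_def
    by (rule quot_alg_hom[OF aPA idl uhom]) (rule \<alpha>class[unfolded tensor_class_def])
  interpret BC: module S BC by (rule mBC)
  have BCs: "carrier BC = carrier (tensor R S RM)" "monoid.mult BC = monoid.mult (tensor R S RM)"
    "\<one>\<^bsub>BC\<^esub> = \<one>\<^bsub>tensor R S RM\<^esub>" "\<zero>\<^bsub>BC\<^esub> = \<zero>\<^bsub>tensor R S RM\<^esub>"
    by (simp_all add: BC_def base_change_simps)
  have \<alpha>inj: "inj_on \<alpha> (carrier BC)"
    by (rule lin_map_inj[OF mBC P.module \<alpha>lin]) (use \<alpha>0 in \<open>simp add: BCs\<close>)
  have cBC: "cring BC" by (rule cring_cong[OF T.M_cring]) (simp_all add: BC_def base_change_simps)
  interpret BCC: cring BC by (rule cBC)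
  have \<alpha>mult: "\<alpha> (x \<otimes>\<^bsub>BC\<^esub> y) = \<alpha> x \<otimes>\<^bsub>?P\<^esub> \<alpha> y" if "x \<in> carrier BC" "y \<in> carrier BC" for x y
    using alg_homD(4)[OF \<alpha>hom] that by (simp add: BCs)
  have aBC: "algebra S BC"
  proof (intro algebra.intro mBC cBC algebra_axioms.intro)
    fix s x y assume *: "s \<in> carrier S" "x \<in> carrier BC" "y \<in> carrier BC"
    \<comment> \<open>Compatibility of the product with the scalars of \<open>S\<close> is pulled
      back from the polynomial ring along the injective \<open>\<alpha>\<close>.\<close>
    have "\<alpha> ((s \<odot>\<^bsub>BC\<^esub> x) \<otimes>\<^bsub>BC\<^esub> y) = \<alpha> (s \<odot>\<^bsub>BC\<^esub> (x \<otimes>\<^bsub>BC\<^esub> y))"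
      using * lin_mapsD(1)[OF \<alpha>lin] by (simp add: \<alpha>mult lin_mapsD(3)[OF \<alpha>lin] P.smult_assoc2)
    then show "(s \<odot>\<^bsub>BC\<^esub> x) \<otimes>\<^bsub>BC\<^esub> y = s \<odot>\<^bsub>BC\<^esub> (x \<otimes>\<^bsub>BC\<^esub> y)"
      using * by (intro inj_onD[OF \<alpha>inj]) auto
  qed
  have \<alpha>alg: "\<alpha> \<in> alg_hom S BC ?P"
    by (rule alg_homI[OF \<alpha>lin]) (use alg_homD(3)[OF \<alpha>hom] \<alpha>mult in \<open>simp_all add: BCs\<close>)

  have ker\<theta>S: "\<theta>S p = \<zero>\<^bsub>?P\<^esub>" if "p \<in> carrier (poly_alg S N)" "SC.rees_cls N p = \<zero>\<^bsub>RS\<^esub>" for p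
    using clS0[OF that(1)] that(2) by (simp add: \<theta>S_def)
  obtain \<beta> where \<beta>: "\<beta> \<in> alg_hom S RS ?P"
    "\<And>p. p \<in> carrier (poly_alg S N) \<Longrightarrow> \<beta> (SC.rees_cls N p) = \<theta>S p"
    using alg_hom_factor[OF SC.poly_alg_algebra aRS aP clS cRS[symmetric] \<theta>S(1) ker\<theta>S] by blast
  have \<beta>inj: "inj_on \<beta> (carrier RS)"
  proof (rule lin_map_inj[OF RS.module P.module alg_homD(1)[OF \<beta>(1)]])
    fix x assume x: "x \<in> carrier RS" "\<beta> x = \<zero>\<^bsub>?P\<^esub>"
    obtain p where p: "p \<in> carrier (poly_alg S N)" "x = SC.rees_cls N p" using x(1) cRS by blast
    then show "x = \<zero>\<^bsub>RS\<^esub>" using x(2) \<beta>(2)[OF p(1)] clS0[OF p(1)] by (simp add: \<theta>S_def)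
  qed

  define HomR where "HomR n = {p \<in> carrier (poly_alg R M). \<forall>\<mu>\<in>supp R p. size \<mu> = n}" for n
  define HomS where "HomS n = {p \<in> carrier (poly_alg S N). \<forall>\<mu>\<in>supp S p. size \<mu> = n}" for n
  note HomR_eq = homogeneous_submodule(2)[OF is_cring, of M, folded HomR_def]
  note HomS_eq = homogeneous_submodule(2)[OF cS, of N, folded HomS_def]
  have HomS_sub: "submodule (HomS n) S (poly_alg S N)" for n
    unfolding HomS_def by (rule homogeneous_submodule(1)[OF cS])
  have compR: "rees_component R M n = rees_cls M ` HomR n" for n
    unfolding HomR_def by (rule rees_component_eq)
  have compS: "rees_component S N n = SC.rees_cls N ` HomS n" for n
    unfolding HomS_def by (rule SC.rees_component_eq)
  have comp_c: "rees_component R M n \<subseteq> carrier RM" for n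
    using cRM by (auto simp: compR HomR_def)
  have \<iota>Hom: "\<iota> p \<in> HomS n" if "p \<in> HomR n" for p n
  proof (rule lin_maps_monoid_alg_mem[where K = "{\<mu>. set_mset \<mu> \<subseteq> carrier M \<and> size \<mu> = n}"
        and G = "monomials (carrier M)", OF QR.module])
    show "\<iota> \<in> lin_maps R (pol (carrier M)) ?QR" using alg_homD(1)[OF \<iota>] by (simp add: poly_alg_def)
    show "submodule (HomS n) R ?QR" by (rule S.restrict_scalars_submodule[OF Q.module HomS_sub])
    show "p \<in> fin_funs R {\<mu>. set_mset \<mu> \<subseteq> carrier M \<and> size \<mu> = n}" using that HomR_eq by simp
    fix \<mu> assume "\<mu> \<in> {\<mu>. set_mset \<mu> \<subseteq> carrier M \<and> size \<mu> = n}"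
    then show "\<iota> (basis_elt R \<mu>) \<in> HomS n"
      unfolding HomS_eq using one_t by (auto simp: \<iota>b subset_iff intro!: SC.basis_elt_closed)
  qed (auto simp: monomials_def)
  define G where "G n = {pure_tensor R S RM s x | s x. s \<in> carrier S \<and> x \<in> rees_component R M n}" for n
  \<comment> \<open>The degree n part of the base change, as it appears in the conclusion. Its image
    under \<open>\<alpha>\<close> is compared with the evaluations of homogeneous polynomials of
    degree n over \<open>S\<close>.\<close>
  define Sp where "Sp n = submodule_span S BC (G n)" for n
  have Gc: "G n \<subseteq> carrier BC" for n
    unfolding G_def BCs using comp_c by (auto intro!: pure_tensor_closed[OF S.module RM.module])
  have Sp: "submodule (Sp n) S BC" for n
    unfolding Sp_def by (rule submodule_submodule_span[OF mBC Gc])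
  note Spc = submoduleD(1)[OF mBC Sp]
  have \<alpha>Sp: "submodule (\<alpha> ` Sp n) S ?P" for n by (rule submodule_image[OF mBC P.module \<alpha>lin Sp])
  have GSp: "pure_tensor R S RM s x \<in> Sp n" if "s \<in> carrier S" "x \<in> rees_component R M n" for s x n
    using that submodule_span_self[of "G n" S BC] by (auto simp: Sp_def G_def)
  \<comment> \<open>The class of a variable has degree one, so multiplying by it raises the degree
    by one; this is read off from the support of a product with a single variable.\<close>
  have gen1: "rees_cls M (var R m) \<otimes>\<^bsub>RM\<^esub> x \<in> rees_component R M (Suc n)"
    if mM: "m \<in> carrier M" and xn: "x \<in> rees_component R M n" for m x n
  proof -
    obtain p where p: "p \<in> HomR n" "x = rees_cls M p" using xn compR by blast
    have pc: "p \<in> carrier (poly_alg R M)" using p(1) by (simp add: HomR_def)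
    interpret PA: algebra R "poly_alg R M" by (rule poly_alg_algebra)
    have vp: "var R m \<otimes>\<^bsub>poly_alg R M\<^esub> p \<in> carrier (poly_alg R M)" using var_closed[OF mM] pc by simp
    have "supp R (var R m \<otimes>\<^bsub>poly_alg R M\<^esub> p) \<subseteq>
        (\<lambda>(i, j). i \<otimes>\<^bsub>monomials (carrier M)\<^esub> j) ` (supp R (var R m) \<times> supp R p)"
      unfolding poly_alg_def
      by (rule mult_closed(2))
        (use var_closed[OF mM] pc in \<open>auto simp: poly_alg_def monoid_alg_simps\<close>, auto simp: monomials_def)
    also have "\<dots> \<subseteq> {\<mu>. size \<mu> = Suc n}"
      using p(1) by (auto simp: monomials_def var_def basis_elt_def supp_def HomR_def split: if_splits)
    finally have "var R m \<otimes>\<^bsub>poly_alg R M\<^esub> p \<in> HomR (Suc n)" using vp by (auto simp: HomR_def)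
    then show ?thesis
      using alg_homD(4)[OF clR var_closed[OF mM] pc] by (auto simp: compR p(2))
  qed
  \<comment> \<open>Multiplication by the form of any element of \<open>N\<close> moves degree n
    images into degree n+1. Linearity in \<open>x\<close> and then in \<open>y\<close> reduces to
    pure tensors, where the product is again the image of a pure tensor by
    \<open>gen1\<close>.\<close>
  have mul1: "SC.form k \<phi>S x \<otimes>\<^bsub>?P\<^esub> \<alpha> y \<in> \<alpha> ` Sp (Suc n)" if x: "x \<in> carrier N" and y: "y \<in> Sp n" for x y n
  proof (rule tensor_mem[OF S.module mM PR.module])
    have yc: "\<alpha> y \<in> carrier ?P" using y Spc lin_mapsD(1)[OF \<alpha>lin] by blast
    show "(\<lambda>x. SC.form k \<phi>S x \<otimes>\<^bsub>?P\<^esub> \<alpha> y) \<in> lin_maps R (tensor R S M) ?PR"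
      by (rule base_change_lin_restrict[OF S mM P.module
            lin_maps_comp[OF formS P.mult_right_lin[OF yc], unfolded N_def]])
    show "submodule (\<alpha> ` Sp (Suc n)) R ?PR" by (rule S.restrict_scalars_submodule[OF P.module \<alpha>Sp])
    show "x \<in> carrier (tensor R S M)" using x by (simp add: N_def base_change_simps)
    fix s m assume s: "s \<in> carrier S" and m: "m \<in> carrier M"
    have g: "rees_cls M (var R m) \<in> carrier RM" using cRM var_closed[OF m] by blast
    have \<gamma>g: "\<gamma> (rees_cls M (var R m)) = SC.form k \<phi>S (one_t m)"
      using m by (simp add: \<gamma>cls var_closed \<iota>v \<theta>S(2) one_t)
    have "pure_tensor R S M s m = s \<odot>\<^bsub>N\<^esub> one_t m"
      using base_change_smult_lin(2)[OF S mM s SC.one_closed m] s by (simp add: N_def one_t_def)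
    then have fs: "SC.form k \<phi>S (pure_tensor R S M s m) = s \<odot>\<^bsub>?P\<^esub> \<gamma> (rees_cls M (var R m))"
      using lin_mapsD(3)[OF formS s one_t[OF m]] by (simp add: \<gamma>g)
    let ?c = "s \<odot>\<^bsub>?P\<^esub> \<gamma> (rees_cls M (var R m))"
    have c: "?c \<in> carrier ?P" using s \<gamma>c[OF g] by simp
    have "Sp n \<subseteq> {y \<in> carrier BC. ?c \<otimes>\<^bsub>?P\<^esub> \<alpha> y \<in> \<alpha> ` Sp (Suc n)}"
      unfolding Sp_def[of n]
    proof (rule submodule_span_minimal)
      show "submodule {y \<in> carrier BC. ?c \<otimes>\<^bsub>?P\<^esub> \<alpha> y \<in> \<alpha> ` Sp (Suc n)} S BC"
        by (rule submodule_vimage[OF mBC P.module lin_maps_comp[OF \<alpha>lin P.mult_left_lin[OF c]] \<alpha>Sp])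
      show "G n \<subseteq> {y \<in> carrier BC. ?c \<otimes>\<^bsub>?P\<^esub> \<alpha> y \<in> \<alpha> ` Sp (Suc n)}"
      proof
        fix y assume yG: "y \<in> G n"
        then obtain t x where tx: "t \<in> carrier S" "x \<in> rees_component R M n" "y = pure_tensor R S RM t x"
          by (auto simp: G_def)
        have xc: "x \<in> carrier RM" using tx(2) comp_c by blast
        have "?c \<otimes>\<^bsub>?P\<^esub> \<alpha> y = (s \<otimes>\<^bsub>S\<^esub> t) \<odot>\<^bsub>?P\<^esub> (\<gamma> (rees_cls M (var R m)) \<otimes>\<^bsub>?P\<^esub> \<gamma> x)"
          using s tx(1) \<gamma>c[OF g] \<gamma>c[OF xc]
          by (simp add: tx(3) \<alpha>pure[OF tx(1) xc] P.smult_mult_smult)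
        also have "\<gamma> (rees_cls M (var R m)) \<otimes>\<^bsub>?P\<^esub> \<gamma> x = \<gamma> (rees_cls M (var R m) \<otimes>\<^bsub>RM\<^esub> x)"
          using alg_homD(4)[OF \<gamma> g xc] by simp
        also have "(s \<otimes>\<^bsub>S\<^esub> t) \<odot>\<^bsub>?P\<^esub> \<dots> = \<alpha> (pure_tensor R S RM (s \<otimes>\<^bsub>S\<^esub> t) (rees_cls M (var R m) \<otimes>\<^bsub>RM\<^esub> x))"
          using s tx(1) g xc by (intro \<alpha>pure[symmetric]) auto
        also have "\<dots> \<in> \<alpha> ` Sp (Suc n)"
          using s tx(1) gen1[OF m tx(2)] by (intro imageI GSp) auto
        finally show "y \<in> {y \<in> carrier BC. ?c \<otimes>\<^bsub>?P\<^esub> \<alpha> y \<in> \<alpha> ` Sp (Suc n)}" using yG Gc by blast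
      qed
    qed
    then show "SC.form k \<phi>S (pure_tensor R S M s m) \<otimes>\<^bsub>?P\<^esub> \<alpha> y \<in> \<alpha> ` Sp (Suc n)"
      using y unfolding fs by blast
  qed
  \<comment> \<open>Induction on the monomial: the empty one is the image of 1 \<otimes> 1 in degree
    zero, and each further variable multiplies by a form as in \<open>mul1\<close>. Tracking the
    degree yields the graded statement along with equality of the images.\<close>
  have mono: "\<theta>S (basis_elt S \<mu>) \<in> \<alpha> ` Sp (size \<mu>)" if "set_mset \<mu> \<subseteq> carrier N" for \<mu>
    using that
  proof (induction \<mu>)
    case empty
    have b0: "basis_elt S {#} = \<one>\<^bsub>poly_alg S N\<^esub>" by (simp add: poly_alg_def SC.monoid_alg_simps monomials_def)
    have b0R: "basis_elt R {#} = \<one>\<^bsub>poly_alg R M\<^esub>" by (simp add: poly_alg_def monoid_alg_simps monomials_def)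
    have "basis_elt R {#} \<in> HomR 0" unfolding HomR_eq by (rule basis_elt_closed) simp
    then have "\<one>\<^bsub>RM\<^esub> \<in> rees_component R M 0"
      unfolding compR using alg_homD(3)[OF clR] b0R by (metis imageI)
    then have "\<alpha> (pure_tensor R S RM \<one>\<^bsub>S\<^esub> \<one>\<^bsub>RM\<^esub>) \<in> \<alpha> ` Sp 0" by (intro imageI GSp) auto
    moreover have "\<alpha> (pure_tensor R S RM \<one>\<^bsub>S\<^esub> \<one>\<^bsub>RM\<^esub>) = \<one>\<^bsub>?P\<^esub>"
      using alg_homD(3)[OF \<gamma>] by (simp add: \<alpha>pure)
    ultimately show ?case by (simp add: b0 alg_homD(3)[OF \<theta>S(1)])
  next
    case (add x \<mu>)
    then obtain y where y: "y \<in> Sp (size \<mu>)" "\<theta>S (basis_elt S \<mu>) = \<alpha> y" by auto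
    have c: "var S x \<in> carrier (poly_alg S N)" "basis_elt S \<mu> \<in> carrier (poly_alg S N)"
      using add.prems SC.var_closed[of x N] SC.monoid_alg_basis_mem[of \<mu> "monomials (carrier N)"]
      by (simp_all add: poly_alg_def) (simp add: monomials_def)
    have "\<theta>S (basis_elt S (add_mset x \<mu>)) = \<theta>S (var S x) \<otimes>\<^bsub>?P\<^esub> \<theta>S (basis_elt S \<mu>)"
      using alg_homD(4)[OF \<theta>S(1) c] by (simp add: SC.basis_elt_add_mset[where V = "carrier N"] poly_alg_def)
    also have "\<dots> = SC.form k \<phi>S x \<otimes>\<^bsub>?P\<^esub> \<alpha> y" using add.prems by (simp add: \<theta>S(2) y(2))
    also have "\<dots> \<in> \<alpha> ` Sp (Suc (size \<mu>))" using add.prems y(1) by (intro mul1) auto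
    finally show ?case by simp
  qed
  have \<theta>Slin: "\<theta>S \<in> lin_maps S (SC.pol (carrier N)) ?P"
    using alg_homD(1)[OF \<theta>S(1)] by (simp add: poly_alg_def)
  have HomS_img: "\<theta>S p \<in> \<alpha> ` Sp n" if "p \<in> HomS n" for p n
    by (rule SC.lin_maps_monoid_alg_mem[OF P.module \<theta>Slin \<alpha>Sp _ _ that[unfolded HomS_eq]])
      (use mono in \<open>auto simp: monomials_def\<close>)
  \<comment> \<open>For one inclusion linearity reduces to monomials, handled by
    \<open>mono\<close>. For the other it reduces to pure tensors s \<otimes> x, where \<gamma>(x)
    is the \<beta>-image of the class of \<iota>(p) for a polynomial p representing x.\<close>
  have im: "\<alpha> ` carrier BC = \<beta> ` carrier RS"
  proof (intro subset_antisym subsetI)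
    fix v assume "v \<in> \<beta> ` carrier RS"
    then obtain p where p: "p \<in> carrier (poly_alg S N)" "v = \<theta>S p" using cRS \<beta>(2) by auto
    have "\<theta>S p \<in> \<alpha> ` carrier BC"
    proof (rule SC.lin_maps_monoid_alg_mem[OF P.module \<theta>Slin
          submodule_image[OF mBC P.module \<alpha>lin BC.carrier_is_submodule] subset_refl])
      fix \<mu> assume "\<mu> \<in> carrier (monomials (carrier N))"
      then have "set_mset \<mu> \<subseteq> carrier N" by (simp add: monomials_def)
      then show "\<theta>S (basis_elt S \<mu>) \<in> \<alpha> ` carrier BC"
        by (rule subsetD[OF image_mono[OF Spc] mono])
    qed (use p in \<open>simp add: poly_alg_def SC.monoid_alg_simps\<close>)
    then show "v \<in> \<alpha> ` carrier BC" by (simp add: p)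
  next
    fix v assume "v \<in> \<alpha> ` carrier BC"
    then obtain z where z: "z \<in> carrier (tensor R S RM)" "v = \<alpha> z" by (auto simp: BCs)
    have sub: "submodule (\<beta> ` carrier RS) S ?P"
      by (rule submodule_image[OF RS.module P.module alg_homD(1)[OF \<beta>(1)] RS.carrier_is_submodule])
    have "\<alpha> z \<in> \<beta> ` carrier RS"
    proof (rule tensor_mem[OF S.module RM.module PR.module \<alpha>R S.restrict_scalars_submodule[OF P.module sub] _ z(1)])
      fix s x assume s: "s \<in> carrier S" and x: "x \<in> carrier RM"
      obtain p where p: "p \<in> carrier (poly_alg R M)" "x = rees_cls M p" using x cRM by blast
      have ip: "\<iota> p \<in> carrier (poly_alg S N)" using lin_mapsD(1)[OF alg_homD(1)[OF \<iota>] p(1)] by simp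
      have "\<gamma> x = \<beta> (SC.rees_cls N (\<iota> p))" by (simp add: p(2) \<gamma>cls[OF p(1)] \<beta>(2)[OF ip])
      then have "\<gamma> x \<in> \<beta> ` carrier RS" using ip cRS by blast
      then show "\<alpha> (pure_tensor R S RM s x) \<in> \<beta> ` carrier RS"
        unfolding \<alpha>pure[OF s x] by (rule submoduleD(4)[OF P.module sub s])
    qed
    then show "v \<in> \<beta> ` carrier RS" by (simp add: z)
  qed
  obtain \<Phi> where \<Phi>: "\<Phi> \<in> alg_iso S BC RS" "\<And>x. x \<in> carrier BC \<Longrightarrow> \<beta> (\<Phi> x) = \<alpha> x"
    using alg_iso_of_embeddings[OF aBC aRS \<alpha>alg \<alpha>inj \<beta>(1) \<beta>inj im] by blast
  \<comment> \<open>Injectivity of \<open>\<beta>\<close> makes an equation in the polynomial ring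
    enough to identify a value of \<Phi>.\<close>
  have \<Phi>eq: "\<Phi> x = y" if "x \<in> carrier BC" "y \<in> carrier RS" "\<beta> y = \<alpha> x" for x y
  proof (rule inj_onD[OF \<beta>inj _ _ that(2)])
    show "\<Phi> x \<in> carrier RS" using \<Phi>(1) that(1) by (auto simp: alg_iso_def dest: lin_mapsD(1))
  qed (use \<Phi>(2) that in simp)
  have "\<Phi> (pure_tensor R S RM \<one>\<^bsub>S\<^esub> (rees_gen R M m)) = rees_gen S N (pure_tensor R S M \<one>\<^bsub>S\<^esub> m)"
    if m: "m \<in> carrier M" for m
  proof (rule \<Phi>eq)
    have g: "rees_gen R M m \<in> carrier RM" using cRM var_closed[OF m] by (auto simp: rees_gen_eq)
    show "pure_tensor R S RM \<one>\<^bsub>S\<^esub> (rees_gen R M m) \<in> carrier BC"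
      unfolding BCs by (rule pure_tensor_closed[OF S.module RM.module SC.one_closed g])
    have v: "var S (one_t m) \<in> carrier (poly_alg S N)" by (rule SC.var_closed[OF one_t[OF m]])
    then show "rees_gen S N (pure_tensor R S M \<one>\<^bsub>S\<^esub> m) \<in> carrier RS"
      using cRS by (auto simp: SC.rees_gen_eq one_t_def)
    have "\<alpha> (pure_tensor R S RM \<one>\<^bsub>S\<^esub> (rees_gen R M m)) = \<theta>S (var S (one_t m))"
      using \<gamma>c[OF g] by (simp add: \<alpha>pure g) (simp add: rees_gen_eq \<gamma>cls var_closed m \<iota>v)
    then show "\<beta> (rees_gen S N (pure_tensor R S M \<one>\<^bsub>S\<^esub> m)) = \<alpha> (pure_tensor R S RM \<one>\<^bsub>S\<^esub> (rees_gen R M m))"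
      using \<beta>(2)[OF v] by (simp add: SC.rees_gen_eq one_t_def)
  qed
  \<comment> \<open>Both inclusions pass through homogeneous polynomials over \<open>S\<close>:
    \<open>HomS_img\<close> lifts an evaluation to the degree n part, and \<open>\<iota>Hom\<close>
    shows that generators of that part evaluate to images of homogeneous polynomials.\<close>
  moreover have "\<Phi> ` Sp n = rees_component S N n" for n
  proof (intro subset_antisym subsetI)
    fix y assume "y \<in> rees_component S N n"
    then obtain p where p: "p \<in> HomS n" "y = SC.rees_cls N p" using compS by blast
    have pc: "p \<in> carrier (poly_alg S N)" using p(1) by (simp add: HomS_def)
    obtain z where z: "z \<in> Sp n" "\<theta>S p = \<alpha> z" using HomS_img[OF p(1)] by blast
    have "\<Phi> z = y" using z Spc p pc cRS \<beta>(2)[OF pc] by (intro \<Phi>eq) auto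
    then show "y \<in> \<Phi> ` Sp n" using z(1) by blast
  next
    fix y assume "y \<in> \<Phi> ` Sp n"
    then obtain z where z: "z \<in> Sp n" "y = \<Phi> z" by blast
    have sub: "submodule (\<theta>S ` HomS n) S ?P"
      by (rule submodule_image[OF Q.module P.module alg_homD(1)[OF \<theta>S(1)] HomS_sub])
    have "Sp n \<subseteq> {z \<in> carrier BC. \<alpha> z \<in> \<theta>S ` HomS n}"
      unfolding Sp_def
    proof (rule submodule_span_minimal[OF submodule_vimage[OF mBC P.module \<alpha>lin sub]])
      show "G n \<subseteq> {z \<in> carrier BC. \<alpha> z \<in> \<theta>S ` HomS n}"
      proof
        fix z assume zG: "z \<in> G n"
        then obtain s x where sx: "s \<in> carrier S" "x \<in> rees_component R M n" "z = pure_tensor R S RM s x"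
          by (auto simp: G_def)
        have xc: "x \<in> carrier RM" using sx(2) comp_c by blast
        obtain p where p: "p \<in> HomR n" "x = rees_cls M p" using sx(2) compR by blast
        have "\<gamma> x \<in> \<theta>S ` HomS n"
          using \<iota>Hom[OF p(1)] \<gamma>cls[of p] p by (auto simp: HomR_def)
        then have "\<alpha> z \<in> \<theta>S ` HomS n"
          unfolding sx(3) \<alpha>pure[OF sx(1) xc] by (rule submoduleD(4)[OF P.module sub sx(1)])
        then show "z \<in> {z \<in> carrier BC. \<alpha> z \<in> \<theta>S ` HomS n}" using zG Gc by blast
      qed
    qed
    then obtain p where p: "p \<in> HomS n" "\<alpha> z = \<theta>S p" using z(1) by blast
    have pc: "p \<in> carrier (poly_alg S N)" using p(1) by (simp add: HomS_def)
    have "\<Phi> z = SC.rees_cls N p" using z(1) Spc p pc cRS \<beta>(2)[OF pc] by (intro \<Phi>eq) auto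
    then show "y \<in> rees_component S N n" using p(1) z(2) compS by auto
  qed
  ultimately show ?thesis
    using \<Phi>(1) unfolding Sp_def G_def BC_def RS_def RM_def N_def by blast
qed

end

theorem proposition1p3:
  fixes R :: "'a ring" and M :: "('a, 'm) module"
    and F :: "('a, 'f) module" and f :: "'m \<Rightarrow> 'f"
    and S :: "('a, 's) module"
  assumes "cring R" and "module R M" and "fin_gen_module R M"
  shows
    "(free_module R F \<and> f \<in> lin_maps R M F \<and> dual_map M f ` dual R F = dual R M \<longrightarrow>
        versal TYPE('g) R M F f \<and>
        rees_nat_surj R F f \<in> alg_iso R (rees_alg R M) (rees_alg_map R M F f)) \<and>
     (noetherian_ring R \<and> algebra R S \<and> flat_module R S \<longrightarrow>
        (\<exists>\<phi> \<in> alg_iso S (base_change R S (rees_alg R M)) (rees_alg S (base_change R S M)).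
          (\<forall>m\<in>carrier M.
            \<phi> (pure_tensor R S (rees_alg R M) \<one>\<^bsub>S\<^esub> (rees_gen R M m)) =
              rees_gen S (base_change R S M) (pure_tensor R S M \<one>\<^bsub>S\<^esub> m)) \<and>
          (\<forall>n. \<phi> ` submodule_span S (base_change R S (rees_alg R M))
                    {pure_tensor R S (rees_alg R M) s x | s x.
                      s \<in> carrier S \<and> x \<in> rees_component R M n} =
                rees_component S (base_change R S M) n)))"
proof -
  interpret cring R by fact
  show ?thesis
  proof (rule conjI; rule impI; elim conjE)
    assume *: "free_module R F" "f \<in> lin_maps R M F" "dual_map M f ` dual R F = dual R M"
    show "versal TYPE('g) R M F f \<and>
        rees_nat_surj R F f \<in> alg_iso R (rees_alg R M) (rees_alg_map R M F f)"
      by (intro conjI dual_epi_versal[OF assms(3) *]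
          versal_rees_nat_surj[OF assms(2) *(1,2) dual_epi_versal[OF assms(3) *]])
  qed (rule flat_base_change_rees[OF _ assms(3)])
qed

end
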